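(* Consider the rescaled defocusing parametric nonlinear Schrödinger system given in the context, in two space dimensions, with $\beta>0$ and bifurcation parameter $\mu\in[-1,3]$, in the limit $0<\epsilon\ll1$. Consider dark-soliton front solutions whose interface $\Gamma$ is smooth and closed, has bounded curvature, and is far from self-intersection. Then, at the level of formal matched asymptotic expansions, the normal velocity $V$ of $\Gamma$ (in the slow time $T=\epsilon^2\tau$) admits the expansion $$V=-\alpha_0\,\kappa_0+\epsilon^2\bigl(\nu\,\Delta_s\kappa_0+\zeta\,\kappa_0^3\bigr)+O(\epsilon^4),$$ where $\kappa_0$ is the curvature of $\Gamma$, $\Delta_s$ is the Laplace–Beltrami (surface diffusion) operator on $\Gamma$, and $\alpha_0,\nu,\zeta$ are $\mu$-dependent real coefficients that do not depend on $\epsilon$ ($\alpha_0$ and $\nu$ are given explicitly in the context). The leading order coefficient $\alpha_0$ has the same sign as $\mu$. Moreover there exists $\mu_*>0$, independent of $\epsilon$, such that $\nu>0$ if $|\mu|<\mu_*$.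
   Context: The system. $U=(U_1,U_2)^t$ is real vector valued on a spatially periodic square in $\mathbb{R}^2$ and satisfies $$U_\tau=\begin{pmatrix}0&-(\epsilon^2\Delta-2|U|^2+1-\mu)\\ \epsilon^2\Delta-2|U|^2+2&-\beta\end{pmatrix}U .$$ It is a rescaling of $i\Theta_t+\frac{\epsilon^2}{2}\Delta\Theta-|\Theta|^2\Theta+(i+a)\Theta-\gamma\Theta^*=0$, with $\beta=4/(a+\sqrt{\gamma^2-1})>0$ and $\mu=-(a-3\sqrt{\gamma^2-1})/(a+\sqrt{\gamma^2-1})$. The front. $\Gamma=\Gamma(T)$ is a smooth closed curve that divides the domain into an inside and an outside region. Let $n$ be its outward unit normal, $s$ a parameter along $\Gamma$, and $z$ the signed distance to $\Gamma$ divided by $\epsilon$ (positive outside). The curvature $\kappa_0$ is normalized so that $\epsilon^2\Delta=\partial_z^2+\epsilon\kappa_0\partial_z+O(\epsilon^2)$ near $\Gamma$, so circles have $\kappa_0>0$. Near $\Gamma$ the solution is expanded as $U=(\phi(z),0)^t+\epsilon\tilde u_1+\epsilon^2\tilde u_2+\cdots$ with $\phi(z)=\tanh z$ and with each correction $\tilde u_i(s,\cdot)\in L^2(\mathbb{R})$. Away from $\Gamma$, $U=(\pm1,0)^t$ (plus outside, minus inside), all higher order outer corrections being taken to be zero on the relevant time scale. $V$ is the velocity of $\Gamma$ in the direction $n$ with respect to $T=\epsilon^2\tau$, i.e. $V=-\epsilon\,\partial z/\partial T$. The terms of the expansion of $V$ are determined by the Fredholm solvability conditions of the successive inner problems; in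 particular $\zeta=\zeta(\mu)$ is the coefficient of $\kappa_0^3$ produced by the solvability condition at order $\epsilon^3$. The coefficients. Let $\psi(z)=\operatorname{sech}z$, and let $\langle\cdot,\cdot\rangle$, $\|\cdot\|$ be the $L^2(\mathbb{R})$ inner product and norm (summed over components for vector functions). Define $$\mathrm{C}=-\partial_z^2-6\psi^2+4,\qquad \mathrm{D}=-\partial_z^2-2\psi^2+\mu+1 .$$ Then $\ker\mathrm{C}=\operatorname{span}\{\phi'\}$ and $\mathrm{D}\psi=\mu\psi$. For $f\perp\phi'$, $\mathrm{C}^{-1}f$ denotes the solution $p\perp\phi'$ of $\mathrm{C}p=f$. For $\mu\neq0$, $$\alpha_0=\frac{\|\phi'\|^2}{\beta\langle\mathrm{D}^{-1}\phi',\phi'\rangle},\qquad \overline q_1=\alpha_0\mathrm{D}^{-1}\phi',\qquad \overline p_1=\mathrm{C}^{-1}\bigl(\phi'-\beta\alpha_0\mathrm{D}^{-1}\phi'\bigr),$$ $$\overline W_1=\begin{pmatrix}\alpha_0\overline p_1+\overline q_1\\-\overline p_1+\alpha_0\overline q_1\end{pmatrix},\qquad \Psi_0^\dagger=\begin{pmatrix}\beta\mathrm{D}^{-1}\phi'\\ \phi'\end{pmatrix},\qquad \nu=\frac{\langle\overline W_1,\Psi_0^\dagger\rangle}{\beta\langle\mathrm{D}^{-1}\phi',\phi'\rangle}.$$ At $\mu=0$ the coefficients are understood as limits $\mu\to0$ (in particular $\alpha_0\to0$). *)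

theory Defs
  imports "HOL-Analysis.Analysis"
begin

section \<open>Smooth functions and asymptotic expansions\<close>

text \<open>Iterated directional derivatives. On an open set \<open>S\<close>, \<open>smooth_on S f\<close> is
  \<open>C\<^sup>\<infinity>\<close>-smoothness; it is only used for open \<open>S\<close>.\<close>

fun dderivs :: "'a list \<Rightarrow> ('a::real_normed_vector \<Rightarrow> 'b::real_normed_vector) \<Rightarrow> 'a \<Rightarrow> 'b" where
  "dderivs [] f = f"
| "dderivs (v # vs) f = (\<lambda>x. frechet_derivative (dderivs vs f) (at x) v)"

definition smooth_on :: "'a::real_normed_vector set \<Rightarrow> ('a \<Rightarrow> 'b::real_normed_vector) \<Rightarrow> bool" where
  "smooth_on S f \<longleftrightarrow> (\<forall>vs. \<forall>x\<in>S. dderivs vs f differentiable (at x))"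

text \<open>\<open>f \<epsilon> \<sim> c 0 + \<epsilon> c 1 + \<epsilon>\<^sup>2 c 2 + \<dots>\<close> as \<open>\<epsilon> \<rightarrow> 0+\<close>, to all orders, together with all
  derivatives and uniformly on compact subsets of the open set \<open>S\<close>.\<close>

definition asymp_expansion ::
  "'a::real_normed_vector set \<Rightarrow> (real \<Rightarrow> 'a \<Rightarrow> 'b::real_normed_vector) \<Rightarrow> (nat \<Rightarrow> 'a \<Rightarrow> 'b) \<Rightarrow> bool"
where
  "asymp_expansion S f c \<longleftrightarrow>
     (\<forall>i. smooth_on S (c i)) \<and>
     (\<forall>\<^sub>F \<epsilon> in at_right 0. smooth_on S (f \<epsilon>)) \<and>
     (\<forall>N vs K. compact K \<and> K \<subseteq> S \<longrightarrow>
        (\<exists>C. \<forall>\<^sub>F \<epsilon> in at_right 0. \<forall>y\<in>K.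
           norm (dderivs vs (\<lambda>y. f \<epsilon> y - (\<Sum>i\<le>N. \<epsilon> ^ i *\<^sub>R c i y)) y) \<le> C * \<epsilon> ^ (N + 1)))"

section \<open>Geometry of plane curves\<close>

text \<open>Closed curves are given by \<open>1\<close>-periodic regular parametrizations, run counterclockwise
  (see \<open>evolving_front\<close> below), so that the normal obtained by rotating the unit tangent by
  \<open>- \<pi> / 2\<close> is the outward one and circles have positive curvature.\<close>

definition speed :: "(real \<Rightarrow> real ^ 2) \<Rightarrow> real \<Rightarrow> real" where
  "speed c s = norm (vector_derivative c (at s))"

definition unit_normal :: "(real \<Rightarrow> real ^ 2) \<Rightarrow> real \<Rightarrow> real ^ 2" where
  "unit_normal c s =
     (let c' = vector_derivative c (at s) in (1 / speed c s) *\<^sub>R vector [c' $ 2, - (c' $ 1)])"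

definition curvature :: "(real \<Rightarrow> real ^ 2) \<Rightarrow> real \<Rightarrow> real" where
  "curvature c s =
     (let c' = vector_derivative c (at s);
          c'' = vector_derivative (\<lambda>r. vector_derivative c (at r)) (at s)
      in (c' $ 1 * c'' $ 2 - c' $ 2 * c'' $ 1) / speed c s ^ 3)"

definition arclength_deriv :: "(real \<Rightarrow> real ^ 2) \<Rightarrow> (real \<Rightarrow> real) \<Rightarrow> real \<Rightarrow> real" where
  "arclength_deriv c f s = deriv f s / speed c s"

definition laplace_beltrami :: "(real \<Rightarrow> real ^ 2) \<Rightarrow> (real \<Rightarrow> real) \<Rightarrow> real \<Rightarrow> real" where
  "laplace_beltrami c f = arclength_deriv c (arclength_deriv c f)"

text \<open>Here \<open>\<gamma> T s\<close> is the point of the moving curve with parameter \<open>s\<close> at time \<open>T\<close>; the value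
  does not depend on the choice of the parametrization.\<close>

definition normal_velocity :: "(real \<Rightarrow> real \<Rightarrow> real ^ 2) \<Rightarrow> real \<Rightarrow> real \<Rightarrow> real" where
  "normal_velocity \<gamma> T s = vector_derivative (\<lambda>t. \<gamma> t s) (at T) \<bullet> unit_normal (\<gamma> T) s"

text \<open>The spatially periodic square of side \<open>L\<close> is the quotient of the plane by the lattice
  \<open>L \<int>\<^sup>2\<close>. A closed curve that divides it into two regions lifts to a closed curve in the plane.\<close>

definition lattice_vec :: "real \<Rightarrow> int \<Rightarrow> int \<Rightarrow> real ^ 2" where
  "lattice_vec L m n = vector [L * of_int m, L * of_int n]"

definition periodic_hull :: "real \<Rightarrow> (real ^ 2) set \<Rightarrow> (real ^ 2) set" where
  "periodic_hull L A = (\<Union>m n. (\<lambda>x. x + lattice_vec L m n) ` A)"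

section \<open>The system\<close>

definition laplacian :: "(real ^ 2 \<Rightarrow> real ^ 2) \<Rightarrow> real ^ 2 \<Rightarrow> real ^ 2" where
  "laplacian f x = (\<Sum>b\<in>Basis. dderivs [b, b] f x)"

text \<open>The field is \<open>U T x\<close> with slow time \<open>T = \<epsilon>\<^sup>2 \<tau>\<close>, hence \<open>U\<^sub>\<tau> = \<epsilon>\<^sup>2 U\<^sub>T\<close>.\<close>

definition rhs :: "real \<Rightarrow> real \<Rightarrow> real \<Rightarrow> (real ^ 2 \<Rightarrow> real ^ 2) \<Rightarrow> real ^ 2 \<Rightarrow> real ^ 2" where
  "rhs \<beta> \<mu> \<epsilon> u x = vector
     [- (\<epsilon>\<^sup>2 * laplacian u x $ 2 - 2 * (norm (u x))\<^sup>2 * u x $ 2 + (1 - \<mu>) * u x $ 2),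
      \<epsilon>\<^sup>2 * laplacian u x $ 1 - 2 * (norm (u x))\<^sup>2 * u x $ 1 + 2 * u x $ 1 - \<beta> * u x $ 2]"

definition residual ::
  "real \<Rightarrow> real \<Rightarrow> real \<Rightarrow> (real \<Rightarrow> real ^ 2 \<Rightarrow> real ^ 2) \<Rightarrow> real \<Rightarrow> real ^ 2 \<Rightarrow> real ^ 2" where
  "residual \<beta> \<mu> \<epsilon> U T x =
     \<epsilon>\<^sup>2 *\<^sub>R vector_derivative (\<lambda>t. U t x) (at T) - rhs \<beta> \<mu> \<epsilon> (U T) x"

section \<open>The coefficients\<close>

definition L2_inner :: "(real \<Rightarrow> 'a::real_inner) \<Rightarrow> (real \<Rightarrow> 'a) \<Rightarrow> real" where
  "L2_inner f g = (LINT z|lborel. f z \<bullet> g z)"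

definition in_L2 :: "(real \<Rightarrow> 'a::real_inner) \<Rightarrow> bool" where
  "in_L2 f \<longleftrightarrow> f \<in> borel_measurable lborel \<and> integrable lborel (\<lambda>z. (norm (f z))\<^sup>2)"

definition \<phi> :: "real \<Rightarrow> real" where "\<phi> z = tanh z"

definition \<psi> :: "real \<Rightarrow> real" where "\<psi> z = 1 / cosh z"

definition twice_differentiable :: "(real \<Rightarrow> real) \<Rightarrow> bool" where
  "twice_differentiable f \<longleftrightarrow>
     (\<forall>z. f field_differentiable (at z)) \<and> (\<forall>z. deriv f field_differentiable (at z))"

definition opC :: "(real \<Rightarrow> real) \<Rightarrow> real \<Rightarrow> real" where
  "opC p z = - deriv (deriv p) z - 6 * (\<psi> z)\<^sup>2 * p z + 4 * p z"

definition opD :: "real \<Rightarrow> (real \<Rightarrow> real) \<Rightarrow> real \<Rightarrow> real" where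
  "opD \<mu> q z = - deriv (deriv q) z - 2 * (\<psi> z)\<^sup>2 * q z + (\<mu> + 1) * q z"

definition Cinv :: "(real \<Rightarrow> real) \<Rightarrow> real \<Rightarrow> real" where
  "Cinv f = (THE p. twice_differentiable p \<and> in_L2 p \<and> L2_inner p (deriv \<phi>) = 0 \<and> opC p = f)"

definition Dinv :: "real \<Rightarrow> (real \<Rightarrow> real) \<Rightarrow> real \<Rightarrow> real" where
  "Dinv \<mu> f = (THE q. twice_differentiable q \<and> in_L2 q \<and> opD \<mu> q = f)"

definition alpha0_formula :: "real \<Rightarrow> real \<Rightarrow> real" where
  "alpha0_formula \<beta> \<mu> =
     L2_inner (deriv \<phi>) (deriv \<phi>) / (\<beta> * L2_inner (Dinv \<mu> (deriv \<phi>)) (deriv \<phi>))"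

definition q1_bar :: "real \<Rightarrow> real \<Rightarrow> real \<Rightarrow> real" where
  "q1_bar \<beta> \<mu> z = alpha0_formula \<beta> \<mu> * Dinv \<mu> (deriv \<phi>) z"

definition p1_bar :: "real \<Rightarrow> real \<Rightarrow> real \<Rightarrow> real" where
  "p1_bar \<beta> \<mu> =
     Cinv (\<lambda>z. deriv \<phi> z - \<beta> * alpha0_formula \<beta> \<mu> * Dinv \<mu> (deriv \<phi>) z)"

definition W1_bar :: "real \<Rightarrow> real \<Rightarrow> real \<Rightarrow> real ^ 2" where
  "W1_bar \<beta> \<mu> z = vector
     [alpha0_formula \<beta> \<mu> * p1_bar \<beta> \<mu> z + q1_bar \<beta> \<mu> z,
      - p1_bar \<beta> \<mu> z + alpha0_formula \<beta> \<mu> * q1_bar \<beta> \<mu> z]"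

definition Psi0_dagger :: "real \<Rightarrow> real \<Rightarrow> real \<Rightarrow> real ^ 2" where
  "Psi0_dagger \<beta> \<mu> z = vector [\<beta> * Dinv \<mu> (deriv \<phi>) z, deriv \<phi> z]"

definition nu_formula :: "real \<Rightarrow> real \<Rightarrow> real" where
  "nu_formula \<beta> \<mu> =
     L2_inner (W1_bar \<beta> \<mu>) (Psi0_dagger \<beta> \<mu>) / (\<beta> * L2_inner (Dinv \<mu> (deriv \<phi>)) (deriv \<phi>))"

text \<open>In \<open>[- 1, 3]\<close> the equation \<open>D q = \<phi>'\<close> has no \<open>L\<^sup>2\<close> solution exactly for \<open>\<mu> = 0\<close>
  (\<open>D \<psi> = \<mu> \<psi>\<close>) and for \<open>\<mu> = - 1\<close> (edge of the essential spectrum); there the coefficients are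
  the limits of the formulas, one-sided at \<open>- 1\<close>.\<close>

definition alpha0 :: "real \<Rightarrow> real \<Rightarrow> real" where
  "alpha0 \<beta> \<mu> =
     (if \<mu> = 0 \<or> \<mu> = -1 then Lim (at \<mu> within {-1<..}) (alpha0_formula \<beta>)
      else alpha0_formula \<beta> \<mu>)"

definition nu :: "real \<Rightarrow> real \<Rightarrow> real" where
  "nu \<beta> \<mu> =
     (if \<mu> = 0 \<or> \<mu> = -1 then Lim (at \<mu> within {-1<..}) (nu_formula \<beta>)
      else nu_formula \<beta> \<mu>)"

section \<open>Front solutions in the sense of formal matched asymptotics\<close>

text \<open>An evolving interface \<open>\<gamma> \<epsilon> T s\<close>, for slow times \<open>T\<close> in the open interval \<open>I\<close>. It depends on
  \<open>\<epsilon>\<close> because its velocity does. The curvature bound and the width \<open>\<delta>\<close> of the tube in which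
  the normal coordinates are injective (modulo the lattice) are uniform in \<open>\<epsilon>\<close>.\<close>

definition evolving_front :: "real \<Rightarrow> real set \<Rightarrow> (real \<Rightarrow> real \<Rightarrow> real \<Rightarrow> real ^ 2) \<Rightarrow> bool" where
  "evolving_front L I \<gamma> \<longleftrightarrow>
     (\<exists>g. asymp_expansion (I \<times> UNIV) (\<lambda>\<epsilon> (T, s). \<gamma> \<epsilon> T s) g) \<and>
     (\<exists>\<epsilon>0>0. \<exists>c>0. \<exists>\<kappa>max. \<exists>\<delta>>0. \<forall>\<epsilon>\<in>{0<..<\<epsilon>0}. \<forall>T\<in>I.
        (\<forall>s. \<gamma> \<epsilon> T (s + 1) = \<gamma> \<epsilon> T s) \<and>
        (\<forall>s. c \<le> speed (\<gamma> \<epsilon> T) s) \<and>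
        (\<forall>s. \<bar>curvature (\<gamma> \<epsilon> T) s\<bar> \<le> \<kappa>max) \<and>
        (\<forall>s\<in>{0..<1}. \<forall>s'\<in>{0..<1}. \<forall>r\<in>{-\<delta><..<\<delta>}. \<forall>r'\<in>{-\<delta><..<\<delta>}. \<forall>m n.
           \<gamma> \<epsilon> T s + r *\<^sub>R unit_normal (\<gamma> \<epsilon> T) s
             = \<gamma> \<epsilon> T s' + r' *\<^sub>R unit_normal (\<gamma> \<epsilon> T) s' + lattice_vec L m n
           \<longrightarrow> s = s' \<and> r = r') \<and>
        (\<forall>s. \<forall>r\<in>{0<..<\<delta>}.
           \<gamma> \<epsilon> T s + r *\<^sub>R unit_normal (\<gamma> \<epsilon> T) s \<in> outside (range (\<gamma> \<epsilon> T)) \<and>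
           \<gamma> \<epsilon> T s - r *\<^sub>R unit_normal (\<gamma> \<epsilon> T) s \<in> inside (range (\<gamma> \<epsilon> T))))"

text \<open>\<open>U\<close> solves the system up to \<open>O(\<epsilon>\<^sup>N)\<close> for all \<open>N\<close>.\<close>

definition formal_solution ::
  "real \<Rightarrow> real \<Rightarrow> real \<Rightarrow> real set \<Rightarrow> (real \<Rightarrow> real \<Rightarrow> real ^ 2 \<Rightarrow> real ^ 2) \<Rightarrow> bool" where
  "formal_solution \<beta> \<mu> L I U \<longleftrightarrow>
     (\<forall>\<^sub>F \<epsilon> in at_right 0. smooth_on (I \<times> UNIV) (\<lambda>(T, x). U \<epsilon> T x) \<and>
        (\<forall>T\<in>I. \<forall>x m n. U \<epsilon> T (x + lattice_vec L m n) = U \<epsilon> T x)) \<and>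
     (\<forall>N K. compact K \<and> K \<subseteq> I \<longrightarrow>
        (\<exists>C. \<forall>\<^sub>F \<epsilon> in at_right 0. \<forall>T\<in>K. \<forall>x. norm (residual \<beta> \<mu> \<epsilon> (U \<epsilon>) T x) \<le> C * \<epsilon> ^ N))"

text \<open>In the inner variables, \<open>x = \<gamma> + \<epsilon> z n\<close> with the scaled signed distance \<open>z\<close>. The
  corrections are determined only up to multiples of the translation mode \<open>(\<phi>', 0)\<close>, that is, up
  to small displacements of \<open>\<Gamma>\<close>; as in the definition of \<open>C\<^sup>-\<^sup>1\<close> they are taken with first
  component orthogonal to \<open>\<phi>'\<close>, which fixes \<open>\<Gamma>\<close> to all orders.\<close>

definition inner_expansion ::
  "real set \<Rightarrow> (real \<Rightarrow> real \<Rightarrow> real \<Rightarrow> real ^ 2) \<Rightarrow> (real \<Rightarrow> real \<Rightarrow> real ^ 2 \<Rightarrow> real ^ 2) \<Rightarrow>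
   (nat \<Rightarrow> real \<times> real \<times> real \<Rightarrow> real ^ 2) \<Rightarrow> bool" where
  "inner_expansion I \<gamma> U u \<longleftrightarrow>
     asymp_expansion (I \<times> UNIV \<times> UNIV)
       (\<lambda>\<epsilon> (T, s, z). U \<epsilon> T (\<gamma> \<epsilon> T s + (\<epsilon> * z) *\<^sub>R unit_normal (\<gamma> \<epsilon> T) s)) u \<and>
     (\<forall>T\<in>I. \<forall>s z. u 0 (T, s, z) = vector [\<phi> z, 0]) \<and>
     (\<forall>i\<ge>1. \<forall>T\<in>I. \<forall>s.
        in_L2 (\<lambda>z. u i (T, s, z)) \<and> L2_inner (\<lambda>z. u i (T, s, z) $ 1) (deriv \<phi>) = 0)"

definition outer_expansion ::
  "real \<Rightarrow> real set \<Rightarrow> (real \<Rightarrow> real \<Rightarrow> real \<Rightarrow> real ^ 2) \<Rightarrow>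
   (real \<Rightarrow> real \<Rightarrow> real ^ 2 \<Rightarrow> real ^ 2) \<Rightarrow> bool" where
  "outer_expansion L I \<gamma> U \<longleftrightarrow>
     (\<forall>\<eta>>0. \<forall>N K. compact K \<and> K \<subseteq> I \<longrightarrow>
        (\<exists>C. \<forall>\<^sub>F \<epsilon> in at_right 0. \<forall>T\<in>K. \<forall>x.
           infdist x (periodic_hull L (range (\<gamma> \<epsilon> T))) \<ge> \<eta> \<longrightarrow>
           norm (U \<epsilon> T x -
             vector [if x \<in> periodic_hull L (inside (range (\<gamma> \<epsilon> T))) then -1 else 1, 0])
             \<le> C * \<epsilon> ^ N))"

definition formal_front ::
  "real \<Rightarrow> real \<Rightarrow> real \<Rightarrow> real set \<Rightarrow> (real \<Rightarrow> real \<Rightarrow> real \<Rightarrow> real ^ 2) \<Rightarrow> bool" where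
  "formal_front \<beta> \<mu> L I \<gamma> \<longleftrightarrow>
     evolving_front L I \<gamma> \<and>
     (\<exists>U u. formal_solution \<beta> \<mu> L I U \<and> inner_expansion I \<gamma> U u \<and> outer_expansion L I \<gamma> U)"

end

(* In the normal coordinates of the moving curve the system becomes an identity between formal
   power series in epsilon. At each order it requires a correction (p, q) and a velocity
   coefficient V with

     D q = f - V phi',   C p = g - beta q,

   where f and g are built from lower orders. For mu > -1 such (V, p, q) in L^2 with p orthogonal
   to phi' is unique, and V is a linear functional of (f, g) with an even kernel. Uniqueness gives
   the corrections kappa W1 and kappa^2 W2, in terms of the full curvature kappa, with W1 even and
   W2 odd; the sources that remain at orders three and four are even multiples of
   Lap kappa, kappa^3 and (0, phi') plus odd ones, which do not contribute to V. The time derivative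
   of kappa is eliminated by kappa_T = - Lap V - kappa^2 V (along normals). For mu = -1 the problem
   at order one has no solution in L^2 unless the leading curvature vanishes, which is impossible
   for a closed curve.

   The signs follow from the factorization D = A* A + mu, A = d/dz + tanh, A A* = 1 - d^2/dz^2: it
   yields a formula for mu D^-1 phi' that is regular at mu = 0, and there the limit of nu is a
   positive multiple of ||psi||^2 / <psi, phi'>^2. *)

theory Submission
  imports Defs
begin

section \<open>Growth classes and integration on the line\<close>

text \<open>The corrections are only known to be square integrable, while the solvability integrals
  contain their derivatives, products and powers of z. The differential equations lift square
  integrability to growth below every exponential, and the adjoint kernel decays exponentially; so
  every pairing converges and integration by parts has no boundary terms.

  At \<mu> = 0 the function \<psi> lies in the kernel of D, and the equation for q alone leaves a
  multiple of \<psi> free. The equation for p restores uniqueness: its right side has to be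
  orthogonal to \<phi>', and \<psi> is not.

  The curve itself depends on \<epsilon>, so curvature, velocity and frame are power series as well.
  A law in terms of the full curvature with an error of order four makes the third coefficient of
  the defect a claim of its own; this is the purpose of the order four problem, where parity alone
  decides about the additional terms.

  The coefficient \<zeta> has to be common to all fronts with the same \<mu>, although the existence
  of W1 and W2 is taken from a front. It is therefore defined from profiles that are chosen once and
  for all.\<close>

definition subexp :: "(real \<Rightarrow> real) \<Rightarrow> bool" where
  "subexp f \<longleftrightarrow> continuous_on UNIV f \<and> (\<forall>d>0. \<exists>C. \<forall>z. \<bar>f z\<bar> \<le> C * exp (d * \<bar>z\<bar>))"

definition expdecay :: "(real \<Rightarrow> real) \<Rightarrow> bool" where
  "expdecay f \<longleftrightarrow> continuous_on UNIV f \<and> (\<exists>d>0. \<exists>C. \<forall>z. \<bar>f z\<bar> \<le> C * exp (- (d * \<bar>z\<bar>)))"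

lemma subexpE:
  assumes "subexp f" "d > 0"
  obtains C where "C \<ge> 0" "\<And>z. \<bar>f z\<bar> \<le> C * exp (d * \<bar>z\<bar>)"
proof -
  obtain C where C: "\<forall>z. \<bar>f z\<bar> \<le> C * exp (d * \<bar>z\<bar>)"
    using assms unfolding subexp_def by blast
  then have "\<bar>f 0\<bar> \<le> C" by (metis abs_zero exp_zero mult.right_neutral mult_zero_right)
  then show ?thesis using C by (intro that[of C]) auto
qed

lemma expdecayE:
  assumes "expdecay f"
  obtains C d where "C \<ge> 0" "d > 0" "\<And>z. \<bar>f z\<bar> \<le> C * exp (- (d * \<bar>z\<bar>))"
proof -
  obtain C d where C: "d > 0" "\<forall>z. \<bar>f z\<bar> \<le> C * exp (- (d * \<bar>z\<bar>))"
    using assms unfolding expdecay_def by blast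
  then have "\<bar>f 0\<bar> \<le> C" by (metis abs_zero exp_zero mult.right_neutral mult_zero_right minus_zero)
  then show ?thesis using C by (intro that[of C d]) auto
qed

lemma subexp_continuous: "subexp f \<Longrightarrow> continuous_on UNIV f"
  and expdecay_continuous: "expdecay f \<Longrightarrow> continuous_on UNIV f"
  by (auto simp: subexp_def expdecay_def)

lemma subexp_bounded:
  assumes "continuous_on UNIV f" "\<And>z. \<bar>f z\<bar> \<le> C"
  shows "subexp f"
  unfolding subexp_def
proof (intro conjI allI impI assms exI[of _ C])
  fix d z :: real assume "d > 0"
  then have "1 \<le> exp (d * \<bar>z\<bar>)" by simp
  moreover have "0 \<le> C" using assms(2)[of 0] by linarith
  ultimately have "C * 1 \<le> C * exp (d * \<bar>z\<bar>)" by (intro mult_left_mono)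
  then show "\<bar>f z\<bar> \<le> C * exp (d * \<bar>z\<bar>)" using assms(2)[of z] by linarith
qed

lemma subexp_const [simp, intro]: "subexp (\<lambda>z. c)"
  by (rule subexp_bounded[of _ "\<bar>c\<bar>"]) auto

lemma subexp_ident [simp, intro]: "subexp (\<lambda>z. z)"
  unfolding subexp_def
proof (intro conjI allI impI)
  fix d :: real assume d: "d > 0"
  have "\<bar>z\<bar> \<le> (1 / d) * exp (d * \<bar>z\<bar>)" for z
  proof -
    have "d * \<bar>z\<bar> \<le> exp (d * \<bar>z\<bar>)" using exp_ge_add_one_self[of "d * \<bar>z\<bar>"] by linarith
    then show ?thesis using d by (simp add: field_simps)
  qed
  then show "\<exists>C. \<forall>z. \<bar>z\<bar> \<le> C * exp (d * \<bar>z\<bar>)" by blast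
qed (auto intro: continuous_intros)

lemma subexp_add [simp, intro]:
  assumes "subexp f" "subexp g" shows "subexp (\<lambda>z. f z + g z)"
  unfolding subexp_def
proof (intro conjI allI impI)
  show "continuous_on UNIV (\<lambda>z. f z + g z)"
    using assms by (intro continuous_intros subexp_continuous)
  fix d :: real assume d: "d > 0"
  obtain A B where "\<And>z. \<bar>f z\<bar> \<le> A * exp (d * \<bar>z\<bar>)" "\<And>z. \<bar>g z\<bar> \<le> B * exp (d * \<bar>z\<bar>)"
    using subexpE[OF assms(1) d] subexpE[OF assms(2) d] by metis
  then have "\<bar>f z + g z\<bar> \<le> (A + B) * exp (d * \<bar>z\<bar>)" for z
    unfolding distrib_right by (smt (verit))
  then show "\<exists>C. \<forall>z. \<bar>f z + g z\<bar> \<le> C * exp (d * \<bar>z\<bar>)" by blast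
qed

lemma abs_prod_exp_bound:
  fixes x y :: real
  assumes "\<bar>x\<bar> \<le> A * exp s" "\<bar>y\<bar> \<le> B * exp t"
  shows "\<bar>x * y\<bar> \<le> (A * B) * exp (s + t)"
proof -
  have "0 \<le> A * exp s" using assms(1) by (meson abs_ge_zero order_trans)
  then have "\<bar>x\<bar> * \<bar>y\<bar> \<le> (A * exp s) * (B * exp t)" using assms by (intro mult_mono) auto
  then show ?thesis by (simp add: abs_mult exp_add mult_ac)
qed

lemma subexp_mult [simp, intro]:
  assumes "subexp f" "subexp g" shows "subexp (\<lambda>z. f z * g z)"
  unfolding subexp_def
proof (intro conjI allI impI)
  show "continuous_on UNIV (\<lambda>z. f z * g z)"
    using assms by (intro continuous_intros subexp_continuous)
  fix d :: real assume "d > 0"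
  then have d: "d / 2 > 0" by simp
  obtain A B where "\<And>z. \<bar>f z\<bar> \<le> A * exp (d / 2 * \<bar>z\<bar>)" "\<And>z. \<bar>g z\<bar> \<le> B * exp (d / 2 * \<bar>z\<bar>)"
    using subexpE[OF assms(1) d] subexpE[OF assms(2) d] by metis
  then have "\<bar>f z * g z\<bar> \<le> (A * B) * exp (d / 2 * \<bar>z\<bar> + d / 2 * \<bar>z\<bar>)" for z
    by (rule abs_prod_exp_bound)
  then have "\<bar>f z * g z\<bar> \<le> (A * B) * exp (d * \<bar>z\<bar>)" for z by simp
  then show "\<exists>C. \<forall>z. \<bar>f z * g z\<bar> \<le> C * exp (d * \<bar>z\<bar>)" by blast
qed

lemma subexp_minus [simp, intro]: "subexp f \<Longrightarrow> subexp (\<lambda>z. - f z)"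
  using subexp_mult[of "\<lambda>z. -1" f] by simp

lemma subexp_diff [simp, intro]: "subexp f \<Longrightarrow> subexp g \<Longrightarrow> subexp (\<lambda>z. f z - g z)"
  using subexp_add[of f "\<lambda>z. - g z"] by simp

lemma subexp_power [simp, intro]: "subexp f \<Longrightarrow> subexp (\<lambda>z. f z ^ n)"
  by (induction n) auto

lemma expdecay_bounded: assumes "expdecay f" obtains C where "\<And>z. \<bar>f z\<bar> \<le> C"
proof -
  obtain C d where C: "C \<ge> 0" "d > 0" "\<And>z. \<bar>f z\<bar> \<le> C * exp (- (d * \<bar>z\<bar>))"
    using expdecayE[OF assms] by metis
  have "\<bar>f z\<bar> \<le> C" for z
    using C(3)[of z] mult_left_mono[OF _ C(1), of "exp (- (d * \<bar>z\<bar>))" 1] C(2) by simp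
  then show ?thesis by (rule that)
qed

lemma expdecay_subexp: "expdecay f \<Longrightarrow> subexp f"
  by (metis expdecay_bounded expdecay_continuous subexp_bounded)

text \<open>Since the growth bound is available at every rate, half of the decay rate absorbs it.
  Decaying functions thus form an ideal in the ring of subexponential ones, which makes all later
  integrability goals syntactic.\<close>

lemma expdecay_mult [intro]:
  assumes "expdecay a" "subexp f" shows "expdecay (\<lambda>z. a z * f z)"
  unfolding expdecay_def
proof (intro conjI)
  show "continuous_on UNIV (\<lambda>z. a z * f z)"
    using assms by (intro continuous_intros subexp_continuous expdecay_continuous)
  obtain A d where a: "d > 0" "\<And>z. \<bar>a z\<bar> \<le> A * exp (- (d * \<bar>z\<bar>))"
    using expdecayE[OF assms(1)] by metis
  then have d: "d / 2 > 0" by simp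
  obtain B where "\<And>z. \<bar>f z\<bar> \<le> B * exp (d / 2 * \<bar>z\<bar>)"
    using subexpE[OF assms(2) d] by metis
  with a have "\<bar>a z * f z\<bar> \<le> (A * B) * exp (- (d * \<bar>z\<bar>) + d / 2 * \<bar>z\<bar>)" for z
    by (intro abs_prod_exp_bound)
  then have "\<bar>a z * f z\<bar> \<le> (A * B) * exp (- (d / 2 * \<bar>z\<bar>))" for z by simp
  with d show "\<exists>d>0. \<exists>C. \<forall>z. \<bar>a z * f z\<bar> \<le> C * exp (- (d * \<bar>z\<bar>))" by blast
qed

lemma expdecay_mult' [intro]: "subexp f \<Longrightarrow> expdecay a \<Longrightarrow> expdecay (\<lambda>z. f z * a z)"
  using expdecay_mult[of a f] by (simp add: mult.commute)

lemma expdecay_add [intro]: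
  assumes "expdecay f" "expdecay g" shows "expdecay (\<lambda>z. f z + g z)"
  unfolding expdecay_def
proof (intro conjI)
  show "continuous_on UNIV (\<lambda>z. f z + g z)"
    using assms by (intro continuous_intros expdecay_continuous)
  obtain A d where a: "A \<ge> 0" "d > 0" "\<And>z. \<bar>f z\<bar> \<le> A * exp (- (d * \<bar>z\<bar>))"
    using expdecayE[OF assms(1)] by metis
  obtain B e where b: "B \<ge> 0" "e > 0" "\<And>z. \<bar>g z\<bar> \<le> B * exp (- (e * \<bar>z\<bar>))"
    using expdecayE[OF assms(2)] by metis
  define m where "m = min d e"
  have "\<bar>f z + g z\<bar> \<le> (A + B) * exp (- (m * \<bar>z\<bar>))" for z
  proof -
    have "exp (- (d * \<bar>z\<bar>)) \<le> exp (- (m * \<bar>z\<bar>))" "exp (- (e * \<bar>z\<bar>)) \<le> exp (- (m * \<bar>z\<bar>))"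
      by (auto simp: m_def intro!: mult_right_mono)
    then have "A * exp (- (d * \<bar>z\<bar>)) \<le> A * exp (- (m * \<bar>z\<bar>))"
      "B * exp (- (e * \<bar>z\<bar>)) \<le> B * exp (- (m * \<bar>z\<bar>))"
      using a(1) b(1) by (auto intro: mult_left_mono)
    with a(3)[of z] b(3)[of z] show ?thesis unfolding distrib_right by linarith
  qed
  moreover have "m > 0" using a b by (simp add: m_def)
  ultimately show "\<exists>d>0. \<exists>C. \<forall>z. \<bar>f z + g z\<bar> \<le> C * exp (- (d * \<bar>z\<bar>))" by blast
qed

lemma expdecay_cmult [intro]: "expdecay f \<Longrightarrow> expdecay (\<lambda>z. c * f z)"
  using expdecay_mult'[of "\<lambda>z. c" f] by simp

lemma expdecay_minus [intro]: "expdecay f \<Longrightarrow> expdecay (\<lambda>z. - f z)"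
  using expdecay_cmult[of f "-1"] by simp

lemma expdecay_diff [intro]: "expdecay f \<Longrightarrow> expdecay g \<Longrightarrow> expdecay (\<lambda>z. f z - g z)"
  unfolding diff_conv_add_uminus by (intro expdecay_add expdecay_minus)

lemma exp_minus_abs_tendsto:
  assumes "(d::real) > 0"
  shows "((\<lambda>z. C * exp (- (d * \<bar>z\<bar>))) \<longlongrightarrow> 0) at_top"
    "((\<lambda>z. C * exp (- (d * \<bar>z\<bar>))) \<longlongrightarrow> 0) at_bot"
proof -
  have "filterlim (\<lambda>z::real. d * \<bar>z\<bar>) at_top at_top"
    using filterlim_tendsto_pos_mult_at_top[OF tendsto_const assms filterlim_abs_real] .
  then have "filterlim (\<lambda>z::real. - (d * \<bar>z\<bar>)) at_bot at_top"
    unfolding filterlim_uminus_at_bot minus_minus .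
  then show *: "((\<lambda>z. C * exp (- (d * \<bar>z\<bar>))) \<longlongrightarrow> 0) at_top"
    by (intro tendsto_mult_right_zero filterlim_compose[OF exp_at_bot])
  then show "((\<lambda>z. C * exp (- (d * \<bar>z\<bar>))) \<longlongrightarrow> 0) at_bot"
    by (simp add: filterlim_at_bot_mirror)
qed

lemma expdecay_tendsto:
  assumes "expdecay f" shows "(f \<longlongrightarrow> 0) at_top" "(f \<longlongrightarrow> 0) at_bot"
proof -
  obtain C d where "d > 0" and f: "\<And>z. \<bar>f z\<bar> \<le> C * exp (- (d * \<bar>z\<bar>))"
    using expdecayE[OF assms] by metis
  note t = exp_minus_abs_tendsto[OF \<open>d > 0\<close>, of C]
  show "(f \<longlongrightarrow> 0) at_top" by (rule Lim_null_comparison[OF _ t(1)]) (simp add: f)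
  show "(f \<longlongrightarrow> 0) at_bot" by (rule Lim_null_comparison[OF _ t(2)]) (simp add: f)
qed

section \<open>Calculus of tanh and sech\<close>

lemma psi_sq: "(\<psi> z)\<^sup>2 = 1 - (\<phi> z)\<^sup>2"
proof -
  have "(cosh z)\<^sup>2 \<noteq> 0" by simp
  then have "1 / (cosh z)\<^sup>2 = 1 - (sinh z)\<^sup>2 / (cosh z)\<^sup>2"
    using cosh_square_eq[of z] by (subst diff_divide_eq_iff) auto
  then show ?thesis by (simp add: \<psi>_def \<phi>_def tanh_def power_divide)
qed

lemma phi_has_deriv: "(\<phi> has_real_derivative (\<psi> z)\<^sup>2) (at z)"
proof -
  have "\<phi> = tanh" by (auto simp: \<phi>_def)
  then show ?thesis unfolding psi_sq by (auto intro!: derivative_eq_intros)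
qed

lemma deriv_phi: "deriv \<phi> = (\<lambda>z. (\<psi> z)\<^sup>2)"
  using phi_has_deriv DERIV_imp_deriv by blast

lemma psi_has_deriv: "(\<psi> has_real_derivative - (\<phi> z * \<psi> z)) (at z)"
proof -
  have "((\<lambda>z. 1 / cosh z) has_real_derivative - (\<phi> z * \<psi> z)) (at z)"
    by (auto intro!: derivative_eq_intros simp: \<phi>_def \<psi>_def tanh_def power2_eq_square)
  then show ?thesis by (simp add: \<psi>_def[abs_def])
qed

lemmas phi_psi_derivs = DERIV_chain2[OF phi_has_deriv] DERIV_chain2[OF psi_has_deriv]
declare phi_psi_derivs [THEN DERIV_cong, derivative_intros]

lemma phi_minus [simp]: "\<phi> (- z) = - \<phi> z" by (simp add: \<phi>_def)
lemma psi_minus [simp]: "\<psi> (- z) = \<psi> z" by (simp add: \<psi>_def)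
lemma psi_pos: "\<psi> z > 0" by (simp add: \<psi>_def)
lemma abs_phi_le: "\<bar>\<phi> z\<bar> \<le> 1"
  using tanh_real_bounds[of z] by (simp add: \<phi>_def abs_le_iff less_imp_le)

lemma continuous_phi_psi: "continuous_on UNIV \<phi>" "continuous_on UNIV \<psi>"
  by (auto intro!: continuous_at_imp_continuous_on DERIV_isCont phi_has_deriv psi_has_deriv)

lemma psi_ge: "exp (- \<bar>z\<bar>) \<le> \<psi> z"
proof -
  have "cosh z \<le> exp \<bar>z\<bar>"
    by (auto simp: cosh_def abs_if)
  then have "inverse (exp \<bar>z\<bar>) \<le> inverse (cosh z)" by (intro le_imp_inverse_le) auto
  then show ?thesis by (simp add: \<psi>_def exp_minus field_simps)
qed

lemma psi_le: "\<psi> z \<le> 2 * exp (- \<bar>z\<bar>)"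
proof -
  have "exp \<bar>z\<bar> / 2 \<le> cosh z" by (auto simp: cosh_def abs_if)
  then have "inverse (cosh z) \<le> inverse (exp \<bar>z\<bar> / 2)" by (intro le_imp_inverse_le) auto
  then show ?thesis by (simp add: \<psi>_def exp_minus field_simps)
qed

lemma expdecay_psi [simp, intro]: "expdecay \<psi>"
  unfolding expdecay_def using continuous_phi_psi psi_le psi_pos
  by (intro conjI exI[of _ 1] exI[of _ 2]) (auto simp: abs_of_pos)

lemma subexp_phi [simp, intro]: "subexp \<phi>"
  by (rule subexp_bounded[OF continuous_phi_psi(1) abs_phi_le])

lemma subexp_psi [simp, intro]: "subexp \<psi>"
  by (simp add: expdecay_subexp)

lemma expdecay_psi2 [simp, intro]: "expdecay (\<lambda>z. (\<psi> z)\<^sup>2)"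
  unfolding power2_eq_square by auto

lemma phi_tendsto: "(\<phi> \<longlongrightarrow> 1) at_top" "(\<phi> \<longlongrightarrow> -1) at_bot"
  using tanh_real_at_top tanh_real_at_bot by (auto simp: \<phi>_def[abs_def])

text \<open>The antiderivative tanh runs from -1 to 1. Because the integrand is nonnegative, the
  fundamental theorem yields integrability along with the value.\<close>

lemma psi2_integral: "integrable lborel (\<lambda>z. (\<psi> z)\<^sup>2)" "(LINT z|lborel. (\<psi> z)\<^sup>2) = 2"
proof -
  have c: "isCont (\<lambda>z. (\<psi> z)\<^sup>2) x" for x
    using continuous_phi_psi(2) by (intro continuous_intros) (simp add: continuous_on_eq_continuous_at)
  have t: "((\<phi> \<circ> real_of_ereal) \<longlongrightarrow> -1) (at_right (-\<infinity>))" "((\<phi> \<circ> real_of_ereal) \<longlongrightarrow> 1) (at_left \<infinity>)"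
    by (simp_all add: ereal_tendsto_simps phi_tendsto)
  note F = interval_integral_FTC_nonneg[of "-\<infinity>" \<infinity> \<phi> "\<lambda>z. (\<psi> z)\<^sup>2", OF _ phi_has_deriv c _ t]
  show "integrable lborel (\<lambda>z. (\<psi> z)\<^sup>2)"
    using F(1) by (simp add: set_integrable_def)
  show "(LINT z|lborel. (\<psi> z)\<^sup>2) = 2"
    using F(2) by (simp add: interval_lebesgue_integral_def set_lebesgue_integral_def)
qed

text \<open>A rescaled copy of \<psi>^2 dominates the exponential by \<open>psi_ge\<close>, and it
  is integrable because tanh is bounded.\<close>

lemma integrable_exp_minus_abs:
  assumes "(d::real) > 0" shows "integrable lborel (\<lambda>z. exp (- (d * \<bar>z\<bar>)))"
proof (rule Bochner_Integration.integrable_bound)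
  show "integrable lborel (\<lambda>z. (\<psi> (0 + d / 2 * z))\<^sup>2)"
    using psi2_integral(1) assms by (intro lborel_integrable_real_affine) auto
  have "exp (- (d * \<bar>z\<bar>)) \<le> (\<psi> (d / 2 * z))\<^sup>2" for z
  proof -
    have "exp (- \<bar>d / 2 * z\<bar>) ^ 2 \<le> (\<psi> (d / 2 * z))\<^sup>2"
      using psi_ge[of "d / 2 * z"] by (intro power_mono) auto
    then show ?thesis using assms by (simp add: abs_mult flip: exp_double)
  qed
  then show "AE z in lborel. norm (exp (- (d * \<bar>z\<bar>))) \<le> norm ((\<psi> (0 + d / 2 * z))\<^sup>2)" by simp
qed (auto intro!: borel_measurable_continuous_onI continuous_intros)

lemma expdecay_integrable [simp, intro]:
  assumes "expdecay f" shows "integrable lborel f"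
proof -
  obtain C d where "d > 0" and f: "\<And>z. \<bar>f z\<bar> \<le> C * exp (- (d * \<bar>z\<bar>))"
    using expdecayE[OF assms] by metis
  have m: "f \<in> borel_measurable borel"
    using expdecay_continuous[OF assms] by (rule borel_measurable_continuous_onI)
  have "integrable lborel (\<lambda>z. C * exp (- (d * \<bar>z\<bar>)))"
    using integrable_exp_minus_abs[OF \<open>d > 0\<close>] by simp
  then show ?thesis
    by (rule Bochner_Integration.integrable_bound) (auto simp: m intro!: AE_I2 order_trans[OF f])
qed

lemma expdecay_in_L2: assumes "expdecay f" shows "in_L2 f"
proof -
  have "f \<in> borel_measurable lborel"
    using expdecay_continuous[OF assms] by (simp add: borel_measurable_continuous_onI)
  moreover have "integrable lborel (\<lambda>z. f z * f z)"
    using assms by (intro expdecay_integrable expdecay_mult expdecay_subexp)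
  ultimately show ?thesis by (simp add: in_L2_def power2_eq_square)
qed

section \<open>Integration by parts on the line, and regularity of square integrable
  solutions\<close>

lemma integral_total_derivative:
  fixes f F :: "real \<Rightarrow> real"
  assumes "\<And>z. (F has_real_derivative f z) (at z)" "expdecay f"
    and "(F \<longlongrightarrow> A) at_bot" "(F \<longlongrightarrow> B) at_top"
  shows "(LINT z|lborel. f z) = B - A"
proof -
  have "(LBINT z=-\<infinity>..\<infinity>. f z) = B - A"
  proof (rule interval_integral_FTC_integrable[where F = F])
    show "isCont f z" for z
      using expdecay_continuous[OF assms(2)] by (simp add: continuous_on_eq_continuous_at)
    show "set_integrable lborel (einterval (- \<infinity>) \<infinity>) f"
      using assms(2) by (simp add: set_integrable_def)
  qed (use assms in \<open>auto simp: ereal_tendsto_simps has_real_derivative_iff_has_vector_derivative\<close>)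
  then show ?thesis by (simp add: interval_lebesgue_integral_def set_lebesgue_integral_def)
qed

text \<open>This is the squared norm of \<phi>', the source of every 4/3 and 3/4 below. The
  antiderivative comes from \<psi>^4 = (1 - \<phi>^2) \<phi>'.\<close>

lemma psi4_integral: "(LINT z|lborel. (\<psi> z)\<^sup>2 * (\<psi> z)\<^sup>2) = 4 / 3"
proof -
  have "(LINT z|lborel. (\<psi> z)\<^sup>2 * (\<psi> z)\<^sup>2) = (1 - 1 ^ 3 / 3) - (- 1 - (- 1) ^ 3 / 3)"
  proof (rule integral_total_derivative)
    show "((\<lambda>z. \<phi> z - \<phi> z ^ 3 / 3) has_real_derivative (\<psi> z)\<^sup>2 * (\<psi> z)\<^sup>2) (at z)" for z
    proof -
      have "((\<lambda>z. \<phi> z - \<phi> z ^ 3 / 3) has_real_derivative (\<psi> z)\<^sup>2 - (\<phi> z)\<^sup>2 * (\<psi> z)\<^sup>2) (at z)"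
        by (auto intro!: derivative_eq_intros)
      moreover have "(\<psi> z)\<^sup>2 - (\<phi> z)\<^sup>2 * (\<psi> z)\<^sup>2 = (\<psi> z)\<^sup>2 * (\<psi> z)\<^sup>2"
        unfolding psi_sq by (simp add: algebra_simps)
      ultimately show ?thesis by simp
    qed
    show "((\<lambda>z. \<phi> z - \<phi> z ^ 3 / 3) \<longlongrightarrow> (- 1 - (- 1) ^ 3 / 3)) at_bot"
      "((\<lambda>z. \<phi> z - \<phi> z ^ 3 / 3) \<longlongrightarrow> (1 - 1 ^ 3 / 3)) at_top"
      by (intro tendsto_intros phi_tendsto; simp)+
  qed (intro expdecay_mult expdecay_subexp expdecay_psi2)
  then show ?thesis by simp
qed

text \<open>The difference of the integrands is the derivative of the Wronskian a q' - a' q, which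
  vanishes at both ends because \<open>a\<close> and its derivative decay.\<close>

lemma integral_second_derivative_swap:
  assumes a: "\<And>z. (a has_real_derivative a1 z) (at z)" "\<And>z. (a1 has_real_derivative a2 z) (at z)"
    and q: "\<And>z. (q has_real_derivative q1 z) (at z)" "\<And>z. (q1 has_real_derivative q2 z) (at z)"
    and d: "expdecay a" "expdecay a1" "expdecay a2" "subexp q" "subexp q1" "subexp q2"
  shows "(LINT z|lborel. a z * q2 z) = (LINT z|lborel. a2 z * q z)"
proof -
  have "(LINT z|lborel. a z * q2 z - a2 z * q z) = 0 - 0"
  proof (rule integral_total_derivative)
    show "((\<lambda>z. a z * q1 z - a1 z * q z) has_real_derivative a z * q2 z - a2 z * q z) (at z)" for z
      by (auto intro!: derivative_eq_intros a q simp: algebra_simps)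
    have "expdecay (\<lambda>z. a z * q1 z - a1 z * q z)" using d by auto
    then show "((\<lambda>z. a z * q1 z - a1 z * q z) \<longlongrightarrow> 0) at_bot" "((\<lambda>z. a z * q1 z - a1 z * q z) \<longlongrightarrow> 0) at_top"
      by (auto dest: expdecay_tendsto)
  qed (use d in auto)
  moreover have "(LINT z|lborel. a z * q2 z - a2 z * q z)
      = (LINT z|lborel. a z * q2 z) - (LINT z|lborel. a2 z * q z)"
    using d by (intro Bochner_Integration.integral_diff expdecay_integrable) auto
  ultimately show ?thesis by simp
qed

lemma integral_odd_eq_0:
  fixes f :: "real \<Rightarrow> real"
  assumes "\<And>z. f (- z) = - f z" shows "(LINT z|lborel. f z) = 0"
proof -
  have "(LINT z|lborel. f z) = (LINT z|lborel. f (0 + (-1) * z))"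
    by (subst lborel_integral_real_affine[where t = 0 and c = "-1"]) auto
  then show ?thesis using assms by simp
qed

text \<open>A regularity estimate on the intervals [x, x+1]. The square integral forces |q| to be
  small at some point of the first and of the last third, so the mean value theorem supplies a point
  with bounded derivative. With |q| \<le> 1 + q^2 the equation bounds the variation of
  \<open>q1\<close> by the square integral and the local maximum of |f|. Hence \<open>q\<close> and
  \<open>q1\<close> grow at most as fast as \<open>f\<close>.\<close>

lemma L2_ode_subexp:
  fixes q q1 q2 f :: "real \<Rightarrow> real"
  assumes q1: "\<And>z. (q has_real_derivative q1 z) (at z)"
    and q2: "\<And>z. (q1 has_real_derivative q2 z) (at z)"
    and L2: "integrable lborel (\<lambda>z. (q z)\<^sup>2)"
    and f: "subexp f" and c: "c \<ge> 0" and b: "\<And>z. \<bar>q2 z\<bar> \<le> c * \<bar>q z\<bar> + \<bar>f z\<bar>"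
  shows "subexp q" "subexp q1"
proof -
  define M where "M = (LINT z|lborel. (q z)\<^sup>2)"
  have M0: "M \<ge> 0" by (simp add: M_def)
  \<comment> \<open>If |q| exceeded B on an interval of length 1/3, then q^2 \<ge> B there and the
    square integral would be at least B/3 = M + 1/3. The summand 1 gives B \<ge> 1, hence B \<le>
    B^2.\<close>
  define B where "B = 3 * M + 1"
  have cq: "continuous_on UNIV q" "continuous_on UNIV q1"
    using q1 q2 by (auto intro!: continuous_at_imp_continuous_on DERIV_isCont)
  have "\<exists>H. \<forall>x::real. -\<infinity> < ereal x \<longrightarrow> ereal x < \<infinity> \<longrightarrow> (H has_vector_derivative (q x)\<^sup>2) (at x)"
    using cq by (intro einterval_antiderivative) (auto simp: continuous_on_eq_continuous_at)
  then obtain H where H: "\<And>x. (H has_real_derivative (q x)\<^sup>2) (at x)"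
    by (auto simp: has_real_derivative_iff_has_vector_derivative)
  have HM: "H y - H x \<le> M" if "x \<le> y" for x y
  proof -
    have cc: "continuous_on {x..y} (\<lambda>z. (q z)\<^sup>2)"
      using cq by (intro continuous_intros) (auto intro: continuous_on_subset)
    have "H y - H x = (LINT z|lborel. indicator {x..y} z *\<^sub>R (q z)\<^sup>2)"
      using H cc that
      by (intro integral_FTC_atLeastAtMost[symmetric])
         (auto simp: has_real_derivative_iff_has_vector_derivative intro: has_vector_derivative_at_within)
    also have "\<dots> \<le> M" unfolding M_def
      using L2 borel_integrable_atLeastAtMost'[OF cc]
      by (intro integral_mono) (auto simp: set_integrable_def indicator_def)
    finally show ?thesis .
  qed
  have pt: "\<exists>y\<in>{x..x+1/3}. \<bar>q y\<bar> \<le> B" for x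
  proof (rule ccontr)
    assume "\<not> ?thesis"
    then have big: "\<bar>q y\<bar> > B" if "y \<in> {x..x+1/3}" for y using that by force
    have "B * B \<le> (q y)\<^sup>2" if "y \<in> {x..x+1/3}" for y
      using big[OF that] M0 mult_mono[of B "\<bar>q y\<bar>" B "\<bar>q y\<bar>"]
      by (simp add: power2_eq_square B_def abs_mult_self_eq)
    moreover have "B \<le> B * B" using M0 by (simp add: B_def)
    ultimately have sq: "B \<le> (q y)\<^sup>2" if "y \<in> {x..x+1/3}" for y using that by force
    have "H (x + 1/3) - B * (x + 1/3) \<ge> H x - B * x"
      using H sq by (intro DERIV_nonneg_imp_nondecreasing[of x "x + 1/3" "\<lambda>y. H y - B * y"])
        (auto intro!: derivative_eq_intros exI)
    moreover have "H (x + 1/3) - H x \<le> M" by (rule HM) simp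
    ultimately show False by (simp add: B_def algebra_simps)
  qed
  have bound: "\<bar>q1 x\<bar> \<le> 6 * B + c * M + c + F \<and> \<bar>q x\<bar> \<le> B + (6 * B + c * M + c + F)"
    if F: "\<And>y. y \<in> {x..x+1} \<Longrightarrow> \<bar>f y\<bar> \<le> F" for x F
  proof -
    obtain x1 where x1: "x1 \<in> {x..x+1/3}" "\<bar>q x1\<bar> \<le> B" using pt[of x] by blast
    obtain x2 where x2: "x2 \<in> {x+2/3..x+1}" "\<bar>q x2\<bar> \<le> B" using pt[of "x+2/3"] by (auto simp: algebra_simps)
    have l: "x1 < x2" using x1 x2 by auto
    obtain x3 where x3: "x1 < x3" "x3 < x2" "q x2 - q x1 = (x2 - x1) * q1 x3"
      using MVT2[OF l, of q q1] q1 by blast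
    have B0: "B \<ge> 0" using M0 by (simp add: B_def)
    have "\<bar>q1 x3\<bar> * (1/3) \<le> \<bar>q1 x3\<bar> * (x2 - x1)"
      using x1 x2 by (intro mult_left_mono) auto
    also have "\<dots> = \<bar>q x2 - q x1\<bar>" using x3 l by (simp add: abs_mult)
    also have "\<dots> \<le> 2 * B" using x1 x2 by linarith
    finally have q13: "\<bar>q1 x3\<bar> \<le> 6 * B" by simp
    have q2b: "\<bar>q2 y\<bar> \<le> c * (q y)\<^sup>2 + (c + F)" if "y \<in> {x..x+1}" for y
    proof -
      have "\<bar>q y\<bar> \<le> 1 + (q y)\<^sup>2"
      proof -
        have "0 \<le> (\<bar>q y\<bar> - 1)\<^sup>2" "0 \<le> (q y)\<^sup>2" by auto
        then show ?thesis unfolding power2_diff by simp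
      qed
      then have "c * \<bar>q y\<bar> \<le> c * (1 + (q y)\<^sup>2)" using c by (rule mult_left_mono)
      then show ?thesis using b[of y] F[OF that] by (simp add: algebra_simps)
    qed
    have F0: "F \<ge> 0" using F[of x] by force
    have var: "\<bar>q1 t - q1 s\<bar> \<le> c * M + c + F" if st: "s \<le> t" "s \<in> {x..x+1}" "t \<in> {x..x+1}" for s t
    proof -
      \<comment> \<open>The bound for |q2| is the derivative of c H + (c + F) t. Subtracting this
        function from \<open>q1\<close> gives a nonincreasing function and adding it a nondecreasing
        one, so the bound is integrated without integrating \<open>q2\<close>.\<close>
      have "q1 t - (c * H t + (c + F) * t) \<le> q1 s - (c * H s + (c + F) * s)"
      proof (rule DERIV_nonpos_imp_nonincreasing[OF st(1)])
        fix y assume "s \<le> y" "y \<le> t"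
        then have "q2 y - (c * (q y)\<^sup>2 + (c + F)) \<le> 0" using q2b[of y] st by auto
        moreover have "((\<lambda>t. q1 t - (c * H t + (c + F) * t)) has_real_derivative
            q2 y - (c * (q y)\<^sup>2 + (c + F))) (at y)"
          by (auto intro!: derivative_eq_intros q2 H)
        ultimately show "\<exists>d. ((\<lambda>t. q1 t - (c * H t + (c + F) * t)) has_real_derivative d) (at y) \<and> d \<le> 0"
          by blast
      qed
      moreover have "q1 t + (c * H t + (c + F) * t) \<ge> q1 s + (c * H s + (c + F) * s)"
      proof (rule DERIV_nonneg_imp_nondecreasing[OF st(1)])
        fix y assume "s \<le> y" "y \<le> t"
        then have "q2 y + (c * (q y)\<^sup>2 + (c + F)) \<ge> 0" using q2b[of y] st by auto
        moreover have "((\<lambda>t. q1 t + (c * H t + (c + F) * t)) has_real_derivative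
            q2 y + (c * (q y)\<^sup>2 + (c + F))) (at y)"
          by (auto intro!: derivative_eq_intros q2 H)
        ultimately show "\<exists>d. ((\<lambda>t. q1 t + (c * H t + (c + F) * t)) has_real_derivative d) (at y) \<and> 0 \<le> d"
          by blast
      qed
      moreover have "c * (H t - H s) \<le> c * M" using HM[OF st(1)] c by (rule mult_left_mono)
      moreover have "(c + F) * (t - s) \<le> (c + F) * 1" using st c F0 by (intro mult_left_mono) auto
      ultimately show ?thesis by (simp add: algebra_simps)
    qed
    have x3I: "x3 \<in> {x..x+1}" using x1 x2 x3 by auto
    have q1b: "\<bar>q1 y\<bar> \<le> 6 * B + c * M + c + F" if "y \<in> {x..x+1}" for y
      using var[of y x3] var[of x3 y] x3I that q13 by (cases "y \<le> x3") force+
    have "\<bar>q x\<bar> \<le> B + (6 * B + c * M + c + F)"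
    proof (cases "x = x1")
      case False
      then have "x < x1" using x1 by auto
      then obtain y where y: "x < y" "y < x1" "q x1 - q x = (x1 - x) * q1 y"
        using MVT2[of x x1 q q1] q1 by blast
      have *: "\<bar>(x1 - x) * q1 y\<bar> \<le> 1 * (6 * B + c * M + c + F)"
        unfolding abs_mult using x1 y q1b[of y] by (intro mult_mono) auto
      have "q x = q x1 - (x1 - x) * q1 y" using y by simp
      then have "\<bar>q x\<bar> \<le> \<bar>q x1\<bar> + \<bar>(x1 - x) * q1 y\<bar>" by (metis abs_triangle_ineq4)
      also have "\<dots> \<le> B + 1 * (6 * B + c * M + c + F)" by (rule add_mono[OF x1(2) *])
      finally show ?thesis by simp
    qed (use x1 B0 c F0 mult_nonneg_nonneg[OF c M0] in auto)
    then show ?thesis using q1b[of x] by simp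
  qed
  have main: "\<exists>C. \<forall>x. \<bar>q1 x\<bar> \<le> C * exp (d * \<bar>x\<bar>) \<and> \<bar>q x\<bar> \<le> C * exp (d * \<bar>x\<bar>)" if d: "d > 0" for d
  proof -
    obtain A where A: "A \<ge> 0" "\<And>z. \<bar>f z\<bar> \<le> A * exp (d * \<bar>z\<bar>)" using subexpE[OF f d] by metis
    have "\<bar>q1 x\<bar> \<le> (7 * B + c * M + c + A * exp d) * exp (d * \<bar>x\<bar>) \<and>
          \<bar>q x\<bar> \<le> (7 * B + c * M + c + A * exp d) * exp (d * \<bar>x\<bar>)" for x
    proof -
      have fb: "\<bar>f y\<bar> \<le> A * exp d * exp (d * \<bar>x\<bar>)" if "y \<in> {x..x+1}" for y
      proof -
        have "d * \<bar>y\<bar> \<le> d * (1 + \<bar>x\<bar>)" using that d by (intro mult_left_mono) auto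
        then have "exp (d * \<bar>y\<bar>) \<le> exp d * exp (d * \<bar>x\<bar>)"
          by (simp add: algebra_simps flip: exp_add)
        then have "A * exp (d * \<bar>y\<bar>) \<le> A * (exp d * exp (d * \<bar>x\<bar>))" using A(1) by (rule mult_left_mono)
        then show ?thesis using A(2)[of y] by (simp add: mult_ac)
      qed
      have bb: "\<bar>q1 x\<bar> \<le> 6 * B + c * M + c + A * exp d * exp (d * \<bar>x\<bar>) \<and>
        \<bar>q x\<bar> \<le> B + (6 * B + c * M + c + A * exp d * exp (d * \<bar>x\<bar>))"
        by (rule bound) (rule fb)
      define K where "K = 7 * B + c * M + c"
      define E where "E = exp (d * \<bar>x\<bar>)"
      have "0 \<le> K" using M0 c by (simp add: K_def B_def)
      then have "K * 1 \<le> K * E" using d by (intro mult_left_mono) (auto simp: E_def)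
      moreover have "B \<ge> 0" using M0 by (simp add: B_def)
      moreover have "6 * B + c * M + c = K - B" by (simp add: K_def)
      moreover have "(K + A * exp d) * E = K * E + A * exp d * E" by (rule distrib_right)
      ultimately have "\<bar>q1 x\<bar> \<le> (K + A * exp d) * E" "\<bar>q x\<bar> \<le> (K + A * exp d) * E"
        using bb[folded E_def] by linarith+
      then show ?thesis by (simp add: K_def E_def)
    qed
    then show ?thesis by blast
  qed
  show "subexp q" "subexp q1"
    using cq main unfolding subexp_def by blast+
qed

section \<open>The linearized operators\<close>

lemma twice_differentiableD:
  assumes "twice_differentiable f"
  shows "(f has_real_derivative deriv f z) (at z)"
    "(deriv f has_real_derivative deriv (deriv f) z) (at z)"
  using assms by (auto simp: twice_differentiable_def DERIV_deriv_iff_field_differentiable)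

lemma twice_differentiableI:
  assumes "\<And>z. (f has_real_derivative f1 z) (at z)" "\<And>z. (f1 has_real_derivative f2 z) (at z)"
  shows "twice_differentiable f" "deriv f = f1" "deriv (deriv f) = f2"
proof -
  have 1: "deriv f = f1" and 2: "deriv f1 = f2"
    using assms by (auto intro: DERIV_imp_deriv)
  then show "deriv f = f1" "deriv (deriv f) = f2" by auto
  show "twice_differentiable f"
    unfolding twice_differentiable_def 1 using assms by (auto simp: field_differentiable_def)
qed

lemma schroedinger_L2_subexp:
  assumes q: "twice_differentiable q" "in_L2 q" and f: "subexp f"
    and w: "subexp w" "\<And>z. \<bar>w z\<bar> \<le> c"
    and eq: "\<And>z. deriv (deriv q) z = w z * q z - f z"
  shows "subexp q" "subexp (deriv q)" "subexp (deriv (deriv q))"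
proof -
  note d = twice_differentiableD[OF q(1)]
  have L: "integrable lborel (\<lambda>z. (q z)\<^sup>2)" using q(2) by (simp add: in_L2_def)
  have "c \<ge> 0" using w(2)[of 0] by linarith
  moreover have "\<bar>deriv (deriv q) z\<bar> \<le> c * \<bar>q z\<bar> + \<bar>f z\<bar>" for z
  proof -
    have "\<bar>w z * q z\<bar> \<le> c * \<bar>q z\<bar>" unfolding abs_mult by (intro mult_right_mono w) auto
    then show ?thesis unfolding eq by linarith
  qed
  ultimately show s: "subexp q" "subexp (deriv q)" using L2_ode_subexp[OF d L f] by auto
  have "deriv (deriv q) = (\<lambda>z. w z * q z - f z)" using eq by auto
  then show "subexp (deriv (deriv q))" using s f w by simp
qed

lemma psi2_le_1: "(\<psi> z)\<^sup>2 \<le> 1" by (simp add: psi_sq)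

lemma opD_subexp:
  assumes "twice_differentiable q" "in_L2 q" "opD \<mu> q = f" "subexp f"
  shows "subexp q" "subexp (deriv q)" "subexp (deriv (deriv q))"
proof -
  have 1: "deriv (deriv q) z = (\<mu> + 1 - 2 * (\<psi> z)\<^sup>2) * q z - f z" for z
    unfolding assms(3)[symmetric] opD_def by (simp add: algebra_simps)
  have 2: "\<bar>\<mu> + 1 - 2 * (\<psi> z)\<^sup>2\<bar> \<le> \<bar>\<mu> + 1\<bar> + 2" for z
    using psi2_le_1[of z] zero_le_power2[of "\<psi> z"] by linarith
  have 3: "subexp (\<lambda>z. \<mu> + 1 - 2 * (\<psi> z)\<^sup>2)" by auto
  show "subexp q" "subexp (deriv q)" "subexp (deriv (deriv q))"
    using schroedinger_L2_subexp[OF assms(1,2,4) 3 2 1] by auto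
qed

lemma opC_subexp:
  assumes "twice_differentiable q" "in_L2 q" "opC q = f" "subexp f"
  shows "subexp q" "subexp (deriv q)" "subexp (deriv (deriv q))"
proof -
  have 1: "deriv (deriv q) z = (4 - 6 * (\<psi> z)\<^sup>2) * q z - f z" for z
    unfolding assms(3)[symmetric] opC_def by (simp add: algebra_simps)
  have 2: "\<bar>4 - 6 * (\<psi> z)\<^sup>2\<bar> \<le> 4" for z
    using psi2_le_1[of z] zero_le_power2[of "\<psi> z"] by linarith
  have 3: "subexp (\<lambda>z. 4 - 6 * (\<psi> z)\<^sup>2)" by auto
  show "subexp q" "subexp (deriv q)" "subexp (deriv (deriv q))"
    using schroedinger_L2_subexp[OF assms(1,2,4) 3 2 1] by auto
qed

lemma opD_green:
  assumes a: "twice_differentiable a" "expdecay a" "expdecay (deriv a)" "expdecay (deriv (deriv a))"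
    and q: "twice_differentiable q" "subexp q" "subexp (deriv q)" "subexp (deriv (deriv q))"
  shows "(LINT z|lborel. a z * opD \<mu> q z) = (LINT z|lborel. opD \<mu> a z * q z)"
proof -
  have *: "(LINT z|lborel. a z * deriv (deriv q) z) = (LINT z|lborel. deriv (deriv a) z * q z)"
    using twice_differentiableD[OF a(1)] twice_differentiableD[OF q(1)] a(2-4) q(2-4)
    by (rule integral_second_derivative_swap)
  have v: "expdecay (\<lambda>z. ((\<mu> + 1 - 2 * (\<psi> z)\<^sup>2) * a z) * q z)"
    using a q by (intro expdecay_mult expdecay_mult') auto
  have "(LINT z|lborel. a z * opD \<mu> q z)
      = (LINT z|lborel. ((\<mu> + 1 - 2 * (\<psi> z)\<^sup>2) * a z) * q z - a z * deriv (deriv q) z)"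
    by (rule arg_cong[of _ _ "integral\<^sup>L lborel"]) (auto simp: opD_def algebra_simps)
  also have "\<dots> = (LINT z|lborel. ((\<mu> + 1 - 2 * (\<psi> z)\<^sup>2) * a z) * q z) - (LINT z|lborel. a z * deriv (deriv q) z)"
    using v a(2) q(4) by (intro Bochner_Integration.integral_diff expdecay_integrable) auto
  also have "\<dots> = (LINT z|lborel. ((\<mu> + 1 - 2 * (\<psi> z)\<^sup>2) * a z) * q z - deriv (deriv a) z * q z)"
    using v a(4) q(2) unfolding * 
    by (intro Bochner_Integration.integral_diff[symmetric] expdecay_integrable) auto
  also have "\<dots> = (LINT z|lborel. opD \<mu> a z * q z)"
    by (rule arg_cong[of _ _ "integral\<^sup>L lborel"]) (auto simp: opD_def algebra_simps)
  finally show ?thesis .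
qed

text \<open>The two lines together are the kernel relation C \<phi>' = 0, which reflects translation
  invariance of the front.\<close>

lemma psi2_derivs:
  "((\<lambda>z. (\<psi> z)\<^sup>2) has_real_derivative - 2 * \<phi> z * (\<psi> z)\<^sup>2) (at z)"
  "((\<lambda>z. - 2 * \<phi> z * (\<psi> z)\<^sup>2) has_real_derivative (4 - 6 * (\<psi> z)\<^sup>2) * (\<psi> z)\<^sup>2) (at z)"
proof -
  show 1: "((\<lambda>z. (\<psi> z)\<^sup>2) has_real_derivative - 2 * \<phi> z * (\<psi> z)\<^sup>2) (at z)" for z
    by (auto intro!: derivative_eq_intros simp: power2_eq_square)
  have "((\<lambda>z. - 2 * \<phi> z * (\<psi> z)\<^sup>2) has_real_derivative
      - 2 * (\<psi> z)\<^sup>2 * (\<psi> z)\<^sup>2 + - 2 * \<phi> z * (- 2 * \<phi> z * (\<psi> z)\<^sup>2)) (at z)"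
    by (rule derivative_eq_intros 1 phi_has_deriv refl | simp)+
  moreover have "- 2 * (\<psi> z)\<^sup>2 * (\<psi> z)\<^sup>2 + - 2 * \<phi> z * (- 2 * \<phi> z * (\<psi> z)\<^sup>2)
      = (4 - 6 * (\<psi> z)\<^sup>2) * (\<psi> z)\<^sup>2"
  proof -
    have "- 2 * (\<psi> z)\<^sup>2 * (\<psi> z)\<^sup>2 + - 2 * \<phi> z * (- 2 * \<phi> z * (\<psi> z)\<^sup>2)
      = (4 * (\<phi> z)\<^sup>2 - 2 * (\<psi> z)\<^sup>2) * (\<psi> z)\<^sup>2" by (simp add: algebra_simps power2_eq_square)
    also have "4 * (\<phi> z)\<^sup>2 - 2 * (\<psi> z)\<^sup>2 = 4 - 6 * (\<psi> z)\<^sup>2" by (simp add: psi_sq)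
    finally show ?thesis .
  qed
  ultimately show "((\<lambda>z. - 2 * \<phi> z * (\<psi> z)\<^sup>2) has_real_derivative (4 - 6 * (\<psi> z)\<^sup>2) * (\<psi> z)\<^sup>2) (at z)"
    by simp
qed

text \<open>The solvability condition for C: the operator is symmetric and annihilates
  \<phi>'.\<close>

lemma opC_range_orthogonal:
  assumes q: "twice_differentiable q" "subexp q" "subexp (deriv q)" "subexp (deriv (deriv q))"
  shows "(LINT z|lborel. (\<psi> z)\<^sup>2 * opC q z) = 0"
proof -
  have e: "expdecay (\<lambda>z. - 2 * \<phi> z * (\<psi> z)\<^sup>2)" "expdecay (\<lambda>z. (4 - 6 * (\<psi> z)\<^sup>2) * (\<psi> z)\<^sup>2)"
    by (intro expdecay_mult' expdecay_psi2; auto)+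
  have *: "(LINT z|lborel. (\<psi> z)\<^sup>2 * deriv (deriv q) z)
      = (LINT z|lborel. ((4 - 6 * (\<psi> z)\<^sup>2) * (\<psi> z)\<^sup>2) * q z)"
    by (rule integral_second_derivative_swap[OF psi2_derivs twice_differentiableD[OF q(1)] expdecay_psi2 e q(2-4)])
  have "(LINT z|lborel. (\<psi> z)\<^sup>2 * opC q z)
     = (LINT z|lborel. ((4 - 6 * (\<psi> z)\<^sup>2) * (\<psi> z)\<^sup>2) * q z - (\<psi> z)\<^sup>2 * deriv (deriv q) z)"
    by (rule arg_cong[of _ _ "integral\<^sup>L lborel"]) (auto simp: opC_def algebra_simps)
  also have "\<dots> = 0"
    using expdecay_integrable[OF expdecay_mult[OF e(2) q(2)]] expdecay_integrable[OF expdecay_mult[OF expdecay_psi2 q(4)]] *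
    by (subst Bochner_Integration.integral_diff) simp_all
  finally show ?thesis .
qed

subsection \<open>Kernels\<close>

lemma exp_mult_subexp_tendsto:
  assumes "subexp g" "k > 0" shows "((\<lambda>z. exp (- (k * z)) * g z) \<longlongrightarrow> 0) at_top"
proof -
  have "k / 2 > 0" using assms by simp
  then obtain C where C: "\<And>z. \<bar>g z\<bar> \<le> C * exp (k / 2 * \<bar>z\<bar>)" using subexpE[OF assms(1)] by metis
  have b: "norm (exp (- (k * z)) * g z) \<le> C * exp (- (k / 2 * \<bar>z\<bar>))" if "z \<ge> 0" for z
    using abs_prod_exp_bound[of "exp (- (k * z))" 1 "- (k * z)" "g z" C "k / 2 * \<bar>z\<bar>"] C[of z] that by simp
  have "eventually (\<lambda>z. norm (exp (- (k * z)) * g z) \<le> C * exp (- (k / 2 * \<bar>z\<bar>))) at_top"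
    by (rule eventually_mono[OF eventually_ge_at_top[of 0] b])
  from Lim_null_comparison[OF this exp_minus_abs_tendsto(1)] assms(2) show ?thesis by simp
qed

lemma wronskian_constant:
  fixes a a1 a2 q q1 q2 :: "real \<Rightarrow> real"
  assumes a: "\<And>z. (a has_real_derivative a1 z) (at z)" "\<And>z. (a1 has_real_derivative a2 z) (at z)"
    and q: "\<And>z. (q has_real_derivative q1 z) (at z)" "\<And>z. (q1 has_real_derivative q2 z) (at z)"
    and "\<And>z. a z * q2 z = a2 z * q z"
  obtains c where "\<And>z. a z * q1 z - a1 z * q z = c"
proof -
  have "((\<lambda>z. a z * q1 z - a1 z * q z) has_real_derivative 0) (at z)" for z
  proof -
    have "((\<lambda>z. a z * q1 z - a1 z * q z) has_real_derivative a z * q2 z - a2 z * q z) (at z)"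
      by (auto intro!: derivative_eq_intros a q simp: algebra_simps)
    then show ?thesis using assms(5) by simp
  qed
  then have "\<forall>x y. a x * q1 x - a1 x * q x = a y * q1 y - a1 y * q y" by (intro DERIV_isconst_all allI)
  then show ?thesis using that by metis
qed

lemma wronskian_zero:
  fixes a a1 a2 q q1 q2 :: "real \<Rightarrow> real"
  assumes a: "\<And>z. (a has_real_derivative a1 z) (at z)" "\<And>z. (a1 has_real_derivative a2 z) (at z)"
    and q: "\<And>z. (q has_real_derivative q1 z) (at z)" "\<And>z. (q1 has_real_derivative q2 z) (at z)"
    and eq: "\<And>z. a z * q2 z = a2 z * q z"
    and lim: "((\<lambda>z. a z * q1 z - a1 z * q z) \<longlongrightarrow> 0) at_top"
  shows "a z * q1 z = a1 z * q z"
proof -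
  obtain c where c: "\<And>z. a z * q1 z - a1 z * q z = c"
    using wronskian_constant[OF a q eq] by metis
  with lim have "c = 0" by (simp add: tendsto_const_iff)
  then show ?thesis using c[of z] by simp
qed

text \<open>The function exp(-kz) (tanh z + k) is the Jost solution of D with k^2 = \<mu> + 1; the
  potential is reflectionless, hence the closed form. Its Wronskian with a subexponential solution
  is constant and tends to 0 at infinity. The vanishing Wronskian, divided by the exponential, is
  the stated first order relation.\<close>

lemma opD_homogeneous_wronskian:
  assumes q: "twice_differentiable q" "subexp q" "subexp (deriv q)"
    and eq: "opD (k\<^sup>2 - 1) q = (\<lambda>z. 0)" and k: "k > 0"
  shows "(\<phi> z + k) * deriv q z = ((\<psi> z)\<^sup>2 - k\<^sup>2 - k * \<phi> z) * q z"
proof -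
  let ?e = "\<lambda>z. exp (- (k * z))"
  let ?a = "\<lambda>z. ?e z * (\<phi> z + k)" and ?a1 = "\<lambda>z. ?e z * ((\<psi> z)\<^sup>2 - k\<^sup>2 - k * \<phi> z)"
    and ?a2 = "\<lambda>z. ?e z * ((k\<^sup>2 - 2 * (\<psi> z)\<^sup>2) * (\<phi> z + k))"
  have "?a z * deriv q z = ?a1 z * q z"
  proof (rule wronskian_zero[of ?a ?a1 ?a2 q "deriv q" "deriv (deriv q)"])
    show "(?a has_real_derivative ?a1 z) (at z)" for z
      by (auto intro!: derivative_eq_intros simp: algebra_simps power2_eq_square)
    show "(?a1 has_real_derivative ?a2 z) (at z)" for z
      by (auto intro!: derivative_eq_intros psi2_derivs simp: algebra_simps power2_eq_square)
    have "deriv (deriv q) z = (k\<^sup>2 - 2 * (\<psi> z)\<^sup>2) * q z" for z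
      using fun_cong[OF eq, of z] by (simp add: opD_def algebra_simps)
    then show "?a z * deriv (deriv q) z = ?a2 z * q z" for z by simp
    have s: "subexp (\<lambda>z. (\<phi> z + k) * deriv q z - ((\<psi> z)\<^sup>2 - k\<^sup>2 - k * \<phi> z) * q z)"
      using q by (intro subexp_mult subexp_diff subexp_add subexp_power) auto
    have eq2: "(\<lambda>z. ?a z * deriv q z - ?a1 z * q z)
      = (\<lambda>z. ?e z * ((\<phi> z + k) * deriv q z - ((\<psi> z)\<^sup>2 - k\<^sup>2 - k * \<phi> z) * q z))"
      by (auto simp: algebra_simps)
    show "((\<lambda>z. ?a z * deriv q z - ?a1 z * q z) \<longlongrightarrow> 0) at_top"
      unfolding eq2 by (rule exp_mult_subexp_tendsto[OF s k])
  qed (use twice_differentiableD[OF q(1)] in auto)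
  then show ?thesis by simp
qed

lemma twice_differentiable_reflect:
  assumes "twice_differentiable q"
  shows "twice_differentiable (\<lambda>z. q (- z))" "deriv (\<lambda>z. q (- z)) = (\<lambda>z. - deriv q (- z))"
    "deriv (deriv (\<lambda>z. q (- z))) = (\<lambda>z. deriv (deriv q) (- z))"
proof -
  note d = twice_differentiableD[OF assms]
  have 1: "((\<lambda>z. q (- z)) has_real_derivative - deriv q (- z)) (at z)" for z
    by (rule DERIV_cong[OF DERIV_chain2[where f = q and g = uminus, OF d(1)]]) (auto intro!: derivative_eq_intros)
  have 2: "((\<lambda>z. - deriv q (- z)) has_real_derivative deriv (deriv q) (- z)) (at z)" for z
    by (rule DERIV_cong[OF DERIV_minus[OF DERIV_chain2[where f = "deriv q" and g = uminus, OF d(2)]]])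
      (auto intro!: derivative_eq_intros)
  show "twice_differentiable (\<lambda>z. q (- z))" "deriv (\<lambda>z. q (- z)) = (\<lambda>z. - deriv q (- z))"
    "deriv (deriv (\<lambda>z. q (- z))) = (\<lambda>z. deriv (deriv q) (- z))"
    using twice_differentiableI[of "\<lambda>z. q (- z)", OF 1 2] by auto
qed

lemma opD_reflect: "twice_differentiable q \<Longrightarrow> opD \<mu> (\<lambda>z. q (- z)) = (\<lambda>z. opD \<mu> q (- z))"
  by (simp add: fun_eq_iff opD_def twice_differentiable_reflect(3))

lemma opC_reflect: "twice_differentiable q \<Longrightarrow> opC (\<lambda>z. q (- z)) = (\<lambda>z. opC q (- z))"
  by (simp add: fun_eq_iff opC_def twice_differentiable_reflect(3))

lemma subexp_reflect: "subexp f \<Longrightarrow> subexp (\<lambda>z. f (- z))"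
  unfolding subexp_def
proof (intro conjI allI impI)
  assume f: "continuous_on UNIV f \<and> (\<forall>d>0. \<exists>C. \<forall>z. \<bar>f z\<bar> \<le> C * exp (d * \<bar>z\<bar>))"
  then show "continuous_on UNIV (\<lambda>z. f (- z))"
    by (auto intro!: continuous_on_compose2[of UNIV f] continuous_intros)
  fix d :: real assume "d > 0"
  with f obtain C where "\<And>z. \<bar>f z\<bar> \<le> C * exp (d * \<bar>z\<bar>)" by blast
  then have "\<And>z. \<bar>f (- z)\<bar> \<le> C * exp (d * \<bar>z\<bar>)" by (metis abs_minus_cancel)
  then show "\<exists>C. \<forall>z. \<bar>f (- z)\<bar> \<le> C * exp (d * \<bar>z\<bar>)" by blast
qed

lemma in_L2_reflect: "in_L2 f \<Longrightarrow> in_L2 (\<lambda>z::real. f (- z) :: real)"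
  unfolding in_L2_def
  using lborel_integrable_real_affine[of "\<lambda>z. (norm (f z))\<^sup>2" "-1" 0] by auto

text \<open>The relation above and its mirror image are two linear equations for
  \<open>deriv q z\<close> and \<open>q z\<close>. Eliminating the derivative leaves the constant
  factor 2 k \<mu>, up to sign the Wronskian of the two Jost solutions, which is nonzero away from
  \<mu> = 0.\<close>

lemma opD_kernel_trivial:
  assumes q: "twice_differentiable q" "subexp q" "subexp (deriv q)"
    and eq: "opD \<mu> q = (\<lambda>z. 0)" and mu: "\<mu> > -1" "\<mu> \<noteq> 0"
  shows "q = (\<lambda>z. 0)"
proof
  fix z
  define k where "k = sqrt (\<mu> + 1)"
  have k: "k > 0" "k\<^sup>2 - 1 = \<mu>" using mu by (auto simp: k_def)
  have 1: "(\<phi> z + k) * deriv q z = ((\<psi> z)\<^sup>2 - k\<^sup>2 - k * \<phi> z) * q z"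
    using opD_homogeneous_wronskian[OF q, of k] eq k by simp
  let ?r = "\<lambda>z. q (- z)"
  have "(\<phi> (- z) + k) * deriv ?r (- z) = ((\<psi> (- z))\<^sup>2 - k\<^sup>2 - k * \<phi> (- z)) * ?r (- z)"
  proof (rule opD_homogeneous_wronskian)
    show "subexp (deriv (\<lambda>z. q (- z)))"
      using q subexp_minus[OF subexp_reflect[of "deriv q"]] by (simp add: twice_differentiable_reflect)
    show "opD (k\<^sup>2 - 1) (\<lambda>z. q (- z)) = (\<lambda>z. 0)" using q eq k by (simp add: opD_reflect)
  qed (fact twice_differentiable_reflect(1)[OF q(1)] subexp_reflect[OF q(2)] k(1))+
  then have 2: "(\<phi> z - k) * deriv q z = ((\<psi> z)\<^sup>2 - k\<^sup>2 + k * \<phi> z) * q z"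
    using q by (simp add: twice_differentiable_reflect algebra_simps)
  have "((\<phi> z - k) * ((\<psi> z)\<^sup>2 - k\<^sup>2 - k * \<phi> z) - (\<phi> z + k) * ((\<psi> z)\<^sup>2 - k\<^sup>2 + k * \<phi> z)) * q z = 0"
    using 1 2 by algebra
  moreover have "(\<phi> z - k) * ((\<psi> z)\<^sup>2 - k\<^sup>2 - k * \<phi> z) - (\<phi> z + k) * ((\<psi> z)\<^sup>2 - k\<^sup>2 + k * \<phi> z) = 2 * k * \<mu>"
    unfolding k(2)[symmetric] psi_sq by (simp add: algebra_simps power2_eq_square)
  ultimately show "q z = 0" using k mu by simp
qed

text \<open>For k = 1 the positive factor \<phi> + 1 cancels from the relation. What remains is q' =
  - \<phi> q, which is solved by the multiples of \<psi>.\<close>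

lemma opD_kernel_0:
  assumes q: "twice_differentiable q" "subexp q" "subexp (deriv q)"
    and eq: "opD 0 q = (\<lambda>z. 0)"
  obtains c where "\<And>z. q z = c * \<psi> z"
proof -
  have 1: "deriv q z = - \<phi> z * q z" for z
  proof -
    have "(\<phi> z + 1) * deriv q z = ((\<psi> z)\<^sup>2 - 1\<^sup>2 - 1 * \<phi> z) * q z"
      by (rule opD_homogeneous_wronskian[OF q]) (use eq in auto)
    also have "(\<psi> z)\<^sup>2 - 1\<^sup>2 - 1 * \<phi> z = (\<phi> z + 1) * (- \<phi> z)"
      using psi_sq[of z] by (simp add: algebra_simps power2_eq_square)
    finally have "(\<phi> z + 1) * (deriv q z + \<phi> z * q z) = 0" by (simp add: algebra_simps)
    moreover have "\<phi> z + 1 \<noteq> 0" using tanh_real_gt_neg1[of z] by (simp add: \<phi>_def)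
    ultimately show ?thesis by simp
  qed
  have "((\<lambda>z. q z / \<psi> z) has_real_derivative 0) (at z)" for z
    using psi_pos[of z]
    by (intro DERIV_cong[OF DERIV_divide[OF twice_differentiableD(1)[OF q(1)] psi_has_deriv]]) (auto simp: 1)
  then have "\<forall>x y. q x / \<psi> x = q y / \<psi> y" by (intro DERIV_isconst_all allI)
  then have "q z = (q 0 / \<psi> 0) * \<psi> z" for z using psi_pos[of z] by (metis nonzero_eq_divide_eq less_irrefl)
  then show ?thesis by (rule that)
qed

text \<open>The Wronskian with \<psi>^2 is constant and vanishes at infinity because \<psi>^2
  decays. This gives q' = - 2 \<phi> q, so q / \<psi>^2 is constant.\<close>

lemma opC_kernel:
  assumes q: "twice_differentiable q" "subexp q" "subexp (deriv q)"
    and eq: "opC q = (\<lambda>z. 0)"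
  obtains c where "\<And>z. q z = c * (\<psi> z)\<^sup>2"
proof -
  have 1: "deriv q z = - 2 * \<phi> z * q z" for z
  proof -
    have "(\<psi> z)\<^sup>2 * deriv q z = (- 2 * \<phi> z * (\<psi> z)\<^sup>2) * q z"
    proof (rule wronskian_zero[OF psi2_derivs twice_differentiableD[OF q(1)]])
      have "deriv (deriv q) z = (4 - 6 * (\<psi> z)\<^sup>2) * q z" for z
        using fun_cong[OF eq, of z] by (simp add: opC_def algebra_simps)
      then show "(\<psi> z)\<^sup>2 * deriv (deriv q) z = (4 - 6 * (\<psi> z)\<^sup>2) * (\<psi> z)\<^sup>2 * q z" for z by simp
      have "expdecay (\<lambda>z. (\<psi> z)\<^sup>2 * (deriv q z - (- 2 * \<phi> z) * q z))"
        using q by (intro expdecay_mult) auto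
      from expdecay_tendsto(1)[OF this]
      show "((\<lambda>z. (\<psi> z)\<^sup>2 * deriv q z - - 2 * \<phi> z * (\<psi> z)\<^sup>2 * q z) \<longlongrightarrow> 0) at_top"
        by (simp add: algebra_simps)
    qed
    then have "(\<psi> z)\<^sup>2 * (deriv q z + 2 * \<phi> z * q z) = 0" by (simp add: algebra_simps)
    then show ?thesis using psi_pos[of z] by simp
  qed
  have "((\<lambda>z. q z / (\<psi> z)\<^sup>2) has_real_derivative 0) (at z)" for z
    using psi_pos[of z]
    by (intro DERIV_cong[OF DERIV_divide[OF twice_differentiableD(1)[OF q(1)] psi2_derivs(1)]]) (auto simp: 1)
  then have "\<forall>x y. q x / (\<psi> x)\<^sup>2 = q y / (\<psi> y)\<^sup>2" by (intro DERIV_isconst_all allI)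
  then have "q z = (q 0 / (\<psi> 0)\<^sup>2) * (\<psi> z)\<^sup>2" for z
    using psi_pos[of z] by (metis nonzero_eq_divide_eq less_irrefl zero_eq_power2)
  then show ?thesis by (rule that)
qed

section \<open>Square integrable functions on the line\<close>

lemma not_integrable_bounded_below:
  fixes f :: "real \<Rightarrow> real"
  assumes "integrable lborel f" "\<And>z. f z \<ge> 0" "d > 0" "eventually (\<lambda>z. f z \<ge> d) at_top"
  shows False
proof -
  obtain R where R: "\<And>z. z \<ge> R \<Longrightarrow> f z \<ge> d" using assms(4) by (auto simp: eventually_at_top_linorder)
  have "real n * d \<le> (LINT z|lborel. f z)" for n
  proof -
    have i: "integrable lborel (\<lambda>z. indicator {R..R+n} z * d)" by simp
    have "real n * d = (LINT z|lborel. indicator {R..R+n} z * d)" by simp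
    also have "\<dots> \<le> (LINT z|lborel. f z)"
      using assms(2) R by (intro integral_mono[OF i assms(1)]) (auto simp: indicator_def)
    finally show ?thesis .
  qed
  then show False using reals_Archimedean3[OF assms(3)] by (metis leD)
qed

lemma in_L2_add:
  fixes f g :: "real \<Rightarrow> real"
  assumes "in_L2 f" "in_L2 g" shows "in_L2 (\<lambda>z. f z + g z)"
  unfolding in_L2_def
proof
  have m: "f \<in> borel_measurable lborel" "g \<in> borel_measurable lborel" using assms by (auto simp: in_L2_def)
  then show "(\<lambda>z. f z + g z) \<in> borel_measurable lborel" by simp
  have i: "integrable lborel (\<lambda>z. 2 * (f z)\<^sup>2 + 2 * (g z)\<^sup>2)" using assms by (auto simp: in_L2_def)
  have "(f z + g z)\<^sup>2 \<le> 2 * (f z)\<^sup>2 + 2 * (g z)\<^sup>2" for z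
    using zero_le_power2[of "f z - g z"] by (simp add: power2_eq_square algebra_simps)
  show "integrable lborel (\<lambda>z. (norm (f z + g z))\<^sup>2)"
  proof (rule Bochner_Integration.integrable_bound[OF i])
    show "(\<lambda>z. (norm (f z + g z))\<^sup>2) \<in> borel_measurable lborel" using m by measurable
    have "norm ((norm (f z + g z))\<^sup>2) \<le> norm (2 * (f z)\<^sup>2 + 2 * (g z)\<^sup>2)" for z
      using \<open>\<And>z. (f z + g z)\<^sup>2 \<le> 2 * (f z)\<^sup>2 + 2 * (g z)\<^sup>2\<close>[of z] by simp
    then show "AE z in lborel. norm ((norm (f z + g z))\<^sup>2) \<le> norm (2 * (f z)\<^sup>2 + 2 * (g z)\<^sup>2)" by simp
  qed
qed

lemma in_L2_cmult: "in_L2 f \<Longrightarrow> in_L2 (\<lambda>z. c * f z :: real)"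
  by (auto simp: in_L2_def power_mult_distrib)

lemma in_L2_minus: "in_L2 f \<Longrightarrow> in_L2 (\<lambda>z. - f z :: real)"
  by (auto simp: in_L2_def)

lemma in_L2_diff: "in_L2 f \<Longrightarrow> in_L2 g \<Longrightarrow> in_L2 (\<lambda>z. f z - g z :: real)"
  using in_L2_add[of f "\<lambda>z. - g z"] in_L2_minus[of g] by simp

subsection \<open>The inner problem\<close>

definition profile ::
  "real \<Rightarrow> real \<Rightarrow> real \<Rightarrow> (real \<Rightarrow> real) \<Rightarrow> (real \<Rightarrow> real) \<Rightarrow> (real \<Rightarrow> real) \<Rightarrow> (real \<Rightarrow> real) \<Rightarrow> bool"
where
  "profile \<mu> \<beta> V f g p q \<longleftrightarrow> twice_differentiable p \<and> twice_differentiable q \<and> in_L2 p \<and> in_L2 q \<and>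
     L2_inner p (deriv \<phi>) = 0 \<and> opD \<mu> q = (\<lambda>z. f z - V * deriv \<phi> z) \<and> opC p = (\<lambda>z. g z - \<beta> * q z)"

text \<open>The upgrade from square integrability goes through q before p, since q enters the source
  of p.\<close>

lemma profile_subexp:
  assumes "profile \<mu> \<beta> V f g p q" "subexp f" "subexp g"
  shows "subexp p" "subexp q" "subexp (deriv p)" "subexp (deriv q)"
    "subexp (deriv (deriv p))" "subexp (deriv (deriv q))"
proof -
  have "subexp (\<lambda>z. f z - V * deriv \<phi> z)" using assms(2) by (auto simp: deriv_phi)
  then show q: "subexp q" "subexp (deriv q)" "subexp (deriv (deriv q))"
    using opD_subexp[of q \<mu> "\<lambda>z. f z - V * deriv \<phi> z"] assms(1) by (auto simp: profile_def)
  have "subexp (\<lambda>z. g z - \<beta> * q z)" using assms(3) q by auto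
  then show "subexp p" "subexp (deriv p)" "subexp (deriv (deriv p))"
    using opC_subexp[of p "\<lambda>z. g z - \<beta> * q z"] assms(1) by (auto simp: profile_def)
qed

lemma twice_differentiable_comb:
  assumes "twice_differentiable f" "twice_differentiable g"
  shows "twice_differentiable (\<lambda>z. f z - c * g z)"
    "deriv (\<lambda>z. f z - c * g z) = (\<lambda>z. deriv f z - c * deriv g z)"
    "deriv (deriv (\<lambda>z. f z - c * g z)) = (\<lambda>z. deriv (deriv f) z - c * deriv (deriv g) z)"
proof -
  note d = twice_differentiableD[OF assms(1)] twice_differentiableD[OF assms(2)]
  have 1: "((\<lambda>z. f z - c * g z) has_real_derivative deriv f z - c * deriv g z) (at z)" for z
    by (auto intro!: derivative_eq_intros d)
  have 2: "((\<lambda>z. deriv f z - c * deriv g z) has_real_derivative deriv (deriv f) z - c * deriv (deriv g) z) (at z)" for z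
    by (auto intro!: derivative_eq_intros d)
  show "twice_differentiable (\<lambda>z. f z - c * g z)"
    "deriv (\<lambda>z. f z - c * g z) = (\<lambda>z. deriv f z - c * deriv g z)"
    "deriv (deriv (\<lambda>z. f z - c * g z)) = (\<lambda>z. deriv (deriv f) z - c * deriv (deriv g) z)"
    using twice_differentiableI[of "\<lambda>z. f z - c * g z", OF 1 2] by auto
qed

lemma in_L2_psi2_integrable:
  fixes p :: "real \<Rightarrow> real"
  assumes "in_L2 p" shows "integrable lborel (\<lambda>z. p z * (\<psi> z)\<^sup>2)"
proof (rule Bochner_Integration.integrable_bound)
  have e: "expdecay (\<lambda>z. (\<psi> z)\<^sup>2 * (\<psi> z)\<^sup>2)" by (intro expdecay_mult expdecay_subexp expdecay_psi2)
  then show "integrable lborel (\<lambda>z. (p z)\<^sup>2 + (\<psi> z)\<^sup>2 * (\<psi> z)\<^sup>2)" using assms by (auto simp: in_L2_def)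
  show "(\<lambda>z. p z * (\<psi> z)\<^sup>2) \<in> borel_measurable lborel"
    using assms borel_measurable_continuous_onI[OF continuous_phi_psi(2)] by (auto simp: in_L2_def)
  have "\<bar>p z * (\<psi> z)\<^sup>2\<bar> \<le> \<bar>(p z)\<^sup>2 + (\<psi> z)\<^sup>2 * (\<psi> z)\<^sup>2\<bar>" for z
  proof -
    have "0 \<le> (\<bar>p z\<bar> - (\<psi> z)\<^sup>2)\<^sup>2" "0 \<le> \<bar>p z\<bar> * (\<psi> z)\<^sup>2" by auto
    then have "\<bar>p z\<bar> * (\<psi> z)\<^sup>2 \<le> (p z)\<^sup>2 + (\<psi> z)\<^sup>2 * (\<psi> z)\<^sup>2"
      unfolding power2_diff power2_abs power2_eq_square[of "(\<psi> z)\<^sup>2"] by linarith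
    then show ?thesis by (simp add: abs_mult)
  qed
  then show "AE z in lborel. norm (p z * (\<psi> z)\<^sup>2) \<le> norm ((p z)\<^sup>2 + (\<psi> z)\<^sup>2 * (\<psi> z)\<^sup>2)" by simp
qed

text \<open>One rule for all linear combinations: a negative \<open>c\<close> gives sums, and the
  zero profile in the first place gives multiples.\<close>

lemma profile_comb:
  assumes "profile \<mu> \<beta> V f g p q" "profile \<mu> \<beta> V' f' g' p' q'"
  shows "profile \<mu> \<beta> (V - c * V') (\<lambda>z. f z - c * f' z) (\<lambda>z. g z - c * g' z)
    (\<lambda>z. p z - c * p' z) (\<lambda>z. q z - c * q' z)"
proof -
  note h = assms[unfolded profile_def]
  have t: "twice_differentiable p" "twice_differentiable p'" "twice_differentiable q" "twice_differentiable q'"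
    using h by auto
  have L: "in_L2 p" "in_L2 p'" "in_L2 q" "in_L2 q'" using h by auto
  have D: "opD \<mu> (\<lambda>z. q z - c * q' z) = (\<lambda>z. opD \<mu> q z - c * opD \<mu> q' z)"
    unfolding opD_def twice_differentiable_comb(3)[OF t(3,4)] by (auto simp: algebra_simps)
  have C: "opC (\<lambda>z. p z - c * p' z) = (\<lambda>z. opC p z - c * opC p' z)"
    unfolding opC_def twice_differentiable_comb(3)[OF t(1,2)] by (auto simp: algebra_simps)
  have "L2_inner (\<lambda>z. p z - c * p' z) (deriv \<phi>)
      = (LINT z|lborel. p z * (\<psi> z)\<^sup>2 - c * (p' z * (\<psi> z)\<^sup>2))"
    by (simp add: L2_inner_def deriv_phi algebra_simps)
  also have "\<dots> = L2_inner p (deriv \<phi>) - c * L2_inner p' (deriv \<phi>)"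
    using L by (subst Bochner_Integration.integral_diff) (auto simp: in_L2_psi2_integrable L2_inner_def deriv_phi)
  finally have "L2_inner (\<lambda>z. p z - c * p' z) (deriv \<phi>) = 0" using h by simp
  then show ?thesis
    unfolding profile_def D C using t L h
    by (intro conjI twice_differentiable_comb in_L2_diff in_L2_cmult) (auto simp: algebra_simps)
qed

lemma profile_reflect:
  assumes "profile \<mu> \<beta> V f g p q"
  shows "profile \<mu> \<beta> V (\<lambda>z. f (- z)) (\<lambda>z. g (- z)) (\<lambda>z. p (- z)) (\<lambda>z. q (- z))"
proof -
  have "L2_inner (\<lambda>z. p (- z)) (deriv \<phi>) = L2_inner p (deriv \<phi>)"
  proof -
    have "L2_inner p (deriv \<phi>) = (LINT z|lborel. p (0 + (-1) * z) * (\<psi> (0 + (-1) * z))\<^sup>2)"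
      unfolding L2_inner_def deriv_phi by (subst lborel_integral_real_affine[where t = 0 and c = "-1"]) auto
    then show ?thesis by (simp add: L2_inner_def deriv_phi)
  qed
  then show ?thesis
    using assms unfolding profile_def
    by (auto simp: twice_differentiable_reflect in_L2_reflect opD_reflect opC_reflect deriv_phi)
qed

lemma opC_trivial_kernel:
  assumes "twice_differentiable p" "in_L2 p" "L2_inner p (deriv \<phi>) = 0" "opC p = (\<lambda>z. 0)"
  shows "p = (\<lambda>z. 0)"
proof -
  note s = opC_subexp[OF assms(1,2,4) subexp_const]
  obtain c where c: "\<And>z. p z = c * (\<psi> z)\<^sup>2" using opC_kernel[OF assms(1) s(1,2) assms(4)] by metis
  then have "c * (4 / 3) = 0" using assms(3) psi4_integral by (simp add: L2_inner_def deriv_phi mult.assoc)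
  then show ?thesis using c by auto
qed

text \<open>For \<open>\<mu> = - 1\<close> the solutions of \<open>D q = - V \<phi>'\<close> are
  \<open>V / 2 + a (z tanh z - 1) + b tanh z\<close>, and none of them is square integrable unless \<open>V = 0\<close>.\<close>

lemma profile_minus1:
  assumes pr: "profile (-1) \<beta> V (\<lambda>z. 0) (\<lambda>z. \<kappa> * deriv \<phi> z) p q"
  shows "\<kappa> = 0"
proof -
  have tq: "twice_differentiable q" and qL: "in_L2 q" and Dq: "opD (-1) q = (\<lambda>z. - V * (\<psi> z)\<^sup>2)"
    using pr by (auto simp: profile_def deriv_phi)
  note dq = twice_differentiableD[OF tq]
  have q2: "deriv (deriv q) z = - 2 * (\<psi> z)\<^sup>2 * (q z - V / 2)" for z
    using fun_cong[OF Dq, of z] by (simp add: opD_def algebra_simps)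
  have r: "((\<lambda>z. q z - V / 2) has_real_derivative deriv q z) (at z)" for z
    by (auto intro!: derivative_eq_intros dq)
  have y2: "((\<lambda>z. z * \<phi> z - 1) has_real_derivative \<phi> z + z * (\<psi> z)\<^sup>2) (at z)"
    "((\<lambda>z. \<phi> z + z * (\<psi> z)\<^sup>2) has_real_derivative - 2 * (\<psi> z)\<^sup>2 * (z * \<phi> z - 1)) (at z)" for z
    by (auto intro!: derivative_eq_intros psi2_derivs simp: algebra_simps power2_eq_square)
  have y1: "((\<lambda>z. (\<psi> z)\<^sup>2) has_real_derivative - 2 * (\<psi> z)\<^sup>2 * \<phi> z) (at z)" for z
    using psi2_derivs(1)[of z] by (simp add: mult_ac)
  \<comment> \<open>The Wronskians of q - V/2 with the two homogeneous solutions \<phi> and z \<phi>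
    - 1 are constants. They determine q - V/2 because \<phi>^2 + \<psi>^2 = 1.\<close>
  obtain c1 where c1: "\<And>z. \<phi> z * deriv q z - (\<psi> z)\<^sup>2 * (q z - V / 2) = c1"
    using wronskian_constant[OF phi_has_deriv y1 r dq(2)] by (simp add: q2) metis
  obtain c2 where c2: "\<And>z. (z * \<phi> z - 1) * deriv q z - (\<phi> z + z * (\<psi> z)\<^sup>2) * (q z - V / 2) = c2"
    by (rule wronskian_constant[OF y2 r dq(2)]) (auto simp: q2)
  have qe: "q z = V / 2 + c1 * (z * \<phi> z - 1) - c2 * \<phi> z" for z
  proof -
    have "c1 * (z * \<phi> z - 1) - c2 * \<phi> z = ((\<phi> z)\<^sup>2 + (\<psi> z)\<^sup>2) * (q z - V / 2)"
      unfolding c1[of z, symmetric] c2[of z, symmetric] by (simp add: field_simps power2_eq_square)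
    then show ?thesis by (simp add: psi_sq)
  qed
  \<comment> \<open>Reflection separates the bounded odd term from the even terms, so each
    coefficient can be excluded on its own: first \<open>c2\<close>, then \<open>c1\<close>, and
    finally \<open>V\<close> as the remaining constant.\<close>
  have odd: "in_L2 (\<lambda>z. q z - q (- z))" and ev: "in_L2 (\<lambda>z. q z + q (- z))"
    using qL in_L2_reflect[OF qL] by (auto intro: in_L2_diff in_L2_add)
  have qo: "q z - q (- z) = - 2 * c2 * \<phi> z" for z
    using qe[of z] qe[of "- z"] by (simp add: algebra_simps)
  have "c2 = 0"
  proof (rule ccontr)
    assume "c2 \<noteq> 0"
    have "((\<lambda>z. (- 2 * c2 * \<phi> z)\<^sup>2) \<longlongrightarrow> (- 2 * c2 * 1)\<^sup>2) at_top" by (intro tendsto_intros phi_tendsto)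
    moreover have "2 * c2\<^sup>2 < (- 2 * c2 * 1)\<^sup>2" using \<open>c2 \<noteq> 0\<close> zero_less_power2[of c2] by (simp add: power_mult_distrib)
    ultimately have "eventually (\<lambda>z. (- 2 * c2 * \<phi> z)\<^sup>2 > 2 * c2\<^sup>2) at_top" by (rule order_tendstoD)
    then have "eventually (\<lambda>z. (q z - q (- z))\<^sup>2 \<ge> 2 * c2\<^sup>2) at_top"
      by eventually_elim (simp only: qo less_imp_le)
    then show False
      using odd \<open>c2 \<noteq> 0\<close> by (intro not_integrable_bounded_below[of "\<lambda>z. (q z - q (- z))\<^sup>2"]) (auto simp: in_L2_def)
  qed
  have ev2: "q z + q (- z) = V - 2 * c1 + 2 * c1 * (z * \<phi> z)" for z
    using qe[of z] qe[of "- z"] by (simp add: algebra_simps)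
  have zphi: "filterlim (\<lambda>z. z * \<phi> z) at_top at_top"
    using filterlim_tendsto_pos_mult_at_top[OF phi_tendsto(1) _ filterlim_ident] by (simp add: mult.commute)
  have c10: "c1 = 0"
  proof (rule ccontr)
    assume c: "c1 \<noteq> 0"
    have "filterlim (\<lambda>z. (- \<bar>V - 2 * c1\<bar>) + \<bar>2 * c1\<bar> * (z * \<phi> z)) at_top at_top"
      using c by (intro filterlim_tendsto_add_at_top[OF tendsto_const] filterlim_tendsto_pos_mult_at_top[OF tendsto_const _ zphi]) auto
    then have "eventually (\<lambda>z. 1 \<le> (- \<bar>V - 2 * c1\<bar>) + \<bar>2 * c1\<bar> * (z * \<phi> z)) at_top"
      by (simp add: filterlim_at_top)
    then have "eventually (\<lambda>z. (q z + q (- z))\<^sup>2 \<ge> 1) at_top"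
      using eventually_ge_at_top[of 0]
    proof eventually_elim
      case (elim z)
      then have "\<bar>2 * c1 * (z * \<phi> z)\<bar> = \<bar>2 * c1\<bar> * (z * \<phi> z)"
        by (simp add: abs_mult \<phi>_def)
      then have "1 \<le> \<bar>q z + q (- z)\<bar>" using elim unfolding ev2 by linarith
      then have "1\<^sup>2 \<le> \<bar>q z + q (- z)\<bar>\<^sup>2" by (intro power_mono) auto
      then show ?case by simp
    qed
    then show False
      using ev by (intro not_integrable_bounded_below[of "\<lambda>z. (q z + q (- z))\<^sup>2" 1]) (auto simp: in_L2_def)
  qed
  have "V = 0"
  proof (rule ccontr)
    assume "V \<noteq> 0"
    then show False using ev unfolding ev2 c10
      by (intro not_integrable_bounded_below[of "\<lambda>z. V\<^sup>2" "V\<^sup>2"]) (auto simp: in_L2_def)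
  qed
  then have q0: "q z = 0" for z using qe \<open>c2 = 0\<close> c10 by simp
  \<comment> \<open>With q = 0 the solvability condition for C p = \<kappa> \<phi>' reads \<kappa>
    times the squared norm of \<phi>' equals 0.\<close>
  have "(LINT z|lborel. (\<psi> z)\<^sup>2 * opC p z) = 0"
    using pr profile_subexp[OF pr] by (intro opC_range_orthogonal) (auto simp: profile_def deriv_phi)
  moreover have "opC p = (\<lambda>z. \<kappa> * (\<psi> z)\<^sup>2)" using pr q0 by (auto simp: profile_def deriv_phi)
  ultimately have "\<kappa> * (LINT z|lborel. (\<psi> z)\<^sup>2 * (\<psi> z)\<^sup>2) = 0" by (simp add: mult_ac)
  then show ?thesis using psi4_integral by simp
qed

subsection \<open>The resolvent of \<open>D\<close>\<close>

lemma integral_lower_tail_has_deriv: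
  fixes f :: "real \<Rightarrow> real"
  assumes c: "continuous_on UNIV f" and i: "\<And>z. integrable lborel (\<lambda>x. indicator {..z} x * f x)"
  shows "((\<lambda>z. LINT x|lborel. indicator {..z} x * f x) has_real_derivative f z) (at z)"
proof -
  have "\<exists>H. \<forall>x::real. -\<infinity> < ereal x \<longrightarrow> ereal x < \<infinity> \<longrightarrow> (H has_vector_derivative f x) (at x)"
    using c by (intro einterval_antiderivative) (auto simp: continuous_on_eq_continuous_at)
  then obtain H where H: "\<And>x. (H has_real_derivative f x) (at x)"
    by (auto simp: has_real_derivative_iff_has_vector_derivative)
  let ?F = "\<lambda>z. LINT x|lborel. indicator {..z} x * f x"
  have eq: "?F y = ?F (z - 1) + (H y - H (z - 1))" if y: "y > z - 1" for y
  proof -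
    have c': "continuous_on {z-1..y} f" using c by (rule continuous_on_subset) auto
    have "H y - H (z - 1) = (LINT x|lborel. indicator {z-1..y} x *\<^sub>R f x)"
      using H c' y
      by (intro integral_FTC_atLeastAtMost[symmetric])
         (auto simp: has_real_derivative_iff_has_vector_derivative intro: has_vector_derivative_at_within)
    moreover have "?F y = (LINT x|lborel. indicator {..z-1} x * f x + indicator {z-1..y} x *\<^sub>R f x)"
    proof (rule integral_cong_AE)
      have fm: "f \<in> borel_measurable borel" using c by (rule borel_measurable_continuous_onI)
      show "(\<lambda>x. indicator {..y} x * f x) \<in> borel_measurable lborel" using fm by measurable
      show "(\<lambda>x. indicator {..z-1} x * f x + indicator {z-1..y} x *\<^sub>R f x) \<in> borel_measurable lborel"
        using fm by measurable
      show "AE x in lborel. indicator {..y} x * f x = indicator {..z-1} x * f x + indicator {z-1..y} x *\<^sub>R f x"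
        using AE_lborel_singleton[of "z - 1"] by eventually_elim (use y in \<open>auto simp: indicator_def\<close>)
    qed
    moreover have j: "integrable lborel (\<lambda>x. indicator {z-1..y} x *\<^sub>R f x)"
      using borel_integrable_atLeastAtMost'[OF c'] by (simp add: set_integrable_def)
    ultimately show ?thesis using Bochner_Integration.integral_add[OF i[of "z - 1"] j] by linarith
  qed
  have "((\<lambda>y. ?F (z - 1) + (H y - H (z - 1))) has_real_derivative f z) (at z)"
    by (auto intro!: derivative_eq_intros H)
  moreover have "eventually (\<lambda>y. ?F y = ?F (z - 1) + (H y - H (z - 1))) (nhds z)"
    using eventually_nhds_in_open[of "{z-1<..}" z] eq by (auto elim: eventually_mono)
  ultimately show ?thesis by (subst DERIV_cong_ev) auto
qed

text \<open>The integral in \<open>greenB\<close> without the factor exp(-kz). Its integrand does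
  not depend on the endpoint, so the fundamental theorem applies directly.\<close>

definition greenE :: "real \<Rightarrow> real \<Rightarrow> real" where
  "greenE k z = (LINT x|lborel. indicator {..z} x * (exp (k * x) * (\<psi> x)\<^sup>2))"

text \<open>\<open>greenB k z = \<integral>\<^sub>x\<^sub>\<le>\<^sub>z exp (- k (z - x)) \<psi>\<^sup>2 dx\<close>, one half of the convolution with the Green
  function of \<open>k\<^sup>2 - \<partial>\<^sup>2\<close>.\<close>

definition greenB :: "real \<Rightarrow> real \<Rightarrow> real" where
  "greenB k z = exp (- (k * z)) * greenE k z"

lemma psi2_le: "(\<psi> x)\<^sup>2 \<le> 4 * exp (- (2 * \<bar>x\<bar>))"
proof -
  have "(\<psi> x)\<^sup>2 \<le> (2 * exp (- \<bar>x\<bar>))\<^sup>2" using psi_le[of x] psi_pos[of x] by (intro power_mono) auto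
  then show ?thesis by (simp add: power_mult_distrib flip: exp_double)
qed

text \<open>The triangle inequality |z| \<le> (z - x) + |x| moves the decay of the kernel from z - x
  to z at the price of a|x| \<le> |x|. The bound 4 exp(-2|x|) for \<psi>^2 pays this price and
  leaves exp(-|x|) for the integration.\<close>

lemma exp_tail_le:
  fixes a x z :: real
  assumes "0 < a" "a \<le> 1" "x \<le> z"
  shows "exp (- (a * (z - x))) * (\<psi> x)\<^sup>2 \<le> 4 * exp (- (a * \<bar>z\<bar>)) * exp (- \<bar>x\<bar>)"
proof -
  have "\<bar>z\<bar> \<le> (z - x) + \<bar>x\<bar>" using assms(3) by linarith
  then have "a * \<bar>z\<bar> \<le> a * (z - x) + a * \<bar>x\<bar>"
    using assms(1) by (metis distrib_left less_imp_le mult_left_mono)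
  moreover have "a * \<bar>x\<bar> \<le> 1 * \<bar>x\<bar>" using assms(2) by (intro mult_right_mono) auto
  ultimately have "exp (- (a * (z - x)) + - (2 * \<bar>x\<bar>)) \<le> exp (- (a * \<bar>z\<bar>) + - \<bar>x\<bar>)" by simp
  moreover have "exp (- (a * (z - x))) * (\<psi> x)\<^sup>2 \<le> exp (- (a * (z - x))) * (4 * exp (- (2 * \<bar>x\<bar>)))"
    using psi2_le by (intro mult_left_mono) auto
  ultimately show ?thesis unfolding exp_add by linarith
qed

text \<open>The constant equals 2. It stays symbolic because the estimates are about uniformity in
  \<open>k\<close> and \<open>z\<close>.\<close>

definition Jconst :: real where "Jconst = (LINT x|lborel. exp (- \<bar>x\<bar>))"

lemma Jconst_integrable: "integrable lborel (\<lambda>x::real. exp (- \<bar>x\<bar>))"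
  using integrable_exp_minus_abs[of 1] by simp

lemma Jconst_nonneg: "Jconst \<ge> 0" by (simp add: Jconst_def)

text \<open>The integrand is general and carries a constant, so the same estimate serves
  \<open>greenB\<close> and its increments in \<open>k\<close>.\<close>

lemma tail_integral_bound:
  fixes g :: "real \<Rightarrow> real"
  assumes m: "g \<in> borel_measurable borel" and a: "0 < a" "a \<le> 1"
    and b: "\<And>x. x \<le> z \<Longrightarrow> \<bar>g x\<bar> \<le> C * (exp (- (a * (z - x))) * (\<psi> x)\<^sup>2)" and C: "C \<ge> 0"
  shows "integrable lborel (\<lambda>x. indicator {..z} x * g x)"
    "\<bar>LINT x|lborel. indicator {..z} x * g x\<bar> \<le> C * 4 * Jconst * exp (- (a * \<bar>z\<bar>))"
proof -
  have i: "integrable lborel (\<lambda>x. C * 4 * exp (- (a * \<bar>z\<bar>)) * exp (- \<bar>x\<bar>))"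
    using Jconst_integrable by simp
  have le: "\<bar>indicator {..z} x * g x\<bar> \<le> C * 4 * exp (- (a * \<bar>z\<bar>)) * exp (- \<bar>x\<bar>)" for x
  proof (cases "x \<le> z")
    case True
    have "C * (exp (- (a * (z - x))) * (\<psi> x)\<^sup>2) \<le> C * (4 * exp (- (a * \<bar>z\<bar>)) * exp (- \<bar>x\<bar>))"
      using exp_tail_le[OF a True] C by (rule mult_left_mono)
    then show ?thesis using b[OF True] True by simp
  qed (use C in auto)
  have m': "(\<lambda>x. indicator {..z} x * g x) \<in> borel_measurable lborel" using m by measurable
  show 1: "integrable lborel (\<lambda>x. indicator {..z} x * g x)"
    by (rule Bochner_Integration.integrable_bound[OF i m']) (use le in \<open>auto intro!: AE_I2 order_trans[OF le]\<close>)
  have "\<bar>LINT x|lborel. indicator {..z} x * g x\<bar> \<le> (LINT x|lborel. \<bar>indicator {..z} x * g x\<bar>)"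
    by (rule integral_abs_bound)
  also have "\<dots> \<le> (LINT x|lborel. C * 4 * exp (- (a * \<bar>z\<bar>)) * exp (- \<bar>x\<bar>))"
    by (rule integral_mono[OF integrable_abs[OF 1] i le])
  also have "\<dots> = C * 4 * Jconst * exp (- (a * \<bar>z\<bar>))" by (simp add: Jconst_def)
  finally show "\<bar>LINT x|lborel. indicator {..z} x * g x\<bar> \<le> C * 4 * Jconst * exp (- (a * \<bar>z\<bar>))" .
qed

lemma psi_measurable [measurable]: "\<psi> \<in> borel_measurable borel"
  using continuous_phi_psi(2) by (rule borel_measurable_continuous_onI)

lemma greenB_eq: "greenB k z = (LINT x|lborel. indicator {..z} x * (exp (- (k * (z - x))) * (\<psi> x)\<^sup>2))"
proof -
  have "greenB k z = (LINT x|lborel. exp (- (k * z)) * (indicator {..z} x * (exp (k * x) * (\<psi> x)\<^sup>2)))"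
    by (simp add: greenB_def greenE_def)
  also have "\<dots> = (LINT x|lborel. indicator {..z} x * (exp (- (k * (z - x))) * (\<psi> x)\<^sup>2))"
    by (rule Bochner_Integration.integral_cong) (auto simp: algebra_simps exp_diff exp_minus field_simps)
  finally show ?thesis .
qed

lemma exp_minus_mult_mono:
  fixes a k t :: real assumes "a \<le> k" "t \<ge> 0" shows "exp (- (k * t)) \<le> exp (- (a * t))"
  using assms by (auto intro: mult_right_mono)

lemma greenB_integrable:
  assumes k: "k > 0"
  shows "integrable lborel (\<lambda>x. indicator {..z} x * (exp (- (k * (z - x))) * (\<psi> x)\<^sup>2))"
proof (rule tail_integral_bound(1))
  show "\<bar>exp (- (k * (z - x))) * (\<psi> x)\<^sup>2\<bar> \<le> 1 * (exp (- (min k 1 * (z - x))) * (\<psi> x)\<^sup>2)" if "x \<le> z" for x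
    using that exp_minus_mult_mono[of "min k 1" k "z - x"] by (auto intro!: mult_right_mono)
qed (use k in auto)

lemma greenB_bound:
  assumes a: "0 < a" "a \<le> 1" "a \<le> k" shows "\<bar>greenB k z\<bar> \<le> 4 * Jconst * exp (- (a * \<bar>z\<bar>))"
proof -
  have "\<bar>greenB k z\<bar> \<le> 1 * 4 * Jconst * exp (- (a * \<bar>z\<bar>))"
    unfolding greenB_eq
  proof (rule tail_integral_bound(2))
    show "\<bar>exp (- (k * (z - x))) * (\<psi> x)\<^sup>2\<bar> \<le> 1 * (exp (- (a * (z - x))) * (\<psi> x)\<^sup>2)" if "x \<le> z" for x
      using that a exp_minus_mult_mono[of a k "z - x"] by (auto intro!: mult_right_mono)
  qed (use a in auto)
  then show ?thesis by simp
qed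

lemma greenB_nonneg: "greenB k z \<ge> 0"
  unfolding greenB_eq by (intro Bochner_Integration.integral_nonneg) auto

lemma greenB_le_2: assumes "k > 0" shows "greenB k z \<le> 2"
proof -
  have "greenB k z \<le> (LINT x|lborel. (\<psi> x)\<^sup>2)"
    unfolding greenB_eq
  proof (rule integral_mono[OF greenB_integrable[OF assms] psi2_integral(1)])
    fix x
    have "exp (- (k * (z - x))) * (\<psi> x)\<^sup>2 \<le> 1 * (\<psi> x)\<^sup>2" if "x \<le> z"
      using that assms by (intro mult_right_mono) auto
    then show "indicator {..z} x * (exp (- (k * (z - x))) * (\<psi> x)\<^sup>2) \<le> (\<psi> x)\<^sup>2"
      by (auto simp: indicator_def)
  qed
  then show ?thesis by (simp add: psi2_integral)
qed

lemma greenB_has_deriv: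
  assumes "k > 0" shows "(greenB k has_real_derivative (\<psi> z)\<^sup>2 - k * greenB k z) (at z)"
proof -
  have i: "integrable lborel (\<lambda>x. indicator {..z} x * (exp (k * x) * (\<psi> x)\<^sup>2))" for z
  proof -
    have "integrable lborel (\<lambda>x. exp (k * z) * (indicator {..z} x * (exp (- (k * (z - x))) * (\<psi> x)\<^sup>2)))"
      using greenB_integrable[OF assms, of z] by simp
    also have "(\<lambda>x. exp (k * z) * (indicator {..z} x * (exp (- (k * (z - x))) * (\<psi> x)\<^sup>2)))
      = (\<lambda>x. indicator {..z} x * (exp (k * x) * (\<psi> x)\<^sup>2))"
      by (auto simp: algebra_simps exp_diff exp_minus field_simps)
    finally show ?thesis .
  qed
  have c: "continuous_on UNIV (\<lambda>x. exp (k * x) * (\<psi> x)\<^sup>2)"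
    using continuous_phi_psi by (intro continuous_intros)
  have E: "(greenE k has_real_derivative exp (k * z) * (\<psi> z)\<^sup>2) (at z)"
    unfolding greenE_def[abs_def] by (rule integral_lower_tail_has_deriv[OF c i])
  have "((\<lambda>z. exp (- (k * z)) * greenE k z) has_real_derivative (\<psi> z)\<^sup>2 - k * greenB k z) (at z)"
    by (auto intro!: derivative_eq_intros E simp: greenB_def exp_minus field_simps)
  then show ?thesis by (simp add: greenB_def[abs_def])
qed

lemma greenB_reflect_has_deriv:
  assumes "k > 0" shows "((\<lambda>z. greenB k (- z)) has_real_derivative k * greenB k (- z) - (\<psi> z)\<^sup>2) (at z)"
  by (rule DERIV_cong[OF DERIV_chain2[where f = "greenB k" and g = uminus, OF greenB_has_deriv[OF assms]]])
    (auto intro!: derivative_eq_intros)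

lemma expdecayI:
  assumes "continuous_on UNIV f" "d > 0" "\<And>z. \<bar>f z\<bar> \<le> C * exp (- (d * \<bar>z\<bar>))" shows "expdecay f"
  using assms unfolding expdecay_def by blast

lemma expdecay_greenB: assumes "k > 0" shows "expdecay (greenB k)" "expdecay (\<lambda>z. greenB k (- z))"
proof -
  have c: "continuous_on UNIV (greenB k)" "continuous_on UNIV (\<lambda>z. greenB k (- z))"
    using greenB_has_deriv[OF assms] greenB_reflect_has_deriv[OF assms]
    by (auto intro!: continuous_at_imp_continuous_on DERIV_isCont)
  have b: "\<bar>greenB k z\<bar> \<le> (4 * Jconst) * exp (- (min k 1 * \<bar>z\<bar>))" for z
    using greenB_bound[of "min k 1" k z] assms by simp
  from b[of "- z" for z] have "\<bar>greenB k (- z)\<bar> \<le> (4 * Jconst) * exp (- (min k 1 * \<bar>z\<bar>))" for z by simp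
  with b c assms show "expdecay (greenB k)" "expdecay (\<lambda>z. greenB k (- z))"
    by (auto intro!: expdecayI[of _ "min k 1" "4 * Jconst"])
qed

text \<open>With \<open>A = \<partial> + tanh\<close> one has \<open>D = A\<^sup>* A + \<mu>\<close> and \<open>A A\<^sup>* = 1 - \<partial>\<^sup>2\<close>, so that \<open>D\<close> can be
  inverted by means of the Green function of \<open>k\<^sup>2 - \<partial>\<^sup>2\<close>, \<open>k\<^sup>2 = \<mu> + 1\<close>. The function below is
  the resulting formula for \<open>\<mu> D\<^sup>-\<^sup>1 \<phi>'\<close>; it stays regular at \<open>\<mu> = 0\<close>.\<close>

definition Qfun :: "real \<Rightarrow> real \<Rightarrow> real" where
  "Qfun k z = (\<psi> z)\<^sup>2 / 2 + ((k + \<phi> z) * greenB k z + (k - \<phi> z) * greenB k (- z)) / 4"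

definition Qfun' :: "real \<Rightarrow> real \<Rightarrow> real" where
  "Qfun' k z = - \<phi> z * (\<psi> z)\<^sup>2 / 2
     + (((\<psi> z)\<^sup>2 - k\<^sup>2 - k * \<phi> z) * greenB k z + (k\<^sup>2 - k * \<phi> z - (\<psi> z)\<^sup>2) * greenB k (- z)) / 4"

text \<open>For k^2 = \<mu> + 1 the second derivative expresses D Q = \<mu> \<phi>'. Both Green
  integrals satisfy first order equations with source \<psi>^2, up to sign, so the computation stays
  polynomial in \<phi>, \<psi>^2 and these two integrals.\<close>

lemma Qfun_derivs:
  assumes k: "k > 0"
  shows "(Qfun k has_real_derivative Qfun' k z) (at z)"
    "(Qfun' k has_real_derivative (k\<^sup>2 - 2 * (\<psi> z)\<^sup>2) * Qfun k z - (k\<^sup>2 - 1) * (\<psi> z)\<^sup>2) (at z)"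
proof -
  note B = greenB_has_deriv[OF k] greenB_reflect_has_deriv[OF k]
  have "((\<lambda>z. (\<psi> z)\<^sup>2 / 2 + ((k + \<phi> z) * greenB k z + (k - \<phi> z) * greenB k (- z)) / 4)
      has_real_derivative
      (- 2 * \<phi> z * (\<psi> z)\<^sup>2) / 2 + (((\<psi> z)\<^sup>2 * greenB k z + (k + \<phi> z) * ((\<psi> z)\<^sup>2 - k * greenB k z))
       + (- (\<psi> z)\<^sup>2 * greenB k (- z) + (k - \<phi> z) * (k * greenB k (- z) - (\<psi> z)\<^sup>2))) / 4) (at z)"
    by (rule psi2_derivs B phi_has_deriv derivative_eq_intros refl | simp only:)+ (simp add: field_simps)
  then show "(Qfun k has_real_derivative Qfun' k z) (at z)"
    unfolding Qfun_def[abs_def] Qfun'_def by (rule DERIV_cong) (simp add: field_simps power2_eq_square)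
  have "((\<lambda>z. (- 2 * \<phi> z * (\<psi> z)\<^sup>2) / 4
      + (((\<psi> z)\<^sup>2 - k\<^sup>2 - k * \<phi> z) * greenB k z + (k\<^sup>2 - k * \<phi> z - (\<psi> z)\<^sup>2) * greenB k (- z)) / 4)
      has_real_derivative
      ((4 - 6 * (\<psi> z)\<^sup>2) * (\<psi> z)\<^sup>2) / 4 +
      (((- 2 * \<phi> z * (\<psi> z)\<^sup>2 - k * (\<psi> z)\<^sup>2) * greenB k z + ((\<psi> z)\<^sup>2 - k\<^sup>2 - k * \<phi> z) * ((\<psi> z)\<^sup>2 - k * greenB k z))
       + ((- k * (\<psi> z)\<^sup>2 + 2 * \<phi> z * (\<psi> z)\<^sup>2) * greenB k (- z) + (k\<^sup>2 - k * \<phi> z - (\<psi> z)\<^sup>2) * (k * greenB k (- z) - (\<psi> z)\<^sup>2))) / 4) (at z)"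
    by (rule psi2_derivs B phi_has_deriv derivative_eq_intros refl | simp only:)+ (simp add: field_simps)
  moreover have "(\<lambda>z. (- 2 * \<phi> z * (\<psi> z)\<^sup>2) / 4
      + (((\<psi> z)\<^sup>2 - k\<^sup>2 - k * \<phi> z) * greenB k z + (k\<^sup>2 - k * \<phi> z - (\<psi> z)\<^sup>2) * greenB k (- z)) / 4) = Qfun' k"
    by (auto simp: Qfun'_def)
  moreover have "((4 - 6 * (\<psi> z)\<^sup>2) * (\<psi> z)\<^sup>2) / 4 +
      (((- 2 * \<phi> z * (\<psi> z)\<^sup>2 - k * (\<psi> z)\<^sup>2) * greenB k z + ((\<psi> z)\<^sup>2 - k\<^sup>2 - k * \<phi> z) * ((\<psi> z)\<^sup>2 - k * greenB k z))
       + ((- k * (\<psi> z)\<^sup>2 + 2 * \<phi> z * (\<psi> z)\<^sup>2) * greenB k (- z) + (k\<^sup>2 - k * \<phi> z - (\<psi> z)\<^sup>2) * (k * greenB k (- z) - (\<psi> z)\<^sup>2))) / 4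
     = (k\<^sup>2 - 2 * (\<psi> z)\<^sup>2) * Qfun k z - (k\<^sup>2 - 1) * (\<psi> z)\<^sup>2"
    by (simp add: Qfun_def field_simps power2_eq_square)
  ultimately show "(Qfun' k has_real_derivative (k\<^sup>2 - 2 * (\<psi> z)\<^sup>2) * Qfun k z - (k\<^sup>2 - 1) * (\<psi> z)\<^sup>2) (at z)"
    by simp
qed

lemma Qfun_minus [simp]: "Qfun k (- z) = Qfun k z"
  by (simp add: Qfun_def algebra_simps)

lemma expdecay_Qfun:
  assumes "k > 0" shows "expdecay (Qfun k)" "expdecay (Qfun' k)"
proof -
  note B = expdecay_greenB[OF assms]
  have "expdecay (\<lambda>z. (1/2) * (\<psi> z)\<^sup>2 + (1/4) * ((k + \<phi> z) * greenB k z + (k - \<phi> z) * greenB k (- z)))"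
    by (intro expdecay_add expdecay_cmult expdecay_psi2 expdecay_mult' B) auto
  then show "expdecay (Qfun k)" by (simp add: Qfun_def[abs_def])
  have "expdecay (\<lambda>z. (- (1/2) * \<phi> z) * (\<psi> z)\<^sup>2
     + (1/4) * (((\<psi> z)\<^sup>2 - k\<^sup>2 - k * \<phi> z) * greenB k z + (k\<^sup>2 - k * \<phi> z - (\<psi> z)\<^sup>2) * greenB k (- z)))"
    by (intro expdecay_add expdecay_cmult expdecay_psi2 expdecay_mult' B subexp_mult subexp_const subexp_phi) auto
  then show "expdecay (Qfun' k)" by (simp add: Qfun'_def[abs_def])
qed

lemma Qfun_twice_differentiable:
  assumes "k > 0"
  shows "twice_differentiable (Qfun k)" "deriv (Qfun k) = Qfun' k"
    "deriv (deriv (Qfun k)) = (\<lambda>z. (k\<^sup>2 - 2 * (\<psi> z)\<^sup>2) * Qfun k z - (k\<^sup>2 - 1) * (\<psi> z)\<^sup>2)"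
  using twice_differentiableI[of "Qfun k", OF Qfun_derivs[OF assms]] by auto

text \<open>The pairing of \<mu> D^-1 \<phi>' with \<phi>', which remains in the denominator of all
  coefficients once the factor \<mu> has been extracted.\<close>

definition mass :: "real \<Rightarrow> real" where "mass k = (LINT z|lborel. Qfun k z * (\<psi> z)\<^sup>2)"

text \<open>Up to a total derivative, Q \<psi>^2 is 3/4 \<psi>^4 + k/8 \<psi>^2 (b + c), with b and
  c the Green integral and its reflection. The first term integrates to 1. The second is nonnegative
  and integrates to at most k, because b and c are at most 2. The lower bound legitimates all
  divisions, the upper one gives the limit at the edge k = 0.\<close>

lemma mass_bounds: assumes k: "k > 0" shows "1 \<le> mass k" "mass k \<le> 1 + k"
proof -
  let ?b = "greenB k" and ?c = "\<lambda>z. greenB k (- z)"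
  note B = expdecay_greenB[OF k]
  have e1: "expdecay (\<lambda>z. - \<phi> z * (\<psi> z)\<^sup>2 * (?b z - ?c z))"
    by (rule expdecay_mult[OF expdecay_mult'[OF subexp_minus[OF subexp_phi] expdecay_psi2]
          subexp_diff[OF B[THEN expdecay_subexp]]])
  have e2: "expdecay (\<lambda>z. (\<psi> z)\<^sup>2 * (2 * (\<psi> z)\<^sup>2 - k * (?b z + ?c z)))"
    using B by (intro expdecay_mult expdecay_psi2 subexp_diff subexp_mult subexp_add subexp_power) (auto dest: expdecay_subexp)
  \<comment> \<open>This is the derivative of \<psi>^2 (b - c) / 2. It trades the term with the
    factor \<phi>, whose sign is not evident, for terms that can be estimated.\<close>
  have W: "(LINT z|lborel. - \<phi> z * (\<psi> z)\<^sup>2 * (?b z - ?c z) + (\<psi> z)\<^sup>2 / 2 * (2 * (\<psi> z)\<^sup>2 - k * (?b z + ?c z))) = 0 - 0"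
  proof (rule integral_total_derivative)
    show "((\<lambda>z. (\<psi> z)\<^sup>2 * (?b z - ?c z) / 2) has_real_derivative
       - \<phi> z * (\<psi> z)\<^sup>2 * (?b z - ?c z) + (\<psi> z)\<^sup>2 / 2 * (2 * (\<psi> z)\<^sup>2 - k * (?b z + ?c z))) (at z)" for z
    proof -
      have "((\<lambda>z. (\<psi> z)\<^sup>2 * (?b z - ?c z) / 2) has_real_derivative
       (- 2 * \<phi> z * (\<psi> z)\<^sup>2 * (?b z - ?c z) + (\<psi> z)\<^sup>2 * (((\<psi> z)\<^sup>2 - k * ?b z) - (k * ?c z - (\<psi> z)\<^sup>2))) / 2) (at z)"
        by (rule derivative_eq_intros psi2_derivs greenB_has_deriv[OF k] greenB_reflect_has_deriv[OF k] refl | simp)+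
      then show ?thesis by (rule DERIV_cong) (simp add: field_simps)
    qed
    have e: "expdecay (\<lambda>z. (1/2) * ((\<psi> z)\<^sup>2 * (?b z - ?c z)))"
      using B by (intro expdecay_cmult expdecay_mult expdecay_psi2 subexp_diff expdecay_subexp)
    then show "((\<lambda>z. (\<psi> z)\<^sup>2 * (?b z - ?c z) / 2) \<longlongrightarrow> 0) at_bot" "((\<lambda>z. (\<psi> z)\<^sup>2 * (?b z - ?c z) / 2) \<longlongrightarrow> 0) at_top"
      using expdecay_tendsto[OF e] by auto
    have "expdecay (\<lambda>z. - \<phi> z * (\<psi> z)\<^sup>2 * (?b z - ?c z) + (1/2) * ((\<psi> z)\<^sup>2 * (2 * (\<psi> z)\<^sup>2 - k * (?b z + ?c z))))"
      by (intro expdecay_add expdecay_cmult e1 e2)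
    then show "expdecay (\<lambda>z. - \<phi> z * (\<psi> z)\<^sup>2 * (?b z - ?c z) + (\<psi> z)\<^sup>2 / 2 * (2 * (\<psi> z)\<^sup>2 - k * (?b z + ?c z)))"
      by simp
  qed
  have eq: "Qfun k z * (\<psi> z)\<^sup>2 = 3 / 4 * ((\<psi> z)\<^sup>2 * (\<psi> z)\<^sup>2) + k / 8 * ((\<psi> z)\<^sup>2 * (?b z + ?c z))
      - 1 / 4 * (- \<phi> z * (\<psi> z)\<^sup>2 * (?b z - ?c z) + (\<psi> z)\<^sup>2 / 2 * (2 * (\<psi> z)\<^sup>2 - k * (?b z + ?c z)))" for z
    by (simp add: Qfun_def field_simps)
  have i1: "integrable lborel (\<lambda>z. (\<psi> z)\<^sup>2 * (\<psi> z)\<^sup>2)"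
    by (intro expdecay_integrable expdecay_mult expdecay_subexp expdecay_psi2)
  have i2: "integrable lborel (\<lambda>z. (\<psi> z)\<^sup>2 * (?b z + ?c z))"
    using B by (intro expdecay_integrable expdecay_mult subexp_add expdecay_subexp expdecay_psi2) auto
  have i3: "integrable lborel (\<lambda>z. Qfun k z * (\<psi> z)\<^sup>2)"
    using expdecay_Qfun[OF k] by (intro expdecay_integrable expdecay_mult expdecay_subexp expdecay_psi2)
  define S where "S = (LINT z|lborel. (\<psi> z)\<^sup>2 * (?b z + ?c z))"
  have i4: "integrable lborel (\<lambda>z. - \<phi> z * (\<psi> z)\<^sup>2 * (?b z - ?c z) + (\<psi> z)\<^sup>2 / 2 * (2 * (\<psi> z)\<^sup>2 - k * (?b z + ?c z)))"
  proof -
    have "expdecay (\<lambda>z. - \<phi> z * (\<psi> z)\<^sup>2 * (?b z - ?c z) + (1/2) * ((\<psi> z)\<^sup>2 * (2 * (\<psi> z)\<^sup>2 - k * (?b z + ?c z))))"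
      by (intro expdecay_add expdecay_cmult e1 e2)
    then show ?thesis by (auto dest: expdecay_integrable)
  qed
  have "mass k = 3 / 4 * (4 / 3) + k / 8 * S - 1 / 4 * 0"
    unfolding mass_def eq S_def using i1 i2 i4 W psi4_integral by simp
  then have mS: "mass k = 1 + k / 8 * S" by simp
  have "S \<ge> 0" unfolding S_def by (intro Bochner_Integration.integral_nonneg) (simp add: greenB_nonneg)
  then show "1 \<le> mass k" using mS k by simp
  have "S \<le> (LINT z|lborel. (\<psi> z)\<^sup>2 * 4)"
    unfolding S_def
  proof (rule integral_mono[OF i2])
    show "integrable lborel (\<lambda>z. (\<psi> z)\<^sup>2 * 4)" using psi2_integral(1) by simp
    show "(\<psi> z)\<^sup>2 * (?b z + ?c z) \<le> (\<psi> z)\<^sup>2 * 4" for z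
      using greenB_le_2[OF k, of z] greenB_le_2[OF k, of "- z"] by (intro mult_left_mono) auto
  qed
  then have "S \<le> 8" by (simp add: psi2_integral)
  then have "k / 8 * S \<le> k / 8 * 8" using k by (intro mult_left_mono) auto
  then show "mass k \<le> 1 + k" using mS by simp
qed

text \<open>The definite description is discharged by \<open>Qfun\<close> divided by \<mu> as a
  solution and by the trivial kernel of D for its uniqueness.\<close>

lemma Dinv_deriv_phi:
  assumes mu: "\<mu> > -1" "\<mu> \<noteq> 0"
  shows "Dinv \<mu> (deriv \<phi>) = (\<lambda>z. Qfun (sqrt (\<mu> + 1)) z / \<mu>)"
proof -
  define k where "k = sqrt (\<mu> + 1)"
  have k: "k > 0" "k\<^sup>2 = \<mu> + 1" using mu by (auto simp: k_def)
  \<comment> \<open>The detour through 0 - c Q fits the shape of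
    \<open>twice_differentiable_comb\<close>.\<close>
  let ?q = "\<lambda>z. 0 - (- 1 / \<mu>) * Qfun k z"
  have z: "twice_differentiable (\<lambda>z. 0)" using twice_differentiableI[of "\<lambda>z. 0" "\<lambda>z. 0" "\<lambda>z. 0"] by auto
  note c = twice_differentiable_comb[OF z Qfun_twice_differentiable(1)[OF k(1)], of "- 1 / \<mu>"]
  have q: "twice_differentiable ?q" "in_L2 ?q"
    using c expdecay_Qfun[OF k(1)] by (auto intro!: expdecay_in_L2 expdecay_cmult[of _ "1 / \<mu>", simplified] simp: expdecay_cmult)
  have Dq: "opD \<mu> ?q = deriv \<phi>"
    unfolding opD_def c(3) Qfun_twice_differentiable(3)[OF k(1)] deriv_phi k(2)
    using mu by (auto simp: field_simps)
  have "Dinv \<mu> (deriv \<phi>) = ?q"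
    unfolding Dinv_def
  proof (rule the_equality)
    fix r assume r: "twice_differentiable r \<and> in_L2 r \<and> opD \<mu> r = deriv \<phi>"
    have s: "subexp (deriv \<phi>)" by (simp add: deriv_phi)
    let ?d = "\<lambda>z. r z - 1 * ?q z"
    have rt: "twice_differentiable r" "in_L2 r" "opD \<mu> r = deriv \<phi>" using r by auto
    note rs = opD_subexp[OF rt s] and qs = opD_subexp[OF q Dq s]
    have "?d = (\<lambda>z. 0)"
    proof (rule opD_kernel_trivial[OF _ _ _ _ mu])
      show "twice_differentiable ?d" by (rule twice_differentiable_comb[OF rt(1) q(1)])
      show "subexp ?d" by (rule subexp_diff[OF rs(1) subexp_mult[OF subexp_const qs(1)]])
      show "subexp (deriv ?d)"
        unfolding twice_differentiable_comb(2)[OF rt(1) q(1)]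
        by (rule subexp_diff[OF rs(2) subexp_mult[OF subexp_const qs(2)]])
      have "opD \<mu> ?d z = opD \<mu> r z - opD \<mu> ?q z" for z
        unfolding opD_def twice_differentiable_comb(3)[OF rt(1) q(1)] by (simp add: algebra_simps)
      then show "opD \<mu> ?d = (\<lambda>z. 0)" using r Dq by auto
    qed
    then show "r = ?q" by (auto simp: fun_eq_iff)
  qed (use q Dq in simp)
  then show ?thesis by (simp add: k_def)
qed

text \<open>As D^-1 \<phi>' = Q / \<mu>, one factor \<mu> moves into the numerator. The remaining
  denominator is at least \<beta>, so the sign and the behaviour at 0 and -1 can be read
  off.\<close>

lemma alpha0_formula_eq:
  assumes mu: "\<mu> > -1" "\<mu> \<noteq> 0"
  shows "alpha0_formula \<beta> \<mu> = 4 / 3 * \<mu> / (\<beta> * mass (sqrt (\<mu> + 1)))"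
proof -
  have "L2_inner (deriv \<phi>) (deriv \<phi>) = 4 / 3" using psi4_integral by (simp add: L2_inner_def deriv_phi)
  moreover have "L2_inner (Dinv \<mu> (deriv \<phi>)) (deriv \<phi>) = mass (sqrt (\<mu> + 1)) / \<mu>"
    unfolding Dinv_deriv_phi[OF mu] by (simp add: L2_inner_def deriv_phi mass_def)
  ultimately show ?thesis by (simp only: alpha0_formula_def) simp
qed

lemma alpha0_0: assumes "\<beta> > 0" shows "alpha0 \<beta> 0 = 0"
proof -
  have "(alpha0_formula \<beta> \<longlongrightarrow> 0) (at 0)"
  proof (rule Lim_null_comparison)
    have "norm (alpha0_formula \<beta> \<mu>) \<le> 4 / 3 / \<beta> * \<bar>\<mu>\<bar>" if "\<mu> > -1" "\<mu> \<noteq> 0" for \<mu>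
    proof -
      have m: "mass (sqrt (\<mu> + 1)) \<ge> 1" using that by (intro mass_bounds) auto
      have "norm (alpha0_formula \<beta> \<mu>) = (4 / 3 * \<bar>\<mu>\<bar> / \<beta>) / mass (sqrt (\<mu> + 1))"
        using m assms by (simp add: alpha0_formula_eq[OF that] abs_mult)
      also have "\<dots> \<le> (4 / 3 * \<bar>\<mu>\<bar> / \<beta>) / 1"
        using m assms by (intro divide_left_mono) auto
      finally show ?thesis by simp
    qed
    moreover have "eventually (\<lambda>\<mu>::real. \<mu> > -1 \<and> \<mu> \<noteq> 0) (at 0)"
      using eventually_at_in_open[of "{-1<..}" "0::real"] by (auto elim: eventually_mono)
    ultimately show "eventually (\<lambda>\<mu>. norm (alpha0_formula \<beta> \<mu>) \<le> 4 / 3 / \<beta> * \<bar>\<mu>\<bar>) (at 0)"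
      by (auto elim: eventually_mono)
    show "((\<lambda>\<mu>. 4 / 3 / \<beta> * \<bar>\<mu>\<bar>) \<longlongrightarrow> 0) (at 0)"
      using assms by (auto intro!: tendsto_eq_intros)
  qed
  moreover have "at (0::real) within {-1<..} = at 0" by (rule at_within_open) auto
  ultimately show ?thesis by (simp add: alpha0_def tendsto_Lim)
qed

text \<open>At the edge k tends to 0 and \<open>mass k\<close> is squeezed between 1 and 1 +
  k.\<close>

lemma alpha0_minus_1: assumes "\<beta> > 0" shows "alpha0 \<beta> (-1) = - 4 / (3 * \<beta>)"
proof -
  have s: "((\<lambda>\<mu>. sqrt (\<mu> + 1)) \<longlongrightarrow> sqrt (- 1 + 1)) (at_right (-1))"
    by (intro tendsto_intros)
  have ev: "eventually (\<lambda>\<mu>::real. \<mu> \<in> {-1<..<0}) (at_right (-1))"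
    by (rule eventually_at_right_real) auto
  have m: "((\<lambda>\<mu>. mass (sqrt (\<mu> + 1))) \<longlongrightarrow> 1) (at_right (-1))"
  proof (rule tendsto_sandwich)
    show "eventually (\<lambda>\<mu>. 1 \<le> mass (sqrt (\<mu> + 1))) (at_right (-1))"
      "eventually (\<lambda>\<mu>. mass (sqrt (\<mu> + 1)) \<le> 1 + sqrt (\<mu> + 1)) (at_right (-1))"
      using ev by (eventually_elim, intro mass_bounds, simp)+
    show "((\<lambda>\<mu>. 1 + sqrt (\<mu> + 1)) \<longlongrightarrow> 1) (at_right (-1))"
      using tendsto_add[OF tendsto_const[of 1] s] by simp
  qed auto
  have "((\<lambda>\<mu>. 4 / 3 * \<mu> / (\<beta> * mass (sqrt (\<mu> + 1)))) \<longlongrightarrow> 4 / 3 * (-1) / (\<beta> * 1)) (at_right (-1))"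
    using assms by (intro tendsto_intros m) auto
  then have "(alpha0_formula \<beta> \<longlongrightarrow> 4 / 3 * (-1) / (\<beta> * 1)) (at_right (-1))"
    by (rule Lim_transform_eventually) (use ev in \<open>eventually_elim, simp add: alpha0_formula_eq\<close>)
  then have "Lim (at_right (-1)) (alpha0_formula \<beta>) = 4 / 3 * (-1) / (\<beta> * 1)"
    by (intro tendsto_Lim) auto
  then show ?thesis by (simp add: alpha0_def)
qed

lemma sgn_alpha0:
  assumes "\<beta> > 0" "\<mu> \<ge> -1" shows "sgn (alpha0 \<beta> \<mu>) = sgn \<mu>"
proof (cases "\<mu> = -1 \<or> \<mu> = 0")
  case True
  then show ?thesis using assms by (auto simp: alpha0_0 alpha0_minus_1)
next
  case False
  then have "mass (sqrt (\<mu> + 1)) \<ge> 1" using assms by (intro mass_bounds) auto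
  then have "sgn (\<beta> * mass (sqrt (\<mu> + 1))) = 1" using assms by simp
  moreover have "alpha0 \<beta> \<mu> = 4 / 3 * \<mu> / (\<beta> * mass (sqrt (\<mu> + 1)))"
    using False assms by (simp add: alpha0_def alpha0_formula_eq)
  ultimately show ?thesis by (simp only: sgn_divide sgn_mult) simp
qed

subsection \<open>The inverse of \<open>C\<close> on even functions\<close>

text \<open>The difference F - K exp(cx) is nonincreasing up to z and tends to 0 at minus infinity,
  hence is not positive at z.\<close>

lemma decay_comparison_upper:
  fixes F g :: "real \<Rightarrow> real"
  assumes "\<And>x. (F has_real_derivative g x) (at x)" "(F \<longlongrightarrow> 0) at_bot" "c > 0"
    and g: "\<And>x. x \<le> 0 \<Longrightarrow> \<bar>g x\<bar> \<le> K * c * exp (c * x)" and z: "z \<le> 0"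
  shows "F z \<le> K * exp (c * z)"
proof -
  let ?u = "\<lambda>x. F x - K * exp (c * x)"
  have "?u z \<le> ?u y" if "y \<le> z" for y
  proof (rule DERIV_nonpos_imp_nonincreasing[OF that])
    fix x assume "y \<le> x" "x \<le> z"
    then have "g x - K * (exp (c * x) * c) \<le> 0" using g[of x] z by (simp add: abs_le_iff mult_ac)
    moreover have "(?u has_real_derivative g x - K * (exp (c * x) * c)) (at x)"
      by (auto intro!: derivative_eq_intros assms(1))
    ultimately show "\<exists>d. (?u has_real_derivative d) (at x) \<and> d \<le> 0" by blast
  qed
  then have "eventually (\<lambda>y. ?u z \<le> ?u y) at_bot"
    by (auto intro: eventually_mono[OF eventually_le_at_bot[of z]])
  moreover have "((\<lambda>y. F y - K * exp (c * y)) \<longlongrightarrow> 0 - K * 0) at_bot"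
    using assms(3) filterlim_tendsto_pos_mult_at_bot[OF tendsto_const assms(3) filterlim_ident]
    by (intro tendsto_intros assms(2) filterlim_compose[OF exp_at_bot])
  ultimately have "?u z \<le> 0 - K * 0" by (intro tendsto_lowerbound) auto
  then show ?thesis by simp
qed

lemma decay_comparison:
  fixes F g :: "real \<Rightarrow> real"
  assumes F: "\<And>x. (F has_real_derivative g x) (at x)" "(F \<longlongrightarrow> 0) at_bot" "c > 0"
    and g: "\<And>x. x \<le> 0 \<Longrightarrow> \<bar>g x\<bar> \<le> K * c * exp (c * x)" and z: "z \<le> 0"
  shows "\<bar>F z\<bar> \<le> K * exp (c * z)"
proof -
  have "F z \<le> K * exp (c * z)" by (rule decay_comparison_upper[OF F g z])
  moreover have "- F z \<le> K * exp (c * z)"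
    using tendsto_minus[OF F(2)] F(3) z g
    by (intro decay_comparison_upper[of "\<lambda>x. - F x" "\<lambda>x. - g x"]) (auto intro: DERIV_minus F(1))
  ultimately show ?thesis by linarith
qed

lemma inverse_psi2_le: "1 / (\<psi> z)\<^sup>2 \<le> exp (2 * \<bar>z\<bar>)"
proof -
  have "exp (- \<bar>z\<bar>) ^ 2 \<le> (\<psi> z)\<^sup>2" using psi_ge[of z] by (intro power_mono) auto
  then have "exp (- (2 * \<bar>z\<bar>)) \<le> (\<psi> z)\<^sup>2" by (simp flip: exp_double)
  then have "inverse ((\<psi> z)\<^sup>2) \<le> inverse (exp (- (2 * \<bar>z\<bar>)))" by (intro le_imp_inverse_le) auto
  then show ?thesis by (simp add: exp_minus divide_inverse)
qed

text \<open>An odd function has an even antiderivative, so the half line z \<ge> 0 suffices. There c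
  \<ge> 1 makes the derivative of K exp(cx) at least K exp(cx), and the constant K is kept.\<close>

lemma even_antiderivative_exp_bound:
  fixes R r :: "real \<Rightarrow> real"
  assumes R: "\<And>x. (R has_real_derivative r x) (at x)" "R 0 = 0" and odd: "\<And>x. r (- x) = - r x"
    and c: "c \<ge> 1" and b: "\<And>x. \<bar>r x\<bar> \<le> K * exp (c * \<bar>x\<bar>)"
  shows "\<bar>R z\<bar> \<le> K * exp (c * \<bar>z\<bar>)"
proof -
  have K: "K \<ge> 0" using b[of 0] by simp
  have "((\<lambda>z. R z - R (- z)) has_real_derivative 0) (at z)" for z
    by (rule DERIV_cong[OF DERIV_diff[OF R(1) DERIV_chain2[where f = R and g = uminus, OF R(1)]]])
      (auto intro!: derivative_eq_intros simp: odd)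
  then have "\<forall>x y. R x - R (- x) = R y - R (- y)" by (intro DERIV_isconst_all allI)
  then have "R x - R (- x) = R 0 - R (- 0)" for x by blast
  then have ev: "R (- x) = R x" for x by simp
  have pos: "\<bar>R x\<bar> \<le> K * exp (c * x)" if "x \<ge> 0" for x
  proof -
    have "R x - K * exp (c * x) \<le> R 0 - K * exp (c * 0)"
    proof (rule DERIV_nonpos_imp_nonincreasing[OF that])
      fix y assume y: "0 \<le> y" "y \<le> x"
      have "K * exp (c * y) * 1 \<le> K * exp (c * y) * c" using K c by (intro mult_left_mono) auto
      then have "r y - K * (exp (c * y) * c) \<le> 0" using b[of y] y by (simp add: mult_ac)
      moreover have "((\<lambda>x. R x - K * exp (c * x)) has_real_derivative r y - K * (exp (c * y) * c)) (at y)"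
        by (auto intro!: derivative_eq_intros R(1))
      ultimately show "\<exists>d. ((\<lambda>x. R x - K * exp (c * x)) has_real_derivative d) (at y) \<and> d \<le> 0" by blast
    qed
    moreover have "R 0 + K * exp (c * 0) \<le> R x + K * exp (c * x)"
    proof (rule DERIV_nonneg_imp_nondecreasing[OF that])
      fix y assume y: "0 \<le> y" "y \<le> x"
      have "K * exp (c * y) * 1 \<le> K * exp (c * y) * c" using K c by (intro mult_left_mono) auto
      then have "r y + K * (exp (c * y) * c) \<ge> 0" using b[of y] y by (simp add: mult_ac)
      moreover have "((\<lambda>x. R x + K * exp (c * x)) has_real_derivative r y + K * (exp (c * y) * c)) (at y)"
        by (auto intro!: derivative_eq_intros R(1))
      ultimately show "\<exists>d. ((\<lambda>x. R x + K * exp (c * x)) has_real_derivative d) (at y) \<and> 0 \<le> d" by blast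
    qed
    ultimately show ?thesis using R(2) K by simp
  qed
  show ?thesis using pos[of z] pos[of "- z"] ev[of z] by (cases "z \<ge> 0") auto
qed

text \<open>The factorization \<open>C = (2 tanh - \<partial>) (2 tanh + \<partial>)\<close> reduces \<open>C p = f\<close> to two first order
  equations; \<open>w\<close> below is \<open>p' + 2 \<phi> p\<close>.\<close>

lemma opC_inverse_even:
  assumes f: "continuous_on UNIV f" "\<And>z. f (- z) = f z" "\<And>z. \<bar>f z\<bar> \<le> M * exp (- (a * \<bar>z\<bar>))"
    and a: "0 < a" "a \<le> 1" and orth: "(LINT z|lborel. (\<psi> z)\<^sup>2 * f z) = 0"
  obtains p where "twice_differentiable p" "in_L2 p" "L2_inner p (deriv \<phi>) = 0" "opC p = f"
    "\<And>z. \<bar>p z\<bar> \<le> 56 * M * exp (- (a * \<bar>z\<bar>))"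
proof -
  have M: "M \<ge> 0" using f(3)[of 0] by simp
  let ?g = "\<lambda>x. (\<psi> x)\<^sup>2 * f x"
  have ef: "expdecay f" by (rule expdecayI[OF f(1) a(1) f(3)])
  have eg: "expdecay ?g" by (intro expdecay_mult expdecay_psi2 expdecay_subexp ef)
  have gi: "integrable lborel (\<lambda>x. indicator A x * ?g x)" if "A \<in> sets borel" for A
    using integrable_mult_indicator[of A lborel ?g] expdecay_integrable[OF eg] that by simp
  define F where "F = (\<lambda>z. LINT x|lborel. indicator {..z} x * ?g x)"
  have F': "(F has_real_derivative ?g z) (at z)" for z
    unfolding F_def by (rule integral_lower_tail_has_deriv[OF expdecay_continuous[OF eg] gi]) simp
  have gb: "\<bar>?g x\<bar> \<le> 4 * M * exp (- ((2 + a) * \<bar>x\<bar>))" for x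
    using abs_prod_exp_bound[of "(\<psi> x)\<^sup>2" 4 "- (2 * \<bar>x\<bar>)" "f x" M "- (a * \<bar>x\<bar>)"] psi2_le[of x] f(3)[of x]
    by (simp add: algebra_simps)
  \<comment> \<open>A crude bound whose purpose is the limit of \<open>F\<close> at minus infinity.
    The sharp rate 2 + a follows from it by comparison; it is required because \<open>w\<close>
    divides \<open>F\<close> by \<psi>^2.\<close>
  have Fb: "\<bar>F z\<bar> \<le> 4 * M * Jconst * exp z" if z: "z \<le> 0" for z
  proof -
    have le: "\<bar>indicator {..z} x * ?g x\<bar> \<le> 4 * M * exp z * exp (- \<bar>x\<bar>)" for x
    proof (cases "x \<le> z")
      case True
      have "(2 + a) * \<bar>x\<bar> \<ge> 2 * \<bar>x\<bar>" using a by (intro mult_right_mono) auto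
      then have "exp (- ((2 + a) * \<bar>x\<bar>)) \<le> exp (z + - \<bar>x\<bar>)" using z True by simp
      then have "4 * M * exp (- ((2 + a) * \<bar>x\<bar>)) \<le> 4 * M * exp (z + - \<bar>x\<bar>)"
        using M by (intro mult_left_mono) auto
      also have "\<dots> = 4 * M * exp z * exp (- \<bar>x\<bar>)" by (simp only: exp_add mult.assoc)
      finally show ?thesis using gb[of x] True by simp
    qed (use M in auto)
    have "\<bar>F z\<bar> \<le> (LINT x|lborel. \<bar>indicator {..z} x * ?g x\<bar>)"
      unfolding F_def by (rule integral_abs_bound)
    also have "\<dots> \<le> (LINT x|lborel. 4 * M * exp z * exp (- \<bar>x\<bar>))"
      using Jconst_integrable by (intro integral_mono[OF integrable_abs[OF gi] _ le]) auto
    finally show ?thesis by (simp add: Jconst_def mult_ac)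
  qed
  have Flim: "(F \<longlongrightarrow> 0) at_bot"
  proof (rule Lim_null_comparison)
    show "eventually (\<lambda>z. norm (F z) \<le> 4 * M * Jconst * exp z) at_bot"
      using Fb by (auto intro: eventually_mono[OF eventually_le_at_bot[of 0]])
    show "((\<lambda>z. 4 * M * Jconst * exp z) \<longlongrightarrow> 0) at_bot"
      by (intro tendsto_mult_right_zero exp_at_bot)
  qed
  \<comment> \<open>Evenness of \<open>f\<close> together with orthogonality to \<phi>' makes the
    antiderivative odd, which carries its decay from minus infinity to plus infinity.\<close>
  have Fodd: "F (- z) = - F z" for z
  proof -
    have "F (- z) = (LINT x|lborel. indicator {..-z} (0 + (-1) * x) * ?g (0 + (-1) * x))"
      unfolding F_def by (subst lborel_integral_real_affine[where t = 0 and c = "-1"]) auto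
    also have "\<dots> = (LINT x|lborel. indicator {z..} x * ?g x)"
      by (rule Bochner_Integration.integral_cong) (auto simp: f(2) indicator_def)
    finally have "F z + F (- z) = (LINT x|lborel. indicator {..z} x * ?g x + indicator {z..} x * ?g x)"
      using gi by (subst Bochner_Integration.integral_add) (auto simp: F_def)
    also have "\<dots> = (LINT x|lborel. ?g x)"
    proof (rule integral_cong_AE)
      have fm: "f \<in> borel_measurable borel" using f(1) by (rule borel_measurable_continuous_onI)
      have gm: "?g \<in> borel_measurable borel" using fm by measurable
      show "(\<lambda>x. indicator {..z} x * ?g x + indicator {z..} x * ?g x) \<in> borel_measurable lborel"
        using fm by measurable
      show "?g \<in> borel_measurable lborel" using gm by simp
      show "AE x in lborel. indicator {..z} x * ?g x + indicator {z..} x * ?g x = ?g x"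
        using AE_lborel_singleton[of z] by eventually_elim (auto simp: indicator_def)
    qed
    finally show ?thesis using orth by simp
  qed
  have Fneg: "\<bar>F z\<bar> \<le> (4 * M / (2 + a)) * exp ((2 + a) * z)" if "z \<le> 0" for z
  proof (rule decay_comparison[OF F' Flim _ _ that])
    show "\<bar>?g x\<bar> \<le> 4 * M / (2 + a) * (2 + a) * exp ((2 + a) * x)" if "x \<le> 0" for x
    proof -
      have "4 * M / (2 + a) * (2 + a) = 4 * M" "- ((2 + a) * \<bar>x\<bar>) = (2 + a) * x" using a that by auto
      then show ?thesis using gb[of x] by (simp only:)
    qed
  qed (use a in auto)
  have Fbd: "\<bar>F z\<bar> \<le> 2 * M * exp (- ((2 + a) * \<bar>z\<bar>))" for z
  proof -
    have "4 * M / (2 + a) \<le> 4 * M / 2" using M a by (intro divide_left_mono) auto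
    then have k: "4 * M / (2 + a) * exp (- ((2 + a) * \<bar>z\<bar>)) \<le> 2 * M * exp (- ((2 + a) * \<bar>z\<bar>))"
      by (intro mult_right_mono) auto
    have "\<bar>F z\<bar> = \<bar>F (- \<bar>z\<bar>)\<bar>" using Fodd[of z] by (cases "z \<ge> 0") auto
    also have "\<dots> \<le> (4 * M / (2 + a)) * exp ((2 + a) * (- \<bar>z\<bar>))" by (rule Fneg) simp
    finally show ?thesis using k by simp
  qed
  \<comment> \<open>The decaying solution of the first factor, 2 \<phi> w - w' = f; the homogeneous
    solution is 1 / \<psi>^2.\<close>
  define w where "w = (\<lambda>z. - F z / (\<psi> z)\<^sup>2)"
  have w': "(w has_real_derivative 2 * \<phi> z * w z - f z) (at z)" for z
    unfolding w_def using psi_pos[of z]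
    by (intro DERIV_cong[OF DERIV_divide[OF DERIV_minus[OF F'] psi2_derivs(1)]]) (auto simp: field_simps power2_eq_square)
  have wb: "\<bar>w z\<bar> \<le> 2 * M * exp (- (a * \<bar>z\<bar>))" for z
    using abs_prod_exp_bound[of "F z" "2 * M" "- ((2 + a) * \<bar>z\<bar>)" "1 / (\<psi> z)\<^sup>2" 1 "2 * \<bar>z\<bar>"] Fbd[of z] inverse_psi2_le[of z]
    by (simp add: w_def algebra_simps)
  let ?r = "\<lambda>z. w z / (\<psi> z)\<^sup>2"
  have cw: "continuous_on UNIV w" using w' by (auto intro!: continuous_at_imp_continuous_on DERIV_isCont)
  have cr: "continuous_on UNIV ?r"
    using cw continuous_phi_psi psi_pos by (intro continuous_intros) (auto simp: less_imp_neq[symmetric])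
  have "\<exists>H. \<forall>x::real. -\<infinity> < ereal x \<longrightarrow> ereal x < \<infinity> \<longrightarrow> (H has_vector_derivative ?r x) (at x)"
    using cr by (intro einterval_antiderivative) (auto simp: continuous_on_eq_continuous_at)
  then obtain H where H: "\<And>x. (H has_real_derivative ?r x) (at x)"
    by (auto simp: has_real_derivative_iff_has_vector_derivative)
  define R where "R = (\<lambda>z. H z - H 0)"
  have R': "(R has_real_derivative ?r z) (at z)" for z
    unfolding R_def by (auto intro!: derivative_eq_intros H)
  have Rb: "\<bar>R z\<bar> \<le> 2 * M * exp ((2 - a) * \<bar>z\<bar>)" for z
  proof (rule even_antiderivative_exp_bound[OF R'])
    show "\<bar>?r x\<bar> \<le> 2 * M * exp ((2 - a) * \<bar>x\<bar>)" for x
      using abs_prod_exp_bound[of "w x" "2 * M" "- (a * \<bar>x\<bar>)" "1 / (\<psi> x)\<^sup>2" 1 "2 * \<bar>x\<bar>"] wb[of x] inverse_psi2_le[of x]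
      by (simp add: algebra_simps)
  qed (use a in \<open>auto simp: R_def w_def Fodd\<close>)
  \<comment> \<open>Variation of constants for the second factor p' + 2 \<phi> p = w, whose
    homogeneous solution is \<psi>^2.\<close>
  define p0 where "p0 = (\<lambda>z. (\<psi> z)\<^sup>2 * R z)"
  have p01: "(p0 has_real_derivative w z - 2 * \<phi> z * p0 z) (at z)" for z
    unfolding p0_def using psi_pos[of z]
    by (intro DERIV_cong[OF DERIV_mult[OF psi2_derivs(1) R']]) auto
  have p02: "((\<lambda>z. w z - 2 * \<phi> z * p0 z) has_real_derivative (4 - 6 * (\<psi> z)\<^sup>2) * p0 z - f z) (at z)" for z
  proof -
    have "((\<lambda>z. w z - 2 * \<phi> z * p0 z) has_real_derivative
      (2 * \<phi> z * w z - f z) - (2 * (\<psi> z)\<^sup>2 * p0 z + 2 * \<phi> z * (w z - 2 * \<phi> z * p0 z))) (at z)"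
      by (rule p01 w' phi_has_deriv derivative_eq_intros refl | simp)+
    moreover have "(2 * \<phi> z * w z - f z) - (2 * (\<psi> z)\<^sup>2 * p0 z + 2 * \<phi> z * (w z - 2 * \<phi> z * p0 z))
      = (4 - 6 * (\<psi> z)\<^sup>2) * p0 z - f z"
      unfolding psi_sq by (simp add: algebra_simps power2_eq_square)
    ultimately show ?thesis by simp
  qed
  note p0t = twice_differentiableI[of p0, OF p01 p02]
  note psit = twice_differentiableI[of "\<lambda>z. (\<psi> z)\<^sup>2", OF psi2_derivs]
  have p0b: "\<bar>p0 z\<bar> \<le> 8 * M * exp (- (a * \<bar>z\<bar>))" for z
    using abs_prod_exp_bound[of "(\<psi> z)\<^sup>2" 4 "- (2 * \<bar>z\<bar>)" "R z" "2 * M" "(2 - a) * \<bar>z\<bar>"] psi2_le[of z] Rb[of z]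
    by (simp add: p0_def algebra_simps)
  have cp0: "continuous_on UNIV p0" using p01 by (auto intro!: continuous_at_imp_continuous_on DERIV_isCont)
  have ep0: "expdecay p0" by (rule expdecayI[OF cp0 a(1) p0b])
  \<comment> \<open>The factor 3/4 is the inverse of the squared norm of \<phi>', so subtracting c
    \<psi>^2 projects onto the orthogonal complement.\<close>
  define c where "c = 3 / 4 * (LINT z|lborel. p0 z * (\<psi> z)\<^sup>2)"
  have ip: "integrable lborel (\<lambda>z. p0 z * (\<psi> z)\<^sup>2)" by (intro expdecay_integrable expdecay_mult expdecay_subexp expdecay_psi2 ep0)
  have "\<bar>LINT z|lborel. p0 z * (\<psi> z)\<^sup>2\<bar> \<le> (LINT z|lborel. \<bar>p0 z * (\<psi> z)\<^sup>2\<bar>)" by (rule integral_abs_bound)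
  also have "\<dots> \<le> (LINT z|lborel. 8 * M * (\<psi> z)\<^sup>2)"
  proof (rule integral_mono[OF integrable_abs[OF ip]])
    show "integrable lborel (\<lambda>z. 8 * M * (\<psi> z)\<^sup>2)" using psi2_integral(1) by simp
    have h: "8 * M * exp (- (a * \<bar>z\<bar>)) \<le> 8 * M * 1" for z using M a by (intro mult_left_mono) auto
    then have "\<bar>p0 z\<bar> \<le> 8 * M" for z using p0b[of z] h[of z] by linarith
    then show "\<bar>p0 z * (\<psi> z)\<^sup>2\<bar> \<le> 8 * M * (\<psi> z)\<^sup>2" for z by (auto simp: abs_mult intro!: mult_right_mono)
  qed
  finally have cb: "\<bar>c\<bar> \<le> 12 * M" by (simp add: c_def psi2_integral abs_mult)
  let ?p = "\<lambda>z. p0 z - c * (\<psi> z)\<^sup>2"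
  note pt = twice_differentiable_comb[OF p0t(1) psit(1), of c]
  show ?thesis
  proof (rule that[of ?p])
    show "twice_differentiable ?p" by (rule pt)
    show "in_L2 ?p" by (intro expdecay_in_L2 expdecay_diff expdecay_cmult ep0 expdecay_psi2)
    have i2: "integrable lborel (\<lambda>z. (\<psi> z)\<^sup>2 * (\<psi> z)\<^sup>2)" by (intro expdecay_integrable expdecay_mult expdecay_subexp expdecay_psi2)
    have "L2_inner ?p (deriv \<phi>) = (LINT z|lborel. p0 z * (\<psi> z)\<^sup>2 - c * ((\<psi> z)\<^sup>2 * (\<psi> z)\<^sup>2))"
      unfolding L2_inner_def deriv_phi by (rule Bochner_Integration.integral_cong) (auto simp: algebra_simps)
    also have "\<dots> = 4 / 3 * c - c * (LINT z|lborel. (\<psi> z)\<^sup>2 * (\<psi> z)\<^sup>2)"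
      using ip i2 by (subst Bochner_Integration.integral_diff) (auto simp: c_def)
    finally show "L2_inner ?p (deriv \<phi>) = 0" unfolding psi4_integral by simp
    show "opC ?p = f" unfolding opC_def pt(3) p0t(3) psit(3) by (auto simp: algebra_simps)
    \<comment> \<open>The constant 56 is 8 from \<open>p0\<close> plus 48 from the projection, where
      |c| \<le> 12 M and \<psi>^2 \<le> 4 exp(-2|z|).\<close>
    fix z
    have "\<bar>c * (\<psi> z)\<^sup>2\<bar> \<le> 12 * M * (4 * exp (- (2 * \<bar>z\<bar>)))"
      unfolding abs_mult using cb psi2_le[of z] M by (intro mult_mono) auto
    moreover have "a * \<bar>z\<bar> \<le> 2 * \<bar>z\<bar>" using a by (intro mult_right_mono) auto
    then have "48 * M * exp (- (2 * \<bar>z\<bar>)) \<le> 48 * M * exp (- (a * \<bar>z\<bar>))" using M by (intro mult_left_mono) auto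
    ultimately have "\<bar>c * (\<psi> z)\<^sup>2\<bar> \<le> 48 * M * exp (- (a * \<bar>z\<bar>))" by (simp add: mult_ac)
    then show "\<bar>?p z\<bar> \<le> 56 * M * exp (- (a * \<bar>z\<bar>))" using p0b[of z] by (simp add: algebra_simps abs_le_iff)
  qed
qed

lemma Cinv_eqI:
  assumes p: "twice_differentiable p" "in_L2 p" "L2_inner p (deriv \<phi>) = 0" "opC p = f"
  shows "Cinv f = p"
  unfolding Cinv_def
proof (rule the_equality)
  fix r assume r: "twice_differentiable r \<and> in_L2 r \<and> L2_inner r (deriv \<phi>) = 0 \<and> opC r = f"
  then have rt: "twice_differentiable r" by simp
  let ?d = "\<lambda>z. r z - 1 * p z"
  have "?d = (\<lambda>z. 0)"
  proof (rule opC_trivial_kernel)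
    show "twice_differentiable ?d" by (rule twice_differentiable_comb[OF rt p(1)])
    show "in_L2 ?d" using r p by (intro in_L2_diff in_L2_cmult) auto
    have "L2_inner ?d (deriv \<phi>) = (LINT z|lborel. r z * (\<psi> z)\<^sup>2 - p z * (\<psi> z)\<^sup>2)"
      by (simp add: L2_inner_def deriv_phi algebra_simps)
    also have "\<dots> = L2_inner r (deriv \<phi>) - L2_inner p (deriv \<phi>)"
      using r p by (subst Bochner_Integration.integral_diff) (auto simp: in_L2_psi2_integrable L2_inner_def deriv_phi)
    finally show "L2_inner ?d (deriv \<phi>) = 0" using r p by simp
    have "opC ?d z = opC r z - opC p z" for z
      unfolding opC_def twice_differentiable_comb(3)[OF rt p(1)] by (simp add: algebra_simps)
    then show "opC ?d = (\<lambda>z. 0)" using r p by auto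
  qed
  then show "r = p" by (auto simp: fun_eq_iff)
qed (use p in simp)

subsection \<open>Solvability\<close>

lemma opD_Qfun: assumes "\<mu> > -1" shows "opD \<mu> (Qfun (sqrt (\<mu> + 1))) = (\<lambda>z. \<mu> * (\<psi> z)\<^sup>2)"
proof -
  have k: "sqrt (\<mu> + 1) > 0" "(sqrt (\<mu> + 1))\<^sup>2 = \<mu> + 1" using assms by auto
  show ?thesis unfolding opD_def Qfun_twice_differentiable(3)[OF k(1)] k(2) by (auto simp: algebra_simps)
qed

text \<open>Pairing the equation for q with Q gives \<langle>Q, f\<rangle> - V \<open>mass k\<close>
  = \<mu> x with x = \<langle>q, \<phi>'\<rangle>, and pairing the equation for p with \<phi>' gives
  \<langle>g, \<phi>'\<rangle> = \<beta> x. Eliminating x yields V. Testing with Q in place of D^-1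
  \<phi>' keeps the argument valid at \<mu> = 0.\<close>

lemma profile_velocity:
  assumes pr: "profile \<mu> \<beta> V f g p q" and s: "subexp f" "subexp g" and mu: "\<mu> > -1" and beta: "\<beta> > 0"
  defines "k \<equiv> sqrt (\<mu> + 1)"
  shows "V = (LINT z|lborel. Qfun k z / mass k * f z) + (LINT z|lborel. - (\<mu> / (\<beta> * mass k) * (\<psi> z)\<^sup>2) * g z)"
proof -
  have k: "k > 0" using mu by (simp add: k_def)
  have m: "mass k \<ge> 1" using mass_bounds[OF k] by simp
  note ps = profile_subexp[OF pr s]
  note Q = expdecay_Qfun[OF k] and Qt = Qfun_twice_differentiable[OF k]
  have h: "twice_differentiable p" "twice_differentiable q"
    "opD \<mu> q = (\<lambda>z. f z - V * (\<psi> z)\<^sup>2)" "opC p = (\<lambda>z. g z - \<beta> * q z)"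
    using pr by (auto simp: profile_def deriv_phi)
  have Q2: "expdecay (deriv (deriv (Qfun k)))"
    unfolding Qt(3) using Q by (intro expdecay_diff expdecay_cmult expdecay_mult' expdecay_psi2) auto
  have i: "integrable lborel (\<lambda>z. Qfun k z * f z)" "integrable lborel (\<lambda>z. Qfun k z * (\<psi> z)\<^sup>2)"
    "integrable lborel (\<lambda>z. (\<psi> z)\<^sup>2 * g z)" "integrable lborel (\<lambda>z. (\<psi> z)\<^sup>2 * q z)"
    using s ps by (auto intro!: expdecay_integrable expdecay_mult Q expdecay_psi2 expdecay_subexp[OF expdecay_psi2])
  define x where "x = (LINT z|lborel. (\<psi> z)\<^sup>2 * q z)"
  have "(LINT z|lborel. Qfun k z * opD \<mu> q z) = (LINT z|lborel. opD \<mu> (Qfun k) z * q z)"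
    using Q Q2 Qt h ps by (intro opD_green) auto
  also have "\<dots> = \<mu> * x"
    unfolding k_def opD_Qfun[OF mu] by (simp add: x_def mult.assoc)
  finally have "(LINT z|lborel. Qfun k z * f z - V * (Qfun k z * (\<psi> z)\<^sup>2)) = \<mu> * x"
    unfolding h(3) by (simp add: algebra_simps)
  then have 1: "(LINT z|lborel. Qfun k z * f z) - V * mass k = \<mu> * x"
    using i by (simp add: mass_def)
  have "(LINT z|lborel. (\<psi> z)\<^sup>2 * opC p z) = 0"
    using h ps by (intro opC_range_orthogonal) auto
  then have "(LINT z|lborel. (\<psi> z)\<^sup>2 * g z - \<beta> * ((\<psi> z)\<^sup>2 * q z)) = 0"
    unfolding h(4) by (simp add: algebra_simps)
  then have 2: "(LINT z|lborel. (\<psi> z)\<^sup>2 * g z) = \<beta> * x"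
    using i by (simp add: x_def)
  have "(LINT z|lborel. Qfun k z / mass k * f z) = (LINT z|lborel. Qfun k z * f z) / mass k" by simp
  moreover have "(LINT z|lborel. - (\<mu> / (\<beta> * mass k) * (\<psi> z)\<^sup>2) * g z)
    = - (\<mu> / (\<beta> * mass k)) * (LINT z|lborel. (\<psi> z)\<^sup>2 * g z)"
    by (subst Bochner_Integration.integral_mult_right_zero[symmetric]) (simp add: mult_ac)
  ultimately show ?thesis using 1 2 m beta by (simp add: field_simps)
qed

text \<open>At \<mu> = 0 the equation for Q is homogeneous, so Q is a multiple of \<psi>. The second
  relation, with \<open>mass 1\<close> at least 1, shows that the multiple is nonzero without
  computing it.\<close>

lemma Qfun_1: obtains c where "\<And>z. Qfun 1 z = c * \<psi> z" "c * (LINT z|lborel. \<psi> z * (\<psi> z)\<^sup>2) = mass 1"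
proof -
  note Q = expdecay_Qfun[of 1, simplified] and Qt = Qfun_twice_differentiable[of 1, simplified]
  obtain c where c: "\<And>z. Qfun 1 z = c * \<psi> z"
  proof (rule opD_kernel_0[of "Qfun 1"])
    show "opD 0 (Qfun 1) = (\<lambda>z. 0)" using opD_Qfun[of 0] by simp
  qed (use Q Qt in \<open>auto intro: expdecay_subexp\<close>)
  then have "mass 1 = c * (LINT z|lborel. \<psi> z * (\<psi> z)\<^sup>2)" by (simp add: mass_def mult.assoc)
  with c show ?thesis by (intro that[of c]) simp_all
qed

text \<open>The orthogonality condition acts at \<mu> = 0, where it removes the multiple of \<psi>
  because the integral of \<psi>^3 is nonzero.\<close>

lemma opD_kernel_orthogonal:
  assumes q: "twice_differentiable q" "subexp q" "subexp (deriv q)" "opD \<mu> q = (\<lambda>z. 0)" and mu: "\<mu> > -1"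
    and orth: "(LINT z|lborel. (\<psi> z)\<^sup>2 * q z) = 0"
  shows "q = (\<lambda>z. 0)"
proof (cases "\<mu> = 0")
  case False
  then show ?thesis using opD_kernel_trivial q mu by blast
next
  case True
  obtain c where c: "\<And>z. q z = c * \<psi> z" using opD_kernel_0 q True by metis
  have "(LINT z|lborel. \<psi> z * (\<psi> z)\<^sup>2) \<noteq> 0"
    using Qfun_1 mass_bounds(1)[of 1] by (metis mult_zero_right not_one_le_zero zero_less_one)
  moreover have "c * (LINT z|lborel. \<psi> z * (\<psi> z)\<^sup>2) = 0" using orth by (simp add: c mult_ac)
  ultimately show ?thesis using c by auto
qed

text \<open>The unknowns vanish one after the other: V by the velocity formula, then \<langle>q,
  \<phi>'\<rangle> by solvability of the second equation, then q, and finally p.\<close>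

lemma profile_trivial:
  assumes pr: "profile \<mu> \<beta> V (\<lambda>z. 0) (\<lambda>z. 0) p q" and mu: "\<mu> > -1" and beta: "\<beta> > 0"
  shows "V = 0" "p = (\<lambda>z. 0)" "q = (\<lambda>z. 0)"
proof -
  show V: "V = 0" using profile_velocity[OF pr _ _ mu beta] by simp
  note ps = profile_subexp[OF pr subexp_const subexp_const]
  have h: "twice_differentiable p" "twice_differentiable q" "opD \<mu> q = (\<lambda>z. 0)" "opC p = (\<lambda>z. - \<beta> * q z)"
    using pr V by (auto simp: profile_def)
  have "(LINT z|lborel. (\<psi> z)\<^sup>2 * opC p z) = 0" using h ps by (intro opC_range_orthogonal) auto
  then have "(LINT z|lborel. - \<beta> * ((\<psi> z)\<^sup>2 * q z)) = 0" unfolding h(4) by (simp add: algebra_simps)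
  then have "(LINT z|lborel. (\<psi> z)\<^sup>2 * q z) = 0" using beta by simp
  then show q: "q = (\<lambda>z. 0)" using opD_kernel_orthogonal[OF h(2) ps(2,4) h(3) mu] by simp
  have "in_L2 p" "L2_inner p (deriv \<phi>) = 0" using pr unfolding profile_def by blast+
  moreover have "opC p = (\<lambda>z. 0)" unfolding h(4) q by simp
  ultimately show "p = (\<lambda>z. 0)" by (rule opC_trivial_kernel[OF h(1)])
qed

lemma profile_unique:
  assumes "profile \<mu> \<beta> V f g p q" "profile \<mu> \<beta> V' f g p' q'" and mu: "\<mu> > -1" and beta: "\<beta> > 0"
  shows "V = V'" "p = p'" "q = q'"
proof -
  have "profile \<mu> \<beta> (V - 1 * V') (\<lambda>z. f z - 1 * f z) (\<lambda>z. g z - 1 * g z) (\<lambda>z. p z - 1 * p' z) (\<lambda>z. q z - 1 * q' z)"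
    by (rule profile_comb[OF assms(1,2)])
  then have "profile \<mu> \<beta> (V - 1 * V') (\<lambda>z. 0) (\<lambda>z. 0) (\<lambda>z. p z - 1 * p' z) (\<lambda>z. q z - 1 * q' z)" by simp
  from profile_trivial[OF this mu beta]
  have "V - 1 * V' = 0" "\<And>z. p z - 1 * p' z = 0" "\<And>z. q z - 1 * q' z = 0" by metis+
  then show "V = V'" "p = p'" "q = q'" by auto
qed

subsection \<open>The coefficient \<open>\<nu>\<close> near \<open>\<mu> = 0\<close>\<close>

lemma psi4_integrable: "integrable lborel (\<lambda>z. (\<psi> z)\<^sup>2 * (\<psi> z)\<^sup>2)"
  by (intro expdecay_integrable expdecay_mult expdecay_psi2 subexp_power subexp_psi)

text \<open>The difference is at most |k - 1| t times the larger exponential, whose rate is at least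
  1/2. The factor t is absorbed by 4 exp(t/4), which leaves the rate 1/4 that occurs in all bounds
  near \<mu> = 0.\<close>

lemma exp_diff_le:
  fixes k t :: real
  assumes k: "k \<ge> 1/2" and t: "t \<ge> 0"
  shows "\<bar>exp (- (k * t)) - exp (- t)\<bar> \<le> 4 * \<bar>k - 1\<bar> * exp (- (1/4 * t))"
proof -
  have gen: "exp (- x) - exp (- y) \<le> (y - x) * exp (- x)" for x y :: real
  proof -
    have "1 - (y - x) \<le> exp (- (y - x))" using exp_ge_add_one_self[of "- (y - x)"] by linarith
    then have "exp (- x) * (1 - (y - x)) \<le> exp (- x) * exp (- (y - x))" by (intro mult_left_mono) auto
    also have "\<dots> = exp (- y)" by (simp flip: exp_add)
    finally show ?thesis by (simp add: algebra_simps)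
  qed
  have le: "exp (- (k * t)) \<le> exp (- (1/2 * t))" "exp (- t) \<le> exp (- (1/2 * t))"
    using exp_minus_mult_mono[OF k t] exp_minus_mult_mono[of "1/2" 1 t] t by auto
  have "\<bar>exp (- (k * t)) - exp (- t)\<bar> \<le> \<bar>k * t - t\<bar> * exp (- (1/2 * t))"
  proof (cases "k \<ge> 1")
    case True
    then have "t * 1 \<le> t * k" using t by (intro mult_left_mono)
    then have a: "t \<le> k * t" by (simp add: mult.commute)
    then have "\<bar>exp (- (k * t)) - exp (- t)\<bar> \<le> (k * t - t) * exp (- t)" using gen[of t "k * t"] by simp
    also have "\<dots> \<le> (k * t - t) * exp (- (1/2 * t))" using a le by (intro mult_left_mono) auto
    finally show ?thesis using a by simp
  next
    case False
    then have "t * k \<le> t * 1" using t by (intro mult_left_mono) auto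
    then have a: "k * t \<le> t" by (simp add: mult.commute)
    then have "\<bar>exp (- (k * t)) - exp (- t)\<bar> \<le> (t - k * t) * exp (- (k * t))" using gen[of "k * t" t] by simp
    also have "\<dots> \<le> (t - k * t) * exp (- (1/2 * t))" using a le by (intro mult_left_mono) auto
    finally show ?thesis using a by simp
  qed
  also have "\<bar>k * t - t\<bar> = \<bar>k - 1\<bar> * t" 
    using t abs_mult[of "k - 1" t] by (simp add: algebra_simps)
  also have "\<bar>k - 1\<bar> * t * exp (- (1/2 * t)) \<le> \<bar>k - 1\<bar> * (4 * exp (1/4 * t)) * exp (- (1/2 * t))"
  proof (intro mult_right_mono mult_left_mono)
    show "t \<le> 4 * exp (1/4 * t)" using exp_ge_add_one_self[of "1/4 * t"] by linarith
  qed auto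
  also have "\<dots> = 4 * \<bar>k - 1\<bar> * (exp (1/4 * t) * exp (- (1/2 * t)))" by simp
  also have "exp (1/4 * t) * exp (- (1/2 * t)) = exp (- (1/4 * t))" by (simp flip: exp_add)
  finally show ?thesis .
qed

lemma greenB_lipschitz:
  assumes k: "k \<ge> 1/2"
  shows "\<bar>greenB k z - greenB 1 z\<bar> \<le> 16 * Jconst * \<bar>k - 1\<bar> * exp (- (1/4 * \<bar>z\<bar>))"
proof -
  let ?g = "\<lambda>x. (exp (- (k * (z - x))) - exp (- (1 * (z - x)))) * (\<psi> x)\<^sup>2"
  have "greenB k z - greenB 1 z
      = (LINT x|lborel. indicator {..z} x * (exp (- (k * (z - x))) * (\<psi> x)\<^sup>2)
         - indicator {..z} x * (exp (- (1 * (z - x))) * (\<psi> x)\<^sup>2))"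
    unfolding greenB_eq
    by (rule Bochner_Integration.integral_diff[symmetric]; rule greenB_integrable) (use k in auto)
  also have "\<dots> = (LINT x|lborel. indicator {..z} x * ?g x)"
    by (rule Bochner_Integration.integral_cong) (auto simp: algebra_simps)
  finally have e: "greenB k z - greenB 1 z = (LINT x|lborel. indicator {..z} x * ?g x)" .
  have "\<bar>LINT x|lborel. indicator {..z} x * ?g x\<bar> \<le> (4 * \<bar>k - 1\<bar>) * 4 * Jconst * exp (- (1/4 * \<bar>z\<bar>))"
  proof (rule tail_integral_bound(2))
    show "\<bar>?g x\<bar> \<le> 4 * \<bar>k - 1\<bar> * (exp (- (1/4 * (z - x))) * (\<psi> x)\<^sup>2)" if "x \<le> z" for x
      using mult_right_mono[OF exp_diff_le[OF k, of "z - x"], of "(\<psi> x)\<^sup>2"] that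
      by (simp add: abs_mult mult.assoc)
  qed auto
  then show ?thesis unfolding e by (simp add: mult_ac)
qed

lemma Qfun_bound:
  assumes k: "1/2 \<le> k" "k \<le> 2" shows "\<bar>Qfun k z\<bar> \<le> (2 + 6 * Jconst) * exp (- (1/4 * \<bar>z\<bar>))"
proof -
  let ?E = "exp (- (1/4 * \<bar>z\<bar>))"
  have b: "\<bar>greenB k z\<bar> \<le> 4 * Jconst * ?E" "\<bar>greenB k (- z)\<bar> \<le> 4 * Jconst * ?E"
    using greenB_bound[of "1/4" k z] greenB_bound[of "1/4" k "- z"] k by auto
  have f: "\<bar>k + \<phi> z\<bar> \<le> 3" "\<bar>k - \<phi> z\<bar> \<le> 3" using k abs_phi_le[of z] by auto
  define x where "x = (k + \<phi> z) * greenB k z"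
  define y where "y = (k - \<phi> z) * greenB k (- z)"
  have "\<bar>x\<bar> \<le> 3 * (4 * Jconst * ?E)" "\<bar>y\<bar> \<le> 3 * (4 * Jconst * ?E)"
    unfolding x_def y_def
    unfolding abs_mult by (intro mult_mono b f; simp)+
  moreover have "exp (- (2 * \<bar>z\<bar>)) \<le> ?E" by simp
  then have "(\<psi> z)\<^sup>2 \<le> 4 * ?E" using psi2_le[of z] by linarith
  moreover have "0 \<le> (\<psi> z)\<^sup>2" by simp
  moreover have "\<bar>P / 2 + (x + y) / 4\<bar> \<le> 2 * E + 6 * X"
    if "\<bar>x\<bar> \<le> 3 * (4 * X)" "\<bar>y\<bar> \<le> 3 * (4 * X)" "P \<le> 4 * E" "0 \<le> P" for x y P E X :: real
    using that unfolding abs_le_iff by (simp add: field_simps)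
  ultimately have "\<bar>Qfun k z\<bar> \<le> 2 * ?E + 6 * (Jconst * ?E)"
    unfolding Qfun_def x_def[symmetric] y_def[symmetric] mult.assoc by blast
  then show ?thesis by (simp add: algebra_simps)
qed

text \<open>Four times the increment splits into (k - 1) times the two Green integrals and (1
  \<plusminus> \<phi>) times their increments. With X = J |k - 1| exp(-|z|/4) these contribute 4 + 4
  + 32 + 32 = 72 times X, whence 18. The exponential is kept so that the estimate can be integrated
  over the line.\<close>

lemma Qfun_lipschitz:
  assumes k: "1/2 \<le> k" "k \<le> 2"
  shows "\<bar>Qfun k z - Qfun 1 z\<bar> \<le> 18 * Jconst * \<bar>k - 1\<bar> * exp (- (1/4 * \<bar>z\<bar>))"
proof -
  let ?E = "exp (- (1/4 * \<bar>z\<bar>))"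
  define X where "X = Jconst * \<bar>k - 1\<bar> * ?E"
  have b: "\<bar>greenB k z\<bar> \<le> 4 * Jconst * ?E" "\<bar>greenB k (- z)\<bar> \<le> 4 * Jconst * ?E"
    using greenB_bound[of "1/4" k z] greenB_bound[of "1/4" k "- z"] k by auto
  have b': "\<bar>(k - 1) * greenB k z\<bar> \<le> \<bar>k - 1\<bar> * (4 * Jconst * ?E)" "\<bar>(k - 1) * greenB k (- z)\<bar> \<le> \<bar>k - 1\<bar> * (4 * Jconst * ?E)"
    unfolding abs_mult using b by (auto intro!: mult_left_mono)
  have l: "\<bar>greenB k z - greenB 1 z\<bar> \<le> 16 * X" "\<bar>greenB k (- z) - greenB 1 (- z)\<bar> \<le> 16 * X"
    using greenB_lipschitz[of k z] greenB_lipschitz[of k "- z"] k by (auto simp: X_def mult_ac)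
  have f: "\<bar>1 + \<phi> z\<bar> \<le> 2" "\<bar>1 - \<phi> z\<bar> \<le> 2" using abs_phi_le[of z] by auto
  have l': "\<bar>(1 + \<phi> z) * (greenB k z - greenB 1 z)\<bar> \<le> 2 * (16 * X)"
    "\<bar>(1 - \<phi> z) * (greenB k (- z) - greenB 1 (- z))\<bar> \<le> 2 * (16 * X)"
    unfolding abs_mult by (intro mult_mono f l; simp)+
  have "4 * (Qfun k z - Qfun 1 z) = (k - 1) * greenB k z + (k - 1) * greenB k (- z)
      + (1 + \<phi> z) * (greenB k z - greenB 1 z) + (1 - \<phi> z) * (greenB k (- z) - greenB 1 (- z))"
    by (simp add: Qfun_def field_simps)
  moreover have "\<bar>k - 1\<bar> * (4 * Jconst * ?E) = 4 * X" by (simp add: X_def)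
  ultimately have "\<bar>4 * (Qfun k z - Qfun 1 z)\<bar> \<le> 4 * X + 4 * X + 2 * (16 * X) + 2 * (16 * X)"
    using b' l' by linarith
  then show ?thesis by (simp add: X_def mult_ac)
qed

definition Iconst :: real where "Iconst = (LINT z|lborel. exp (- (1/4 * \<bar>z\<bar>)))"

lemma Iconst_integrable: "integrable lborel (\<lambda>z::real. exp (- (1/4 * \<bar>z\<bar>)))"
  by (rule integrable_exp_minus_abs) simp

lemma abs_integral_le_Iconst:
  fixes f :: "real \<Rightarrow> real"
  assumes "integrable lborel f" "\<And>z. \<bar>f z\<bar> \<le> C * exp (- (1/4 * \<bar>z\<bar>))"
  shows "\<bar>LINT z|lborel. f z\<bar> \<le> C * Iconst"
proof -
  have "\<bar>LINT z|lborel. f z\<bar> \<le> (LINT z|lborel. \<bar>f z\<bar>)" by (rule integral_abs_bound)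
  also have "\<dots> \<le> (LINT z|lborel. C * exp (- (1/4 * \<bar>z\<bar>)))"
    using Iconst_integrable by (intro integral_mono[OF integrable_abs[OF assms(1)] _ assms(2)]) auto
  finally show ?thesis by (simp add: Iconst_def)
qed

definition Qnorm2 :: "real \<Rightarrow> real" where "Qnorm2 k = (LINT z|lborel. Qfun k z * Qfun k z)"

lemma Qfun_product_integrable:
  assumes "k > 0" "subexp f" shows "integrable lborel (\<lambda>z. Qfun k z * f z)"
  using expdecay_Qfun[OF assms(1)] assms(2) by (intro expdecay_integrable expdecay_mult)

lemma lipschitz_at_isCont:
  fixes f :: "real \<Rightarrow> real"
  assumes "\<And>x. 1/2 \<le> x \<Longrightarrow> x \<le> 2 \<Longrightarrow> \<bar>f x - f 1\<bar> \<le> C * \<bar>x - 1\<bar>" shows "isCont f 1"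
proof -
  have "((\<lambda>x. f x - f 1) \<longlongrightarrow> 0) (at 1)"
  proof (rule Lim_null_comparison)
    have "eventually (\<lambda>x::real. x \<in> {1/2<..<2}) (at 1)" by (rule eventually_at_in_open') auto
    then show "eventually (\<lambda>x. norm (f x - f 1) \<le> C * \<bar>x - 1\<bar>) (at 1)"
      by eventually_elim (use assms in auto)
    show "((\<lambda>x. C * \<bar>x - 1\<bar>) \<longlongrightarrow> 0) (at 1)" by (auto intro!: tendsto_eq_intros)
  qed
  then show ?thesis by (simp add: isCont_def LIM_zero_iff)
qed

lemma isCont_mass: "isCont mass 1"
proof (rule lipschitz_at_isCont)
  fix k :: real assume k: "1/2 \<le> k" "k \<le> 2"
  have i: "integrable lborel (\<lambda>z. Qfun k z * (\<psi> z)\<^sup>2)" if "k > 0" for k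
    using that by (intro Qfun_product_integrable) auto
  have "mass k - mass 1 = (LINT z|lborel. Qfun k z * (\<psi> z)\<^sup>2 - Qfun 1 z * (\<psi> z)\<^sup>2)"
    unfolding mass_def using i k by (subst Bochner_Integration.integral_diff) auto
  also have "\<bar>\<dots>\<bar> \<le> (18 * Jconst * \<bar>k - 1\<bar>) * Iconst"
  proof (rule abs_integral_le_Iconst)
    show "integrable lborel (\<lambda>z. Qfun k z * (\<psi> z)\<^sup>2 - Qfun 1 z * (\<psi> z)\<^sup>2)" using i k by auto
    fix z
    have "\<bar>Qfun k z - Qfun 1 z\<bar> * (\<psi> z)\<^sup>2 \<le> \<bar>Qfun k z - Qfun 1 z\<bar> * 1"
      using psi2_le_1 by (intro mult_left_mono) auto
    then have "\<bar>(Qfun k z - Qfun 1 z) * (\<psi> z)\<^sup>2\<bar> \<le> \<bar>Qfun k z - Qfun 1 z\<bar>" by (simp add: abs_mult)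
    then show "\<bar>Qfun k z * (\<psi> z)\<^sup>2 - Qfun 1 z * (\<psi> z)\<^sup>2\<bar> \<le> 18 * Jconst * \<bar>k - 1\<bar> * exp (- (1/4 * \<bar>z\<bar>))"
      using Qfun_lipschitz[OF k, of z] by (simp add: left_diff_distrib)
  qed
  finally show "\<bar>mass k - mass 1\<bar> \<le> (18 * Jconst * Iconst) * \<bar>k - 1\<bar>" by (simp add: mult_ac)
qed

lemma isCont_Qnorm2: "isCont Qnorm2 1"
proof (rule lipschitz_at_isCont)
  fix k :: real assume k: "1/2 \<le> k" "k \<le> 2"
  have i: "integrable lborel (\<lambda>z. Qfun k z * Qfun k z)" if "k > 0" for k
    using that expdecay_Qfun[of k] by (intro Qfun_product_integrable expdecay_subexp) auto
  have "Qnorm2 k - Qnorm2 1 = (LINT z|lborel. Qfun k z * Qfun k z - Qfun 1 z * Qfun 1 z)"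
    unfolding Qnorm2_def using i k by (subst Bochner_Integration.integral_diff) auto
  also have "\<bar>\<dots>\<bar> \<le> (18 * Jconst * \<bar>k - 1\<bar> * (2 * (2 + 6 * Jconst))) * Iconst"
  proof (rule abs_integral_le_Iconst)
    show "integrable lborel (\<lambda>z. Qfun k z * Qfun k z - Qfun 1 z * Qfun 1 z)" using i k by auto
    fix z
    have e1: "exp (- (1/4 * \<bar>z\<bar>)) \<le> (1::real)" by simp
    have s: "\<bar>Qfun k z + Qfun 1 z\<bar> \<le> 2 * (2 + 6 * Jconst)"
    proof -
      have "(2 + 6 * Jconst) * exp (- (1/4 * \<bar>z\<bar>)) \<le> (2 + 6 * Jconst) * 1"
        using Jconst_nonneg by (intro mult_left_mono e1) auto
      then show ?thesis using Qfun_bound[OF k, of z] Qfun_bound[of 1 z] by linarith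
    qed
    have "\<bar>Qfun k z * Qfun k z - Qfun 1 z * Qfun 1 z\<bar> = \<bar>Qfun k z - Qfun 1 z\<bar> * \<bar>Qfun k z + Qfun 1 z\<bar>"
      by (simp add: algebra_simps flip: abs_mult)
    also have "\<dots> \<le> (18 * Jconst * \<bar>k - 1\<bar> * exp (- (1/4 * \<bar>z\<bar>))) * (2 * (2 + 6 * Jconst))"
      using Jconst_nonneg by (intro mult_mono Qfun_lipschitz[OF k] s) auto
    finally show "\<bar>Qfun k z * Qfun k z - Qfun 1 z * Qfun 1 z\<bar>
      \<le> 18 * Jconst * \<bar>k - 1\<bar> * (2 * (2 + 6 * Jconst)) * exp (- (1/4 * \<bar>z\<bar>))" by (simp only: mult_ac)
  qed
  finally show "\<bar>Qnorm2 k - Qnorm2 1\<bar> \<le> (18 * Jconst * (2 * (2 + 6 * Jconst)) * Iconst) * \<bar>k - 1\<bar>"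
    by (simp only: mult_ac)
qed

lemma inner_vector_2: "(vector [a, b] :: real ^ 2) \<bullet> vector [c, d] = a * c + b * d"
  by (simp add: inner_vec_def sum_2)

text \<open>The factor 1/\<mu> in D^-1 \<phi>' = Q / \<mu> occurs in the inner product and in its
  denominator and cancels. The result is regular at \<mu> = 0, where the norm of Q alone survives.
  Taking \<open>p\<close> as a parameter allows any solution of its equation in place of the
  description \<open>p1_bar\<close>.\<close>

lemma nu_formula_eq:
  assumes mu: "\<mu> > -1" "\<mu> \<noteq> 0" and beta: "\<beta> > 0"
  defines "k \<equiv> sqrt (\<mu> + 1)"
  defines "\<gamma> \<equiv> 4 / (3 * \<beta> * mass k)"
  assumes p: "twice_differentiable p" "in_L2 p" "L2_inner p (deriv \<phi>) = 0"
    "opC p = (\<lambda>z. (\<psi> z)\<^sup>2 - \<beta> * (\<gamma> * Qfun k z))"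
  shows "p1_bar \<beta> \<mu> = p"
    "nu_formula \<beta> \<mu> = \<gamma> / mass k * (\<mu> * (LINT z|lborel. Qfun k z * p z) + Qnorm2 k) + \<gamma>\<^sup>2 * \<mu>\<^sup>2 / \<beta>"
proof -
  have k: "k > 0" using mu by (simp add: k_def)
  have m: "mass k \<ge> 1" using mass_bounds[OF k] by simp
  have \<alpha>: "alpha0_formula \<beta> \<mu> = \<gamma> * \<mu>"
    using alpha0_formula_eq[OF mu] by (simp add: \<gamma>_def k_def)
  have Di: "Dinv \<mu> (deriv \<phi>) = (\<lambda>z. Qfun k z / \<mu>)" using Dinv_deriv_phi[OF mu] by (simp add: k_def)
  have eq: "(\<lambda>z. deriv \<phi> z - \<beta> * alpha0_formula \<beta> \<mu> * Dinv \<mu> (deriv \<phi>) z) = (\<lambda>z. (\<psi> z)\<^sup>2 - \<beta> * (\<gamma> * Qfun k z))"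
    unfolding \<alpha> Di unfolding deriv_phi using mu by (auto simp: field_simps)
  show p1: "p1_bar \<beta> \<mu> = p"
    unfolding p1_bar_def eq by (rule Cinv_eqI[OF p])
  note Q = expdecay_Qfun[OF k]
  have "subexp (\<lambda>z. (\<psi> z)\<^sup>2 - \<beta> * (\<gamma> * Qfun k z))"
    using Q by (intro subexp_diff subexp_power subexp_psi subexp_mult subexp_const expdecay_subexp)
  note ps = opC_subexp[OF p(1,2,4) this]
  have q1: "q1_bar \<beta> \<mu> z = \<gamma> * Qfun k z" for z using mu by (simp add: q1_bar_def \<alpha> Di)
  have i: "integrable lborel (\<lambda>z. Qfun k z * p z)" "integrable lborel (\<lambda>z. Qfun k z * Qfun k z)"
    "integrable lborel (\<lambda>z. p z * (\<psi> z)\<^sup>2)" "integrable lborel (\<lambda>z. Qfun k z * (\<psi> z)\<^sup>2)"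
    using ps Q by (auto intro!: Qfun_product_integrable k expdecay_integrable intro: expdecay_subexp)
  have "L2_inner (W1_bar \<beta> \<mu>) (Psi0_dagger \<beta> \<mu>)
    = (LINT z|lborel. \<gamma> * \<beta> * (Qfun k z * p z) + \<gamma> * \<beta> / \<mu> * (Qfun k z * Qfun k z)
        - p z * (\<psi> z)\<^sup>2 + \<gamma> * \<mu> * \<gamma> * (Qfun k z * (\<psi> z)\<^sup>2))"
    unfolding L2_inner_def W1_bar_def Psi0_dagger_def inner_vector_2 p1 q1 \<alpha> Di
    unfolding deriv_phi
    by (rule Bochner_Integration.integral_cong) (use mu in \<open>auto simp: field_simps\<close>)
  also have "\<dots> = \<gamma> * \<beta> * (LINT z|lborel. Qfun k z * p z) + \<gamma> * \<beta> / \<mu> * Qnorm2 k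
      - L2_inner p (deriv \<phi>) + \<gamma> * \<mu> * \<gamma> * mass k"
    using i by (simp add: Qnorm2_def mass_def L2_inner_def deriv_phi)
  finally have W: "L2_inner (W1_bar \<beta> \<mu>) (Psi0_dagger \<beta> \<mu>) = \<gamma> * \<beta> * (LINT z|lborel. Qfun k z * p z)
      + \<gamma> * \<beta> / \<mu> * Qnorm2 k + \<gamma> * \<mu> * \<gamma> * mass k" using p(3) by simp
  have "L2_inner (Dinv \<mu> (deriv \<phi>)) (deriv \<phi>) = mass k / \<mu>"
    unfolding Di by (simp add: L2_inner_def deriv_phi mass_def)
  then have "nu_formula \<beta> \<mu> = (\<gamma> * \<beta> * (LINT z|lborel. Qfun k z * p z)
      + \<gamma> * \<beta> / \<mu> * Qnorm2 k + \<gamma> * \<mu> * \<gamma> * mass k) / (\<beta> * (mass k / \<mu>))"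
    by (simp add: nu_formula_def W)
  also have "\<dots> = \<gamma> / mass k * (\<mu> * (LINT z|lborel. Qfun k z * p z) + Qnorm2 k) + \<gamma>\<^sup>2 * \<mu>\<^sup>2 / \<beta>"
  proof -
    have "mass k \<noteq> 0" using m by simp
    then show ?thesis using mu beta by (simp add: field_simps power2_eq_square)
  qed
  finally show "nu_formula \<beta> \<mu> = \<gamma> / mass k * (\<mu> * (LINT z|lborel. Qfun k z * p z) + Qnorm2 k) + \<gamma>\<^sup>2 * \<mu>\<^sup>2 / \<beta>" .
qed

text \<open>The pairing of Q with \<open>p1_bar\<close> carries the factor \<mu>, so a bound for it
  that is uniform in \<mu> suffices. The explicit inverse of C on even functions provides this
  bound, while \<open>mass\<close> and \<open>Qnorm2\<close> are continuous at k = 1.\<close>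

lemma nu_formula_tendsto:
  assumes beta: "\<beta> > 0"
  shows "(nu_formula \<beta> \<longlongrightarrow> 4 * Qnorm2 1 / (3 * \<beta> * (mass 1)\<^sup>2)) (at 0)"
proof -
  define M0 where "M0 = 2 + 6 * Jconst"
  have M0: "M0 \<ge> 0" using Jconst_nonneg by (simp add: M0_def)
  \<comment> \<open>The bound for the source of p: 4 from \<psi>^2, and \<beta> g \<le> 4/3 times
    the bound \<open>M0\<close> for Q.\<close>
  define M where "M = 4 + 4 / 3 * M0"
  define P where "P = (\<lambda>\<mu>. LINT z|lborel. Qfun (sqrt (\<mu> + 1)) z * p1_bar \<beta> \<mu> z)"
  define G where "G = (\<lambda>\<mu>. 4 / (3 * \<beta> * mass (sqrt (\<mu> + 1))))"
  have main: "\<bar>P \<mu>\<bar> \<le> 56 * M * M0 * Iconst \<and>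
      nu_formula \<beta> \<mu> = G \<mu> / mass (sqrt (\<mu> + 1)) * (\<mu> * P \<mu> + Qnorm2 (sqrt (\<mu> + 1))) + (G \<mu>)\<^sup>2 * \<mu>\<^sup>2 / \<beta>"
    if mu: "\<mu> \<in> {-1/2<..<1}" "\<mu> \<noteq> 0" for \<mu>
  proof -
    define k where "k = sqrt (\<mu> + 1)"
    have k: "1/2 \<le> k" "k \<le> 2" "k > 0"
    proof -
      have "sqrt ((1/2)\<^sup>2) \<le> k" "k \<le> sqrt (2\<^sup>2)"
        unfolding k_def using mu by (intro real_sqrt_le_mono; simp add: power2_eq_square)+
      then show "1/2 \<le> k" "k \<le> 2" "k > 0" by auto
    qed
    have mass1: "mass k \<ge> 1" using mass_bounds[OF k(3)] by simp
    \<comment> \<open>With this value \<beta> g \<open>mass k\<close> is the squared norm of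
      \<phi>', which is the orthogonality of the source of p to \<phi>'.\<close>
    define g where "g = 4 / (3 * \<beta> * mass k)"
    define f where "f = (\<lambda>z. (\<psi> z)\<^sup>2 - \<beta> * (g * Qfun k z))"
    have bg: "\<beta> * g = 4 / 3 / mass k" using beta by (simp add: g_def)
    note Q = expdecay_Qfun[OF k(3)]
    have ef: "expdecay f" unfolding f_def using Q by (intro expdecay_diff expdecay_cmult expdecay_psi2)
    obtain p where p: "twice_differentiable p" "in_L2 p" "L2_inner p (deriv \<phi>) = 0" "opC p = f"
      "\<And>z. \<bar>p z\<bar> \<le> 56 * M * exp (- (1/4 * \<bar>z\<bar>))"
    proof (rule opC_inverse_even[of f M "1/4"])
      show "continuous_on UNIV f" using expdecay_continuous[OF ef] .
      show "f (- z) = f z" for z by (simp add: f_def)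
      fix z :: real
      let ?E = "exp (- (1/4 * \<bar>z\<bar>))"
      have "\<bar>\<beta> * g\<bar> \<le> 4 / 3"
      proof -
        have "4 / 3 / mass k \<le> 4 / 3 / 1" using mass1 by (intro divide_left_mono) auto
        then show ?thesis unfolding bg using mass1 by simp
      qed
      then have "\<bar>(\<beta> * g) * Qfun k z\<bar> \<le> 4 / 3 * (M0 * ?E)"
        unfolding abs_mult[of "\<beta> * g"] M0_def using Qfun_bound[OF k(1,2), of z] by (intro mult_mono) auto
      moreover have "exp (- (2 * \<bar>z\<bar>)) \<le> ?E" by simp
      then have "(\<psi> z)\<^sup>2 \<le> 4 * ?E" using psi2_le[of z] by linarith
      moreover have "0 \<le> (\<psi> z)\<^sup>2" by simp
      moreover have "f z = (\<psi> z)\<^sup>2 - (\<beta> * g) * Qfun k z" by (simp add: f_def)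
      ultimately have "\<bar>f z\<bar> \<le> 4 * ?E + 4 / 3 * (M0 * ?E)" by linarith
      then show "\<bar>f z\<bar> \<le> M * ?E" by (simp add: M_def algebra_simps)
    next
      have i: "integrable lborel (\<lambda>z. (\<psi> z)\<^sup>2 * (\<psi> z)\<^sup>2)" "integrable lborel (\<lambda>z. Qfun k z * (\<psi> z)\<^sup>2)"
        by (rule psi4_integrable) (intro Qfun_product_integrable k subexp_power subexp_psi)
      have "(LINT z|lborel. (\<psi> z)\<^sup>2 * f z)
         = (LINT z|lborel. (\<psi> z)\<^sup>2 * (\<psi> z)\<^sup>2 - (\<beta> * g) * (Qfun k z * (\<psi> z)\<^sup>2))"
        by (rule Bochner_Integration.integral_cong) (auto simp: f_def algebra_simps)
      also have "\<dots> = (LINT z|lborel. (\<psi> z)\<^sup>2 * (\<psi> z)\<^sup>2) - (\<beta> * g) * mass k"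
        using i by (subst Bochner_Integration.integral_diff) (auto simp: mass_def)
      also have "\<dots> = 0" unfolding psi4_integral bg using mass1 by simp
      finally show "(LINT z|lborel. (\<psi> z)\<^sup>2 * f z) = 0" .
    qed auto
    have mu': "\<mu> > -1" using mu by simp
    note nf = nu_formula_eq[OF mu' mu(2) beta p(1-3), folded k_def, folded g_def, OF p(4)[unfolded f_def]]
    have P: "P \<mu> = (LINT z|lborel. Qfun k z * p z)" by (simp add: P_def k_def[symmetric] nf(1))
    have s: "subexp p"
      using opC_subexp(1)[OF p(1,2,4)] ef by (auto intro: expdecay_subexp)
    have "\<bar>P \<mu>\<bar> \<le> (56 * M * M0) * Iconst"
      unfolding P
    proof (rule abs_integral_le_Iconst)
      show "integrable lborel (\<lambda>z. Qfun k z * p z)" using k s by (intro Qfun_product_integrable)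
      fix z :: real
      let ?E = "exp (- (1/4 * \<bar>z\<bar>))"
      have "M \<ge> 0" using M0 by (simp add: M_def)
      then have "56 * M * ?E \<le> 56 * M * 1" by (intro mult_left_mono) auto
      then have "\<bar>p z\<bar> \<le> 56 * M" using p(5)[of z] by linarith
      then have "\<bar>Qfun k z * p z\<bar> \<le> (M0 * ?E) * (56 * M)"
        unfolding abs_mult using Qfun_bound[OF k(1,2), of z] M0 by (intro mult_mono) (auto simp: M0_def)
      then show "\<bar>Qfun k z * p z\<bar> \<le> 56 * M * M0 * ?E" by (simp add: mult_ac)
    qed
    then show ?thesis using nf(2) by (simp add: P G_def k_def[symmetric] g_def)
  qed
  have ev: "eventually (\<lambda>\<mu>::real. \<mu> \<in> {-1/2<..<1} \<and> \<mu> \<noteq> 0) (at 0)"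
    using eventually_at_in_open[of "{-1/2<..<1}" "0::real"] by (auto elim: eventually_mono)
  have s: "((\<lambda>\<mu>. sqrt (\<mu> + 1)) \<longlongrightarrow> 1) (at 0)" by (auto intro!: tendsto_eq_intros)
  have m: "((\<lambda>\<mu>. mass (sqrt (\<mu> + 1))) \<longlongrightarrow> mass 1) (at 0)"
    by (rule isCont_tendsto_compose[OF isCont_mass s])
  have N: "((\<lambda>\<mu>. Qnorm2 (sqrt (\<mu> + 1))) \<longlongrightarrow> Qnorm2 1) (at 0)"
    by (rule isCont_tendsto_compose[OF isCont_Qnorm2 s])
  have m1: "mass 1 \<noteq> 0" using mass_bounds(1)[of 1] by auto
  have P0: "((\<lambda>\<mu>. \<mu> * P \<mu>) \<longlongrightarrow> 0) (at 0)"
  proof (rule Lim_null_comparison)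
    show "eventually (\<lambda>\<mu>. norm (\<mu> * P \<mu>) \<le> \<bar>\<mu>\<bar> * (56 * M * M0 * Iconst)) (at 0)"
      using ev
    proof eventually_elim
      case (elim \<mu>)
      then have "\<bar>P \<mu>\<bar> \<le> 56 * M * M0 * Iconst" using main by blast
      then show ?case unfolding real_norm_def abs_mult by (rule mult_left_mono) simp
    qed
    show "((\<lambda>\<mu>. \<bar>\<mu>\<bar> * (56 * M * M0 * Iconst)) \<longlongrightarrow> 0) (at 0)"
      by (auto intro!: tendsto_eq_intros)
  qed
  have G1: "(G \<longlongrightarrow> 4 / (3 * \<beta> * mass 1)) (at 0)"
    unfolding G_def using beta m1 by (intro tendsto_intros m) auto
  have "((\<lambda>\<mu>. G \<mu> / mass (sqrt (\<mu> + 1)) * (\<mu> * P \<mu> + Qnorm2 (sqrt (\<mu> + 1))) + (G \<mu>)\<^sup>2 * \<mu>\<^sup>2 / \<beta>)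
     \<longlongrightarrow> 4 / (3 * \<beta> * mass 1) / mass 1 * (0 + Qnorm2 1) + (4 / (3 * \<beta> * mass 1))\<^sup>2 * 0\<^sup>2 / \<beta>) (at 0)"
    using beta m1 by (intro tendsto_intros G1 m P0 N) auto
  moreover have "eventually (\<lambda>\<mu>. G \<mu> / mass (sqrt (\<mu> + 1)) * (\<mu> * P \<mu> + Qnorm2 (sqrt (\<mu> + 1))) + (G \<mu>)\<^sup>2 * \<mu>\<^sup>2 / \<beta>
     = nu_formula \<beta> \<mu>) (at 0)"
    using ev by eventually_elim (use main in auto)
  ultimately have "(nu_formula \<beta> \<longlongrightarrow> 4 / (3 * \<beta> * mass 1) / mass 1 * (0 + Qnorm2 1) + (4 / (3 * \<beta> * mass 1))\<^sup>2 * 0\<^sup>2 / \<beta>) (at 0)"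
    by (rule Lim_transform_eventually)
  then show ?thesis by (simp add: power2_eq_square mult_ac)
qed

lemma nu_0: assumes "\<beta> > 0" shows "nu \<beta> 0 = 4 * Qnorm2 1 / (3 * \<beta> * (mass 1)\<^sup>2)"
proof -
  have "at (0::real) within {-1<..} = at 0" by (rule at_within_open) auto
  then show ?thesis using tendsto_Lim[OF _ nu_formula_tendsto[OF assms]] by (simp add: nu_def)
qed

lemma Qnorm2_pos: "Qnorm2 1 > 0"
proof -
  obtain c where c: "\<And>z. Qfun 1 z = c * \<psi> z" "c * (LINT z|lborel. \<psi> z * (\<psi> z)\<^sup>2) = mass 1" using Qfun_1 by metis
  then have "c \<noteq> 0" using mass_bounds(1)[of 1] by auto
  have "Qnorm2 1 = c\<^sup>2 * (LINT z|lborel. (\<psi> z)\<^sup>2)"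
    unfolding Qnorm2_def by (subst Bochner_Integration.integral_mult_right_zero[symmetric])
      (simp add: c power2_eq_square mult_ac)
  then show ?thesis using \<open>c \<noteq> 0\<close> by (simp add: psi2_integral)
qed

lemma nu_pos_near_0:
  assumes beta: "\<beta> > 0" shows "\<exists>\<mu>s>0. \<forall>\<mu>. \<bar>\<mu>\<bar> < \<mu>s \<longrightarrow> nu \<beta> \<mu> > 0"
proof -
  let ?l = "4 * Qnorm2 1 / (3 * \<beta> * (mass 1)\<^sup>2)"
  have "mass 1 \<noteq> 0" using mass_bounds(1)[of 1] by auto
  then have l: "?l > 0" using Qnorm2_pos beta by (intro divide_pos_pos mult_pos_pos) auto
  from order_tendstoD(1)[OF nu_formula_tendsto[OF beta] l]
  obtain d where d: "d > 0" "\<And>\<mu>. \<mu> \<noteq> 0 \<Longrightarrow> \<bar>\<mu>\<bar> < d \<Longrightarrow> nu_formula \<beta> \<mu> > 0"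
    by (auto simp: eventually_at dist_real_def)
  have "nu \<beta> \<mu> > 0" if "\<bar>\<mu>\<bar> < min d 1" for \<mu>
    using that d l nu_0[OF beta] by (cases "\<mu> = 0") (auto simp: nu_def)
  then show ?thesis using d by (intro exI[of _ "min d 1"]) auto
qed

subsection \<open>The solvability functional\<close>

text \<open>The components of the normalized adjoint kernel function. They are also defined for
  \<open>\<mu> = 0\<close>, where they are a multiple of \<open>(\<psi>, 0)\<close>.\<close>

definition adj1 :: "real \<Rightarrow> real \<Rightarrow> real" where
  "adj1 \<mu> z = Qfun (sqrt (\<mu> + 1)) z / mass (sqrt (\<mu> + 1))"

definition adj2 :: "real \<Rightarrow> real \<Rightarrow> real \<Rightarrow> real" where
  "adj2 \<beta> \<mu> z = - (\<mu> / (\<beta> * mass (sqrt (\<mu> + 1))) * (\<psi> z)\<^sup>2)"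

definition solv :: "real \<Rightarrow> real \<Rightarrow> (real \<Rightarrow> real) \<Rightarrow> (real \<Rightarrow> real) \<Rightarrow> real" where
  "solv \<beta> \<mu> f g = (LINT z|lborel. adj1 \<mu> z * f z) + (LINT z|lborel. adj2 \<beta> \<mu> z * g z)"

lemma adj_expdecay:
  assumes "\<mu> > -1" shows "expdecay (adj1 \<mu>)" "expdecay (adj2 \<beta> \<mu>)"
proof -
  have "expdecay (\<lambda>z. (1 / mass (sqrt (\<mu> + 1))) * Qfun (sqrt (\<mu> + 1)) z)"
    using assms by (intro expdecay_cmult expdecay_Qfun) auto
  then show "expdecay (adj1 \<mu>)" by (simp add: adj1_def[abs_def])
  show "expdecay (adj2 \<beta> \<mu>)" unfolding adj2_def[abs_def] by (intro expdecay_minus expdecay_cmult expdecay_psi2)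
qed

lemma profile_solv:
  assumes "profile \<mu> \<beta> V f g p q" "subexp f" "subexp g" "\<mu> > -1" "\<beta> > 0"
  shows "V = solv \<beta> \<mu> f g"
  unfolding solv_def adj1_def[abs_def] adj2_def[abs_def] using profile_velocity[OF assms] .

lemma solv_add:
  assumes "\<mu> > -1" "subexp f" "subexp g" "subexp f'" "subexp g'"
  shows "solv \<beta> \<mu> (\<lambda>z. f z + c * f' z) (\<lambda>z. g z + c * g' z) = solv \<beta> \<mu> f g + c * solv \<beta> \<mu> f' g'"
proof -
  note a = adj_expdecay[OF assms(1)]
  have "(LINT z|lborel. adj1 \<mu> z * (f z + c * f' z)) = (LINT z|lborel. adj1 \<mu> z * f z + c * (adj1 \<mu> z * f' z))"
    "(LINT z|lborel. adj2 \<beta> \<mu> z * (g z + c * g' z)) = (LINT z|lborel. adj2 \<beta> \<mu> z * g z + c * (adj2 \<beta> \<mu> z * g' z))"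
    by (simp_all add: algebra_simps)
  moreover have "integrable lborel (\<lambda>z. adj1 \<mu> z * f z)" "integrable lborel (\<lambda>z. adj1 \<mu> z * f' z)"
    "integrable lborel (\<lambda>z. adj2 \<beta> \<mu> z * g z)" "integrable lborel (\<lambda>z. adj2 \<beta> \<mu> z * g' z)"
    using a assms by (auto intro!: expdecay_integrable expdecay_mult)
  ultimately show ?thesis by (simp add: solv_def algebra_simps)
qed

lemma solv_odd:
  assumes "\<And>z. f (- z) = - f z" "\<And>z. g (- z) = - g z" shows "solv \<beta> \<mu> f g = 0"
  unfolding solv_def adj1_def adj2_def
  by (subst (1 2) integral_odd_eq_0) (auto simp: assms)

lemma alpha0_solv:
  assumes mu: "\<mu> > -1" and beta: "\<beta> > 0"
  shows "alpha0 \<beta> \<mu> = - solv \<beta> \<mu> (\<lambda>z. 0) (deriv \<phi>)"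
    "alpha0 \<beta> \<mu> = 4 / (3 * \<beta> * mass (sqrt (\<mu> + 1))) * \<mu>"
proof -
  show a: "alpha0 \<beta> \<mu> = 4 / (3 * \<beta> * mass (sqrt (\<mu> + 1))) * \<mu>"
  proof (cases "\<mu> = 0")
    case True
    then show ?thesis using alpha0_0[OF beta] by simp
  next
    case False
    then show ?thesis using mu by (simp add: alpha0_def alpha0_formula_eq)
  qed
  have "solv \<beta> \<mu> (\<lambda>z. 0) (deriv \<phi>)
      = (LINT z|lborel. - (\<mu> / (\<beta> * mass (sqrt (\<mu> + 1)))) * ((\<psi> z)\<^sup>2 * (\<psi> z)\<^sup>2))"
    unfolding solv_def adj2_def deriv_phi by (simp add: mult.assoc)
  also have "\<dots> = - (\<mu> / (\<beta> * mass (sqrt (\<mu> + 1)))) * (4 / 3)"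
    unfolding psi4_integral[symmetric] by (rule Bochner_Integration.integral_mult_right_zero)
  finally show "alpha0 \<beta> \<mu> = - solv \<beta> \<mu> (\<lambda>z. 0) (deriv \<phi>)" unfolding a by simp
qed

text \<open>The bridge between the coefficient defined by formulas or limits and a correction found
  in a front. The difference q - \<gamma> Q lies in the kernel of D and is orthogonal to \<phi>' by
  the solvability of the equation for p, so it vanishes for \<mu> = 0 as well. After that both sides
  are combinations of the same integrals.\<close>

lemma first_profile:
  assumes pr: "profile \<mu> \<beta> (- alpha0 \<beta> \<mu>) (\<lambda>z. 0) (deriv \<phi>) p q" and mu: "\<mu> > -1" and beta: "\<beta> > 0"
  shows "nu \<beta> \<mu> = solv \<beta> \<mu> (\<lambda>z. alpha0 \<beta> \<mu> * p z + q z) (\<lambda>z. p z - alpha0 \<beta> \<mu> * q z)"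
proof -
  define k where "k = sqrt (\<mu> + 1)"
  have k: "k > 0" using mu by (simp add: k_def)
  have m: "mass k \<ge> 1" using mass_bounds[OF k] by simp
  define \<gamma> where "\<gamma> = 4 / (3 * \<beta> * mass k)"
  have \<alpha>: "alpha0 \<beta> \<mu> = \<gamma> * \<mu>" using alpha0_solv(2)[OF mu beta] by (simp add: \<gamma>_def k_def)
  have sp: "subexp (deriv \<phi>)" by (simp add: deriv_phi)
  note ps = profile_subexp[OF pr subexp_const sp]
  note Q = expdecay_Qfun[OF k] and Qt = Qfun_twice_differentiable[OF k]
  have h: "twice_differentiable p" "twice_differentiable q" "in_L2 p" "L2_inner p (deriv \<phi>) = 0"
    "opD \<mu> q = (\<lambda>z. \<gamma> * \<mu> * (\<psi> z)\<^sup>2)" "opC p = (\<lambda>z. (\<psi> z)\<^sup>2 - \<beta> * q z)"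
    using pr by (auto simp: profile_def deriv_phi \<alpha>)
  have i: "integrable lborel (\<lambda>z. (\<psi> z)\<^sup>2 * (\<psi> z)\<^sup>2)" "integrable lborel (\<lambda>z. (\<psi> z)\<^sup>2 * q z)"
    "integrable lborel (\<lambda>z. (\<psi> z)\<^sup>2 * Qfun k z)"
    by (fact psi4_integrable, fact expdecay_integrable[OF expdecay_mult[OF expdecay_psi2 ps(2)]],
        fact expdecay_integrable[OF expdecay_mult[OF expdecay_psi2 expdecay_subexp[OF Q(1)]]])
  have qQ: "(\<lambda>z. q z - \<gamma> * Qfun k z) = (\<lambda>z. 0)"
  proof (rule opD_kernel_orthogonal[OF _ _ _ _ mu])
    note t = twice_differentiable_comb[OF h(2) Qt(1), of \<gamma>]
    show "twice_differentiable (\<lambda>z. q z - \<gamma> * Qfun k z)" by (rule t)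
    show "subexp (\<lambda>z. q z - \<gamma> * Qfun k z)" "subexp (deriv (\<lambda>z. q z - \<gamma> * Qfun k z))"
      unfolding t(2) Qt(2) using ps Q by (auto intro!: subexp_diff subexp_mult intro: expdecay_subexp)
    have "opD \<mu> (\<lambda>z. q z - \<gamma> * Qfun k z) z = opD \<mu> q z - \<gamma> * opD \<mu> (Qfun k) z" for z
      unfolding opD_def t(3) by (simp add: algebra_simps)
    then have "opD \<mu> (\<lambda>z. q z - \<gamma> * Qfun k z) z = 0" for z
      using opD_Qfun[OF mu, folded k_def] by (simp add: h(5))
    then show "opD \<mu> (\<lambda>z. q z - \<gamma> * Qfun k z) = (\<lambda>z. 0)" by (rule ext)
    have "(LINT z|lborel. (\<psi> z)\<^sup>2 * opC p z) = 0" using h ps by (intro opC_range_orthogonal) auto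
    then have "(LINT z|lborel. (\<psi> z)\<^sup>2 * (\<psi> z)\<^sup>2 - \<beta> * ((\<psi> z)\<^sup>2 * q z)) = 0" unfolding h(6) by (simp add: algebra_simps)
    then have 1: "\<beta> * (LINT z|lborel. (\<psi> z)\<^sup>2 * q z) = 4 / 3"
      using Bochner_Integration.integral_diff[OF i(1) integrable_mult_right[OF i(2), of \<beta>]] psi4_integral by simp
    have "(LINT z|lborel. (\<psi> z)\<^sup>2 * (q z - \<gamma> * Qfun k z))
        = (LINT z|lborel. (\<psi> z)\<^sup>2 * q z - \<gamma> * ((\<psi> z)\<^sup>2 * Qfun k z))" by (simp add: algebra_simps)
    also have "\<dots> = (LINT z|lborel. (\<psi> z)\<^sup>2 * q z) - \<gamma> * mass k" using i by (simp add: mass_def mult.commute)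
    also have "\<dots> = 0"
    proof -
      have "mass k \<noteq> 0" using m by simp
      then show ?thesis using 1 beta by (simp add: \<gamma>_def field_simps)
    qed
    finally show "(LINT z|lborel. (\<psi> z)\<^sup>2 * (q z - \<gamma> * Qfun k z)) = 0" .
  qed
  then have q: "q z = \<gamma> * Qfun k z" for z by (metis eq_iff_diff_eq_0)
  have nu: "nu \<beta> \<mu> = \<gamma> / mass k * (\<mu> * (LINT z|lborel. Qfun k z * p z) + Qnorm2 k) + \<gamma>\<^sup>2 * \<mu>\<^sup>2 / \<beta>"
  proof (cases "\<mu> = 0")
    case True
    then show ?thesis using nu_0[OF beta] by (simp add: k_def \<gamma>_def power2_eq_square mult_ac)
  next
    case False
    have "opC p = (\<lambda>z. (\<psi> z)\<^sup>2 - \<beta> * (\<gamma> * Qfun k z))" by (simp add: h(6) q)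
    from nu_formula_eq(2)[OF mu False beta h(1,3,4), folded k_def, folded \<gamma>_def, OF this]
    show ?thesis using False mu by (simp add: nu_def)
  qed
  have j: "integrable lborel (\<lambda>z. Qfun k z * p z)" "integrable lborel (\<lambda>z. Qfun k z * Qfun k z)"
    "integrable lborel (\<lambda>z. p z * (\<psi> z)\<^sup>2)" "integrable lborel (\<lambda>z. Qfun k z * (\<psi> z)\<^sup>2)"
    using ps Q by (auto intro!: Qfun_product_integrable k expdecay_integrable intro: expdecay_subexp)
  have "(LINT z|lborel. adj1 \<mu> z * (alpha0 \<beta> \<mu> * p z + q z))
     = (LINT z|lborel. (\<gamma> * \<mu> / mass k) * (Qfun k z * p z) + \<gamma> / mass k * (Qfun k z * Qfun k z))"
    unfolding adj1_def k_def[symmetric] \<alpha> q by (simp add: algebra_simps add_divide_distrib)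
  also have "\<dots> = (\<gamma> * \<mu> / mass k) * (LINT z|lborel. Qfun k z * p z) + \<gamma> / mass k * Qnorm2 k"
    using j by (simp add: Qnorm2_def)
  finally have 1: "(LINT z|lborel. adj1 \<mu> z * (alpha0 \<beta> \<mu> * p z + q z))
     = (\<gamma> * \<mu> / mass k) * (LINT z|lborel. Qfun k z * p z) + \<gamma> / mass k * Qnorm2 k" .
  let ?c = "\<mu> / (\<beta> * mass k)"
  have "(LINT z|lborel. adj2 \<beta> \<mu> z * (p z - alpha0 \<beta> \<mu> * q z))
     = (LINT z|lborel. ?c * (\<gamma> * \<mu> * \<gamma>) * (Qfun k z * (\<psi> z)\<^sup>2) - ?c * (p z * (\<psi> z)\<^sup>2))"
    unfolding adj2_def k_def[symmetric] \<alpha> q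
    by (rule Bochner_Integration.integral_cong) (auto simp: algebra_simps diff_divide_distrib)
  also have "\<dots> = ?c * (\<gamma> * \<mu> * \<gamma>) * mass k - ?c * L2_inner p (deriv \<phi>)"
    using j by (subst Bochner_Integration.integral_diff) (auto simp: mass_def L2_inner_def deriv_phi)
  finally have 2: "(LINT z|lborel. adj2 \<beta> \<mu> z * (p z - alpha0 \<beta> \<mu> * q z)) = ?c * (\<gamma> * \<mu> * \<gamma>) * mass k"
    using h(4) by simp
  have "mass k \<noteq> 0" using m by simp
  then show ?thesis unfolding solv_def 1 2 nu using beta by (simp add: field_simps power2_eq_square)
qed

section \<open>Directional derivatives\<close>

definition Dir :: "'a::real_normed_vector \<Rightarrow> ('a \<Rightarrow> 'b::real_normed_vector) \<Rightarrow> 'a \<Rightarrow> 'b" where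
  "Dir v f = (\<lambda>x. frechet_derivative f (at x) v)"

lemma Dir_eqI: "(f has_derivative f') (at x) \<Longrightarrow> Dir v f x = f' v"
  unfolding Dir_def using frechet_derivative_at by metis

lemma has_derivative_Dir: "f differentiable (at x) \<Longrightarrow> (f has_derivative (\<lambda>v. Dir v f x)) (at x)"
  unfolding Dir_def using frechet_derivative_works[of f "at x"] by simp

text \<open>Both functions have the same candidates for a derivative at \<open>x\<close>, so
  \<open>frechet_derivative\<close> makes the same choice even at points without
  differentiability.\<close>

lemma Dir_cong:
  assumes "open S" "x \<in> S" "\<And>y. y \<in> S \<Longrightarrow> f y = g y" shows "Dir v f x = Dir v g x"
proof -
  have "(f has_derivative f') (at x) \<longleftrightarrow> (g has_derivative f') (at x)" for f'
    using assms has_derivative_transform_within_open[of f f' x UNIV S g]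
      has_derivative_transform_within_open[of g f' x UNIV S f] by auto
  then show ?thesis by (simp add: Dir_def frechet_derivative_def)
qed

lemma differentiable_cong_open:
  assumes "f differentiable (at x)" "open S" "x \<in> S" "\<And>y. y \<in> S \<Longrightarrow> f y = g y"
  shows "g differentiable (at x)"
  using assms has_derivative_transform_within_open[of f _ x UNIV S g] unfolding differentiable_def by metis

lemma Dir_const [simp]: "Dir v (\<lambda>x. c) = (\<lambda>x. 0)" by (simp add: Dir_def)

lemma Dir_bounded_linear:
  assumes "bounded_linear h" "f differentiable (at x)" shows "Dir v (\<lambda>x. h (f x)) x = h (Dir v f x)"
  using Dir_eqI[OF bounded_linear.has_derivative[OF assms(1) has_derivative_Dir[OF assms(2)]]] .

lemma differentiable_bounded_linear:
  assumes "bounded_linear h" "f differentiable (at x)" shows "(\<lambda>x. h (f x)) differentiable (at x)"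
  using bounded_linear.has_derivative[OF assms(1) has_derivative_Dir[OF assms(2)]] by (rule differentiableI)

lemma Dir_add:
  assumes "f differentiable (at x)" "g differentiable (at x)"
  shows "Dir v (\<lambda>x. f x + g x) x = Dir v f x + Dir v g x"
  using Dir_eqI[OF has_derivative_add[OF assms[THEN has_derivative_Dir]]] .

lemma Dir_diff:
  assumes "f differentiable (at x)" "g differentiable (at x)"
  shows "Dir v (\<lambda>x. f x - g x) x = Dir v f x - Dir v g x"
  using Dir_eqI[OF has_derivative_diff[OF assms[THEN has_derivative_Dir]]] .

lemma Dir_minus:
  assumes "f differentiable (at x)" shows "Dir v (\<lambda>x. - f x) x = - Dir v f x"
  using Dir_eqI[OF has_derivative_minus[OF assms[THEN has_derivative_Dir]]] .

lemma Dir_scaleR: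
  assumes "f differentiable (at x)" shows "Dir v (\<lambda>x. c *\<^sub>R f x) x = c *\<^sub>R Dir v f x"
  by (rule Dir_bounded_linear[OF bounded_linear_scaleR_right assms])

lemma Dir_mult:
  fixes f g :: "'a::real_normed_vector \<Rightarrow> real"
  assumes "f differentiable (at x)" "g differentiable (at x)"
  shows "Dir v (\<lambda>x. f x * g x) x = f x * Dir v g x + Dir v f x * g x"
  using Dir_eqI[OF has_derivative_mult[OF assms[THEN has_derivative_Dir]]] .

lemma Dir_sum:
  assumes "finite I" "\<And>i. i \<in> I \<Longrightarrow> f i differentiable (at x)"
  shows "Dir v (\<lambda>x. \<Sum>i\<in>I. f i x) x = (\<Sum>i\<in>I. Dir v (f i) x)"
  using Dir_eqI[OF has_derivative_sum[of I f "\<lambda>i v. Dir v (f i) x"]] assms has_derivative_Dir by blast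

lemma Dir_chain:
  assumes "f differentiable (at x)" "g differentiable (at (f x))"
  shows "Dir v (\<lambda>x. g (f x)) x = Dir (Dir v f x) g (f x)"
  using Dir_eqI[OF has_derivative_compose[OF has_derivative_Dir[OF assms(1)] has_derivative_Dir[OF assms(2)]]] .

lemma Dir_vec_add:
  assumes "f differentiable (at x)" shows "Dir (a *\<^sub>R v + b *\<^sub>R w) f x = a *\<^sub>R Dir v f x + b *\<^sub>R Dir w f x"
proof -
  interpret bounded_linear "\<lambda>v. Dir v f x" using has_derivative_bounded_linear[OF has_derivative_Dir[OF assms]] .
  show ?thesis by (simp add: add scaleR)
qed

lemma has_vector_derivative_Dir:
  assumes "f differentiable (at (p t))" "(p has_vector_derivative v) (at t)"
  shows "((\<lambda>t. f (p t)) has_vector_derivative Dir v f (p t)) (at t)"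
proof -
  have "((\<lambda>t. f (p t)) has_derivative (\<lambda>h. Dir (h *\<^sub>R v) f (p t))) (at t)"
    using has_derivative_compose[OF assms(2)[unfolded has_vector_derivative_def] has_derivative_Dir[OF assms(1)]] .
  moreover have "Dir (h *\<^sub>R v) f (p t) = h *\<^sub>R Dir v f (p t)" for h
    using Dir_vec_add[OF assms(1), of h v 0 0] by simp
  ultimately show ?thesis by (simp add: has_vector_derivative_def)
qed

text \<open>A list of directions is applied from its end. Appending therefore differentiates the
  function first, which is why smoothness and expansions pass to \<open>Dir v f\<close>.\<close>

lemma dderivs_append: "dderivs (vs @ [v]) f = dderivs vs (Dir v f)"
  by (induction vs) (auto simp: Dir_def)

lemma dderivs_Cons_Dir: "dderivs (v # vs) f = Dir v (dderivs vs f)"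
  by (simp add: Dir_def)

lemma smooth_on_Dir: "smooth_on S f \<Longrightarrow> smooth_on S (Dir v f)"
  unfolding smooth_on_def dderivs_append[symmetric] by blast

lemma smooth_on_differentiable: "smooth_on S f \<Longrightarrow> x \<in> S \<Longrightarrow> f differentiable (at x)"
  unfolding smooth_on_def by (metis dderivs.simps(1))

lemma dderivs_cong:
  assumes "open S" "\<And>y. y \<in> S \<Longrightarrow> f y = g y" "x \<in> S" shows "dderivs vs f x = dderivs vs g x"
  using assms(3)
proof (induction vs arbitrary: x)
  case (Cons v vs)
  then show ?case unfolding dderivs_Cons_Dir using Dir_cong[OF assms(1), of x] by blast
qed (use assms in auto)

lemma smooth_on_bounded_linear:
  assumes "open S" "smooth_on S f" "bounded_linear h"
  shows "smooth_on S (\<lambda>x. h (f x))" "\<And>x. x \<in> S \<Longrightarrow> dderivs vs (\<lambda>x. h (f x)) x = h (dderivs vs f x)"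
proof -
  have d: "dderivs vs f differentiable (at x)" if "x \<in> S" for vs x
    using assms(2) that by (simp add: smooth_on_def)
  have eq: "dderivs vs (\<lambda>x. h (f x)) x = h (dderivs vs f x)" if "x \<in> S" for vs x
    using that
  proof (induction vs arbitrary: x)
    case (Cons v vs)
    have "dderivs (v # vs) (\<lambda>x. h (f x)) x = Dir v (\<lambda>x. h (dderivs vs f x)) x"
      unfolding dderivs_Cons_Dir using Cons by (intro Dir_cong[OF assms(1)]) auto
    also have "\<dots> = h (dderivs (v # vs) f x)"
      unfolding dderivs_Cons_Dir by (rule Dir_bounded_linear[OF assms(3) d[OF Cons.prems]])
    finally show ?case .
  qed auto
  then show "\<And>x. x \<in> S \<Longrightarrow> dderivs vs (\<lambda>x. h (f x)) x = h (dderivs vs f x)" .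
  show "smooth_on S (\<lambda>x. h (f x))"
    unfolding smooth_on_def
  proof (intro allI ballI)
    fix vs x assume x: "x \<in> S"
    show "dderivs vs (\<lambda>x. h (f x)) differentiable (at x)"
      by (rule differentiable_cong_open[OF differentiable_bounded_linear[OF assms(3) d[OF x, of vs]] assms(1) x])
        (simp add: eq)
  qed
qed

text \<open>Schwarz's theorem: both mixed second differences are equal to the same increment
  \<open>f (x + h a + h b) - f (x + h a) - f (x + h b) + f x\<close>.\<close>

lemma Dir_commute:
  fixes f :: "'a::real_normed_vector \<Rightarrow> real"
  assumes S: "open S" "x \<in> S" and f: "\<And>y. y \<in> S \<Longrightarrow> f differentiable (at y)"
    and fa: "\<And>y. y \<in> S \<Longrightarrow> Dir a f differentiable (at y)" and fb: "\<And>y. y \<in> S \<Longrightarrow> Dir b f differentiable (at y)"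
    and c: "isCont (Dir b (Dir a f)) x" "isCont (Dir a (Dir b f)) x"
  shows "Dir a (Dir b f) x = Dir b (Dir a f) x"
proof (rule ccontr)
  assume ne: "Dir a (Dir b f) x \<noteq> Dir b (Dir a f) x"
  define e where "e = \<bar>Dir a (Dir b f) x - Dir b (Dir a f) x\<bar> / 2"
  have e: "e > 0" using ne by (simp add: e_def)
  obtain d1 where d1: "d1 > 0" "\<And>y. dist y x < d1 \<Longrightarrow> \<bar>Dir b (Dir a f) y - Dir b (Dir a f) x\<bar> < e"
    using c(1) e unfolding continuous_at_eps_delta by (auto simp: dist_real_def)
  obtain d2 where d2: "d2 > 0" "\<And>y. dist y x < d2 \<Longrightarrow> \<bar>Dir a (Dir b f) y - Dir a (Dir b f) x\<bar> < e"
    using c(2) e unfolding continuous_at_eps_delta by (auto simp: dist_real_def)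
  obtain d3 where d3: "d3 > 0" "ball x d3 \<subseteq> S" using S by (auto simp: open_contains_ball)
  define d where "d = min d1 (min d2 d3)"
  have d: "d > 0" using d1 d2 d3 by (simp add: d_def)
  \<comment> \<open>This keeps the parallelogram with sides h a and h b inside the ball of radius d;
    the summand 1 covers a = b = 0.\<close>
  define h where "h = d / (2 * (norm a + norm b + 1))"
  have np: "norm a + norm b + 1 > 0" by (simp add: add_nonneg_pos)
  have h: "h > 0" using d np by (simp add: h_def)
  have near: "dist (x + s *\<^sub>R a + t *\<^sub>R b) x < d" if "0 \<le> s" "s \<le> h" "0 \<le> t" "t \<le> h" for s t
  proof -
    have "norm (s *\<^sub>R a + t *\<^sub>R b) \<le> s * norm a + t * norm b"
      using norm_triangle_ineq[of "s *\<^sub>R a" "t *\<^sub>R b"] that by simp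
    also have "\<dots> \<le> h * norm a + h * norm b" using that by (intro add_mono mult_right_mono) auto
    also have "\<dots> < h * (norm a + norm b + 1) + h * (norm a + norm b + 1)"
    proof -
      have "0 \<le> h * norm a" "0 \<le> h * norm b" using h by auto
      then show ?thesis using h unfolding distrib_left by linarith
    qed
    also have "\<dots> = d"
    proof -
      have "d / (2 * n) * n + d / (2 * n) * n = d" if "n > 0" for n :: real using that by (simp add: field_simps)
      from this[OF np] show ?thesis unfolding h_def .
    qed
    finally show ?thesis by (simp add: dist_norm add.assoc)
  qed
  have inS: "x + s *\<^sub>R a + t *\<^sub>R b \<in> S" if "0 \<le> s" "s \<le> h" "0 \<le> t" "t \<le> h" for s t
    using near[OF that] d3 by (auto simp: d_def dist_commute)
  have dera: "((\<lambda>s. g (x + s *\<^sub>R a + t *\<^sub>R b)) has_real_derivative Dir a g (x + s *\<^sub>R a + t *\<^sub>R b)) (at s)"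
    if "g differentiable (at (x + s *\<^sub>R a + t *\<^sub>R b))" for g :: "'a \<Rightarrow> real" and s t
    unfolding has_real_derivative_iff_has_vector_derivative
    by (rule has_vector_derivative_Dir[where p = "\<lambda>s. x + s *\<^sub>R a + t *\<^sub>R b", OF that]) (auto intro!: derivative_eq_intros)
  have derb: "((\<lambda>t. g (x + s *\<^sub>R a + t *\<^sub>R b)) has_real_derivative Dir b g (x + s *\<^sub>R a + t *\<^sub>R b)) (at t)"
    if "g differentiable (at (x + s *\<^sub>R a + t *\<^sub>R b))" for g :: "'a \<Rightarrow> real" and s t
    unfolding has_real_derivative_iff_has_vector_derivative
    by (rule has_vector_derivative_Dir[where p = "\<lambda>t. x + s *\<^sub>R a + t *\<^sub>R b", OF that]) (auto intro!: derivative_eq_intros)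
  let ?\<Delta> = "f (x + h *\<^sub>R a + h *\<^sub>R b) - f (x + h *\<^sub>R a + 0 *\<^sub>R b) - f (x + 0 *\<^sub>R a + h *\<^sub>R b) + f (x + 0 *\<^sub>R a + 0 *\<^sub>R b)"
  have "\<exists>s>0. s < h \<and> (f (x + h *\<^sub>R a + h *\<^sub>R b) - f (x + h *\<^sub>R a + 0 *\<^sub>R b)) - (f (x + 0 *\<^sub>R a + h *\<^sub>R b) - f (x + 0 *\<^sub>R a + 0 *\<^sub>R b))
      = (h - 0) * (Dir a f (x + s *\<^sub>R a + h *\<^sub>R b) - Dir a f (x + s *\<^sub>R a + 0 *\<^sub>R b))"
    by (rule MVT2[OF h]) (use h in \<open>intro DERIV_diff dera f inS; simp\<close>)
  then obtain s where s: "0 < s" "s < h"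
    "?\<Delta> = h * (Dir a f (x + s *\<^sub>R a + h *\<^sub>R b) - Dir a f (x + s *\<^sub>R a + 0 *\<^sub>R b))" by auto
  have "\<exists>t>0. t < h \<and> Dir a f (x + s *\<^sub>R a + h *\<^sub>R b) - Dir a f (x + s *\<^sub>R a + 0 *\<^sub>R b) = (h - 0) * Dir b (Dir a f) (x + s *\<^sub>R a + t *\<^sub>R b)"
    by (rule MVT2[OF h]) (use h s in \<open>intro derb fa inS; simp\<close>)
  then obtain t where t: "0 < t" "t < h" "?\<Delta> = h * (h * Dir b (Dir a f) (x + s *\<^sub>R a + t *\<^sub>R b))"
    using s(3) by auto
  have "\<exists>t>0. t < h \<and> (f (x + h *\<^sub>R a + h *\<^sub>R b) - f (x + 0 *\<^sub>R a + h *\<^sub>R b)) - (f (x + h *\<^sub>R a + 0 *\<^sub>R b) - f (x + 0 *\<^sub>R a + 0 *\<^sub>R b))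
      = (h - 0) * (Dir b f (x + h *\<^sub>R a + t *\<^sub>R b) - Dir b f (x + 0 *\<^sub>R a + t *\<^sub>R b))"
    by (rule MVT2[OF h]) (use h in \<open>intro DERIV_diff derb f inS; simp\<close>)
  then obtain t' where t': "0 < t'" "t' < h"
    "?\<Delta> = h * (Dir b f (x + h *\<^sub>R a + t' *\<^sub>R b) - Dir b f (x + 0 *\<^sub>R a + t' *\<^sub>R b))" by auto
  have "\<exists>s>0. s < h \<and> Dir b f (x + h *\<^sub>R a + t' *\<^sub>R b) - Dir b f (x + 0 *\<^sub>R a + t' *\<^sub>R b) = (h - 0) * Dir a (Dir b f) (x + s *\<^sub>R a + t' *\<^sub>R b)"
    by (rule MVT2[OF h]) (use h t' in \<open>intro dera fb inS; simp\<close>)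
  then obtain s' where s': "0 < s'" "s' < h" "?\<Delta> = h * (h * Dir a (Dir b f) (x + s' *\<^sub>R a + t' *\<^sub>R b))"
    using t'(3) by auto
  have "h * (h * Dir b (Dir a f) (x + s *\<^sub>R a + t *\<^sub>R b)) = h * (h * Dir a (Dir b f) (x + s' *\<^sub>R a + t' *\<^sub>R b))"
    using t(3) s'(3) by simp
  then have eq: "Dir b (Dir a f) (x + s *\<^sub>R a + t *\<^sub>R b) = Dir a (Dir b f) (x + s' *\<^sub>R a + t' *\<^sub>R b)" using h by simp
  have "dist (x + s *\<^sub>R a + t *\<^sub>R b) x < d1" "dist (x + s' *\<^sub>R a + t' *\<^sub>R b) x < d2"
    using near[of s t] near[of s' t'] s t s' t' by (auto simp: d_def)
  from d1(2)[OF this(1)] d2(2)[OF this(2)]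
  have "\<bar>Dir a (Dir b f) x - Dir b (Dir a f) x\<bar> < 2 * e" unfolding eq by linarith
  then show False by (simp add: e_def)
qed

section \<open>Asymptotic expansions with formal power series\<close>

notation fps_nth (infixl "$$" 75)

text \<open>The truncation of a uniform expansion at level N. The level is explicit because the
  product rule is an induction on it, and the coefficients are required to be bounded because in a
  product they multiply remainders.\<close>

definition Ulev :: "nat \<Rightarrow> 'y set \<Rightarrow> (real \<Rightarrow> 'y \<Rightarrow> real) \<Rightarrow> ('y \<Rightarrow> real fps) \<Rightarrow> bool" where
  "Ulev N K e c \<longleftrightarrow> (\<forall>i<N. \<exists>B. \<forall>y\<in>K. \<bar>c y $$ i\<bar> \<le> B) \<and>
     (\<exists>C. \<forall>\<^sub>F \<epsilon> in at_right 0. \<forall>y\<in>K. \<bar>e \<epsilon> y - (\<Sum>i<N. c y $$ i * \<epsilon> ^ i)\<bar> \<le> C * \<epsilon> ^ N)"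

definition uexp :: "'y set \<Rightarrow> (real \<Rightarrow> 'y \<Rightarrow> real) \<Rightarrow> ('y \<Rightarrow> real fps) \<Rightarrow> bool" where
  "uexp K e c \<longleftrightarrow> (\<forall>N. Ulev N K e c)"

lemma eventually_at_right_0_pos: "eventually (\<lambda>\<epsilon>::real. 0 < \<epsilon> \<and> \<epsilon> < 1) (at_right 0)"
  using eventually_at_right_real[of 0 1] by (auto elim: eventually_mono)

text \<open>Peeling off the constant coefficient: (e - c_0) / \<epsilon> has the shifted series.
  This replaces manipulations of double sums by an induction.\<close>

lemma Ulev_Suc:
  "Ulev (Suc N) K e c \<longleftrightarrow> (\<exists>B. \<forall>y\<in>K. \<bar>c y $$ 0\<bar> \<le> B) \<and>
     Ulev N K (\<lambda>\<epsilon> y. (e \<epsilon> y - c y $$ 0) / \<epsilon>) (\<lambda>y. fps_shift 1 (c y))"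
proof -
  have 1: "(\<forall>i<Suc N. \<exists>B. \<forall>y\<in>K. \<bar>c y $$ i\<bar> \<le> B)
      \<longleftrightarrow> (\<exists>B. \<forall>y\<in>K. \<bar>c y $$ 0\<bar> \<le> B) \<and> (\<forall>i<N. \<exists>B. \<forall>y\<in>K. \<bar>fps_shift 1 (c y) $$ i\<bar> \<le> B)"
    by (auto simp: less_Suc_eq_0_disj)
  have 2: "(\<forall>\<^sub>F \<epsilon> in at_right 0. \<forall>y\<in>K. \<bar>e \<epsilon> y - (\<Sum>i<Suc N. c y $$ i * \<epsilon> ^ i)\<bar> \<le> C * \<epsilon> ^ Suc N) \<longleftrightarrow>
    (\<forall>\<^sub>F \<epsilon> in at_right 0. \<forall>y\<in>K. \<bar>(e \<epsilon> y - c y $$ 0) / \<epsilon> - (\<Sum>i<N. fps_shift 1 (c y) $$ i * \<epsilon> ^ i)\<bar> \<le> C * \<epsilon> ^ N)" for C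
  proof (rule eventually_cong[OF eventually_at_right_0_pos])
    fix \<epsilon> :: real assume \<epsilon>: "0 < \<epsilon> \<and> \<epsilon> < 1"
    have "\<bar>e \<epsilon> y - (\<Sum>i<Suc N. c y $$ i * \<epsilon> ^ i)\<bar>
       = \<epsilon> * \<bar>(e \<epsilon> y - c y $$ 0) / \<epsilon> - (\<Sum>i<N. fps_shift 1 (c y) $$ i * \<epsilon> ^ i)\<bar>" for y
    proof -
      have "e \<epsilon> y - (\<Sum>i<Suc N. c y $$ i * \<epsilon> ^ i)
         = \<epsilon> * ((e \<epsilon> y - c y $$ 0) / \<epsilon> - (\<Sum>i<N. fps_shift 1 (c y) $$ i * \<epsilon> ^ i))"
        using \<epsilon> by (subst sum.lessThan_Suc_shift) (simp add: sum_distrib_left right_diff_distrib mult_ac, simp add: field_simps)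
      then show ?thesis using \<epsilon> by (simp add: abs_mult)
    qed
    then show "(\<forall>y\<in>K. \<bar>e \<epsilon> y - (\<Sum>i<Suc N. c y $$ i * \<epsilon> ^ i)\<bar> \<le> C * \<epsilon> ^ Suc N) \<longleftrightarrow>
      (\<forall>y\<in>K. \<bar>(e \<epsilon> y - c y $$ 0) / \<epsilon> - (\<Sum>i<N. fps_shift 1 (c y) $$ i * \<epsilon> ^ i)\<bar> \<le> C * \<epsilon> ^ N)"
      using \<epsilon> by (simp add: mult_ac)
  qed
  show ?thesis unfolding Ulev_def 1 2 by blast
qed

lemma Ulev_0: "Ulev 0 K e c \<longleftrightarrow> (\<exists>C. \<forall>\<^sub>F \<epsilon> in at_right 0. \<forall>y\<in>K. \<bar>e \<epsilon> y\<bar> \<le> C)"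
  by (simp add: Ulev_def)

lemma Ulev_add:
  assumes "Ulev N K e c" "Ulev N K f d" shows "Ulev N K (\<lambda>\<epsilon> y. e \<epsilon> y + f \<epsilon> y) (\<lambda>y. c y + d y)"
  unfolding Ulev_def
proof (intro conjI allI impI)
  fix i assume "i < N"
  then obtain A B where "\<forall>y\<in>K. \<bar>c y $$ i\<bar> \<le> A" "\<forall>y\<in>K. \<bar>d y $$ i\<bar> \<le> B" using assms unfolding Ulev_def by blast
  then have "\<forall>y\<in>K. \<bar>(c y + d y) $$ i\<bar> \<le> A + B" by (auto intro: order_trans[OF abs_triangle_ineq add_mono])
  then show "\<exists>B. \<forall>y\<in>K. \<bar>(c y + d y) $$ i\<bar> \<le> B" by blast
next
  obtain A B where "\<forall>\<^sub>F \<epsilon> in at_right 0. \<forall>y\<in>K. \<bar>e \<epsilon> y - (\<Sum>i<N. c y $$ i * \<epsilon> ^ i)\<bar> \<le> A * \<epsilon> ^ N"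
    "\<forall>\<^sub>F \<epsilon> in at_right 0. \<forall>y\<in>K. \<bar>f \<epsilon> y - (\<Sum>i<N. d y $$ i * \<epsilon> ^ i)\<bar> \<le> B * \<epsilon> ^ N"
    using assms unfolding Ulev_def by blast
  then have "\<forall>\<^sub>F \<epsilon> in at_right 0. \<forall>y\<in>K. \<bar>e \<epsilon> y + f \<epsilon> y - (\<Sum>i<N. (c y + d y) $$ i * \<epsilon> ^ i)\<bar> \<le> (A + B) * \<epsilon> ^ N"
  proof eventually_elim
    case (elim \<epsilon>)
    show ?case
    proof
      fix y assume "y \<in> K"
      with elim have "\<bar>e \<epsilon> y - (\<Sum>i<N. c y $$ i * \<epsilon> ^ i)\<bar> \<le> A * \<epsilon> ^ N" "\<bar>f \<epsilon> y - (\<Sum>i<N. d y $$ i * \<epsilon> ^ i)\<bar> \<le> B * \<epsilon> ^ N" by auto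
      then show "\<bar>e \<epsilon> y + f \<epsilon> y - (\<Sum>i<N. (c y + d y) $$ i * \<epsilon> ^ i)\<bar> \<le> (A + B) * \<epsilon> ^ N"
        by (simp add: distrib_right sum.distrib)
    qed
  qed
  then show "\<exists>C. \<forall>\<^sub>F \<epsilon> in at_right 0. \<forall>y\<in>K. \<bar>e \<epsilon> y + f \<epsilon> y - (\<Sum>i<N. (c y + d y) $$ i * \<epsilon> ^ i)\<bar> \<le> C * \<epsilon> ^ N" by blast
qed

lemma Ulev_bounded_const:
  assumes "\<And>y. y \<in> K \<Longrightarrow> \<bar>g y\<bar> \<le> B" shows "Ulev N K (\<lambda>\<epsilon> y. g y) (\<lambda>y. fps_const (g y))"
proof (induction N)
  case 0
  then show ?case unfolding Ulev_0 using assms by (intro exI[of _ B] always_eventually) auto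
next
  case (Suc N)
  have z: "Ulev N K (\<lambda>\<epsilon> y. 0) (\<lambda>y. 0)" for N
    by (auto simp: Ulev_def intro!: exI[of _ 0])
  show ?case unfolding Ulev_Suc using assms z[of N] by (auto simp: fps_shift_fps_const)
qed

lemma Ulev_Suc_imp: assumes "Ulev (Suc N) K e c" shows "Ulev N K e c"
  unfolding Ulev_def
proof (intro conjI allI impI)
  fix i assume "i < N" then show "\<exists>B. \<forall>y\<in>K. \<bar>c y $$ i\<bar> \<le> B" using assms unfolding Ulev_def by simp
next
  obtain B where B: "\<forall>y\<in>K. \<bar>c y $$ N\<bar> \<le> B" using assms unfolding Ulev_def by blast
  obtain C where "\<forall>\<^sub>F \<epsilon> in at_right 0. \<forall>y\<in>K. \<bar>e \<epsilon> y - (\<Sum>i<Suc N. c y $$ i * \<epsilon> ^ i)\<bar> \<le> C * \<epsilon> ^ Suc N"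
    using assms unfolding Ulev_def by blast
  then have "\<forall>\<^sub>F \<epsilon> in at_right 0. \<forall>y\<in>K. \<bar>e \<epsilon> y - (\<Sum>i<N. c y $$ i * \<epsilon> ^ i)\<bar> \<le> (\<bar>C\<bar> + B) * \<epsilon> ^ N"
    using eventually_at_right_0_pos
  proof eventually_elim
    case (elim \<epsilon>)
    show ?case
    proof
      fix y assume y: "y \<in> K"
      have "C * \<epsilon> ^ Suc N \<le> \<bar>C\<bar> * \<epsilon> ^ N" using elim by (intro mult_mono) (auto intro: power_decreasing mult_left_le_one_le)
      moreover have "\<bar>c y $$ N * \<epsilon> ^ N\<bar> \<le> B * \<epsilon> ^ N" unfolding abs_mult using B y elim by (auto intro!: mult_mono)
      moreover have "\<bar>e \<epsilon> y - (\<Sum>i<N. c y $$ i * \<epsilon> ^ i) - c y $$ N * \<epsilon> ^ N\<bar> \<le> C * \<epsilon> ^ Suc N"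
        using elim y by (simp add: algebra_simps)
      ultimately show "\<bar>e \<epsilon> y - (\<Sum>i<N. c y $$ i * \<epsilon> ^ i)\<bar> \<le> (\<bar>C\<bar> + B) * \<epsilon> ^ N"
        unfolding distrib_right by linarith
    qed
  qed
  then show "\<exists>C. \<forall>\<^sub>F \<epsilon> in at_right 0. \<forall>y\<in>K. \<bar>e \<epsilon> y - (\<Sum>i<N. c y $$ i * \<epsilon> ^ i)\<bar> \<le> C * \<epsilon> ^ N" by blast
qed

lemma Ulev_le: assumes "Ulev N K e c" "m \<le> N" shows "Ulev m K e c"
  using assms(2,1) by (induction rule: dec_induct) (auto dest: Ulev_Suc_imp)

lemma Ulev_cong:
  assumes "Ulev N K e c" "\<forall>\<^sub>F \<epsilon> in at_right 0. \<forall>y\<in>K. e \<epsilon> y = f \<epsilon> y" "\<And>y. y \<in> K \<Longrightarrow> c y = d y"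
  shows "Ulev N K f d"
proof -
  obtain C where C: "\<forall>\<^sub>F \<epsilon> in at_right 0. \<forall>y\<in>K. \<bar>e \<epsilon> y - (\<Sum>i<N. c y $$ i * \<epsilon> ^ i)\<bar> \<le> C * \<epsilon> ^ N"
    using assms(1) unfolding Ulev_def by blast
  have "\<forall>\<^sub>F \<epsilon> in at_right 0. \<forall>y\<in>K. \<bar>f \<epsilon> y - (\<Sum>i<N. d y $$ i * \<epsilon> ^ i)\<bar> \<le> C * \<epsilon> ^ N"
    using C assms(2) by eventually_elim (use assms(3) in auto)
  moreover have "\<forall>i<N. \<exists>B. \<forall>y\<in>K. \<bar>d y $$ i\<bar> \<le> B" using assms(1,3) unfolding Ulev_def by simp
  ultimately show ?thesis unfolding Ulev_def by blast
qed

text \<open>The induction rests on e f - c_0 d_0 = c_0 (f - d_0) + (e - c_0) f, divided by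
  \<epsilon>.\<close>

lemma Ulev_mult:
  assumes "Ulev N K e c" "Ulev N K f d" shows "Ulev N K (\<lambda>\<epsilon> y. e \<epsilon> y * f \<epsilon> y) (\<lambda>y. c y * d y)"
  using assms
proof (induction N arbitrary: e c f d)
  case 0
  then obtain A B where "\<forall>\<^sub>F \<epsilon> in at_right 0. \<forall>y\<in>K. \<bar>e \<epsilon> y\<bar> \<le> A" "\<forall>\<^sub>F \<epsilon> in at_right 0. \<forall>y\<in>K. \<bar>f \<epsilon> y\<bar> \<le> B"
    unfolding Ulev_0 by blast
  then have "\<forall>\<^sub>F \<epsilon> in at_right 0. \<forall>y\<in>K. \<bar>e \<epsilon> y * f \<epsilon> y\<bar> \<le> \<bar>A\<bar> * \<bar>B\<bar>"
    by eventually_elim (force simp: abs_mult intro!: mult_mono)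
  then show ?case unfolding Ulev_0 by blast
next
  case (Suc N)
  obtain A B where AB: "\<forall>y\<in>K. \<bar>c y $$ 0\<bar> \<le> A" "\<forall>y\<in>K. \<bar>d y $$ 0\<bar> \<le> B"
    using Suc.prems unfolding Ulev_Suc by blast
  let ?e1 = "\<lambda>\<epsilon> y. (e \<epsilon> y - c y $$ 0) / \<epsilon>" and ?f1 = "\<lambda>\<epsilon> y. (f \<epsilon> y - d y $$ 0) / \<epsilon>"
  have U: "Ulev N K (\<lambda>\<epsilon> y. c y $$ 0 * ?f1 \<epsilon> y + ?e1 \<epsilon> y * f \<epsilon> y)
     (\<lambda>y. fps_const (c y $$ 0) * fps_shift 1 (d y) + fps_shift 1 (c y) * d y)"
    using Suc.prems AB unfolding Ulev_Suc
    by (intro Ulev_add Suc.IH Ulev_bounded_const[of K _ A] Ulev_Suc_imp[OF Suc.prems(2)]) auto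
  have sh: "fps_const (c y $$ 0) * fps_shift 1 (d y) + fps_shift 1 (c y) * d y = fps_shift 1 (c y * d y)" for y
    by (rule fps_ext) (simp add: fps_mult_nth[of "c y" "d y"] fps_mult_nth[of "fps_shift (Suc 0) (c y)" "d y"]
        sum.atLeast0_atMost_Suc_shift del: sum.cl_ivl_Suc)
  have ev: "\<forall>\<^sub>F \<epsilon> in at_right 0. \<forall>y\<in>K. c y $$ 0 * ?f1 \<epsilon> y + ?e1 \<epsilon> y * f \<epsilon> y = (e \<epsilon> y * f \<epsilon> y - (c y * d y) $$ 0) / \<epsilon>"
    using eventually_at_right_0_pos by eventually_elim (simp add: field_simps)
  have "Ulev N K (\<lambda>\<epsilon> y. (e \<epsilon> y * f \<epsilon> y - (c y * d y) $$ 0) / \<epsilon>) (\<lambda>y. fps_shift 1 (c y * d y))"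
    by (rule Ulev_cong[OF U ev sh])
  moreover have "\<forall>y\<in>K. \<bar>(c y * d y) $$ 0\<bar> \<le> \<bar>A\<bar> * \<bar>B\<bar>"
    using AB by (force simp: abs_mult intro!: mult_mono)
  ultimately show ?case unfolding Ulev_Suc by blast
qed

lemma uexp_add: "uexp K e c \<Longrightarrow> uexp K f d \<Longrightarrow> uexp K (\<lambda>\<epsilon> y. e \<epsilon> y + f \<epsilon> y) (\<lambda>y. c y + d y)"
  and uexp_mult: "uexp K e c \<Longrightarrow> uexp K f d \<Longrightarrow> uexp K (\<lambda>\<epsilon> y. e \<epsilon> y * f \<epsilon> y) (\<lambda>y. c y * d y)"
  by (auto simp: uexp_def Ulev_add Ulev_mult)

lemma uexp_cong:
  assumes "uexp K e c" "\<forall>\<^sub>F \<epsilon> in at_right 0. \<forall>y\<in>K. e \<epsilon> y = f \<epsilon> y" "\<And>y. y \<in> K \<Longrightarrow> c y = d y"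
  shows "uexp K f d"
  using assms Ulev_cong unfolding uexp_def by blast

lemma uexp_const: "uexp K (\<lambda>\<epsilon> y. a) (\<lambda>y. fps_const a)"
  unfolding uexp_def using Ulev_bounded_const[of K "\<lambda>y. a" "\<bar>a\<bar>"] by auto

lemma uexp_eps: "uexp K (\<lambda>\<epsilon> y. \<epsilon>) (\<lambda>y. fps_X)"
  unfolding uexp_def
proof
  fix N
  have a: "Ulev N K (\<lambda>\<epsilon> y. 1) (\<lambda>y. fps_const 1)" for N by (rule Ulev_bounded_const[of K _ 1]) auto
  have "Ulev (Suc N) K (\<lambda>\<epsilon> y. \<epsilon>) (\<lambda>y. fps_X)"
    unfolding Ulev_Suc
  proof
    have "fps_shift 1 (fps_X :: real fps) = fps_const 1" by (rule fps_ext) auto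
    then have "Ulev N K (\<lambda>\<epsilon> y. 1) (\<lambda>y. fps_shift 1 fps_X)" using a by simp
    then show "Ulev N K (\<lambda>\<epsilon> y. (\<epsilon> - fps_X $$ 0) / \<epsilon>) (\<lambda>y. fps_shift 1 fps_X)"
      by (rule Ulev_cong) (use eventually_at_right_0_pos in \<open>auto elim: eventually_mono\<close>)
  qed auto
  then show "Ulev N K (\<lambda>\<epsilon> y. \<epsilon>) (\<lambda>y. fps_X)" by (rule Ulev_Suc_imp)
qed

lemma uexp_minus: "uexp K e c \<Longrightarrow> uexp K (\<lambda>\<epsilon> y. - e \<epsilon> y) (\<lambda>y. - c y)"
  using uexp_mult[OF uexp_const[of K "-1"]] by (simp flip: fps_const_neg)

lemma uexp_diff: "uexp K e c \<Longrightarrow> uexp K f d \<Longrightarrow> uexp K (\<lambda>\<epsilon> y. e \<epsilon> y - f \<epsilon> y) (\<lambda>y. c y - d y)"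
  using uexp_add[of K e c "\<lambda>\<epsilon> y. - f \<epsilon> y" "\<lambda>y. - d y"] uexp_minus[of K f d] by simp

lemma Ulev_reindex:
  assumes "Ulev N K e c" "\<And>y. y \<in> K' \<Longrightarrow> g y \<in> K" shows "Ulev N K' (\<lambda>\<epsilon> y. e \<epsilon> (g y)) (\<lambda>y. c (g y))"
  unfolding Ulev_def
proof (intro conjI allI impI)
  fix i assume "i < N"
  then obtain B where "\<forall>y\<in>K. \<bar>c y $$ i\<bar> \<le> B" using assms(1) unfolding Ulev_def by blast
  then have "\<forall>y\<in>K'. \<bar>c (g y) $$ i\<bar> \<le> B" using assms(2) by blast
  then show "\<exists>B. \<forall>y\<in>K'. \<bar>c (g y) $$ i\<bar> \<le> B" ..
next
  obtain C where "\<forall>\<^sub>F \<epsilon> in at_right 0. \<forall>y\<in>K. \<bar>e \<epsilon> y - (\<Sum>i<N. c y $$ i * \<epsilon> ^ i)\<bar> \<le> C * \<epsilon> ^ N"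
    using assms(1) unfolding Ulev_def by blast
  then have "\<forall>\<^sub>F \<epsilon> in at_right 0. \<forall>y\<in>K'. \<bar>e \<epsilon> (g y) - (\<Sum>i<N. c (g y) $$ i * \<epsilon> ^ i)\<bar> \<le> C * \<epsilon> ^ N"
    by eventually_elim (use assms(2) in blast)
  then show "\<exists>C. \<forall>\<^sub>F \<epsilon> in at_right 0. \<forall>y\<in>K'. \<bar>e \<epsilon> (g y) - (\<Sum>i<N. c (g y) $$ i * \<epsilon> ^ i)\<bar> \<le> C * \<epsilon> ^ N" ..
qed

lemma uexp_reindex:
  assumes "uexp K e c" "\<And>y. y \<in> K' \<Longrightarrow> g y \<in> K" shows "uexp K' (\<lambda>\<epsilon> y. e \<epsilon> (g y)) (\<lambda>y. c (g y))"
  using assms Ulev_reindex[of _ K e c K' g] unfolding uexp_def by blast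

lemma uexpE:
  assumes "uexp K e c"
  obtains C where "\<forall>\<^sub>F \<epsilon> in at_right 0. \<forall>y\<in>K. \<bar>e \<epsilon> y - (\<Sum>i<N. c y $$ i * \<epsilon> ^ i)\<bar> \<le> C * \<epsilon> ^ N"
proof -
  have "Ulev N K e c" using assms by (simp add: uexp_def)
  then show ?thesis using that unfolding Ulev_def by blast
qed

lemma uexp_coeff_bounded:
  assumes "uexp K e c" shows "\<exists>B. \<forall>y\<in>K. \<bar>c y $$ i\<bar> \<le> B"
proof -
  have "Ulev (Suc i) K e c" using assms by (simp add: uexp_def)
  then show ?thesis unfolding Ulev_def by blast
qed

text \<open>Estimates turn into algebra here: a quantity below all powers of \<epsilon> has the zero
  series. If all coefficients below n vanish, then the coefficient n is itself of order
  \<epsilon>.\<close>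

lemma uexp_negligible_imp_0:
  assumes "uexp {y} e c" "\<And>N. \<exists>C. \<forall>\<^sub>F \<epsilon> in at_right 0. \<bar>e \<epsilon> y\<bar> \<le> C * \<epsilon> ^ N"
  shows "c y = 0"
proof (rule fps_ext)
  fix n show "c y $$ n = 0 $$ n"
  proof (induction n rule: less_induct)
    case (less n)
    obtain C where "\<forall>\<^sub>F \<epsilon> in at_right 0. \<forall>y\<in>{y}. \<bar>e \<epsilon> y - (\<Sum>i<Suc n. c y $$ i * \<epsilon> ^ i)\<bar> \<le> C * \<epsilon> ^ Suc n"
      by (rule uexpE[OF assms(1)])
    then have C: "\<forall>\<^sub>F \<epsilon> in at_right 0. \<bar>e \<epsilon> y - (\<Sum>i<Suc n. c y $$ i * \<epsilon> ^ i)\<bar> \<le> C * \<epsilon> ^ Suc n"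
      by (simp only: ball_simps simp_thms)
    obtain C' where C': "\<forall>\<^sub>F \<epsilon> in at_right 0. \<bar>e \<epsilon> y\<bar> \<le> C' * \<epsilon> ^ Suc n" using assms(2) by blast
    have s: "(\<Sum>i<Suc n. c y $$ i * \<epsilon> ^ i) = c y $$ n * \<epsilon> ^ n" for \<epsilon> using less by simp
    have ev: "\<forall>\<^sub>F \<epsilon> in at_right 0. norm (c y $$ n) \<le> (C + C') * \<epsilon>"
      using C C' eventually_at_right_0_pos
    proof eventually_elim
      case (elim \<epsilon>)
      then have "\<bar>c y $$ n * \<epsilon> ^ n\<bar> \<le> C * \<epsilon> ^ Suc n + C' * \<epsilon> ^ Suc n" unfolding s by linarith
      then have "\<bar>c y $$ n\<bar> * \<epsilon> ^ n \<le> ((C + C') * \<epsilon>) * \<epsilon> ^ n" using elim by (simp add: abs_mult algebra_simps)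
      then show ?case using elim by simp
    qed
    have t: "((\<lambda>\<epsilon>::real. (C + C') * \<epsilon>) \<longlongrightarrow> 0) (at_right 0)" by (auto intro!: tendsto_eq_intros)
    have "((\<lambda>\<epsilon>::real. c y $$ n) \<longlongrightarrow> 0) (at_right 0)" by (rule Lim_null_comparison[OF ev t])
    then show ?case by (simp add: tendsto_const_iff)
  qed
qed

lemma uexp_unique:
  assumes "uexp {y} e c" "uexp {y} e d" shows "c y = d y"
proof -
  have "uexp {y} (\<lambda>\<epsilon> y. 0) (\<lambda>y. c y - d y)" using uexp_diff[OF assms] by simp
  from uexp_negligible_imp_0[OF this] have "c y - d y = 0" by (force intro!: exI[of _ 0])
  then show ?thesis by simp
qed

lemma uexp_first_coeff_ge:
  assumes "uexp K e c" "\<forall>\<^sub>F \<epsilon> in at_right 0. \<forall>y\<in>K. e \<epsilon> y \<ge> m" "y \<in> K" shows "c y $$ 0 \<ge> m"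
proof -
  obtain C where "\<forall>\<^sub>F \<epsilon> in at_right 0. \<forall>y\<in>K. \<bar>e \<epsilon> y - (\<Sum>i<Suc 0. c y $$ i * \<epsilon> ^ i)\<bar> \<le> C * \<epsilon> ^ Suc 0"
    by (rule uexpE[OF assms(1)])
  with assms(2) have "\<forall>\<^sub>F \<epsilon> in at_right 0. m - C * \<epsilon> \<le> c y $$ 0"
    by eventually_elim (use assms(3) in force)
  moreover have "((\<lambda>\<epsilon>::real. m - C * \<epsilon>) \<longlongrightarrow> m - C * 0) (at_right 0)" by (intro tendsto_intros)
  ultimately have "m - C * 0 \<le> c y $$ 0" by (intro tendsto_upperbound) auto
  then show ?thesis by simp
qed

subsection \<open>Reciprocal square roots\<close>

text \<open>The reciprocal of the speed is the basic nonpolynomial operation in the geometry of the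
  curve. The relation R R c = 1 is what later arguments work with.\<close>

definition fps_rsqrt :: "real fps \<Rightarrow> real fps" where
  "fps_rsqrt a = inverse (fps_radical root 2 a)"

lemma fps_rsqrt:
  assumes "a $$ 0 > 0"
  shows "fps_rsqrt a * fps_rsqrt a * a = 1" "fps_rsqrt a $$ 0 = 1 / sqrt (a $$ 0)"
proof -
  define r where "r = fps_radical root 2 a"
  have "r ^ 2 = a"
    using power_radical[of a root 1] real_root_pow_pos[of "Suc 1" "a $$ 0"] assms
    by (simp add: r_def numeral_2_eq_2 del: power_Suc)
  then have r: "a = r * r" by (simp add: power2_eq_square)
  have r0: "r $$ 0 = sqrt (a $$ 0)"
    by (simp add: r_def numeral_2_eq_2 sqrt_def)
  then show "fps_rsqrt a $$ 0 = 1 / sqrt (a $$ 0)" by (simp add: fps_rsqrt_def r_def[symmetric] divide_inverse)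
  have "inverse r * r = 1" using r0 assms by (intro inverse_mult_eq_1) simp
  moreover have "inverse r * inverse r * (r * r) = (inverse r * r) * (inverse r * r)" by (simp only: mult_ac)
  ultimately have "inverse r * inverse r * (r * r) = 1" by simp
  then show "fps_rsqrt a * fps_rsqrt a * a = 1" unfolding fps_rsqrt_def r_def[symmetric] r[symmetric] .
qed

text \<open>In the coefficient n of R R c the unknown R_n occurs linearly, with the factor 2 R_0
  c_0, and R_0 R_0 c_0 = 1. The recursion thus expresses R_n polynomially in R_0, the earlier
  coefficients and those of c.\<close>

lemma fps_rsqrt_nth:
  fixes R c :: "real fps"
  assumes R: "R * R * c = 1" and n: "n > 0"
  shows "R $$ n = - (R $$ 0 / 2) * (fps_cutoff n R * fps_cutoff n R * c) $$ n"
proof -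
  let ?A = "fps_cutoff n R" and ?S = "fps_shift n R"
  have split: "R = fps_X ^ n * ?S + ?A" by (rule fps_shift_cutoff'[symmetric])
  have "R * R * c = ?A * ?A * c + fps_X ^ n * (2 * (?S * (?A * c)) + ?S * (fps_X ^ n * (?S * c)))"
    by (subst (1 2) split) (simp add: algebra_simps)
  then have "(R * R * c) $$ n = (?A * ?A * c) $$ n + (2 * (?S * (?A * c)) + ?S * (fps_X ^ n * (?S * c))) $$ 0"
    by (simp only: fps_add_nth fps_X_power_mult_nth) simp
  also have "(2 * (?S * (?A * c)) + ?S * (fps_X ^ n * (?S * c))) $$ 0 = 2 * (R $$ n * (R $$ 0 * c $$ 0))"
    using n by (simp add: fps_X_power_mult_nth fps_numeral_nth_0)
  finally have e: "0 = (?A * ?A * c) $$ n + 2 * (R $$ n * (R $$ 0 * c $$ 0))" using R n by simp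
  have "(R * R * c) $$ 0 = 1" using R by simp
  then have z: "R $$ 0 * R $$ 0 * c $$ 0 = 1" by simp
  have "R $$ n = (R $$ 0 * R $$ 0 * c $$ 0) * R $$ n" using z by simp
  also have "\<dots> = (R $$ 0 / 2) * (2 * (R $$ n * (R $$ 0 * c $$ 0)))" by simp
  also have "2 * (R $$ n * (R $$ 0 * c $$ 0)) = - (?A * ?A * c) $$ n" using e by simp
  finally show ?thesis by simp
qed

text \<open>An abstraction of the two properties that are propagated along this recursion:
  boundedness on a set and differentiability at a point.\<close>

definition alg_closed :: "'y set \<Rightarrow> (('y \<Rightarrow> real) \<Rightarrow> bool) \<Rightarrow> bool" where
  "alg_closed K P \<longleftrightarrow> (\<forall>f g. P f \<longrightarrow> P g \<longrightarrow> P (\<lambda>y. f y + g y)) \<and> (\<forall>f g. P f \<longrightarrow> P g \<longrightarrow> P (\<lambda>y. f y * g y)) \<and>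
     (\<forall>a. P (\<lambda>y. a)) \<and> (\<forall>f g. P f \<longrightarrow> (\<forall>y\<in>K. f y = g y) \<longrightarrow> P g)"

lemma alg_closedD:
  assumes "alg_closed K P"
  shows "P f \<Longrightarrow> P g \<Longrightarrow> P (\<lambda>y. f y + g y)" "P f \<Longrightarrow> P g \<Longrightarrow> P (\<lambda>y. f y * g y)" "P (\<lambda>y. a)"
    "P f \<Longrightarrow> (\<And>y. y \<in> K \<Longrightarrow> f y = g y) \<Longrightarrow> P g"
  using assms unfolding alg_closed_def by auto

lemma alg_closed_sum:
  assumes "alg_closed K P" "finite I" "\<And>i. i \<in> I \<Longrightarrow> P (f i)" shows "P (\<lambda>y. \<Sum>i\<in>I. f i y)"
  using assms(2,3) by (induction I rule: finite_induct) (use assms(1) in \<open>auto simp: alg_closed_def\<close>)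

lemma alg_closed_fps_mult:
  assumes P: "alg_closed K P" and "\<And>i. i \<le> n \<Longrightarrow> P (\<lambda>y. c y $$ i)" "\<And>i. i \<le> n \<Longrightarrow> P (\<lambda>y. d y $$ i)"
  shows "P (\<lambda>y. (c y * d y) $$ n)"
  unfolding fps_mult_nth using assms by (intro alg_closed_sum[OF P]) (auto simp: alg_closed_def)

lemma alg_closed_fps_rsqrt:
  assumes P: "alg_closed K P" and c: "\<And>i. P (\<lambda>y. c y $$ i)" and R: "\<And>y. y \<in> K \<Longrightarrow> R y * R y * c y = 1"
    and R0: "P (\<lambda>y. R y $$ 0)"
  shows "P (\<lambda>y. R y $$ n)"
proof (induction n rule: less_induct)
  case (less n)
  show ?case
  proof (cases "n = 0")
    case False
    have cut: "P (\<lambda>y. fps_cutoff n (R y) $$ i)" for i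
      using less P by (cases "i < n") (auto simp: alg_closed_def)
    have "P (\<lambda>y. (fps_cutoff n (R y) * fps_cutoff n (R y) * c y) $$ n)"
      by (intro alg_closed_fps_mult[OF P] cut c)
    then have "P (\<lambda>y. (- 1 / 2) * R y $$ 0 * (fps_cutoff n (R y) * fps_cutoff n (R y) * c y) $$ n)"
      by (intro alg_closedD(2)[OF P] alg_closedD(3)[OF P] R0)
    then show ?thesis
      by (rule alg_closedD(4)[OF P]) (use fps_rsqrt_nth[OF R] False in simp)
  qed (use R0 in simp)
qed

lemma alg_closed_bounded: "alg_closed K (\<lambda>f. \<exists>B. \<forall>y\<in>K. \<bar>f y\<bar> \<le> B)"
  unfolding alg_closed_def
proof (intro conjI allI impI)
  fix f g :: "'a \<Rightarrow> real" assume "\<exists>B. \<forall>y\<in>K. \<bar>f y\<bar> \<le> B" "\<exists>B. \<forall>y\<in>K. \<bar>g y\<bar> \<le> B"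
  then obtain A B where AB: "\<forall>y\<in>K. \<bar>f y\<bar> \<le> A" "\<forall>y\<in>K. \<bar>g y\<bar> \<le> B" by blast
  then have "\<forall>y\<in>K. \<bar>f y + g y\<bar> \<le> A + B" by (auto intro: order_trans[OF abs_triangle_ineq add_mono])
  then show "\<exists>B. \<forall>y\<in>K. \<bar>f y + g y\<bar> \<le> B" by blast
  have "\<forall>y\<in>K. \<bar>f y * g y\<bar> \<le> \<bar>A\<bar> * \<bar>B\<bar>" using AB by (force simp: abs_mult intro!: mult_mono)
  then show "\<exists>B. \<forall>y\<in>K. \<bar>f y * g y\<bar> \<le> B" by blast
qed (metis order_refl, metis)

text \<open>The truncated series S satisfies S^2 e = 1 up to order \<epsilon>^N, and (1/sqrt e - S)
  sqrt e (1 + S sqrt e) = 1 - S^2 e. For small \<epsilon> the sum S is nonnegative, since its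
  constant coefficient is bounded away from 0, and the cofactor is at least sqrt m.\<close>

lemma uexp_rsqrt:
  assumes e: "uexp K e c" and m: "m > 0" "\<forall>\<^sub>F \<epsilon> in at_right 0. \<forall>y\<in>K. e \<epsilon> y \<ge> m"
  shows "uexp K (\<lambda>\<epsilon> y. 1 / sqrt (e \<epsilon> y)) (\<lambda>y. fps_rsqrt (c y))"
  unfolding uexp_def
proof
  fix N0
  \<comment> \<open>The level has to be positive for the truncation of the series 1 to be 1.\<close>
  define N where "N = Suc N0"
  let ?R = "\<lambda>y. fps_rsqrt (c y)"
  have c0: "c y $$ 0 \<ge> m" if "y \<in> K" for y using uexp_first_coeff_ge[OF e m(2) that] .
  have R: "?R y * ?R y * c y = 1" "?R y $$ 0 = 1 / sqrt (c y $$ 0)" if "y \<in> K" for y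
    using fps_rsqrt[of "c y"] c0[OF that] m by auto
  have cb: "\<exists>B. \<forall>y\<in>K. \<bar>c y $$ i\<bar> \<le> B" for i
    by (rule uexp_coeff_bounded[OF e])
  have R0: "\<forall>y\<in>K. \<bar>?R y $$ 0\<bar> \<le> 1 / sqrt m"
  proof
    fix y assume y: "y \<in> K"
    have "sqrt m \<le> sqrt (c y $$ 0)" "sqrt m > 0" using c0[OF y] m by auto
    then have "1 / sqrt (c y $$ 0) \<le> 1 / sqrt m" by (intro divide_left_mono) auto
    then show "\<bar>?R y $$ 0\<bar> \<le> 1 / sqrt m" using R(2)[OF y] c0[OF y] m by simp
  qed
  have Rb: "\<exists>B. \<forall>y\<in>K. \<bar>?R y $$ n\<bar> \<le> B" for n
    by (rule alg_closed_fps_rsqrt[OF alg_closed_bounded[of K], of c]) (use cb R R0 in auto)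
  obtain B where B: "\<forall>y\<in>K. \<bar>c y $$ 0\<bar> \<le> B" using cb by blast
  define B' where "B' = max B m"
  have B': "B' > 0" "\<And>y. y \<in> K \<Longrightarrow> c y $$ 0 \<le> B'" using B m by (force simp: B'_def)+
  have R0': "?R y $$ 0 \<ge> 1 / sqrt B'" if "y \<in> K" for y
    using R(2)[OF that] B'(2)[OF that] c0[OF that] m B'(1) by (auto intro!: divide_left_mono)
  let ?S = "\<lambda>\<epsilon> y. \<Sum>i<N. ?R y $$ i * \<epsilon> ^ i"
  have S: "Ulev N K ?S ?R" unfolding Ulev_def using Rb by (auto intro!: exI[of _ 0])
  have "Ulev N K (\<lambda>\<epsilon> y. ?S \<epsilon> y * ?S \<epsilon> y * e \<epsilon> y) (\<lambda>y. ?R y * ?R y * c y)"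
    using e unfolding uexp_def by (intro Ulev_mult S) auto
  then have "Ulev N K (\<lambda>\<epsilon> y. ?S \<epsilon> y * ?S \<epsilon> y * e \<epsilon> y) (\<lambda>y. 1)"
    by (rule Ulev_cong) (use R in auto)
  then obtain C where C: "\<forall>\<^sub>F \<epsilon> in at_right 0. \<forall>y\<in>K. \<bar>?S \<epsilon> y * ?S \<epsilon> y * e \<epsilon> y - (\<Sum>i<N. 1 $$ i * \<epsilon> ^ i)\<bar> \<le> C * \<epsilon> ^ N"
    unfolding Ulev_def by blast
  have one: "(\<Sum>i<N. (1 :: real fps) $$ i * \<epsilon> ^ i) = 1" for \<epsilon>
    by (simp add: N_def if_distrib if_distribR sum.delta cong: if_cong)
  have Spos: "\<forall>\<^sub>F \<epsilon> in at_right 0. \<forall>y\<in>K. ?S \<epsilon> y \<ge> 0"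
  proof -
    have "Ulev 1 K ?S ?R"
      using Ulev_le[OF S, of 1] by (simp add: N_def)
    then obtain C1 where C1: "\<forall>\<^sub>F \<epsilon> in at_right 0. \<forall>y\<in>K. \<bar>?S \<epsilon> y - ?R y $$ 0\<bar> \<le> C1 * \<epsilon>"
      unfolding Ulev_def by auto
    have "((\<lambda>\<epsilon>::real. C1 * \<epsilon>) \<longlongrightarrow> C1 * 0) (at_right 0)" by (intro tendsto_intros)
    then have "\<forall>\<^sub>F \<epsilon> in at_right 0. C1 * \<epsilon> < 1 / sqrt B'"
      using B' by (intro order_tendstoD(2)[where y = "C1 * 0"]) auto
    with C1 show ?thesis by eventually_elim (use R0' in force)
  qed
  have "\<forall>\<^sub>F \<epsilon> in at_right 0. \<forall>y\<in>K. \<bar>1 / sqrt (e \<epsilon> y) - ?S \<epsilon> y\<bar> \<le> C / sqrt m * \<epsilon> ^ N"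
    using C Spos m(2)
  proof eventually_elim
    case (elim \<epsilon>)
    show ?case
    proof
      fix y assume y: "y \<in> K"
      define E where "E = e \<epsilon> y"
      define s where "s = ?S \<epsilon> y"
      have E: "E \<ge> m" "s \<ge> 0" "\<bar>s * s * E - 1\<bar> \<le> C * \<epsilon> ^ N"
        using elim y unfolding one E_def s_def by auto
      have sE: "sqrt E > 0" "sqrt E * sqrt E = E" "sqrt E \<ge> sqrt m" using E m by auto
      have "(1 / sqrt E - s) * (sqrt E * (1 + s * sqrt E)) = 1 - s * s * E"
        using sE by (simp add: field_simps)
      then have abs: "\<bar>1 / sqrt E - s\<bar> * \<bar>sqrt E * (1 + s * sqrt E)\<bar> = \<bar>s * s * E - 1\<bar>"
        by (metis abs_minus_commute abs_mult)
      have pos: "1 * sqrt m \<le> (1 + s * sqrt E) * sqrt E" using sE E m by (intro mult_mono) auto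
      have "\<bar>sqrt E * (1 + s * sqrt E)\<bar> = (1 + s * sqrt E) * sqrt E" using sE E by (simp add: mult.commute)
      then have "\<bar>1 / sqrt E - s\<bar> * ((1 + s * sqrt E) * sqrt E) \<le> C * \<epsilon> ^ N"
        using abs E(3) by simp
      moreover have "\<bar>1 / sqrt E - s\<bar> * (1 * sqrt m) \<le> \<bar>1 / sqrt E - s\<bar> * ((1 + s * sqrt E) * sqrt E)"
        by (rule mult_left_mono[OF pos]) simp
      ultimately have "\<bar>1 / sqrt E - s\<bar> * sqrt m \<le> C * \<epsilon> ^ N" by linarith
      then show "\<bar>1 / sqrt (e \<epsilon> y) - ?S \<epsilon> y\<bar> \<le> C / sqrt m * \<epsilon> ^ N"
        using m by (simp add: E_def s_def field_simps)
    qed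
  qed
  then have "Ulev N K (\<lambda>\<epsilon> y. 1 / sqrt (e \<epsilon> y)) ?R" unfolding Ulev_def using Rb by blast
  then show "Ulev N0 K (\<lambda>\<epsilon> y. 1 / sqrt (e \<epsilon> y)) ?R" unfolding N_def by (rule Ulev_Suc_imp)
qed

subsection \<open>Expansions together with derivatives\<close>

definition fDir :: "'a::real_normed_vector \<Rightarrow> ('a \<Rightarrow> real fps) \<Rightarrow> 'a \<Rightarrow> real fps" where
  "fDir v c y = Abs_fps (\<lambda>i. Dir v (\<lambda>y. c y $$ i) y)"

lemma fDir_nth [simp]: "fDir v c y $$ i = Dir v (\<lambda>y. c y $$ i) y"
  by (simp add: fDir_def)

definition fps_diff_at :: "('a::real_normed_vector \<Rightarrow> real fps) \<Rightarrow> 'a \<Rightarrow> bool" where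
  "fps_diff_at c y \<longleftrightarrow> (\<forall>i. (\<lambda>y. c y $$ i) differentiable (at y))"

text \<open>Expansions that may be differentiated n times. The counter gives an induction for the
  closure properties; the functions of interest satisfy the predicate for all n. Remainders are
  controlled on compact sets, whereas the threshold in \<epsilon> for differentiability is common to
  all of S.\<close>

fun Aexp :: "nat \<Rightarrow> 'a::real_normed_vector set \<Rightarrow> (real \<Rightarrow> 'a \<Rightarrow> real) \<Rightarrow> ('a \<Rightarrow> real fps) \<Rightarrow> bool" where
  "Aexp 0 S e c \<longleftrightarrow> (\<forall>K. compact K \<and> K \<subseteq> S \<longrightarrow> uexp K e c)"
| "Aexp (Suc n) S e c \<longleftrightarrow> (\<forall>K. compact K \<and> K \<subseteq> S \<longrightarrow> uexp K e c) \<and>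
     (\<forall>\<^sub>F \<epsilon> in at_right 0. \<forall>y\<in>S. e \<epsilon> differentiable (at y)) \<and> (\<forall>y\<in>S. fps_diff_at c y) \<and>
     (\<forall>v. Aexp n S (\<lambda>\<epsilon>. Dir v (e \<epsilon>)) (fDir v c))"

lemma Aexp_uexp: "Aexp n S e c \<Longrightarrow> compact K \<Longrightarrow> K \<subseteq> S \<Longrightarrow> uexp K e c"
  by (cases n) auto

lemma Aexp_SucD:
  assumes "Aexp (Suc n) S e c"
  shows "\<forall>\<^sub>F \<epsilon> in at_right 0. \<forall>y\<in>S. e \<epsilon> differentiable (at y)" "\<And>y. y \<in> S \<Longrightarrow> fps_diff_at c y"
    "Aexp n S (\<lambda>\<epsilon>. Dir v (e \<epsilon>)) (fDir v c)"
  using assms by auto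

lemma Aexp_Suc_imp: "Aexp (Suc n) S e c \<Longrightarrow> Aexp n S e c"
proof (induction n arbitrary: e c)
  case (Suc n)
  then show ?case using Aexp_SucD[OF Suc.prems] Aexp_uexp[OF Suc.prems] by (auto simp del: Aexp.simps(2) simp add: Aexp.simps(2)[of n])
qed simp

lemma fps_diff_at_cong:
  assumes "fps_diff_at c y" "open S" "y \<in> S" "\<And>x. x \<in> S \<Longrightarrow> c x = d x" shows "fps_diff_at d y"
  unfolding fps_diff_at_def
proof
  fix i
  have "(\<lambda>y. c y $$ i) differentiable (at y)" using assms(1) by (simp add: fps_diff_at_def)
  then show "(\<lambda>y. d y $$ i) differentiable (at y)"
    by (rule differentiable_cong_open[OF _ assms(2,3)]) (simp add: assms(4))
qed

lemma fDir_cong: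
  assumes "open S" "y \<in> S" "\<And>x. x \<in> S \<Longrightarrow> c x = d x" shows "fDir v c y = fDir v d y"
  by (rule fps_ext) (simp add: Dir_cong[OF assms(1,2), of "\<lambda>y. c y $$ i" "\<lambda>y. d y $$ i" for i] assms(3))

lemma Aexp_cong:
  assumes "Aexp n S e c" "open S" "\<forall>\<^sub>F \<epsilon> in at_right 0. \<forall>y\<in>S. e \<epsilon> y = f \<epsilon> y" "\<And>y. y \<in> S \<Longrightarrow> c y = d y"
  shows "Aexp n S f d"
  using assms(1,3,4)
proof (induction n arbitrary: e c f d)
  case 0
  have "uexp K f d" if "compact K" "K \<subseteq> S" for K
    using Aexp_uexp[OF 0(1) that]
    by (rule uexp_cong) (use 0 that in \<open>auto elim!: eventually_mono\<close>)
  then show ?case by simp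
next
  case (Suc n)
  note D = Aexp_SucD[OF Suc.prems(1)]
  have "uexp K f d" if "compact K" "K \<subseteq> S" for K
    using Aexp_uexp[OF Suc.prems(1) that]
    by (rule uexp_cong) (use Suc that in \<open>auto elim!: eventually_mono\<close>)
  moreover have "\<forall>\<^sub>F \<epsilon> in at_right 0. \<forall>y\<in>S. f \<epsilon> differentiable (at y)"
    using D(1) Suc.prems(2)
  proof eventually_elim
    case (elim \<epsilon>)
    then show ?case using differentiable_cong_open[OF _ assms(2), of "e \<epsilon>" _ "f \<epsilon>"] by blast
  qed
  moreover have "\<forall>y\<in>S. fps_diff_at d y"
    using fps_diff_at_cong[OF D(2) assms(2)] Suc.prems(3) by blast
  moreover have "Aexp n S (\<lambda>\<epsilon>. Dir v (f \<epsilon>)) (fDir v d)" for v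
  proof (rule Suc.IH[OF D(3)])
    show "\<forall>\<^sub>F \<epsilon> in at_right 0. \<forall>y\<in>S. Dir v (e \<epsilon>) y = Dir v (f \<epsilon>) y"
      using Suc.prems(2)
    proof eventually_elim
      case (elim \<epsilon>)
      then show ?case using Dir_cong[OF assms(2), of _ "e \<epsilon>" "f \<epsilon>"] by blast
    qed
    show "fDir v c y = fDir v d y" if "y \<in> S" for y using fDir_cong[OF assms(2) that Suc.prems(3)] by simp
  qed
  ultimately show ?case by simp
qed

lemma fps_diff_at_add: "fps_diff_at c y \<Longrightarrow> fps_diff_at d y \<Longrightarrow> fps_diff_at (\<lambda>y. c y + d y) y"
  by (auto simp: fps_diff_at_def intro: differentiable_add)

lemma fDir_add: "fps_diff_at c y \<Longrightarrow> fps_diff_at d y \<Longrightarrow> fDir v (\<lambda>y. c y + d y) y = fDir v c y + fDir v d y"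
  by (rule fps_ext) (simp add: fps_diff_at_def Dir_add)

lemma fps_diff_at_mult: "fps_diff_at c y \<Longrightarrow> fps_diff_at d y \<Longrightarrow> fps_diff_at (\<lambda>y. c y * d y) y"
  unfolding fps_diff_at_def fps_mult_nth by (intro allI differentiable_sum ballI differentiable_mult) auto

lemma fDir_mult:
  assumes "fps_diff_at c y" "fps_diff_at d y"
  shows "fDir v (\<lambda>y. c y * d y) y = c y * fDir v d y + fDir v c y * d y"
proof (rule fps_ext)
  fix n
  have d: "(\<lambda>y. c y $$ i) differentiable (at y)" "(\<lambda>y. d y $$ i) differentiable (at y)" for i
    using assms by (auto simp: fps_diff_at_def)
  have "fDir v (\<lambda>y. c y * d y) y $$ n = Dir v (\<lambda>y. \<Sum>i=0..n. c y $$ i * d y $$ (n - i)) y"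
    by (simp add: fps_mult_nth)
  also have "\<dots> = (\<Sum>i=0..n. Dir v (\<lambda>y. c y $$ i * d y $$ (n - i)) y)"
    by (intro Dir_sum differentiable_mult d) auto
  also have "\<dots> = (\<Sum>i=0..n. c y $$ i * Dir v (\<lambda>y. d y $$ (n - i)) y + Dir v (\<lambda>y. c y $$ i) y * d y $$ (n - i))"
    by (intro sum.cong refl Dir_mult d)
  also have "\<dots> = (c y * fDir v d y + fDir v c y * d y) $$ n"
    by (simp add: fps_mult_nth sum.distrib)
  finally show "fDir v (\<lambda>y. c y * d y) y $$ n = (c y * fDir v d y + fDir v c y * d y) $$ n" .
qed

lemma fDir_const [simp]: "fDir v (\<lambda>y. a) = (\<lambda>y. 0)"
  by (auto simp: fun_eq_iff fps_eq_iff)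

lemma fps_diff_at_const [simp]: "fps_diff_at (\<lambda>y. a) y"
  by (simp add: fps_diff_at_def)

lemma Aexp_const: "Aexp n S (\<lambda>\<epsilon> y. a) (\<lambda>y. fps_const a)"
proof (induction n arbitrary: a)
  case (Suc n)
  show ?case using Suc.IH[of 0] by (simp add: uexp_const)
qed (simp add: uexp_const)

lemma Aexp_add:
  assumes "open S" "Aexp n S e c" "Aexp n S f d" shows "Aexp n S (\<lambda>\<epsilon> y. e \<epsilon> y + f \<epsilon> y) (\<lambda>y. c y + d y)"
  using assms(2,3)
proof (induction n arbitrary: e c f d)
  case (Suc n)
  note D = Aexp_SucD[OF Suc.prems(1)] Aexp_SucD[OF Suc.prems(2)]
  have ev: "\<forall>\<^sub>F \<epsilon> in at_right 0. \<forall>y\<in>S. e \<epsilon> differentiable (at y) \<and> f \<epsilon> differentiable (at y)"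
    using D(1,4) by eventually_elim blast
  have "Aexp n S (\<lambda>\<epsilon>. Dir v (\<lambda>y. e \<epsilon> y + f \<epsilon> y)) (fDir v (\<lambda>y. c y + d y))" for v
    by (rule Aexp_cong[OF Suc.IH[OF D(3) D(6), of v v] assms(1)])
      (use ev D(2,5) in \<open>auto elim!: eventually_mono simp: Dir_add fDir_add\<close>)
  moreover have "\<forall>\<^sub>F \<epsilon> in at_right 0. \<forall>y\<in>S. (\<lambda>y. e \<epsilon> y + f \<epsilon> y) differentiable (at y)"
    using ev by eventually_elim auto
  ultimately show ?case
    using Suc.prems[THEN Aexp_uexp] D(2,5) by (auto intro!: uexp_add fps_diff_at_add)
qed (auto intro: uexp_add)

lemma Aexp_mult:
  assumes "open S" "Aexp n S e c" "Aexp n S f d" shows "Aexp n S (\<lambda>\<epsilon> y. e \<epsilon> y * f \<epsilon> y) (\<lambda>y. c y * d y)"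
  using assms(2,3)
proof (induction n arbitrary: e c f d)
  case (Suc n)
  note D = Aexp_SucD[OF Suc.prems(1)] Aexp_SucD[OF Suc.prems(2)]
  have ev: "\<forall>\<^sub>F \<epsilon> in at_right 0. \<forall>y\<in>S. e \<epsilon> differentiable (at y) \<and> f \<epsilon> differentiable (at y)"
    using D(1,4) by eventually_elim blast
  have "Aexp n S (\<lambda>\<epsilon>. Dir v (\<lambda>y. e \<epsilon> y * f \<epsilon> y)) (fDir v (\<lambda>y. c y * d y))" for v
    by (rule Aexp_cong[OF Aexp_add[OF assms(1) Suc.IH[OF Aexp_Suc_imp[OF Suc.prems(1)] D(6)[of v]]
            Suc.IH[OF D(3)[of v] Aexp_Suc_imp[OF Suc.prems(2)]]] assms(1)])
      (use ev D(2,5) in \<open>auto elim!: eventually_mono simp: Dir_mult fDir_mult\<close>)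
  moreover have "\<forall>\<^sub>F \<epsilon> in at_right 0. \<forall>y\<in>S. (\<lambda>y. e \<epsilon> y * f \<epsilon> y) differentiable (at y)"
    using ev by eventually_elim auto
  ultimately show ?case
    using Suc.prems[THEN Aexp_uexp] D(2,5) by (auto intro!: uexp_mult fps_diff_at_mult)
qed (auto intro: uexp_mult)

lemma Aexp_minus:
  assumes "open S" "Aexp n S e c" shows "Aexp n S (\<lambda>\<epsilon> y. - e \<epsilon> y) (\<lambda>y. - c y)"
  using Aexp_mult[OF assms(1) Aexp_const[of n S "-1"] assms(2)] by (simp flip: fps_const_neg)

lemma Aexp_diff:
  assumes "open S" "Aexp n S e c" "Aexp n S f d" shows "Aexp n S (\<lambda>\<epsilon> y. e \<epsilon> y - f \<epsilon> y) (\<lambda>y. c y - d y)"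
  using Aexp_add[OF assms(1,2) Aexp_minus[OF assms(1,3)]] by simp

lemma rsqrt_Dir:
  fixes f :: "'a::real_normed_vector \<Rightarrow> real"
  assumes "f differentiable (at y)" "f y > 0"
  shows "(\<lambda>y. 1 / sqrt (f y)) differentiable (at y)"
    "Dir v (\<lambda>y. 1 / sqrt (f y)) y = - (1/2) * (Dir v f y * (1 / sqrt (f y)) * (1 / sqrt (f y)) * (1 / sqrt (f y)))"
proof -
  have "((\<lambda>x. 1 / sqrt x) has_real_derivative - (1/2) * (1 / sqrt (f y)) * (1 / sqrt (f y)) * (1 / sqrt (f y))) (at (f y))"
    using assms(2) by (auto intro!: derivative_eq_intros simp: field_simps)
  then have "((\<lambda>y. 1 / sqrt (f y)) has_derivative
     (\<lambda>v. (- (1/2) * (1 / sqrt (f y)) * (1 / sqrt (f y)) * (1 / sqrt (f y))) * Dir v f y)) (at y)"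
    using has_derivative_compose[OF has_derivative_Dir[OF assms(1)]] unfolding has_field_derivative_def by blast
  from differentiableI[OF this] Dir_eqI[OF this]
  show "(\<lambda>y. 1 / sqrt (f y)) differentiable (at y)"
    "Dir v (\<lambda>y. 1 / sqrt (f y)) y = - (1/2) * (Dir v f y * (1 / sqrt (f y)) * (1 / sqrt (f y)) * (1 / sqrt (f y)))"
    by (auto simp: mult_ac)
qed

text \<open>Differentiability of the coefficients comes from their recursion. The formula results
  from differentiating R R c = 1 by the Leibniz rule and multiplying by R.\<close>

lemma fps_rsqrt_Dir:
  assumes S: "open S" "y \<in> S" and c: "\<And>y. y \<in> S \<Longrightarrow> fps_diff_at c y" "\<And>y. y \<in> S \<Longrightarrow> c y $$ 0 > 0"
  shows "fps_diff_at (\<lambda>y. fps_rsqrt (c y)) y"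
    "fDir v (\<lambda>y. fps_rsqrt (c y)) y
       = fps_const (- (1/2)) * (fDir v c y * fps_rsqrt (c y) * fps_rsqrt (c y) * fps_rsqrt (c y))"
proof -
  let ?R = "\<lambda>y. fps_rsqrt (c y)"
  have cl: "alg_closed S (\<lambda>f. f differentiable (at y))"
    unfolding alg_closed_def using differentiable_cong_open[OF _ S] by auto
  have R: "?R x * ?R x * c x = 1" "?R x $$ 0 = 1 / sqrt (c x $$ 0)" if "x \<in> S" for x
    using fps_rsqrt c(2)[OF that] by auto
  have R0: "(\<lambda>x. ?R x $$ 0) differentiable (at y)"
  proof (rule differentiable_cong_open[OF rsqrt_Dir(1) S])
    show "(\<lambda>y. c y $$ 0) differentiable (at y)" "c y $$ 0 > 0" using c S by (auto simp: fps_diff_at_def)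
  qed (simp add: R)
  have "(\<lambda>x. ?R x $$ n) differentiable (at y)" for n
  proof (rule alg_closed_fps_rsqrt[where P = "\<lambda>f. f differentiable (at y)" and K = S and c = c])
    show "(\<lambda>y. c y $$ i) differentiable (at y)" for i using c(1)[OF S(2)] by (simp add: fps_diff_at_def)
  qed (fact cl R(1) R0)+
  then show Rd: "fps_diff_at ?R y" by (simp add: fps_diff_at_def)
  have cd: "fps_diff_at c y" using c S by blast
  have "fDir v (\<lambda>y. ?R y * ?R y * c y) y = fDir v (\<lambda>y. 1) y"
    by (rule fDir_cong[OF S]) (simp add: R)
  then have X: "?R y * ?R y * fDir v c y + (?R y * fDir v ?R y + fDir v ?R y * ?R y) * c y = 0"
    using Rd cd by (simp add: fDir_mult fps_diff_at_mult)
  \<comment> \<open>This polynomial identity isolates the two relations that are known, the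
    differentiated one and R R c = 1.\<close>
  have gen: "f * r * r * r + 2 * g = r * (r * r * f + (r * g + g * r) * x) + 2 * g * (1 - r * r * x)"
    for f g r x :: "real fps" by (simp add: algebra_simps)
  have e: "fDir v c y * ?R y * ?R y * ?R y + 2 * fDir v ?R y = 0"
    unfolding gen[of "fDir v c y" "?R y" "fDir v ?R y" "c y"] X R(1)[OF S(2)] by simp
  have h: "fps_const (- (1/2)) * 2 = (-1 :: real fps)" by (simp add: numeral_fps_const flip: fps_const_neg)
  have "fps_const (- (1/2)) * (fDir v c y * ?R y * ?R y * ?R y + 2 * fDir v ?R y)
      = fps_const (- (1/2)) * (fDir v c y * ?R y * ?R y * ?R y) + (fps_const (- (1/2)) * 2) * fDir v ?R y"
    by (simp only: distrib_left mult.assoc)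
  then show "fDir v ?R y = fps_const (- (1/2)) * (fDir v c y * ?R y * ?R y * ?R y)" unfolding e h by simp
qed

text \<open>The derivative is a product of \<open>Dir v (e \<epsilon>)\<close> with copies of the
  function itself, so level n for the function gives level n for its derivatives, which is level n +
  1.\<close>

lemma Aexp_rsqrt:
  assumes S: "open S" and e: "Aexp n S e c" and m: "m > 0" "\<forall>\<^sub>F \<epsilon> in at_right 0. \<forall>y\<in>S. e \<epsilon> y \<ge> m"
  shows "Aexp n S (\<lambda>\<epsilon> y. 1 / sqrt (e \<epsilon> y)) (\<lambda>y. fps_rsqrt (c y))"
  using e
proof (induction n)
  case 0
  have "uexp K (\<lambda>\<epsilon> y. 1 / sqrt (e \<epsilon> y)) (\<lambda>y. fps_rsqrt (c y))" if "compact K" "K \<subseteq> S" for K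
    using m(2) that by (intro uexp_rsqrt[OF Aexp_uexp[OF 0 that] m(1)]) (auto elim!: eventually_mono)
  then show ?case by simp
next
  case (Suc n)
  note D = Aexp_SucD[OF Suc.prems]
  have u: "uexp K (\<lambda>\<epsilon> y. 1 / sqrt (e \<epsilon> y)) (\<lambda>y. fps_rsqrt (c y))" if "compact K" "K \<subseteq> S" for K
    using m(2) that by (intro uexp_rsqrt[OF Aexp_uexp[OF Suc.prems that] m(1)]) (auto elim!: eventually_mono)
  have c0: "c y $$ 0 > 0" if "y \<in> S" for y
  proof -
    have "c y $$ 0 \<ge> m"
      by (rule uexp_first_coeff_ge[OF Aexp_uexp[OF Suc.prems, of "{y}"]]) (use m(2) that in \<open>auto elim!: eventually_mono\<close>)
    then show ?thesis using m by simp
  qed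
  have ev: "\<forall>\<^sub>F \<epsilon> in at_right 0. \<forall>y\<in>S. e \<epsilon> differentiable (at y) \<and> e \<epsilon> y > 0"
    using D(1) m(2) by eventually_elim (use m(1) in force)
  let ?r = "\<lambda>\<epsilon> y. 1 / sqrt (e \<epsilon> y)" and ?R = "\<lambda>y. fps_rsqrt (c y)"
  have r: "Aexp n S ?r ?R" by (rule Suc.IH[OF Aexp_Suc_imp[OF Suc.prems]])
  have "Aexp n S (\<lambda>\<epsilon> y. - (1/2) * (Dir v (e \<epsilon>) y * ?r \<epsilon> y * ?r \<epsilon> y * ?r \<epsilon> y))
    (\<lambda>y. fps_const (- (1/2)) * (fDir v c y * ?R y * ?R y * ?R y))" for v
    by (intro Aexp_mult[OF S] Aexp_const D(3) r)
  then have "Aexp n S (\<lambda>\<epsilon>. Dir v (?r \<epsilon>)) (fDir v ?R)" for v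
    by (rule Aexp_cong[OF _ S])
      (use ev D(2) c0 in \<open>auto elim!: eventually_mono simp only: rsqrt_Dir(2) fps_rsqrt_Dir(2)[OF S]\<close>)
  moreover have "\<forall>\<^sub>F \<epsilon> in at_right 0. \<forall>y\<in>S. ?r \<epsilon> differentiable (at y)"
    using ev by eventually_elim (use rsqrt_Dir(1) in blast)
  ultimately show ?case using u fps_rsqrt_Dir(1)[OF S _ D(2) c0] by simp
qed

text \<open>All iterated derivatives of the remainder are controlled by definition; appending the
  direction \<open>v\<close> to the list turns a remainder of f into one of its derivative.\<close>

lemma asymp_expansion_Dir:
  assumes S: "open S" and a: "asymp_expansion S f c"
  shows "asymp_expansion S (\<lambda>\<epsilon>. Dir v (f \<epsilon>)) (\<lambda>i. Dir v (c i))"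
  unfolding asymp_expansion_def
proof (intro conjI allI impI)
  have cs: "smooth_on S (c i)" for i using a unfolding asymp_expansion_def by blast
  then show "smooth_on S (Dir v (c i))" for i by (rule smooth_on_Dir)
  have ev: "\<forall>\<^sub>F \<epsilon> in at_right 0. smooth_on S (f \<epsilon>)" using a unfolding asymp_expansion_def by blast
  then show "\<forall>\<^sub>F \<epsilon> in at_right 0. smooth_on S (Dir v (f \<epsilon>))" by eventually_elim (rule smooth_on_Dir)
  fix N vs K assume K: "compact K \<and> K \<subseteq> S"
  then obtain C where "\<forall>\<^sub>F \<epsilon> in at_right 0. \<forall>y\<in>K.
      norm (dderivs (vs @ [v]) (\<lambda>y. f \<epsilon> y - (\<Sum>i\<le>N. \<epsilon> ^ i *\<^sub>R c i y)) y) \<le> C * \<epsilon> ^ (N + 1)"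
    using a unfolding asymp_expansion_def by blast
  then have "\<forall>\<^sub>F \<epsilon> in at_right 0. \<forall>y\<in>K.
      norm (dderivs vs (\<lambda>y. Dir v (f \<epsilon>) y - (\<Sum>i\<le>N. \<epsilon> ^ i *\<^sub>R Dir v (c i) y)) y) \<le> C * \<epsilon> ^ (N + 1)"
    using ev
  proof eventually_elim
    case (elim \<epsilon>)
    have eq: "Dir v (\<lambda>y. f \<epsilon> y - (\<Sum>i\<le>N. \<epsilon> ^ i *\<^sub>R c i y)) x = Dir v (f \<epsilon>) x - (\<Sum>i\<le>N. \<epsilon> ^ i *\<^sub>R Dir v (c i) x)"
      if "x \<in> S" for x
    proof -
      have d: "f \<epsilon> differentiable (at x)" "c i differentiable (at x)" for i
        using elim(2) cs that by (auto intro: smooth_on_differentiable)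
      have d': "(\<lambda>x. \<epsilon> ^ i *\<^sub>R c i x) differentiable (at x)" for i
        using differentiable_bounded_linear[OF bounded_linear_scaleR_right d(2)] .
      have "Dir v (\<lambda>y. f \<epsilon> y - (\<Sum>i\<le>N. \<epsilon> ^ i *\<^sub>R c i y)) x = Dir v (f \<epsilon>) x - Dir v (\<lambda>y. \<Sum>i\<le>N. \<epsilon> ^ i *\<^sub>R c i y) x"
        using d d' by (intro Dir_diff differentiable_sum) auto
      also have "Dir v (\<lambda>y. \<Sum>i\<le>N. \<epsilon> ^ i *\<^sub>R c i y) x = (\<Sum>i\<le>N. \<epsilon> ^ i *\<^sub>R Dir v (c i) x)"
        using d d' by (subst Dir_sum) (auto simp: Dir_scaleR)
      finally show ?thesis .
    qed
    show ?case
    proof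
      fix y assume y: "y \<in> K"
      have "dderivs (vs @ [v]) (\<lambda>y. f \<epsilon> y - (\<Sum>i\<le>N. \<epsilon> ^ i *\<^sub>R c i y)) y
         = dderivs vs (\<lambda>y. Dir v (f \<epsilon>) y - (\<Sum>i\<le>N. \<epsilon> ^ i *\<^sub>R Dir v (c i) y)) y"
        unfolding dderivs_append using K y by (intro dderivs_cong[OF S eq]) auto
      then show "norm (dderivs vs (\<lambda>y. Dir v (f \<epsilon>) y - (\<Sum>i\<le>N. \<epsilon> ^ i *\<^sub>R Dir v (c i) y)) y) \<le> C * \<epsilon> ^ (N + 1)"
        using bspec[OF elim(1) y] by (simp only:)
    qed
  qed
  then show "\<exists>C. \<forall>\<^sub>F \<epsilon> in at_right 0. \<forall>y\<in>K.
      norm (dderivs vs (\<lambda>y. Dir v (f \<epsilon>) y - (\<Sum>i\<le>N. \<epsilon> ^ i *\<^sub>R Dir v (c i) y)) y) \<le> C * \<epsilon> ^ (N + 1)" by blast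
qed

lemma asymp_expansion_uexp:
  fixes h :: "'b::real_normed_vector \<Rightarrow> real"
  assumes a: "asymp_expansion S f c" and h: "bounded_linear h" and K: "compact K" "K \<subseteq> S"
  shows "uexp K (\<lambda>\<epsilon> y. h (f \<epsilon> y)) (\<lambda>y. Abs_fps (\<lambda>i. h (c i y)))"
  unfolding uexp_def
proof
  fix N
  have "Ulev (Suc N) K (\<lambda>\<epsilon> y. h (f \<epsilon> y)) (\<lambda>y. Abs_fps (\<lambda>i. h (c i y)))"
    unfolding Ulev_def
  proof (intro conjI allI impI)
    fix i
    have "smooth_on S (c i)" using a unfolding asymp_expansion_def by blast
    then have "continuous_on K (c i)"
      using K by (intro continuous_at_imp_continuous_on ballI differentiable_imp_continuous_within)
        (auto intro: smooth_on_differentiable)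
    then have "continuous_on K (\<lambda>y. h (c i y))" by (rule bounded_linear.continuous_on[OF h])
    then have "bounded ((\<lambda>y. h (c i y)) ` K)" using K by (intro compact_imp_bounded compact_continuous_image)
    then show "\<exists>B. \<forall>y\<in>K. \<bar>Abs_fps (\<lambda>i. h (c i y)) $$ i\<bar> \<le> B" by (auto simp: bounded_iff)
  next
    have "\<exists>C. \<forall>\<^sub>F \<epsilon> in at_right 0. \<forall>y\<in>K. norm (dderivs [] (\<lambda>y. f \<epsilon> y - (\<Sum>i\<le>N. \<epsilon> ^ i *\<^sub>R c i y)) y) \<le> C * \<epsilon> ^ (N + 1)"
      using a K unfolding asymp_expansion_def by blast
    then obtain C where C: "\<forall>\<^sub>F \<epsilon> in at_right 0. \<forall>y\<in>K. norm (f \<epsilon> y - (\<Sum>i\<le>N. \<epsilon> ^ i *\<^sub>R c i y)) \<le> C * \<epsilon> ^ (N + 1)" by auto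
    obtain B where B: "B > 0" "\<And>x. \<bar>h x\<bar> \<le> norm x * B" using bounded_linear.pos_bounded[OF h] by auto
    from C have "\<forall>\<^sub>F \<epsilon> in at_right 0. \<forall>y\<in>K. \<bar>h (f \<epsilon> y) - (\<Sum>i<Suc N. Abs_fps (\<lambda>i. h (c i y)) $$ i * \<epsilon> ^ i)\<bar> \<le> (C * B) * \<epsilon> ^ Suc N"
    proof eventually_elim
      case (elim \<epsilon>)
      interpret bounded_linear h by (rule h)
      show ?case
      proof
        fix y assume "y \<in> K"
        then have "norm (f \<epsilon> y - (\<Sum>i\<le>N. \<epsilon> ^ i *\<^sub>R c i y)) * B \<le> C * \<epsilon> ^ (N + 1) * B" using elim B by (intro mult_right_mono) auto
        moreover have "h (f \<epsilon> y) - (\<Sum>i<Suc N. Abs_fps (\<lambda>i. h (c i y)) $$ i * \<epsilon> ^ i) = h (f \<epsilon> y - (\<Sum>i\<le>N. \<epsilon> ^ i *\<^sub>R c i y))"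
          by (simp add: diff sum scaleR lessThan_Suc_atMost mult.commute del: sum.lessThan_Suc)
        ultimately show "\<bar>h (f \<epsilon> y) - (\<Sum>i<Suc N. Abs_fps (\<lambda>i. h (c i y)) $$ i * \<epsilon> ^ i)\<bar> \<le> (C * B) * \<epsilon> ^ Suc N"
          using B(2)[of "f \<epsilon> y - (\<Sum>i\<le>N. \<epsilon> ^ i *\<^sub>R c i y)"] by (simp add: mult_ac)
      qed
    qed
    then show "\<exists>C. \<forall>\<^sub>F \<epsilon> in at_right 0. \<forall>y\<in>K. \<bar>h (f \<epsilon> y) - (\<Sum>i<Suc N. Abs_fps (\<lambda>i. h (c i y)) $$ i * \<epsilon> ^ i)\<bar> \<le> C * \<epsilon> ^ Suc N"
      by blast
  qed
  then show "Ulev N K (\<lambda>\<epsilon> y. h (f \<epsilon> y)) (\<lambda>y. Abs_fps (\<lambda>i. h (c i y)))" by (rule Ulev_Suc_imp)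
qed

text \<open>The map \<open>h\<close> is meant as a coordinate projection: vector valued expansions
  are reduced to scalar ones, where products are available.\<close>

lemma asymp_expansion_Aexp:
  fixes h :: "'b::real_normed_vector \<Rightarrow> real"
  assumes S: "open S" and a: "asymp_expansion S f c" and h: "bounded_linear h"
  shows "Aexp n S (\<lambda>\<epsilon> y. h (f \<epsilon> y)) (\<lambda>y. Abs_fps (\<lambda>i. h (c i y)))"
  using a
proof (induction n arbitrary: f c)
  case 0
  have "uexp K (\<lambda>\<epsilon> y. h (f \<epsilon> y)) (\<lambda>y. Abs_fps (\<lambda>i. h (c i y)))" if "compact K" "K \<subseteq> S" for K
    by (rule asymp_expansion_uexp[OF 0 h that])
  then show ?case by simp
next
  case (Suc n)
  have ev: "\<forall>\<^sub>F \<epsilon> in at_right 0. \<forall>y\<in>S. f \<epsilon> differentiable (at y)"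
  proof -
    have "\<forall>\<^sub>F \<epsilon> in at_right 0. smooth_on S (f \<epsilon>)" using Suc.prems unfolding asymp_expansion_def by blast
    then show ?thesis by eventually_elim (use smooth_on_differentiable in blast)
  qed
  have cd: "c i differentiable (at y)" if "y \<in> S" for i y
    using Suc.prems that smooth_on_differentiable unfolding asymp_expansion_def by blast
  have "Aexp n S (\<lambda>\<epsilon>. Dir v (\<lambda>y. h (f \<epsilon> y))) (fDir v (\<lambda>y. Abs_fps (\<lambda>i. h (c i y))))" for v
  proof (rule Aexp_cong[OF Suc.IH[OF asymp_expansion_Dir[OF S Suc.prems, of v]] S])
    show "\<forall>\<^sub>F \<epsilon> in at_right 0. \<forall>y\<in>S. h (Dir v (f \<epsilon>) y) = Dir v (\<lambda>y. h (f \<epsilon> y)) y"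
      using ev by eventually_elim (simp add: Dir_bounded_linear[OF h])
    show "Abs_fps (\<lambda>i. h (Dir v (c i) y)) = fDir v (\<lambda>y. Abs_fps (\<lambda>i. h (c i y))) y" if "y \<in> S" for y
      by (rule fps_ext) (simp add: Dir_bounded_linear[OF h cd[OF that]])
  qed
  moreover have "\<forall>\<^sub>F \<epsilon> in at_right 0. \<forall>y\<in>S. (\<lambda>y. h (f \<epsilon> y)) differentiable (at y)"
    using ev by eventually_elim (use differentiable_bounded_linear[OF h] in blast)
  moreover have "fps_diff_at (\<lambda>y. Abs_fps (\<lambda>i. h (c i y))) y" if "y \<in> S" for y
    using differentiable_bounded_linear[OF h cd[OF that]] by (simp add: fps_diff_at_def)
  ultimately show ?case using asymp_expansion_uexp[OF Suc.prems h] by simp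
qed

section \<open>Geometry of the moving curve\<close>

abbreviation dT :: "(real \<times> real \<Rightarrow> real) \<Rightarrow> real \<times> real \<Rightarrow> real" where "dT \<equiv> Dir (1, 0)"
abbreviation dS :: "(real \<times> real \<Rightarrow> real) \<Rightarrow> real \<times> real \<Rightarrow> real" where "dS \<equiv> Dir (0, 1)"

definition C3 :: "(real \<times> real) set \<Rightarrow> (real \<times> real \<Rightarrow> real) \<Rightarrow> bool" where
  "C3 S f \<longleftrightarrow> (\<forall>y\<in>S. f differentiable (at y) \<and> dT f differentiable (at y) \<and> dS f differentiable (at y) \<and>
     dT (dT f) differentiable (at y) \<and> dT (dS f) differentiable (at y) \<and>
     dS (dT f) differentiable (at y) \<and> dS (dS f) differentiable (at y))"

lemma C3D:
  assumes "C3 S f" "y \<in> S"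
  shows "f differentiable (at y)" "dT f differentiable (at y)" "dS f differentiable (at y)"
    "dT (dS f) differentiable (at y)" "dS (dT f) differentiable (at y)" "dS (dS f) differentiable (at y)"
  using assms by (auto simp: C3_def)

lemma Aexp_C3:
  assumes "Aexp 3 S e c" shows "\<forall>\<^sub>F \<epsilon> in at_right 0. C3 S (e \<epsilon>)"
proof -
  have a: "Aexp (Suc (Suc (Suc 0))) S e c" using assms by (simp only: numeral_3_eq_3)
  note 1 = Aexp_SucD(3)[OF a]
  note 2 = Aexp_SucD(3)[OF 1]
  show ?thesis
    unfolding C3_def
    using Aexp_SucD(1)[OF a] Aexp_SucD(1)[OF 1[of "(1,0)"]] Aexp_SucD(1)[OF 1[of "(0,1)"]]
      Aexp_SucD(1)[OF 2[of "(1,0)" "(1,0)"]] Aexp_SucD(1)[OF 2[of "(1,0)" "(0,1)"]]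
      Aexp_SucD(1)[OF 2[of "(0,1)" "(1,0)"]] Aexp_SucD(1)[OF 2[of "(0,1)" "(0,1)"]]
    by eventually_elim blast
qed

lemma C3_commute: "C3 S f \<Longrightarrow> open S \<Longrightarrow> y \<in> S \<Longrightarrow> dT (dS f) y = dS (dT f) y"
  by (rule Dir_commute[of S]) (auto dest: C3D intro: differentiable_imp_continuous_within)

text \<open>The geometric quantities are polynomials in the derivatives of the parametrization and
  this one reciprocal. Every other quotient is written as a product with it, so that each quantity
  inherits an expansion from the curve.\<close>

definition g_rho :: "(real \<times> real \<Rightarrow> real) \<Rightarrow> (real \<times> real \<Rightarrow> real) \<Rightarrow> real \<times> real \<Rightarrow> real" where
  "g_rho X Y y = 1 / sqrt (dS X y * dS X y + dS Y y * dS Y y)"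
definition g_sig :: "(real \<times> real \<Rightarrow> real) \<Rightarrow> (real \<times> real \<Rightarrow> real) \<Rightarrow> real \<times> real \<Rightarrow> real" where
  "g_sig X Y y = (dS X y * dS X y + dS Y y * dS Y y) * g_rho X Y y"
definition g_t1 :: "(real \<times> real \<Rightarrow> real) \<Rightarrow> (real \<times> real \<Rightarrow> real) \<Rightarrow> real \<times> real \<Rightarrow> real" where
  "g_t1 X Y y = dS X y * g_rho X Y y"
definition g_t2 :: "(real \<times> real \<Rightarrow> real) \<Rightarrow> (real \<times> real \<Rightarrow> real) \<Rightarrow> real \<times> real \<Rightarrow> real" where
  "g_t2 X Y y = dS Y y * g_rho X Y y"
definition g_kap :: "(real \<times> real \<Rightarrow> real) \<Rightarrow> (real \<times> real \<Rightarrow> real) \<Rightarrow> real \<times> real \<Rightarrow> real" where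
  "g_kap X Y y = (dS X y * dS (dS Y) y - dS Y y * dS (dS X) y) * (g_rho X Y y * g_rho X Y y * g_rho X Y y)"
definition g_vel :: "(real \<times> real \<Rightarrow> real) \<Rightarrow> (real \<times> real \<Rightarrow> real) \<Rightarrow> real \<times> real \<Rightarrow> real" where
  "g_vel X Y y = dT X y * g_t2 X Y y - dT Y y * g_t1 X Y y"
definition g_tau :: "(real \<times> real \<Rightarrow> real) \<Rightarrow> (real \<times> real \<Rightarrow> real) \<Rightarrow> real \<times> real \<Rightarrow> real" where
  "g_tau X Y y = dT X y * g_t1 X Y y + dT Y y * g_t2 X Y y"
definition g_rot :: "(real \<times> real \<Rightarrow> real) \<Rightarrow> (real \<times> real \<Rightarrow> real) \<Rightarrow> real \<times> real \<Rightarrow> real" where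
  "g_rot X Y y = g_t2 X Y y * dT (g_t1 X Y) y - g_t1 X Y y * dT (g_t2 X Y) y"

text \<open>Here \<open>t\<close>, \<open>\<sigma>\<close>, \<open>\<kappa>\<close>, \<open>V\<close> and \<open>\<tau>\<close> are the unit tangent, the speed, the curvature and the
  normal and tangential velocities, and \<open>\<theta>\<close> is defined by \<open>\<partial>\<^sub>T t = \<theta> n\<close>, where the outward normal
  is \<open>n = (t\<^sub>2, - t\<^sub>1)\<close>.\<close>

locale moving_frame =
  fixes S :: "(real \<times> real) set" and X Y :: "real \<times> real \<Rightarrow> real"
  assumes S: "open S"
    and reg: "C3 S X" "C3 S Y" "C3 S (g_sig X Y)" "C3 S (g_t1 X Y)" "C3 S (g_t2 X Y)" "C3 S (g_kap X Y)"
      "C3 S (g_vel X Y)" "C3 S (g_tau X Y)" "C3 S (g_rot X Y)"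
    and immersed: "\<And>y. y \<in> S \<Longrightarrow> dS X y * dS X y + dS Y y * dS Y y > 0"
begin

abbreviation "\<sigma> \<equiv> g_sig X Y"
abbreviation "\<rho> \<equiv> g_rho X Y"
abbreviation "t1 \<equiv> g_t1 X Y"
abbreviation "t2 \<equiv> g_t2 X Y"
abbreviation "\<kappa> \<equiv> g_kap X Y"
abbreviation "V \<equiv> g_vel X Y"
abbreviation "\<tau> \<equiv> g_tau X Y"
abbreviation "\<theta> \<equiv> g_rot X Y"

lemma rho_sigma:
  assumes "y \<in> S"
  shows "\<rho> y * \<sigma> y = 1" "\<sigma> y > 0" "dS X y = \<sigma> y * t1 y" "dS Y y = \<sigma> y * t2 y" "t1 y * t1 y + t2 y * t2 y = 1"
proof -
  define a where "a = dS X y * dS X y + dS Y y * dS Y y"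
  have a: "a > 0" using immersed[OF assms] by (simp add: a_def)
  have r: "\<rho> y = 1 / sqrt a" by (simp add: g_rho_def a_def)
  have rr: "\<rho> y * \<rho> y * a = 1" using a by (simp add: r)
  show s: "\<rho> y * \<sigma> y = 1" using rr by (simp add: g_sig_def a_def mult_ac)
  have "\<rho> y > 0" using a by (simp add: r)
  with s show "\<sigma> y > 0" by (metis zero_less_mult_pos zero_less_one)
  show "dS X y = \<sigma> y * t1 y" "dS Y y = \<sigma> y * t2 y" using s by (simp_all add: g_t1_def g_t2_def mult_ac)
  show "t1 y * t1 y + t2 y * t2 y = 1" using rr by (simp add: g_t1_def g_t2_def a_def algebra_simps)
qed

lemmas diffs = reg[THEN C3D(1)] reg[THEN C3D(2)] reg[THEN C3D(3)] reg[THEN C3D(4)] reg[THEN C3D(5)] reg[THEN C3D(6)]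

lemma rho_eq: "y \<in> S \<Longrightarrow> \<rho> y = 1 / \<sigma> y"
  using rho_sigma(1,2)[of y] by (simp add: field_simps)

lemma tangent_orth:
  assumes "y \<in> S" "v = (1, 0) \<or> v = (0, 1)"
  shows "t1 y * Dir v t1 y + t2 y * Dir v t2 y = 0"
proof -
  have "Dir v (\<lambda>y. t1 y * t1 y + t2 y * t2 y) y = Dir v (\<lambda>y. 1) y"
    by (rule Dir_cong[OF S assms(1)]) (rule rho_sigma)
  then have "(t1 y * Dir v t1 y + Dir v t1 y * t1 y) + (t2 y * Dir v t2 y + Dir v t2 y * t2 y) = 0"
    using assms(1) by (simp add: Dir_add Dir_mult diffs)
  then show ?thesis by (simp add: algebra_simps)
qed

lemma second_derivs:
  assumes "y \<in> S"
  shows "dS (dS X) y = \<sigma> y * dS t1 y + dS \<sigma> y * t1 y" "dS (dS Y) y = \<sigma> y * dS t2 y + dS \<sigma> y * t2 y"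
    "dT (dS X) y = \<sigma> y * dT t1 y + dT \<sigma> y * t1 y" "dT (dS Y) y = \<sigma> y * dT t2 y + dT \<sigma> y * t2 y"
proof -
  have "Dir v (dS X) y = Dir v (\<lambda>y. \<sigma> y * t1 y) y" "Dir v (dS Y) y = Dir v (\<lambda>y. \<sigma> y * t2 y) y" for v
    by (rule Dir_cong[OF S assms], simp add: rho_sigma)+
  then show "dS (dS X) y = \<sigma> y * dS t1 y + dS \<sigma> y * t1 y" "dS (dS Y) y = \<sigma> y * dS t2 y + dS \<sigma> y * t2 y"
    "dT (dS X) y = \<sigma> y * dT t1 y + dT \<sigma> y * t1 y" "dT (dS Y) y = \<sigma> y * dT t2 y + dT \<sigma> y * t2 y"
    using assms by (simp_all add: Dir_mult diffs)
qed

text \<open>Unit length makes the derivative of the tangent orthogonal to the tangent, and the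
  definition of the curvature identifies the remaining component.\<close>

lemma frenet:
  assumes y: "y \<in> S"
  shows "dS t1 y = - (\<sigma> y * \<kappa> y * t2 y)" "dS t2 y = \<sigma> y * \<kappa> y * t1 y"
proof -
  note r = rho_sigma[OF y] and o = tangent_orth[OF y, of "(0,1)", simplified]
  have "\<kappa> y = (\<sigma> y * t1 y * (\<sigma> y * dS t2 y + dS \<sigma> y * t2 y) - \<sigma> y * t2 y * (\<sigma> y * dS t1 y + dS \<sigma> y * t1 y)) * (\<rho> y * \<rho> y * \<rho> y)"
    unfolding g_kap_def second_derivs[OF y] r(3,4) ..
  also have "\<dots> = (\<rho> y * \<sigma> y) * (\<rho> y * \<sigma> y) * \<rho> y * (t1 y * dS t2 y - t2 y * dS t1 y)" by (simp add: algebra_simps)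
  finally have k: "\<sigma> y * \<kappa> y = t1 y * dS t2 y - t2 y * dS t1 y" using r(1) by algebra
  show "dS t1 y = - (\<sigma> y * \<kappa> y * t2 y)" "dS t2 y = \<sigma> y * \<kappa> y * t1 y"
    unfolding k using o r(5) by algebra+
qed

lemma frame_T:
  assumes y: "y \<in> S"
  shows "dT t1 y = \<theta> y * t2 y" "dT t2 y = - (\<theta> y * t1 y)"
    "dT X y = V y * t2 y + \<tau> y * t1 y" "dT Y y = - (V y * t1 y) + \<tau> y * t2 y"
proof -
  note r = rho_sigma[OF y] and o = tangent_orth[OF y, of "(1,0)", simplified]
  show "dT t1 y = \<theta> y * t2 y" "dT t2 y = - (\<theta> y * t1 y)"
    unfolding g_rot_def using o r(5) by algebra+
  show "dT X y = V y * t2 y + \<tau> y * t1 y" "dT Y y = - (V y * t1 y) + \<tau> y * t2 y"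
    unfolding g_vel_def g_tau_def using r(5) by algebra+
qed

text \<open>These are the normal and the tangential component of one identity, the symmetry of the
  mixed derivative of the position: the T-derivative of \<sigma> t equals the s-derivative of V n +
  \<tau> t.\<close>

lemma frame_velocity:
  assumes y: "y \<in> S"
  shows "\<sigma> y * \<theta> y = dS V y - \<tau> y * \<sigma> y * \<kappa> y" "dT \<sigma> y = V y * \<sigma> y * \<kappa> y + dS \<tau> y"
proof -
  have X: "dS (dT X) y = dS (\<lambda>y. V y * t2 y + \<tau> y * t1 y) y"
    by (rule Dir_cong[OF S y]) (rule frame_T)
  have Y: "dS (dT Y) y = dS (\<lambda>y. - (V y * t1 y) + \<tau> y * t2 y) y"
    by (rule Dir_cong[OF S y]) (rule frame_T)
  have X': "\<sigma> y * (\<theta> y * t2 y) + dT \<sigma> y * t1 y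
      = V y * (\<sigma> y * \<kappa> y * t1 y) + dS V y * t2 y + (\<tau> y * - (\<sigma> y * \<kappa> y * t2 y) + dS \<tau> y * t1 y)"
    using X C3_commute[OF reg(1) S y] y
    by (simp add: Dir_add Dir_mult diffs second_derivs frenet frame_T)
  have Y': "\<sigma> y * - (\<theta> y * t1 y) + dT \<sigma> y * t2 y
      = - (V y * - (\<sigma> y * \<kappa> y * t2 y) + dS V y * t1 y) + (\<tau> y * (\<sigma> y * \<kappa> y * t1 y) + dS \<tau> y * t2 y)"
    using Y C3_commute[OF reg(2) S y] y
    by (simp add: Dir_add Dir_diff Dir_mult diffs second_derivs frenet frame_T)
  show "\<sigma> y * \<theta> y = dS V y - \<tau> y * \<sigma> y * \<kappa> y" "dT \<sigma> y = V y * \<sigma> y * \<kappa> y + dS \<tau> y"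
    using X' Y' rho_sigma(5)[OF y] by algebra+
qed

text \<open>The symmetry of the mixed derivatives of the unit tangent; both components contain the
  same relation, which unit length extracts.\<close>

lemma sigma_kappa_T:
  assumes y: "y \<in> S" shows "\<sigma> y * dT \<kappa> y + dT \<sigma> y * \<kappa> y = - dS \<theta> y"
proof -
  have 1: "dT (dS t1) y = dT (\<lambda>y. - (\<sigma> y * \<kappa> y * t2 y)) y" "dT (dS t2) y = dT (\<lambda>y. \<sigma> y * \<kappa> y * t1 y) y"
    by (rule Dir_cong[OF S y], simp add: frenet)+
  have 2: "dS (dT t1) y = dS (\<lambda>y. \<theta> y * t2 y) y" "dS (dT t2) y = dS (\<lambda>y. - (\<theta> y * t1 y)) y"
    by (rule Dir_cong[OF S y], simp add: frame_T)+
  let ?A = "\<sigma> y * dT \<kappa> y + dT \<sigma> y * \<kappa> y"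
  have a: "- (\<sigma> y * \<kappa> y * - (\<theta> y * t1 y) + ?A * t2 y) = \<theta> y * (\<sigma> y * \<kappa> y * t1 y) + dS \<theta> y * t2 y"
    using 1(1) 2(1) C3_commute[OF reg(4) S y] y
    by (simp add: Dir_minus Dir_mult diffs differentiable_mult frenet frame_T)
  have b: "\<sigma> y * \<kappa> y * (\<theta> y * t2 y) + ?A * t1 y = - (\<theta> y * - (\<sigma> y * \<kappa> y * t2 y) + dS \<theta> y * t1 y)"
    using 1(2) 2(2) C3_commute[OF reg(5) S y] y
    by (simp add: Dir_minus Dir_mult diffs differentiable_mult frenet frame_T)
  show ?thesis using a b rho_sigma(5)[OF y] by algebra
qed

text \<open>The left side is the derivative of the curvature along normals, free of the tangential
  motion of the parametrization. The formula results from inserting the rotation rate of the frame,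
  differentiated in s, into the evolution of \<sigma> \<kappa>.\<close>

lemma curvature_evolution:
  assumes y: "y \<in> S"
  shows "dT \<kappa> y - \<tau> y * \<rho> y * dS \<kappa> y
    = - (\<rho> y * \<rho> y * dS (dS V) y - dS \<sigma> y * \<rho> y * \<rho> y * \<rho> y * dS V y) - \<kappa> y * \<kappa> y * V y"
proof -
  have "dS (\<lambda>y. \<sigma> y * \<theta> y) y = dS (\<lambda>y. dS V y - \<tau> y * \<sigma> y * \<kappa> y) y"
    by (rule Dir_cong[OF S y]) (rule frame_velocity)
  then have d: "\<sigma> y * dS \<theta> y + dS \<sigma> y * \<theta> y
      = dS (dS V) y - (\<tau> y * \<sigma> y * dS \<kappa> y + (\<tau> y * dS \<sigma> y + dS \<tau> y * \<sigma> y) * \<kappa> y)"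
    using y by (simp add: Dir_diff Dir_mult diffs differentiable_mult)
  show ?thesis
    using d sigma_kappa_T[OF y] frame_velocity[OF y] rho_sigma(1)[OF y] by algebra
qed

end

lemma Aexp_geometry:
  assumes S: "open S" and X: "\<And>n. Aexp n S X cX" and Y: "\<And>n. Aexp n S Y cY"
    and m: "m > 0" "\<forall>\<^sub>F \<epsilon> in at_right 0. \<forall>y\<in>S. dS (X \<epsilon>) y * dS (X \<epsilon>) y + dS (Y \<epsilon>) y * dS (Y \<epsilon>) y \<ge> m"
  shows "\<exists>c. \<forall>n. Aexp n S (\<lambda>\<epsilon>. g_rho (X \<epsilon>) (Y \<epsilon>)) c" "\<exists>c. \<forall>n. Aexp n S (\<lambda>\<epsilon>. g_sig (X \<epsilon>) (Y \<epsilon>)) c"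
    "\<exists>c. \<forall>n. Aexp n S (\<lambda>\<epsilon>. g_t1 (X \<epsilon>) (Y \<epsilon>)) c" "\<exists>c. \<forall>n. Aexp n S (\<lambda>\<epsilon>. g_t2 (X \<epsilon>) (Y \<epsilon>)) c"
    "\<exists>c. \<forall>n. Aexp n S (\<lambda>\<epsilon>. g_kap (X \<epsilon>) (Y \<epsilon>)) c" "\<exists>c. \<forall>n. Aexp n S (\<lambda>\<epsilon>. g_vel (X \<epsilon>) (Y \<epsilon>)) c"
    "\<exists>c. \<forall>n. Aexp n S (\<lambda>\<epsilon>. g_tau (X \<epsilon>) (Y \<epsilon>)) c" "\<exists>c. \<forall>n. Aexp n S (\<lambda>\<epsilon>. g_rot (X \<epsilon>) (Y \<epsilon>)) c"
proof -
  have D: "Aexp n S (\<lambda>\<epsilon>. Dir v (e \<epsilon>)) (fDir v c)" if "\<And>n. Aexp n S e c" for n v e c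
    using Aexp_SucD(3)[OF that[of "Suc n"]] .
  note XY = D[OF X] D[OF Y] D[OF D[OF X]] D[OF D[OF Y]]
  note op = Aexp_add[OF S] Aexp_mult[OF S] Aexp_diff[OF S]
  have r: "Aexp n S (\<lambda>\<epsilon>. g_rho (X \<epsilon>) (Y \<epsilon>)) (\<lambda>y. fps_rsqrt (fDir (0,1) cX y * fDir (0,1) cX y + fDir (0,1) cY y * fDir (0,1) cY y))" for n
    unfolding g_rho_def[abs_def] by (intro Aexp_rsqrt[OF S _ m] op XY)
  then show "\<exists>c. \<forall>n. Aexp n S (\<lambda>\<epsilon>. g_rho (X \<epsilon>) (Y \<epsilon>)) c" by blast
  from r obtain R where R: "\<And>n. Aexp n S (\<lambda>\<epsilon>. g_rho (X \<epsilon>) (Y \<epsilon>)) R" by blast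
  have "Aexp n S (\<lambda>\<epsilon>. g_sig (X \<epsilon>) (Y \<epsilon>)) (\<lambda>y. (fDir (0,1) cX y * fDir (0,1) cX y + fDir (0,1) cY y * fDir (0,1) cY y) * R y)" for n
    unfolding g_sig_def[abs_def] by (intro op XY R)
  then show "\<exists>c. \<forall>n. Aexp n S (\<lambda>\<epsilon>. g_sig (X \<epsilon>) (Y \<epsilon>)) c" by blast
  have "Aexp n S (\<lambda>\<epsilon>. g_t1 (X \<epsilon>) (Y \<epsilon>)) (\<lambda>y. fDir (0,1) cX y * R y)" for n
    unfolding g_t1_def[abs_def] by (intro op XY R)
  then show 1: "\<exists>c. \<forall>n. Aexp n S (\<lambda>\<epsilon>. g_t1 (X \<epsilon>) (Y \<epsilon>)) c" by blast
  have "Aexp n S (\<lambda>\<epsilon>. g_t2 (X \<epsilon>) (Y \<epsilon>)) (\<lambda>y. fDir (0,1) cY y * R y)" for n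
    unfolding g_t2_def[abs_def] by (intro op XY R)
  then show 2: "\<exists>c. \<forall>n. Aexp n S (\<lambda>\<epsilon>. g_t2 (X \<epsilon>) (Y \<epsilon>)) c" by blast
  obtain c1 c2 where c: "\<And>n. Aexp n S (\<lambda>\<epsilon>. g_t1 (X \<epsilon>) (Y \<epsilon>)) c1" "\<And>n. Aexp n S (\<lambda>\<epsilon>. g_t2 (X \<epsilon>) (Y \<epsilon>)) c2"
    using 1 2 by blast
  have "Aexp n S (\<lambda>\<epsilon>. g_kap (X \<epsilon>) (Y \<epsilon>)) (\<lambda>y. (fDir (0,1) cX y * fDir (0,1) (fDir (0,1) cY) y
      - fDir (0,1) cY y * fDir (0,1) (fDir (0,1) cX) y) * (R y * R y * R y))" for n
    unfolding g_kap_def[abs_def] by (intro op XY R)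
  then show "\<exists>c. \<forall>n. Aexp n S (\<lambda>\<epsilon>. g_kap (X \<epsilon>) (Y \<epsilon>)) c" by blast
  have "Aexp n S (\<lambda>\<epsilon>. g_vel (X \<epsilon>) (Y \<epsilon>)) (\<lambda>y. fDir (1,0) cX y * c2 y - fDir (1,0) cY y * c1 y)" for n
    unfolding g_vel_def[abs_def] by (intro op XY c)
  then show "\<exists>c. \<forall>n. Aexp n S (\<lambda>\<epsilon>. g_vel (X \<epsilon>) (Y \<epsilon>)) c" by blast
  have "Aexp n S (\<lambda>\<epsilon>. g_tau (X \<epsilon>) (Y \<epsilon>)) (\<lambda>y. fDir (1,0) cX y * c1 y + fDir (1,0) cY y * c2 y)" for n
    unfolding g_tau_def[abs_def] by (intro op XY c)
  then show "\<exists>c. \<forall>n. Aexp n S (\<lambda>\<epsilon>. g_tau (X \<epsilon>) (Y \<epsilon>)) c" by blast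
  have "Aexp n S (\<lambda>\<epsilon>. g_rot (X \<epsilon>) (Y \<epsilon>)) (\<lambda>y. c2 y * fDir (1,0) c1 y - c1 y * fDir (1,0) c2 y)" for n
    unfolding g_rot_def[abs_def] by (intro op D c)
  then show "\<exists>c. \<forall>n. Aexp n S (\<lambda>\<epsilon>. g_rot (X \<epsilon>) (Y \<epsilon>)) c" by blast
qed

lemma eventually_moving_frame:
  assumes S: "open S" and X: "\<And>n. Aexp n S X cX" and Y: "\<And>n. Aexp n S Y cY"
    and m: "m > 0" "\<forall>\<^sub>F \<epsilon> in at_right 0. \<forall>y\<in>S. dS (X \<epsilon>) y * dS (X \<epsilon>) y + dS (Y \<epsilon>) y * dS (Y \<epsilon>) y \<ge> m"
  shows "\<forall>\<^sub>F \<epsilon> in at_right 0. moving_frame S (X \<epsilon>) (Y \<epsilon>)"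
proof -
  have ev: "\<forall>\<^sub>F \<epsilon> in at_right 0. C3 S (e \<epsilon>)" if "\<exists>c. \<forall>n. Aexp n S e c" for e
    using that Aexp_C3 by blast
  note g = Aexp_geometry[OF assms]
  have C: "\<forall>\<^sub>F \<epsilon> in at_right 0. C3 S (X \<epsilon>)" "\<forall>\<^sub>F \<epsilon> in at_right 0. C3 S (Y \<epsilon>)" using X Y ev by blast+
  show ?thesis
    using C ev[OF g(2)] ev[OF g(3)] ev[OF g(4)] ev[OF g(5)] ev[OF g(6)] ev[OF g(7)] ev[OF g(8)] m(2)
  proof eventually_elim
    case (elim \<epsilon>)
    show ?case
      using elim S m(1) by (intro moving_frame.intro) force+
  qed
qed

subsection \<open>The equation in the inner variables\<close>

abbreviation "E1 \<equiv> (axis 1 1 :: real ^ 2)"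
abbreviation "E2 \<equiv> (axis 2 1 :: real ^ 2)"

lemma Dir_has_real_derivative:
  fixes f :: "'a::real_normed_vector \<Rightarrow> real"
  assumes "f differentiable (at (p t))" "(p has_vector_derivative v) (at t)"
  shows "((\<lambda>t. f (p t)) has_real_derivative Dir v f (p t)) (at t)"
  using has_vector_derivative_Dir[OF assms] by (simp add: has_real_derivative_iff_has_vector_derivative)

lemma partial_derivs:
  fixes f :: "real \<times> real \<Rightarrow> real"
  assumes "f differentiable (at (T, s))"
  shows "((\<lambda>s. f (T, s)) has_real_derivative dS f (T, s)) (at s)"
    "((\<lambda>T. f (T, s)) has_real_derivative dT f (T, s)) (at T)"
  by (rule Dir_has_real_derivative[where p = "\<lambda>s. (T, s)"], use assms in simp, auto intro!: derivative_eq_intros)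
     (rule Dir_has_real_derivative[where p = "\<lambda>T. (T, s)"], use assms in simp, auto intro!: derivative_eq_intros)

lemma partial_derivs3:
  fixes f :: "real \<times> real \<times> real \<Rightarrow> real"
  assumes "f differentiable (at (T, s, z))"
  shows "((\<lambda>T. f (T, s, z)) has_real_derivative Dir (1, 0, 0) f (T, s, z)) (at T)"
    "((\<lambda>s. f (T, s, z)) has_real_derivative Dir (0, 1, 0) f (T, s, z)) (at s)"
    "((\<lambda>z. f (T, s, z)) has_real_derivative Dir (0, 0, 1) f (T, s, z)) (at z)"
proof -
  have "((\<lambda>T. (T, s, z)) has_vector_derivative (1, 0, 0)) (at T)"
    "((\<lambda>s. (T, s, z)) has_vector_derivative (0, 1, 0)) (at s)"
    "((\<lambda>z. (T, s, z)) has_vector_derivative (0, 0, 1)) (at z)"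
    by (auto intro!: derivative_eq_intros simp: zero_prod_def)
  from this[THEN Dir_has_real_derivative[rotated], of f] assms
  show "((\<lambda>T. f (T, s, z)) has_real_derivative Dir (1, 0, 0) f (T, s, z)) (at T)"
    "((\<lambda>s. f (T, s, z)) has_real_derivative Dir (0, 1, 0) f (T, s, z)) (at s)"
    "((\<lambda>z. f (T, s, z)) has_real_derivative Dir (0, 0, 1) f (T, s, z)) (at z)" by auto
qed

lemma chain_curve:
  fixes g :: "real \<times> (real ^ 2) \<Rightarrow> real"
  assumes g: "g differentiable (at (r t, x t *\<^sub>R E1 + y t *\<^sub>R E2))"
    and d: "(r has_real_derivative r') (at t)" "(x has_real_derivative x') (at t)" "(y has_real_derivative y') (at t)"
  shows "((\<lambda>t. g (r t, x t *\<^sub>R E1 + y t *\<^sub>R E2)) has_real_derivative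
    r' * Dir (1, 0) g (r t, x t *\<^sub>R E1 + y t *\<^sub>R E2)
    + (x' * Dir (0, E1) g (r t, x t *\<^sub>R E1 + y t *\<^sub>R E2) + y' * Dir (0, E2) g (r t, x t *\<^sub>R E1 + y t *\<^sub>R E2))) (at t)"
proof -
  let ?p = "\<lambda>t. (r t, x t *\<^sub>R E1 + y t *\<^sub>R E2)"
  have p: "(?p has_vector_derivative (r', x' *\<^sub>R E1 + y' *\<^sub>R E2)) (at t)"
  proof (rule has_vector_derivative_Pair)
    show "(r has_vector_derivative r') (at t)" using d(1) by (simp add: has_real_derivative_iff_has_vector_derivative)
    have "((\<lambda>t. x t *\<^sub>R E1 + y t *\<^sub>R E2) has_vector_derivative (x t *\<^sub>R 0 + x' *\<^sub>R E1) + (y t *\<^sub>R 0 + y' *\<^sub>R E2)) (at t)"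
      by (intro has_vector_derivative_add has_vector_derivative_scaleR d has_vector_derivative_const)
    then show "((\<lambda>t. x t *\<^sub>R E1 + y t *\<^sub>R E2) has_vector_derivative x' *\<^sub>R E1 + y' *\<^sub>R E2) (at t)" by simp
  qed
  have "(r', x' *\<^sub>R E1 + y' *\<^sub>R E2) = r' *\<^sub>R (1, 0) + 1 *\<^sub>R (x' *\<^sub>R (0, E1) + y' *\<^sub>R (0, E2))" by simp
  then have "Dir (r', x' *\<^sub>R E1 + y' *\<^sub>R E2) g (?p t)
     = r' * Dir (1, 0) g (?p t) + (x' * Dir (0, E1) g (?p t) + y' * Dir (0, E2) g (?p t))"
    by (simp only: Dir_vec_add[OF g] real_scaleR_def mult_1)
  with Dir_has_real_derivative[where p = ?p, OF g p] show ?thesis by simp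
qed

lemma Dir_slice:
  assumes "F differentiable (at (T, x))" shows "Dir b (\<lambda>x. F (T, x)) x = Dir (0, b) F (T, x)"
    "(\<lambda>x. F (T, x)) differentiable (at x)"
proof -
  have "((\<lambda>x. (T, x)) has_derivative (\<lambda>h. (0, h))) (at x)" by (auto intro!: derivative_eq_intros)
  from has_derivative_compose[OF this has_derivative_Dir[OF assms]]
  have "((\<lambda>x. F (T, x)) has_derivative (\<lambda>h. Dir (0, h) F (T, x))) (at x)" .
  from Dir_eqI[OF this] differentiableI[OF this]
  show "Dir b (\<lambda>x. F (T, x)) x = Dir (0, b) F (T, x)" "(\<lambda>x. F (T, x)) differentiable (at x)" by auto
qed

text \<open>Derivatives in x at a fixed time are rewritten as directional derivatives on space-time,
  the form in which the chain rule along the moving tube applies.\<close>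

lemma laplacian_component:
  fixes U :: "real \<Rightarrow> real ^ 2 \<Rightarrow> real ^ 2" and j :: 2
  assumes I: "open I" "T \<in> I" and U: "smooth_on (I \<times> UNIV) (\<lambda>(T, x). U T x)"
  defines "f \<equiv> \<lambda>(T, x). U T x $ j"
  shows "laplacian (U T) x $ j = Dir (0, E1) (Dir (0, E1) f) (T, x) + Dir (0, E2) (Dir (0, E2) f) (T, x)"
    "vector_derivative (\<lambda>t. U t x) (at T) $ j = Dir (1, 0) f (T, x)"
    "smooth_on (I \<times> UNIV) f"
proof -
  let ?F = "\<lambda>(T, x). U T x"
  have S: "open (I \<times> (UNIV :: (real ^ 2) set))" using I by (intro open_Times) auto
  have bl: "bounded_linear (\<lambda>v :: real ^ 2. v $ j)" by (rule bounded_linear_vec_nth)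
  have f: "f = (\<lambda>y. ?F y $ j)" by (auto simp: f_def)
  show "smooth_on (I \<times> UNIV) f" unfolding f by (rule smooth_on_bounded_linear(1)[OF S U bl])
  have d: "dderivs vs ?F differentiable (at (T, x))" for vs x
    using U I(2) by (auto simp: smooth_on_def)
  have d0: "?F differentiable (at (T, x))" for x using d[of "[]" x] by simp
  have d1: "Dir v ?F differentiable (at (T, x))" for v x using d[of "[v]" x] by (simp add: Dir_def)
  have comp: "Dir b (Dir b (U T)) x $ j = Dir (0, b) (Dir (0, b) f) (T, x)" for b
  proof -
    have "Dir b (U T) = (\<lambda>x. Dir (0, b) ?F (T, x))"
    proof
      fix x show "Dir b (U T) x = Dir (0, b) ?F (T, x)" using Dir_slice(1)[OF d0[of x], of b] by simp
    qed
    then have "Dir b (Dir b (U T)) x = Dir (0, b) (Dir (0, b) ?F) (T, x)"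
      using Dir_slice(1)[OF d1[of "(0, b)" x], of b] by simp
    moreover have "dderivs [(0, b), (0, b)] f (T, x) = dderivs [(0, b), (0, b)] ?F (T, x) $ j"
      unfolding f by (rule smooth_on_bounded_linear(2)[OF S U bl]) (use I in auto)
    ultimately show ?thesis by (simp add: Dir_def)
  qed
  have B: "(Basis :: (real ^ 2) set) = {E1, E2}" by (auto simp: Basis_vec_def UNIV_2)
  have ne: "E1 \<noteq> E2" by (simp add: axis_eq_axis)
  have "laplacian (U T) x = Dir E1 (Dir E1 (U T)) x + Dir E2 (Dir E2 (U T)) x"
    unfolding laplacian_def B using ne by (simp add: Dir_def)
  then show "laplacian (U T) x $ j = Dir (0, E1) (Dir (0, E1) f) (T, x) + Dir (0, E2) (Dir (0, E2) f) (T, x)"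
    by (simp add: comp)
  have "((\<lambda>t. (t, x)) has_vector_derivative (1, 0)) (at T)" by (auto intro!: derivative_eq_intros)
  from has_vector_derivative_Dir[where p = "\<lambda>t. (t, x)", OF d0 this]
  have "((\<lambda>t. U t x) has_vector_derivative Dir (1, 0) ?F (T, x)) (at T)" by simp
  then have "vector_derivative (\<lambda>t. U t x) (at T) = Dir (1, 0) ?F (T, x)" by (rule vector_derivative_at)
  then show "vector_derivative (\<lambda>t. U t x) (at T) $ j = Dir (1, 0) f (T, x)"
    unfolding f using Dir_bounded_linear[OF bl d0] by simp
qed

context moving_frame
begin

definition tube :: "real \<Rightarrow> real \<times> real \<times> real \<Rightarrow> real ^ 2" where
  "tube e = (\<lambda>(T, s, z). (X (T, s) + e * z * t2 (T, s)) *\<^sub>R E1 + (Y (T, s) - e * z * t1 (T, s)) *\<^sub>R E2)"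

text \<open>Parallel curves are stretched by h = 1 + e z \<kappa> by the Frenet equations. In time
  the normal also rotates, which changes the tangential velocity at distance e z to \<tau> - e z
  \<theta>.\<close>

lemma tube_chain:
  assumes y: "(T, s) \<in> S" and g: "g differentiable (at (T, tube e (T, s, z)))"
  defines "p \<equiv> (T, tube e (T, s, z))" and "h \<equiv> 1 + e * z * \<kappa> (T, s)"
  shows "((\<lambda>s. g (T, tube e (T, s, z))) has_real_derivative
      \<sigma> (T, s) * h * (t1 (T, s) * Dir (0, E1) g p + t2 (T, s) * Dir (0, E2) g p)) (at s)"
    "((\<lambda>z. g (T, tube e (T, s, z))) has_real_derivative
      e * (t2 (T, s) * Dir (0, E1) g p - t1 (T, s) * Dir (0, E2) g p)) (at z)"
    "((\<lambda>T. g (T, tube e (T, s, z))) has_real_derivative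
      Dir (1, 0) g p + V (T, s) * (t2 (T, s) * Dir (0, E1) g p - t1 (T, s) * Dir (0, E2) g p)
      + (\<tau> (T, s) - e * z * \<theta> (T, s)) * (t1 (T, s) * Dir (0, E1) g p + t2 (T, s) * Dir (0, E2) g p)) (at T)"
proof -
  note pd = partial_derivs
  note g' = g[unfolded tube_def prod.case]
  have p: "p = (T, (X (T, s) + e * z * t2 (T, s)) *\<^sub>R E1 + (Y (T, s) - e * z * t1 (T, s)) *\<^sub>R E2)"
    by (simp add: p_def tube_def)
  have "((\<lambda>s. X (T, s) + e * z * t2 (T, s)) has_real_derivative \<sigma> (T, s) * h * t1 (T, s)) (at s)"
    by (rule derivative_eq_intros refl pd(1) diffs y | simp add: rho_sigma y frenet h_def algebra_simps)+
  moreover have "((\<lambda>s. Y (T, s) - e * z * t1 (T, s)) has_real_derivative \<sigma> (T, s) * h * t2 (T, s)) (at s)"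
    by (rule derivative_eq_intros refl pd(1) diffs y | simp add: rho_sigma y frenet h_def algebra_simps)+
  ultimately show "((\<lambda>s. g (T, tube e (T, s, z))) has_real_derivative
      \<sigma> (T, s) * h * (t1 (T, s) * Dir (0, E1) g p + t2 (T, s) * Dir (0, E2) g p)) (at s)"
    unfolding tube_def prod.case p
    by (rule DERIV_cong[OF chain_curve[where g = g and r = "\<lambda>s. T" and x = "\<lambda>s. X (T, s) + e * z * t2 (T, s)"
            and y = "\<lambda>s. Y (T, s) - e * z * t1 (T, s)", OF g' DERIV_const]]) (simp_all add: algebra_simps)
  have "((\<lambda>z. X (T, s) + e * z * t2 (T, s)) has_real_derivative e * t2 (T, s)) (at z)"
    "((\<lambda>z. Y (T, s) - e * z * t1 (T, s)) has_real_derivative - (e * t1 (T, s))) (at z)"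
    by (auto intro!: derivative_eq_intros)
  then show "((\<lambda>z. g (T, tube e (T, s, z))) has_real_derivative
      e * (t2 (T, s) * Dir (0, E1) g p - t1 (T, s) * Dir (0, E2) g p)) (at z)"
    unfolding tube_def prod.case p
    by (rule DERIV_cong[OF chain_curve[where g = g and r = "\<lambda>z. T" and x = "\<lambda>z. X (T, s) + e * z * t2 (T, s)"
            and y = "\<lambda>z. Y (T, s) - e * z * t1 (T, s)", OF g' DERIV_const]]) (simp_all add: algebra_simps)
  have "((\<lambda>T. X (T, s) + e * z * t2 (T, s)) has_real_derivative V (T, s) * t2 (T, s) + (\<tau> (T, s) - e * z * \<theta> (T, s)) * t1 (T, s)) (at T)"
    by (rule derivative_eq_intros refl pd(2) diffs y | simp add: y frame_T algebra_simps)+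
  moreover have "((\<lambda>T. Y (T, s) - e * z * t1 (T, s)) has_real_derivative - (V (T, s) * t1 (T, s)) + (\<tau> (T, s) - e * z * \<theta> (T, s)) * t2 (T, s)) (at T)"
    by (rule derivative_eq_intros refl pd(2) diffs y | simp add: y frame_T algebra_simps)+
  ultimately show "((\<lambda>T. g (T, tube e (T, s, z))) has_real_derivative
      Dir (1, 0) g p + V (T, s) * (t2 (T, s) * Dir (0, E1) g p - t1 (T, s) * Dir (0, E2) g p)
      + (\<tau> (T, s) - e * z * \<theta> (T, s)) * (t1 (T, s) * Dir (0, E1) g p + t2 (T, s) * Dir (0, E2) g p)) (at T)"
    unfolding tube_def prod.case p
    by (rule DERIV_cong[OF chain_curve[where g = g and r = "\<lambda>T. T" and x = "\<lambda>T. X (T, s) + e * z * t2 (T, s)"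
            and y = "\<lambda>T. Y (T, s) - e * z * t1 (T, s)", OF g' DERIV_ident]]) (simp_all add: algebra_simps)
qed

text \<open>The Laplacian and the time derivative in normal coordinates. The chain rule is solved
  for the components of the gradient in the moving frame; the second derivatives in s and z then
  combine to the trace of the Hessian, with curvature terms from differentiating the frame.\<close>

lemma inner_operators:
  assumes SI: "S = I \<times> UNIV" and I: "open I" and T: "T \<in> I" and e: "e > 0"
    and f: "smooth_on (I \<times> UNIV) f"
    and W: "smooth_on (I \<times> UNIV \<times> UNIV) W" "\<And>T s z. T \<in> I \<Longrightarrow> W (T, s, z) = f (T, tube e (T, s, z))"
    and h: "1 + e * z * \<kappa> (T, s) \<noteq> 0"
  defines "Ws \<equiv> Dir (0, 1, 0) W" and "Wz \<equiv> Dir (0, 0, 1) W" and "hi \<equiv> 1 / (1 + e * z * \<kappa> (T, s))"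
    and "p \<equiv> (T, tube e (T, s, z))" and "y \<equiv> (T, s)" and "w \<equiv> (T, s, z)"
  shows "e\<^sup>2 * (Dir (0, E1) (Dir (0, E1) f) p + Dir (0, E2) (Dir (0, E2) f) p)
     = Dir (0, 0, 1) Wz w + e * \<kappa> y * hi * Wz w
       + e\<^sup>2 * ((\<rho> y * hi)\<^sup>2 * Dir (0, 1, 0) Ws w
          - (dS \<sigma> y * (1 + e * z * \<kappa> y) + \<sigma> y * e * z * dS \<kappa> y) * (\<rho> y * hi) ^ 3 * Ws w)"
    "e\<^sup>2 * Dir (1, 0) f p = e\<^sup>2 * (Dir (1, 0, 0) W w - (\<tau> y - e * z * \<theta> y) * \<rho> y * hi * Ws w) - e * V y * Wz w"
proof -
  let ?f1 = "Dir (0, E1) f" and ?f2 = "Dir (0, E2) f"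
  have fd: "f differentiable (at (T, x))" "?f1 differentiable (at (T, x))" "?f2 differentiable (at (T, x))" if "T \<in> I" for T x
    using f that by (auto intro!: smooth_on_differentiable smooth_on_Dir)
  have Wd: "W differentiable (at (T, s, z))" "Dir v W differentiable (at (T, s, z))" if "T \<in> I" for v T s z
    using W(1) that by (auto intro!: smooth_on_differentiable smooth_on_Dir)
  have yS: "(T, s) \<in> S" if "T \<in> I" for T s using that by (simp add: SI)
  have Ws: "Ws (T, s, z) = \<sigma> (T, s) * (1 + e * z * \<kappa> (T, s)) * (t1 (T, s) * ?f1 (T, tube e (T, s, z)) + t2 (T, s) * ?f2 (T, tube e (T, s, z)))"
    if T: "T \<in> I" for T s z
  proof -
    have "((\<lambda>s. W (T, s, z)) has_real_derivative Ws (T, s, z)) (at s)"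
      unfolding Ws_def by (rule partial_derivs3(2)[OF Wd(1)[OF T]])
    then show ?thesis unfolding W(2)[OF T]
      using DERIV_unique tube_chain(1)[OF yS[OF T] fd(1)[OF T]] by blast
  qed
  have Wz: "Wz (T, s, z) = e * (t2 (T, s) * ?f1 (T, tube e (T, s, z)) - t1 (T, s) * ?f2 (T, tube e (T, s, z)))"
    if T: "T \<in> I" for T s z
  proof -
    have "((\<lambda>z. W (T, s, z)) has_real_derivative Wz (T, s, z)) (at z)"
      unfolding Wz_def by (rule partial_derivs3(3)[OF Wd(1)[OF T]])
    then show ?thesis unfolding W(2)[OF T]
      using DERIV_unique tube_chain(2)[OF yS[OF T] fd(1)[OF T]] by blast
  qed
  have WT: "Dir (1, 0, 0) W w = Dir (1, 0) f p + V y * (t2 y * ?f1 p - t1 y * ?f2 p) + (\<tau> y - e * z * \<theta> y) * (t1 y * ?f1 p + t2 y * ?f2 p)"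
  proof -
    have "((\<lambda>T. W (T, s, z)) has_real_derivative Dir (1, 0, 0) W w) (at T)"
      unfolding w_def by (rule partial_derivs3(1)[OF Wd(1)[OF T]])
    moreover have "eventually (\<lambda>T. W (T, s, z) = f (T, tube e (T, s, z))) (nhds T)"
      using eventually_nhds_in_open[OF I T] by eventually_elim (rule W(2))
    ultimately have "((\<lambda>T. f (T, tube e (T, s, z))) has_real_derivative Dir (1, 0, 0) W w) (at T)"
      by (simp add: DERIV_cong_ev)
    then show ?thesis using DERIV_unique tube_chain(3)[OF yS[OF T] fd(1)[OF T]] unfolding p_def y_def by blast
  qed
  note c1 = tube_chain[OF yS[OF T] fd(2)[OF T], of e s z] and c2 = tube_chain[OF yS[OF T] fd(3)[OF T], of e s z]
  let ?f11 = "Dir (0, E1) ?f1 p" and ?f21 = "Dir (0, E2) ?f1 p" and ?f12 = "Dir (0, E1) ?f2 p" and ?f22 = "Dir (0, E2) ?f2 p"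
  let ?h = "1 + e * z * \<kappa> y"
  have "((\<lambda>z. Wz (T, s, z)) has_real_derivative Dir (0, 0, 1) Wz w) (at z)"
    unfolding w_def Wz_def by (rule partial_derivs3(3)[OF Wd(2)[OF T]])
  moreover have "((\<lambda>z. Wz (T, s, z)) has_real_derivative
      e * (t2 y * (e * (t2 y * ?f11 - t1 y * ?f21)) - t1 y * (e * (t2 y * ?f12 - t1 y * ?f22)))) (at z)"
    unfolding Wz[OF T] y_def p_def by (rule DERIV_cmult DERIV_diff c1(2) c2(2))+
  ultimately have Wzz: "Dir (0, 0, 1) Wz w = e * (t2 y * (e * (t2 y * ?f11 - t1 y * ?f21)) - t1 y * (e * (t2 y * ?f12 - t1 y * ?f22)))"
    by (rule DERIV_unique)
  have hs: "((\<lambda>s. 1 + e * z * \<kappa> (T, s)) has_real_derivative e * z * dS \<kappa> y) (at s)"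
    unfolding y_def by (rule derivative_eq_intros refl partial_derivs(1) diffs yS T | simp)+
  have d1: "((\<lambda>s. ?f1 (T, tube e (T, s, z))) has_real_derivative \<sigma> y * ?h * (t1 y * ?f11 + t2 y * ?f21)) (at s)"
    unfolding y_def p_def by (rule tube_chain(1)[OF yS[OF T] fd(2)[OF T]])
  have d2: "((\<lambda>s. ?f2 (T, tube e (T, s, z))) has_real_derivative \<sigma> y * ?h * (t1 y * ?f12 + t2 y * ?f22)) (at s)"
    unfolding y_def p_def by (rule tube_chain(1)[OF yS[OF T] fd(3)[OF T]])
  have ds: "((\<lambda>s. \<sigma> (T, s)) has_real_derivative dS \<sigma> y) (at s)" "((\<lambda>s. t1 (T, s)) has_real_derivative dS t1 y) (at s)"
    "((\<lambda>s. t2 (T, s)) has_real_derivative dS t2 y) (at s)"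
    unfolding y_def by (rule partial_derivs(1) diffs yS T)+
  have "((\<lambda>s. Ws (T, s, z)) has_real_derivative Dir (0, 1, 0) Ws w) (at s)"
    unfolding w_def Ws_def by (rule partial_derivs3(2)[OF Wd(2)[OF T]])
  moreover have "((\<lambda>s. Ws (T, s, z)) has_real_derivative
      (dS \<sigma> y * ?h + (e * z * dS \<kappa> y) * \<sigma> y) * (t1 y * ?f1 p + t2 y * ?f2 p)
      + ((dS t1 y * ?f1 p + (\<sigma> y * ?h * (t1 y * ?f11 + t2 y * ?f21)) * t1 y)
        + (dS t2 y * ?f2 p + (\<sigma> y * ?h * (t1 y * ?f12 + t2 y * ?f22)) * t2 y)) * (\<sigma> y * ?h)) (at s)"
  proof -
    have "((\<lambda>s. (\<sigma> (T, s) * (1 + e * z * \<kappa> (T, s))) * (t1 (T, s) * ?f1 (T, tube e (T, s, z)) + t2 (T, s) * ?f2 (T, tube e (T, s, z))))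
      has_real_derivative (dS \<sigma> y * (1 + e * z * \<kappa> (T, s)) + (e * z * dS \<kappa> y) * \<sigma> (T, s))
          * (t1 (T, s) * ?f1 (T, tube e (T, s, z)) + t2 (T, s) * ?f2 (T, tube e (T, s, z)))
      + ((dS t1 y * ?f1 (T, tube e (T, s, z)) + (\<sigma> y * ?h * (t1 y * ?f11 + t2 y * ?f21)) * t1 (T, s))
        + (dS t2 y * ?f2 (T, tube e (T, s, z)) + (\<sigma> y * ?h * (t1 y * ?f12 + t2 y * ?f22)) * t2 (T, s)))
          * (\<sigma> (T, s) * (1 + e * z * \<kappa> (T, s)))) (at s)"
      by (intro DERIV_mult DERIV_add d1 d2 ds hs)
    then show ?thesis unfolding Ws[OF T] by (simp only: y_def p_def)
  qed
  ultimately have Wss: "Dir (0, 1, 0) Ws w = (dS \<sigma> y * ?h + (e * z * dS \<kappa> y) * \<sigma> y) * (t1 y * ?f1 p + t2 y * ?f2 p)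
      + ((dS t1 y * ?f1 p + (\<sigma> y * ?h * (t1 y * ?f11 + t2 y * ?f21)) * t1 y)
        + (dS t2 y * ?f2 p + (\<sigma> y * ?h * (t1 y * ?f12 + t2 y * ?f22)) * t2 y)) * (\<sigma> y * ?h)"
    by (rule DERIV_unique)
  have yy: "y \<in> S" using yS[OF T] by (simp add: y_def)
  have hh: "?h * hi = 1" using h by (simp add: hi_def y_def)
  note rs = rho_sigma(1,5)[OF yy] and fr = frenet[OF yy]
  have ws: "Ws w = \<sigma> y * ?h * (t1 y * ?f1 p + t2 y * ?f2 p)" and wz: "Wz w = e * (t2 y * ?f1 p - t1 y * ?f2 p)"
    using Ws[OF T] Wz[OF T] by (simp_all add: w_def y_def p_def)
  \<comment> \<open>The tangential component of the gradient at the tube point; \<open>b\<close> is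
    the normal component.\<close>
  define a where "a = t1 y * ?f1 p + t2 y * ?f2 p"
  define b where "b = t2 y * ?f1 p - t1 y * ?f2 p"
  have wa: "(\<rho> y * hi) * Ws w = a"
  proof -
    have "(\<rho> y * hi) * Ws w = (\<rho> y * \<sigma> y) * (?h * hi) * a" unfolding ws a_def by (simp add: mult_ac)
    then show ?thesis using rs(1) hh by simp
  qed
  show "e\<^sup>2 * Dir (1, 0) f p = e\<^sup>2 * (Dir (1, 0, 0) W w - (\<tau> y - e * z * \<theta> y) * \<rho> y * hi * Ws w) - e * V y * Wz w"
  proof -
    have x: "(\<tau> y - e * z * \<theta> y) * \<rho> y * hi * Ws w = (\<tau> y - e * z * \<theta> y) * a"
      unfolding wa[symmetric] by (simp add: mult_ac)
    show ?thesis unfolding x WT[folded a_def b_def] wz[folded b_def] by (simp add: algebra_simps power2_eq_square)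
  qed
  let ?m = "t1 y * (t1 y * ?f11 + t2 y * ?f21) + t2 y * (t1 y * ?f12 + t2 y * ?f22)"
  have wss: "Dir (0, 1, 0) Ws w = (dS \<sigma> y * ?h + \<sigma> y * e * z * dS \<kappa> y) * a - \<sigma> y * \<sigma> y * ?h * \<kappa> y * b + (\<sigma> y * ?h) * (\<sigma> y * ?h) * ?m"
    unfolding Wss fr a_def b_def by (simp add: algebra_simps)
  have "(\<rho> y * hi)\<^sup>2 * Dir (0, 1, 0) Ws w
      = (dS \<sigma> y * ?h + \<sigma> y * e * z * dS \<kappa> y) * (\<rho> y * hi)\<^sup>2 * a
        - (\<rho> y * \<sigma> y) * (\<rho> y * \<sigma> y) * (?h * hi) * hi * \<kappa> y * b
        + (\<rho> y * \<sigma> y) * (\<rho> y * \<sigma> y) * (?h * hi) * (?h * hi) * ?m"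
    unfolding wss by (simp only: power2_eq_square distrib_left right_diff_distrib mult_ac)
  then have 1: "(\<rho> y * hi)\<^sup>2 * Dir (0, 1, 0) Ws w
      = (dS \<sigma> y * ?h + \<sigma> y * e * z * dS \<kappa> y) * (\<rho> y * hi)\<^sup>2 * a - hi * \<kappa> y * b + ?m"
    unfolding rs(1) hh by simp
  have 2: "(dS \<sigma> y * ?h + \<sigma> y * e * z * dS \<kappa> y) * (\<rho> y * hi) ^ 3 * Ws w
      = (dS \<sigma> y * ?h + \<sigma> y * e * z * dS \<kappa> y) * (\<rho> y * hi)\<^sup>2 * a"
    unfolding wa[symmetric] by (simp add: power2_eq_square power3_eq_cube mult_ac)
  have 3: "Dir (0, 0, 1) Wz w = e\<^sup>2 * (t2 y * (t2 y * ?f11 - t1 y * ?f21) - t1 y * (t2 y * ?f12 - t1 y * ?f22))"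
    unfolding Wzz by (simp add: power2_eq_square algebra_simps)
  have 4: "e * \<kappa> y * hi * Wz w = e\<^sup>2 * (hi * \<kappa> y * b)"
    unfolding wz b_def by (simp add: power2_eq_square algebra_simps)
  \<comment> \<open>The sum of the second derivatives along an orthonormal frame is the
    Laplacian.\<close>
  have m: "t2 y * (t2 y * ?f11 - t1 y * ?f21) - t1 y * (t2 y * ?f12 - t1 y * ?f22) + ?m = ?f11 + ?f22"
  proof -
    have "t2 y * (t2 y * ?f11 - t1 y * ?f21) - t1 y * (t2 y * ?f12 - t1 y * ?f22) + ?m
      = (t1 y * t1 y + t2 y * t2 y) * (?f11 + ?f22)" by (simp add: algebra_simps)
    then show ?thesis using rs(2) by simp
  qed
  show "e\<^sup>2 * (Dir (0, E1) (Dir (0, E1) f) p + Dir (0, E2) (Dir (0, E2) f) p)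
     = Dir (0, 0, 1) Wz w + e * \<kappa> y * hi * Wz w
       + e\<^sup>2 * ((\<rho> y * hi)\<^sup>2 * Dir (0, 1, 0) Ws w
          - (dS \<sigma> y * (1 + e * z * \<kappa> y) + \<sigma> y * e * z * dS \<kappa> y) * (\<rho> y * hi) ^ 3 * Ws w)"
    unfolding 1 2 3 4 m[symmetric] by (simp add: algebra_simps)
qed

end

section \<open>Solving the inner problem order by order\<close>

lemma fps_mult_small:
  fixes a b :: "real fps"
  shows "(a * b) $$ 2 = a $$ 0 * b $$ 2 + a $$ Suc 0 * b $$ Suc 0 + a $$ 2 * b $$ 0"
    "(a * b) $$ 3 = a $$ 0 * b $$ 3 + a $$ Suc 0 * b $$ 2 + a $$ 2 * b $$ Suc 0 + a $$ 3 * b $$ 0"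
    "(a * b) $$ 4 = a $$ 0 * b $$ 4 + a $$ Suc 0 * b $$ 3 + a $$ 2 * b $$ 2 + a $$ 3 * b $$ Suc 0 + a $$ 4 * b $$ 0"
  by (simp_all add: fps_mult_nth eval_nat_numeral)

lemma fps_X_mult_small:
  fixes a :: "real fps"
  shows "(fps_X * a) $$ 0 = 0" "(fps_X * a) $$ Suc 0 = a $$ 0" "(fps_X * a) $$ 2 = a $$ Suc 0"
    "(fps_X * a) $$ 3 = a $$ 2" "(fps_X * a) $$ 4 = a $$ 3"
  by (simp_all add: numeral_3_eq_3 numeral_2_eq_2 eval_nat_numeral)

text \<open>The profiles \<open>W\<^sub>1\<close> and \<open>W\<^sub>2\<close> of the first two corrections
  \<open>\<epsilon> \<kappa> W\<^sub>1 + \<epsilon>\<^sup>2 \<kappa>\<^sup>2 W\<^sub>2\<close>. They are unique, and they exist as soon as there is a front whose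
  curvature does not vanish identically.\<close>

definition W1 :: "real \<Rightarrow> real \<Rightarrow> (real \<Rightarrow> real) \<times> (real \<Rightarrow> real)" where
  "W1 \<beta> \<mu> = (SOME (p, q). profile \<mu> \<beta> (- alpha0 \<beta> \<mu>) (\<lambda>z. 0) (deriv \<phi>) p q)"

text \<open>The sources of order two divided by \<kappa>^2: transport of W1 with the velocity -
  \<alpha> \<kappa>, the drift term with the curvature, and the quadratic part of the nonlinearity.
  The companion \<open>src2_2\<close> also contains - z \<phi>', from the variation of the curvature
  over parallel curves.\<close>

definition src2_1 :: "real \<Rightarrow> real \<Rightarrow> real \<Rightarrow> real" where
  "src2_1 \<beta> \<mu> z = (let a = fst (W1 \<beta> \<mu>); b = snd (W1 \<beta> \<mu>) in
     alpha0 \<beta> \<mu> * deriv a z + deriv b z - 4 * \<phi> z * a z * b z)"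

definition src2_2 :: "real \<Rightarrow> real \<Rightarrow> real \<Rightarrow> real" where
  "src2_2 \<beta> \<mu> z = (let a = fst (W1 \<beta> \<mu>); b = snd (W1 \<beta> \<mu>) in
     deriv a z - alpha0 \<beta> \<mu> * deriv b z - z * deriv \<phi> z - 6 * \<phi> z * (a z)\<^sup>2 - 2 * \<phi> z * (b z)\<^sup>2)"

definition W2 :: "real \<Rightarrow> real \<Rightarrow> (real \<Rightarrow> real) \<times> (real \<Rightarrow> real)" where
  "W2 \<beta> \<mu> = (SOME (p, q). profile \<mu> \<beta> 0 (src2_1 \<beta> \<mu>) (src2_2 \<beta> \<mu>) p q)"

text \<open>The factor of \<kappa>^3 in the sources of order three, as far as it does not stem from
  the time derivative of the first correction.\<close>

definition src3_1 :: "real \<Rightarrow> real \<Rightarrow> real \<Rightarrow> real" where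
  "src3_1 \<beta> \<mu> z = (let a = fst (W1 \<beta> \<mu>); b = snd (W1 \<beta> \<mu>); c = fst (W2 \<beta> \<mu>); d = snd (W2 \<beta> \<mu>) in
     alpha0 \<beta> \<mu> * deriv c z + deriv d z - z * deriv b z
     - 2 * (2 * \<phi> z * (a z * d z + c z * b z) + (a z)\<^sup>2 * b z + (b z) ^ 3))"

definition src3_2 :: "real \<Rightarrow> real \<Rightarrow> real \<Rightarrow> real" where
  "src3_2 \<beta> \<mu> z = (let a = fst (W1 \<beta> \<mu>); b = snd (W1 \<beta> \<mu>); c = fst (W2 \<beta> \<mu>); d = snd (W2 \<beta> \<mu>) in
     deriv c z - alpha0 \<beta> \<mu> * deriv d z - z * deriv a z + z\<^sup>2 * deriv \<phi> z
     - 2 * (6 * \<phi> z * a z * c z + (a z) ^ 3 + 2 * \<phi> z * b z * d z + (b z)\<^sup>2 * a z))"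

text \<open>The additional terms with \<open>alpha0\<close> come from the time derivative of
  \<kappa> W1: at leading order the curvature changes along normals by \<alpha> (Lap \<kappa> +
  \<kappa>^3), and the cubic part is collected here.\<close>

definition zeta :: "real \<Rightarrow> real \<Rightarrow> real" where
  "zeta \<beta> \<mu> = solv \<beta> \<mu> (\<lambda>z. src3_1 \<beta> \<mu> z + alpha0 \<beta> \<mu> * fst (W1 \<beta> \<mu>) z)
     (\<lambda>z. src3_2 \<beta> \<mu> z - alpha0 \<beta> \<mu> * snd (W1 \<beta> \<mu>) z)"

lemma profile_zero: "profile \<mu> \<beta> 0 (\<lambda>z. 0) (\<lambda>z. 0) (\<lambda>z. 0) (\<lambda>z. 0)"
proof -
  have "twice_differentiable (\<lambda>z. 0)" using twice_differentiableI[of "\<lambda>z. 0" "\<lambda>z. 0" "\<lambda>z. 0"] by auto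
  then show ?thesis by (auto simp: profile_def in_L2_def L2_inner_def opD_def opC_def)
qed

lemma profile_scale:
  assumes "profile \<mu> \<beta> V f g p q"
  shows "profile \<mu> \<beta> (c * V) (\<lambda>z. c * f z) (\<lambda>z. c * g z) (\<lambda>z. c * p z) (\<lambda>z. c * q z)"
  using profile_comb[OF profile_zero assms, of "- c"] by simp

text \<open>The reflected profile solves the same problem, so uniqueness transfers the symmetry of
  the sources to the solution.\<close>

lemma profile_even:
  assumes "profile \<mu> \<beta> V f g p q" "\<mu> > -1" "\<beta> > 0" "\<And>z. f (- z) = f z" "\<And>z. g (- z) = g z"
  shows "p (- z) = p z" "q (- z) = q z"
proof -
  have "profile \<mu> \<beta> V f g (\<lambda>z. p (- z)) (\<lambda>z. q (- z))" using profile_reflect[OF assms(1)] assms(4,5) by simp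
  from profile_unique(2,3)[OF this assms(1-3)] show "p (- z) = p z" "q (- z) = q z" by (auto dest: fun_cong)
qed

text \<open>Here V is 0, in accordance with parity: the term V \<phi>' is even and would spoil an
  odd equation.\<close>

lemma profile_odd:
  assumes "profile \<mu> \<beta> 0 f g p q" "\<mu> > -1" "\<beta> > 0" "\<And>z. f (- z) = - f z" "\<And>z. g (- z) = - g z"
  shows "p (- z) = - p z" "q (- z) = - q z"
proof -
  have "profile \<mu> \<beta> 0 f g (\<lambda>z. - p (- z)) (\<lambda>z. - q (- z))"
    using profile_scale[OF profile_reflect[OF assms(1)], of "-1"] assms(4,5) by simp
  from profile_unique(2,3)[OF this assms(1-3)] show "p (- z) = - p z" "q (- z) = - q z"
    by (auto simp: fun_eq_iff minus_equation_iff)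
qed

lemma deriv_even:
  assumes "twice_differentiable p" "\<And>z. p (- z) = p z" shows "deriv p (- z) = - deriv p z"
proof -
  have "(\<lambda>z. p (- z)) = p" using assms(2) by auto
  then have "deriv p = (\<lambda>z. - deriv p (- z))" using twice_differentiable_reflect(2)[OF assms(1)] by simp
  from fun_cong[OF this, of z] show ?thesis by simp
qed

lemma deriv_odd:
  assumes "twice_differentiable p" "\<And>z. p (- z) = - p z" shows "deriv p (- z) = deriv p z"
proof -
  have "p = (\<lambda>z. - p (- z))" using assms(2) by auto
  moreover have "((\<lambda>z. - p (- z)) has_real_derivative deriv p (- z)) (at z)" for z
    by (rule DERIV_cong[OF DERIV_minus[OF DERIV_chain2[where f = p and g = uminus, OF twice_differentiableD(1)[OF assms(1)]]]])
      (auto intro!: derivative_eq_intros)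
  ultimately have "(p has_real_derivative deriv p (- z)) (at z)" by metis
  then show ?thesis by (simp add: DERIV_imp_deriv)
qed

text \<open>The inner problem reduced to series algebra. The curve enters through the series of
  curvature, normal velocity, reciprocal speed, speed, tangential velocity and rotation rate, and
  the field through the series of its two components. The equations are stated for any inverse
  \<open>H\<close> of 1 + \<epsilon> z \<kappa>, which characterizes the inverse by its defining
  relation.\<close>

locale formal_inner =
  fixes I :: "real set" and \<beta> \<mu> :: real
    and K V R Sg Ta Th :: "real \<times> real \<Rightarrow> real fps" and P Q :: "real \<times> real \<times> real \<Rightarrow> real fps"
  assumes I: "open I" and beta: "\<beta> > 0" and mu1: "\<mu> \<ge> -1"
    and Kd: "\<And>y. y \<in> I \<times> UNIV \<Longrightarrow> fps_diff_at K y" "\<And>y. y \<in> I \<times> UNIV \<Longrightarrow> fps_diff_at (fDir (0, 1) K) y"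
    and Pd: "\<And>w. w \<in> I \<times> UNIV \<times> UNIV \<Longrightarrow> fps_diff_at P w" "\<And>w v. w \<in> I \<times> UNIV \<times> UNIV \<Longrightarrow> fps_diff_at (fDir v P) w"
    and Qd: "\<And>w. w \<in> I \<times> UNIV \<times> UNIV \<Longrightarrow> fps_diff_at Q w" "\<And>w v. w \<in> I \<times> UNIV \<times> UNIV \<Longrightarrow> fps_diff_at (fDir v Q) w"
    and lead: "\<And>T s z. T \<in> I \<Longrightarrow> P (T, s, z) $$ 0 = \<phi> z" "\<And>T s z. T \<in> I \<Longrightarrow> Q (T, s, z) $$ 0 = 0"
    and L2: "\<And>i T s. i \<ge> 1 \<Longrightarrow> T \<in> I \<Longrightarrow> in_L2 (\<lambda>z. P (T, s, z) $$ i)"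
      "\<And>i T s. i \<ge> 1 \<Longrightarrow> T \<in> I \<Longrightarrow> in_L2 (\<lambda>z. Q (T, s, z) $$ i)"
      "\<And>i T s. i \<ge> 1 \<Longrightarrow> T \<in> I \<Longrightarrow> L2_inner (\<lambda>z. P (T, s, z) $$ i) (deriv \<phi>) = 0"
    and evolution: "\<And>y. y \<in> I \<times> UNIV \<Longrightarrow> fDir (1, 0) K y - Ta y * R y * fDir (0, 1) K y
      = - (R y * R y * fDir (0, 1) (fDir (0, 1) V) y - fDir (0, 1) Sg y * R y * R y * R y * fDir (0, 1) V y) - K y * K y * V y"
    and nonflat: "\<And>T. T \<in> I \<Longrightarrow> \<exists>s. K (T, s) $$ 0 \<noteq> 0"
    and pde: "\<And>T s z H. T \<in> I \<Longrightarrow> H * (1 + fps_X * (fps_const z * K (T, s))) = 1 \<Longrightarrow>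
      fps_X * (fps_X * (fDir (1, 0, 0) P (T, s, z) - (Ta (T, s) - fps_X * (fps_const z * Th (T, s))) * R (T, s) * H * fDir (0, 1, 0) P (T, s, z)))
        - fps_X * (V (T, s) * fDir (0, 0, 1) P (T, s, z))
      = - (fDir (0, 0, 1) (fDir (0, 0, 1) Q) (T, s, z) + fps_X * (K (T, s) * H * fDir (0, 0, 1) Q (T, s, z))
         + fps_X * (fps_X * (R (T, s) * H * (R (T, s) * H) * fDir (0, 1, 0) (fDir (0, 1, 0) Q) (T, s, z)
            - (fDir (0, 1) Sg (T, s) * (1 + fps_X * (fps_const z * K (T, s))) + Sg (T, s) * (fps_X * (fps_const z * fDir (0, 1) K (T, s))))
              * (R (T, s) * H * (R (T, s) * H) * (R (T, s) * H)) * fDir (0, 1, 0) Q (T, s, z)))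
         - fps_const 2 * ((P (T, s, z) * P (T, s, z) + Q (T, s, z) * Q (T, s, z)) * Q (T, s, z)) + fps_const (1 - \<mu>) * Q (T, s, z))"
      "\<And>T s z H. T \<in> I \<Longrightarrow> H * (1 + fps_X * (fps_const z * K (T, s))) = 1 \<Longrightarrow>
      fps_X * (fps_X * (fDir (1, 0, 0) Q (T, s, z) - (Ta (T, s) - fps_X * (fps_const z * Th (T, s))) * R (T, s) * H * fDir (0, 1, 0) Q (T, s, z)))
        - fps_X * (V (T, s) * fDir (0, 0, 1) Q (T, s, z))
      = fDir (0, 0, 1) (fDir (0, 0, 1) P) (T, s, z) + fps_X * (K (T, s) * H * fDir (0, 0, 1) P (T, s, z))
         + fps_X * (fps_X * (R (T, s) * H * (R (T, s) * H) * fDir (0, 1, 0) (fDir (0, 1, 0) P) (T, s, z)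
            - (fDir (0, 1) Sg (T, s) * (1 + fps_X * (fps_const z * K (T, s))) + Sg (T, s) * (fps_X * (fps_const z * fDir (0, 1) K (T, s))))
              * (R (T, s) * H * (R (T, s) * H) * (R (T, s) * H)) * fDir (0, 1, 0) P (T, s, z)))
         - fps_const 2 * ((P (T, s, z) * P (T, s, z) + Q (T, s, z) * Q (T, s, z)) * P (T, s, z)) + fps_const 2 * P (T, s, z) - fps_const \<beta> * Q (T, s, z)"
begin

text \<open>The time derivative in normal coordinates, corrected for the tangential drift of the
  frame. The normal motion is kept apart, in the term with \<open>V\<close>, because it is of lower
  order in \<epsilon>.\<close>

definition mat_op :: "(real \<times> real \<times> real \<Rightarrow> real fps) \<Rightarrow> real fps \<Rightarrow> real \<Rightarrow> real \<Rightarrow> real \<Rightarrow> real fps" where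
  "mat_op F H T s z = fDir (1, 0, 0) F (T, s, z)
     - (Ta (T, s) - fps_X * (fps_const z * Th (T, s))) * R (T, s) * H * fDir (0, 1, 0) F (T, s, z)"

definition tan_op :: "(real \<times> real \<times> real \<Rightarrow> real fps) \<Rightarrow> real fps \<Rightarrow> real \<Rightarrow> real \<Rightarrow> real \<Rightarrow> real fps" where
  "tan_op F H T s z = R (T, s) * H * (R (T, s) * H) * fDir (0, 1, 0) (fDir (0, 1, 0) F) (T, s, z)
     - (fDir (0, 1) Sg (T, s) * (1 + fps_X * (fps_const z * K (T, s))) + Sg (T, s) * (fps_X * (fps_const z * fDir (0, 1) K (T, s))))
       * (R (T, s) * H * (R (T, s) * H) * (R (T, s) * H)) * fDir (0, 1, 0) F (T, s, z)"

definition Hf :: "real \<Rightarrow> real \<Rightarrow> real \<Rightarrow> real fps" where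
  "Hf T s z = inverse (1 + fps_X * (fps_const z * K (T, s)))"

definition DtK :: "real \<times> real \<Rightarrow> real fps" where
  "DtK y = fDir (1, 0) K y - Ta y * R y * fDir (0, 1) K y"

definition LapK :: "real \<times> real \<Rightarrow> real fps" where
  "LapK y = R y * R y * fDir (0, 1) (fDir (0, 1) K) y - fDir (0, 1) Sg y * R y * R y * R y * fDir (0, 1) K y"

lemma Hf: "Hf T s z * (1 + fps_X * (fps_const z * K (T, s))) = 1"
  unfolding Hf_def by (rule inverse_mult_eq_1) simp

lemma Hf_nth:
  "Hf T s z $$ 0 = 1" "Hf T s z $$ Suc 0 = - (z * K (T, s) $$ 0)"
  "Hf T s z $$ 2 = z\<^sup>2 * (K (T, s) $$ 0)\<^sup>2 - z * K (T, s) $$ Suc 0"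
  "Hf T s z $$ 3 = - (z ^ 3 * (K (T, s) $$ 0) ^ 3) + 2 * z\<^sup>2 * K (T, s) $$ 0 * K (T, s) $$ Suc 0 - z * K (T, s) $$ 2"
proof -
  have e: "(Hf T s z * (1 + fps_X * (fps_const z * K (T, s)))) $$ n = 1 $$ n" for n by (simp only: Hf)
  show 0: "Hf T s z $$ 0 = 1" using e[of 0] by simp
  show 1: "Hf T s z $$ Suc 0 = - (z * K (T, s) $$ 0)" using e[of "Suc 0"] 0 by simp
  show 2: "Hf T s z $$ 2 = z\<^sup>2 * (K (T, s) $$ 0)\<^sup>2 - z * K (T, s) $$ Suc 0"
    using e[of 2] 0 1 by (simp add: fps_mult_small fps_X_mult_small fps_one_nth power2_eq_square algebra_simps)
  show "Hf T s z $$ 3 = - (z ^ 3 * (K (T, s) $$ 0) ^ 3) + 2 * z\<^sup>2 * K (T, s) $$ 0 * K (T, s) $$ Suc 0 - z * K (T, s) $$ 2"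
    using e[of 3] 0 1 2 by (simp add: fps_mult_small fps_X_mult_small fps_one_nth power2_eq_square power3_eq_cube algebra_simps)
qed

lemma pdeH:
  assumes "T \<in> I"
  shows "fDir (0, 0, 1) (fDir (0, 0, 1) Q) (T, s, z)
      = - (fps_X * (fps_X * mat_op P (Hf T s z) T s z)) + fps_X * (V (T, s) * fDir (0, 0, 1) P (T, s, z))
        - fps_X * (K (T, s) * Hf T s z * fDir (0, 0, 1) Q (T, s, z)) - fps_X * (fps_X * tan_op Q (Hf T s z) T s z)
        + fps_const 2 * ((P (T, s, z) * P (T, s, z) + Q (T, s, z) * Q (T, s, z)) * Q (T, s, z)) - fps_const (1 - \<mu>) * Q (T, s, z)"
    "fDir (0, 0, 1) (fDir (0, 0, 1) P) (T, s, z)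
      = fps_X * (fps_X * mat_op Q (Hf T s z) T s z) - fps_X * (V (T, s) * fDir (0, 0, 1) Q (T, s, z))
        - fps_X * (K (T, s) * Hf T s z * fDir (0, 0, 1) P (T, s, z)) - fps_X * (fps_X * tan_op P (Hf T s z) T s z)
        + fps_const 2 * ((P (T, s, z) * P (T, s, z) + Q (T, s, z) * Q (T, s, z)) * P (T, s, z))
        - fps_const 2 * P (T, s, z) + fps_const \<beta> * Q (T, s, z)"
  using pde[OF assms Hf[of T s z]] unfolding mat_op_def tan_op_def
  by (simp_all only: algebra_simps) (simp_all add: algebra_simps eq_neg_iff_add_eq_0)

lemma z_derivs:
  assumes "T \<in> I"
  shows "twice_differentiable (\<lambda>z. P (T, s, z) $$ i)" "twice_differentiable (\<lambda>z. Q (T, s, z) $$ i)"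
    "fDir (0, 0, 1) P (T, s, z) $$ i = deriv (\<lambda>z. P (T, s, z) $$ i) z"
    "fDir (0, 0, 1) Q (T, s, z) $$ i = deriv (\<lambda>z. Q (T, s, z) $$ i) z"
    "fDir (0, 0, 1) (fDir (0, 0, 1) P) (T, s, z) $$ i = deriv (deriv (\<lambda>z. P (T, s, z) $$ i)) z"
    "fDir (0, 0, 1) (fDir (0, 0, 1) Q) (T, s, z) $$ i = deriv (deriv (\<lambda>z. Q (T, s, z) $$ i)) z"
proof -
  have gen: "twice_differentiable (\<lambda>z. F (T, s, z) $$ i) \<and> fDir (0, 0, 1) F (T, s, z) $$ i = deriv (\<lambda>z. F (T, s, z) $$ i) z
     \<and> fDir (0, 0, 1) (fDir (0, 0, 1) F) (T, s, z) $$ i = deriv (deriv (\<lambda>z. F (T, s, z) $$ i)) z"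
    if F: "\<And>w. w \<in> I \<times> UNIV \<times> UNIV \<Longrightarrow> fps_diff_at F w" "\<And>w v. w \<in> I \<times> UNIV \<times> UNIV \<Longrightarrow> fps_diff_at (fDir v F) w" for F
  proof -
    have d: "(\<lambda>w. F w $$ i) differentiable (at (T, s, z))" "(\<lambda>w. fDir (0, 0, 1) F w $$ i) differentiable (at (T, s, z))" for z
      using F[of "(T, s, z)"] assms unfolding fps_diff_at_def by auto
    have 1: "((\<lambda>z. F (T, s, z) $$ i) has_real_derivative fDir (0, 0, 1) F (T, s, z) $$ i) (at z)" for z
      using partial_derivs3(3)[OF d(1)] by simp
    have 2: "((\<lambda>z. fDir (0, 0, 1) F (T, s, z) $$ i) has_real_derivative fDir (0, 0, 1) (fDir (0, 0, 1) F) (T, s, z) $$ i) (at z)" for z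
      using partial_derivs3(3)[OF d(2)] unfolding fDir_nth[of _ "fDir (0, 0, 1) F"] .
    show ?thesis using twice_differentiableI[of "\<lambda>z. F (T, s, z) $$ i", OF 1 2] by auto
  qed
  show "twice_differentiable (\<lambda>z. P (T, s, z) $$ i)" "twice_differentiable (\<lambda>z. Q (T, s, z) $$ i)"
    "fDir (0, 0, 1) P (T, s, z) $$ i = deriv (\<lambda>z. P (T, s, z) $$ i) z"
    "fDir (0, 0, 1) Q (T, s, z) $$ i = deriv (\<lambda>z. Q (T, s, z) $$ i) z"
    "fDir (0, 0, 1) (fDir (0, 0, 1) P) (T, s, z) $$ i = deriv (deriv (\<lambda>z. P (T, s, z) $$ i)) z"
    "fDir (0, 0, 1) (fDir (0, 0, 1) Q) (T, s, z) $$ i = deriv (deriv (\<lambda>z. Q (T, s, z) $$ i)) z"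
    using gen[OF Pd] gen[OF Qd] by auto
qed

text \<open>The corrections will be sums of products of a function on the curve with a profile in z.
  At fixed z the profiles are constants, so the derivatives in T and s fall on the coefficients
  alone.\<close>

lemma separated_derivs:
  fixes F :: "real \<times> real \<times> real \<Rightarrow> real fps"
  assumes F: "\<And>w. w \<in> I \<times> UNIV \<times> UNIV \<Longrightarrow> fps_diff_at F w" "\<And>w v. w \<in> I \<times> UNIV \<times> UNIV \<Longrightarrow> fps_diff_at (fDir v F) w"
    and k: "\<And>y. y \<in> I \<times> UNIV \<Longrightarrow> k differentiable (at y)" "\<And>y. y \<in> I \<times> UNIV \<Longrightarrow> dS k differentiable (at y)"
    and k': "\<And>y. y \<in> I \<times> UNIV \<Longrightarrow> k' differentiable (at y)" "\<And>y. y \<in> I \<times> UNIV \<Longrightarrow> dS k' differentiable (at y)"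
    and eq: "\<And>T s z. T \<in> I \<Longrightarrow> F (T, s, z) $$ i = k (T, s) * a z + k' (T, s) * b z + c z" and T: "T \<in> I"
  shows "fDir (1, 0, 0) F (T, s, z) $$ i = dT k (T, s) * a z + dT k' (T, s) * b z"
    "fDir (0, 1, 0) F (T, s, z) $$ i = dS k (T, s) * a z + dS k' (T, s) * b z"
    "fDir (0, 1, 0) (fDir (0, 1, 0) F) (T, s, z) $$ i = dS (dS k) (T, s) * a z + dS (dS k') (T, s) * b z"
proof -
  have d1: "(\<lambda>w. F w $$ i) differentiable (at (T, s, z))" if "T \<in> I" for T s z
    using F(1)[of "(T, s, z)"] that unfolding fps_diff_at_def by auto
  have d2: "(\<lambda>w. fDir v F w $$ i) differentiable (at (T, s, z))" if "T \<in> I" for T s z v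
    using F(2)[of "(T, s, z)" v] that unfolding fps_diff_at_def by auto
  have kd: "k differentiable (at (T, s))" "dS k differentiable (at (T, s))" "k' differentiable (at (T, s))" "dS k' differentiable (at (T, s))"
    if "T \<in> I" for T s using k k' that by auto
  have s: "fDir (0, 1, 0) F (T, s, z) $$ i = dS k (T, s) * a z + dS k' (T, s) * b z" if "T \<in> I" for T s z
  proof -
    have "((\<lambda>s. F (T, s, z) $$ i) has_real_derivative fDir (0, 1, 0) F (T, s, z) $$ i) (at s)"
      using partial_derivs3(2)[OF d1[OF that]] by simp
    moreover have "((\<lambda>s. F (T, s, z) $$ i) has_real_derivative dS k (T, s) * a z + dS k' (T, s) * b z) (at s)"
      unfolding eq[OF that] by (auto intro!: derivative_eq_intros partial_derivs(1) kd that)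
    ultimately show ?thesis by (rule DERIV_unique)
  qed
  show "fDir (0, 1, 0) F (T, s, z) $$ i = dS k (T, s) * a z + dS k' (T, s) * b z" by (rule s[OF T])
  have "((\<lambda>s. fDir (0, 1, 0) F (T, s, z) $$ i) has_real_derivative fDir (0, 1, 0) (fDir (0, 1, 0) F) (T, s, z) $$ i) (at s)"
    using partial_derivs3(2)[OF d2[OF T]] unfolding fDir_nth[of _ "fDir (0, 1, 0) F"] .
  moreover have "((\<lambda>s. fDir (0, 1, 0) F (T, s, z) $$ i) has_real_derivative dS (dS k) (T, s) * a z + dS (dS k') (T, s) * b z) (at s)"
    unfolding s[OF T] by (auto intro!: derivative_eq_intros partial_derivs(1) kd T)
  ultimately show "fDir (0, 1, 0) (fDir (0, 1, 0) F) (T, s, z) $$ i = dS (dS k) (T, s) * a z + dS (dS k') (T, s) * b z"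
    by (rule DERIV_unique)
  have "((\<lambda>T. F (T, s, z) $$ i) has_real_derivative fDir (1, 0, 0) F (T, s, z) $$ i) (at T)"
    using partial_derivs3(1)[OF d1[OF T]] by simp
  moreover have "eventually (\<lambda>T. F (T, s, z) $$ i = k (T, s) * a z + k' (T, s) * b z + c z) (nhds T)"
    using eventually_nhds_in_open[OF I T] by eventually_elim (rule eq)
  ultimately have "((\<lambda>T. k (T, s) * a z + k' (T, s) * b z + c z) has_real_derivative fDir (1, 0, 0) F (T, s, z) $$ i) (at T)"
    by (simp add: DERIV_cong_ev)
  moreover have "((\<lambda>T. k (T, s) * a z + k' (T, s) * b z + c z) has_real_derivative dT k (T, s) * a z + dT k' (T, s) * b z) (at T)"
    by (auto intro!: derivative_eq_intros partial_derivs(2) kd T)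
  ultimately show "fDir (1, 0, 0) F (T, s, z) $$ i = dT k (T, s) * a z + dT k' (T, s) * b z" by (rule DERIV_unique)
qed

lemma Kc_diff:
  assumes "y \<in> I \<times> UNIV"
  shows "(\<lambda>y. K y $$ i) differentiable (at y)" "dS (\<lambda>y. K y $$ i) differentiable (at y)"
proof -
  show "(\<lambda>y. K y $$ i) differentiable (at y)" using Kd(1)[OF assms] by (simp add: fps_diff_at_def)
  have "(\<lambda>y. fDir (0, 1) K y $$ i) differentiable (at y)" using Kd(2)[OF assms] unfolding fps_diff_at_def by blast
  then show "dS (\<lambda>y. K y $$ i) differentiable (at y)" by simp
qed

lemma leading_tangential:
  fixes F :: "real \<times> real \<times> real \<Rightarrow> real fps"
  assumes F: "\<And>w. w \<in> I \<times> UNIV \<times> UNIV \<Longrightarrow> fps_diff_at F w" "\<And>w v. w \<in> I \<times> UNIV \<times> UNIV \<Longrightarrow> fps_diff_at (fDir v F) w"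
    and eq: "\<And>T s z. T \<in> I \<Longrightarrow> F (T, s, z) $$ 0 = c z" and T: "T \<in> I"
  shows "fDir (1, 0, 0) F (T, s, z) $$ 0 = 0" "fDir (0, 1, 0) F (T, s, z) $$ 0 = 0" "fDir (0, 1, 0) (fDir (0, 1, 0) F) (T, s, z) $$ 0 = 0"
proof -
  have e: "F (T, s, z) $$ 0 = (\<lambda>y. 0) (T, s) * (\<lambda>z. 0) z + (\<lambda>y. 0) (T, s) * (\<lambda>z. 0) z + c z" if "T \<in> I" for T s z
    using eq[OF that] by simp
  have k: "(\<lambda>y::real \<times> real. 0::real) differentiable (at y)" "dS (\<lambda>y::real \<times> real. 0::real) differentiable (at y)" for y
    by simp_all
  note s = separated_derivs[where F = F and k = "\<lambda>y. 0" and k' = "\<lambda>y. 0" and a = "\<lambda>z. 0" and b = "\<lambda>z. 0" and c = c and i = 0]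
  show "fDir (1, 0, 0) F (T, s, z) $$ 0 = 0"
    using s(1)[OF F(1) F(2) k(1) k(2) k(1) k(2) e T, of s z] by simp
  show "fDir (0, 1, 0) F (T, s, z) $$ 0 = 0"
    using s(2)[OF F(1) F(2) k(1) k(2) k(1) k(2) e T, of s z] by simp
  show "fDir (0, 1, 0) (fDir (0, 1, 0) F) (T, s, z) $$ 0 = 0"
    using s(3)[OF F(1) F(2) k(1) k(2) k(1) k(2) e T, of s z] by simp
qed

lemma leading_derivs:
  assumes "T \<in> I"
  shows "fDir (1, 0, 0) P (T, s, z) $$ 0 = 0" "fDir (0, 1, 0) P (T, s, z) $$ 0 = 0" "fDir (0, 1, 0) (fDir (0, 1, 0) P) (T, s, z) $$ 0 = 0"
    "fDir (1, 0, 0) Q (T, s, z) $$ 0 = 0" "fDir (0, 1, 0) Q (T, s, z) $$ 0 = 0" "fDir (0, 1, 0) (fDir (0, 1, 0) Q) (T, s, z) $$ 0 = 0"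
    "fDir (0, 0, 1) P (T, s, z) $$ 0 = deriv \<phi> z" "fDir (0, 0, 1) Q (T, s, z) $$ 0 = 0"
proof -
  show "fDir (1, 0, 0) P (T, s, z) $$ 0 = 0" "fDir (0, 1, 0) P (T, s, z) $$ 0 = 0" "fDir (0, 1, 0) (fDir (0, 1, 0) P) (T, s, z) $$ 0 = 0"
    by (rule leading_tangential[OF Pd(1) Pd(2) lead(1) assms]; assumption)+
  show "fDir (1, 0, 0) Q (T, s, z) $$ 0 = 0" "fDir (0, 1, 0) Q (T, s, z) $$ 0 = 0" "fDir (0, 1, 0) (fDir (0, 1, 0) Q) (T, s, z) $$ 0 = 0"
    by (rule leading_tangential[where c = "\<lambda>z. 0", OF Qd(1) Qd(2) lead(2) assms]; assumption)+
  show "fDir (0, 0, 1) P (T, s, z) $$ 0 = deriv \<phi> z" "fDir (0, 0, 1) Q (T, s, z) $$ 0 = 0"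
    unfolding z_derivs(3,4)[OF assms] lead(1,2)[OF assms] by simp_all
qed

text \<open>The operator carries the factor \<epsilon>^2 in the equation, so its coefficients up to
  2 serve all equations up to order four.\<close>

lemma mat_op_nth:
  assumes T: "T \<in> I" and F: "fDir (1, 0, 0) F (T, s, z) $$ 0 = 0" "fDir (0, 1, 0) F (T, s, z) $$ 0 = 0"
  shows "mat_op F (Hf T s z) T s z $$ 0 = 0"
    "mat_op F (Hf T s z) T s z $$ Suc 0 = fDir (1, 0, 0) F (T, s, z) $$ Suc 0
        - Ta (T, s) $$ 0 * R (T, s) $$ 0 * fDir (0, 1, 0) F (T, s, z) $$ Suc 0"
    "mat_op F (Hf T s z) T s z $$ 2 = fDir (1, 0, 0) F (T, s, z) $$ 2
        - Ta (T, s) $$ 0 * R (T, s) $$ 0 * fDir (0, 1, 0) F (T, s, z) $$ 2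
        - (Ta (T, s) $$ 0 * R (T, s) $$ Suc 0 + Ta (T, s) $$ Suc 0 * R (T, s) $$ 0
           - z * (Ta (T, s) $$ 0 * R (T, s) $$ 0 * K (T, s) $$ 0 + Th (T, s) $$ 0 * R (T, s) $$ 0)) * fDir (0, 1, 0) F (T, s, z) $$ Suc 0"
  unfolding mat_op_def using F
  by (simp_all add: fps_mult_small fps_X_mult_small Hf_nth algebra_simps del: fDir_nth)

lemma tan_op_nth:
  assumes T: "T \<in> I" and F: "fDir (0, 1, 0) F (T, s, z) $$ 0 = 0" "fDir (0, 1, 0) (fDir (0, 1, 0) F) (T, s, z) $$ 0 = 0"
  shows "tan_op F (Hf T s z) T s z $$ 0 = 0"
    "tan_op F (Hf T s z) T s z $$ Suc 0 = (R (T, s) $$ 0)\<^sup>2 * fDir (0, 1, 0) (fDir (0, 1, 0) F) (T, s, z) $$ Suc 0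
        - fDir (0, 1) Sg (T, s) $$ 0 * (R (T, s) $$ 0) ^ 3 * fDir (0, 1, 0) F (T, s, z) $$ Suc 0"
    "tan_op F (Hf T s z) T s z $$ 2 = (R (T, s) $$ 0)\<^sup>2 * fDir (0, 1, 0) (fDir (0, 1, 0) F) (T, s, z) $$ 2
        + (2 * R (T, s) $$ 0 * R (T, s) $$ Suc 0 - 2 * z * K (T, s) $$ 0 * (R (T, s) $$ 0)\<^sup>2) * fDir (0, 1, 0) (fDir (0, 1, 0) F) (T, s, z) $$ Suc 0
        - fDir (0, 1) Sg (T, s) $$ 0 * (R (T, s) $$ 0) ^ 3 * fDir (0, 1, 0) F (T, s, z) $$ 2
        - (fDir (0, 1) Sg (T, s) $$ Suc 0 * (R (T, s) $$ 0) ^ 3 + 3 * fDir (0, 1) Sg (T, s) $$ 0 * (R (T, s) $$ 0)\<^sup>2 * R (T, s) $$ Suc 0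
           + z * (Sg (T, s) $$ 0 * fDir (0, 1) K (T, s) $$ 0 - 2 * fDir (0, 1) Sg (T, s) $$ 0 * K (T, s) $$ 0) * (R (T, s) $$ 0) ^ 3)
          * fDir (0, 1, 0) F (T, s, z) $$ Suc 0"
  unfolding tan_op_def using F
  by (simp_all add: fps_mult_small fps_X_mult_small Hf_nth algebra_simps power2_eq_square power3_eq_cube del: fDir_nth)

end

lemma cubic_nth:
  fixes A B :: "real fps"
  assumes "B $$ 0 = 0"
  shows "((A * A + B * B) * B) $$ Suc 0 = (A $$ 0)\<^sup>2 * B $$ Suc 0"
    "((A * A + B * B) * A) $$ Suc 0 = 3 * (A $$ 0)\<^sup>2 * A $$ Suc 0"
    "((A * A + B * B) * B) $$ 2 = (A $$ 0)\<^sup>2 * B $$ 2 + 2 * A $$ 0 * A $$ Suc 0 * B $$ Suc 0"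
    "((A * A + B * B) * A) $$ 2 = 3 * (A $$ 0)\<^sup>2 * A $$ 2 + 3 * A $$ 0 * (A $$ Suc 0)\<^sup>2 + A $$ 0 * (B $$ Suc 0)\<^sup>2"
    "((A * A + B * B) * B) $$ 3 = (A $$ 0)\<^sup>2 * B $$ 3 + 2 * A $$ 0 * (A $$ Suc 0 * B $$ 2 + A $$ 2 * B $$ Suc 0)
       + (A $$ Suc 0)\<^sup>2 * B $$ Suc 0 + (B $$ Suc 0) ^ 3"
    "((A * A + B * B) * A) $$ 3 = 3 * (A $$ 0)\<^sup>2 * A $$ 3 + 6 * A $$ 0 * A $$ Suc 0 * A $$ 2 + (A $$ Suc 0) ^ 3
       + 2 * A $$ 0 * B $$ Suc 0 * B $$ 2 + (B $$ Suc 0)\<^sup>2 * A $$ Suc 0"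
    "((A * A + B * B) * B) $$ 4 = (A $$ 0)\<^sup>2 * B $$ 4 + 2 * A $$ 0 * (A $$ Suc 0 * B $$ 3 + A $$ 2 * B $$ 2 + A $$ 3 * B $$ Suc 0)
       + 2 * A $$ Suc 0 * A $$ 2 * B $$ Suc 0 + (A $$ Suc 0)\<^sup>2 * B $$ 2 + 3 * (B $$ Suc 0)\<^sup>2 * B $$ 2"
    "((A * A + B * B) * A) $$ 4 = 3 * (A $$ 0)\<^sup>2 * A $$ 4 + 3 * A $$ 0 * (2 * A $$ Suc 0 * A $$ 3 + (A $$ 2)\<^sup>2)
       + 3 * (A $$ Suc 0)\<^sup>2 * A $$ 2 + A $$ 0 * (2 * B $$ Suc 0 * B $$ 3 + (B $$ 2)\<^sup>2)
       + 2 * B $$ Suc 0 * B $$ 2 * A $$ Suc 0 + (B $$ Suc 0)\<^sup>2 * A $$ 2"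
  using assms
  by (simp_all add: fps_mult_small power2_eq_square power3_eq_cube algebra_simps)

lemma solv_zero: "solv \<beta> \<mu> (\<lambda>z. 0) (\<lambda>z. 0) = 0"
  by (rule solv_odd) simp_all

lemma solv_scale:
  assumes "\<mu> > -1" "subexp f" "subexp g"
  shows "solv \<beta> \<mu> (\<lambda>z. c * f z) (\<lambda>z. c * g z) = c * solv \<beta> \<mu> f g"
  using solv_add[OF assms(1) subexp_const[of 0] subexp_const[of 0] assms(2,3), where c = c] by (simp add: solv_zero)

lemma deriv_phi_facts [simp]: "deriv \<phi> (- z) = deriv \<phi> z" "subexp (deriv \<phi>)"
  by (simp_all add: deriv_phi)

lemma profile_cong:
  assumes "profile \<mu> \<beta> v f g p q" "\<And>z. f z = f' z" "\<And>z. g z = g' z" shows "profile \<mu> \<beta> v f' g' p q"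
  using assms(1) unfolding ext[of f f', OF assms(2)] ext[of g g', OF assms(3)] .

section \<open>The inner problems of orders one to four\<close>

context formal_inner
begin

text \<open>Linearizing the cubic term at (\<phi>, 0) gives 6 \<phi>^2 for p and 2 \<phi>^2 for q.
  With \<phi>^2 = 1 - \<psi>^2 these are the potentials of C and D.\<close>

lemma profileI:
  assumes T: "T \<in> I" and i: "i \<ge> 1"
    and q: "\<And>z. fDir (0, 0, 1) (fDir (0, 0, 1) Q) (T, s, z) $$ i
      = v * deriv \<phi> z - f z + 2 * (\<phi> z)\<^sup>2 * Q (T, s, z) $$ i - (1 - \<mu>) * Q (T, s, z) $$ i"
    and p: "\<And>z. fDir (0, 0, 1) (fDir (0, 0, 1) P) (T, s, z) $$ i
      = - g z + 6 * (\<phi> z)\<^sup>2 * P (T, s, z) $$ i - 2 * P (T, s, z) $$ i + \<beta> * Q (T, s, z) $$ i"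
  shows "profile \<mu> \<beta> v f g (\<lambda>z. P (T, s, z) $$ i) (\<lambda>z. Q (T, s, z) $$ i)"
proof -
  note zd = z_derivs[OF T]
  have "opD \<mu> (\<lambda>z. Q (T, s, z) $$ i) z = f z - v * deriv \<phi> z" for z
    using q[of z] unfolding opD_def zd(6) psi_sq by (simp add: algebra_simps)
  moreover have "opC (\<lambda>z. P (T, s, z) $$ i) z = g z - \<beta> * Q (T, s, z) $$ i" for z
    using p[of z] unfolding opC_def zd(5) psi_sq by (simp add: algebra_simps)
  ultimately show ?thesis unfolding profile_def using zd(1,2) L2(1)[OF i T] L2(2)[OF i T] L2(3)[OF i T] by auto
qed

text \<open>The coefficients of \<epsilon> to \<epsilon>^4 in the inner equations. The correction of
  order i comes with the velocity coefficient of index i - 1, since the velocity acts through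
  \<epsilon> V d/dz on the leading front.\<close>

lemma order_profiles:
  fixes T s
  defines "y \<equiv> (T, s)" and "p \<equiv> \<lambda>i z. P (T, s, z) $$ i" and "q \<equiv> \<lambda>i z. Q (T, s, z) $$ i"
  assumes T: "T \<in> I"
  shows "profile \<mu> \<beta> (V y $$ 0) (\<lambda>z. 0) (\<lambda>z. K y $$ 0 * deriv \<phi> z) (p (Suc 0)) (q (Suc 0))"
    "profile \<mu> \<beta> (V y $$ Suc 0)
       (\<lambda>z. - V y $$ 0 * deriv (p (Suc 0)) z + K y $$ 0 * deriv (q (Suc 0)) z - 4 * \<phi> z * p (Suc 0) z * q (Suc 0) z)
       (\<lambda>z. V y $$ 0 * deriv (q (Suc 0)) z + K y $$ 0 * deriv (p (Suc 0)) z + (K y $$ Suc 0 - z * (K y $$ 0)\<^sup>2) * deriv \<phi> z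
          - 6 * \<phi> z * (p (Suc 0) z)\<^sup>2 - 2 * \<phi> z * (q (Suc 0) z)\<^sup>2) (p 2) (q 2)"
    "profile \<mu> \<beta> (V y $$ 2)
       (\<lambda>z. mat_op P (Hf T s z) T s z $$ Suc 0 + tan_op Q (Hf T s z) T s z $$ Suc 0
          - V y $$ Suc 0 * deriv (p (Suc 0)) z - V y $$ 0 * deriv (p 2) z
          + K y $$ 0 * deriv (q 2) z + (K y $$ Suc 0 - z * (K y $$ 0)\<^sup>2) * deriv (q (Suc 0)) z
          - 2 * (2 * \<phi> z * (p (Suc 0) z * q 2 z + p 2 z * q (Suc 0) z) + (p (Suc 0) z)\<^sup>2 * q (Suc 0) z + (q (Suc 0) z) ^ 3))
       (\<lambda>z. - mat_op Q (Hf T s z) T s z $$ Suc 0 + tan_op P (Hf T s z) T s z $$ Suc 0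
          + V y $$ Suc 0 * deriv (q (Suc 0)) z + V y $$ 0 * deriv (q 2) z
          + K y $$ 0 * deriv (p 2) z + (K y $$ Suc 0 - z * (K y $$ 0)\<^sup>2) * deriv (p (Suc 0)) z
          + (K y $$ 2 - 2 * z * K y $$ 0 * K y $$ Suc 0 + z\<^sup>2 * (K y $$ 0) ^ 3) * deriv \<phi> z
          - 2 * (6 * \<phi> z * p (Suc 0) z * p 2 z + (p (Suc 0) z) ^ 3 + 2 * \<phi> z * q (Suc 0) z * q 2 z + (q (Suc 0) z)\<^sup>2 * p (Suc 0) z))
       (p 3) (q 3)"
    "profile \<mu> \<beta> (V y $$ 3)
       (\<lambda>z. mat_op P (Hf T s z) T s z $$ 2 + tan_op Q (Hf T s z) T s z $$ 2
          - V y $$ 2 * deriv (p (Suc 0)) z - V y $$ Suc 0 * deriv (p 2) z - V y $$ 0 * deriv (p 3) z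
          + K y $$ 0 * deriv (q 3) z + (K y $$ Suc 0 - z * (K y $$ 0)\<^sup>2) * deriv (q 2) z
          + (K y $$ 2 - 2 * z * K y $$ 0 * K y $$ Suc 0 + z\<^sup>2 * (K y $$ 0) ^ 3) * deriv (q (Suc 0)) z
          - 2 * (2 * \<phi> z * (p (Suc 0) z * q 3 z + p 2 z * q 2 z + p 3 z * q (Suc 0) z)
             + 2 * p (Suc 0) z * p 2 z * q (Suc 0) z + (p (Suc 0) z)\<^sup>2 * q 2 z + 3 * (q (Suc 0) z)\<^sup>2 * q 2 z))
       (\<lambda>z. - mat_op Q (Hf T s z) T s z $$ 2 + tan_op P (Hf T s z) T s z $$ 2
          + V y $$ 2 * deriv (q (Suc 0)) z + V y $$ Suc 0 * deriv (q 2) z + V y $$ 0 * deriv (q 3) z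
          + K y $$ 0 * deriv (p 3) z + (K y $$ Suc 0 - z * (K y $$ 0)\<^sup>2) * deriv (p 2) z
          + (K y $$ 2 - 2 * z * K y $$ 0 * K y $$ Suc 0 + z\<^sup>2 * (K y $$ 0) ^ 3) * deriv (p (Suc 0)) z
          + (K y $$ 3 - z * (2 * K y $$ 0 * K y $$ 2 + (K y $$ Suc 0)\<^sup>2) + 3 * z\<^sup>2 * (K y $$ 0)\<^sup>2 * K y $$ Suc 0
              - z ^ 3 * (K y $$ 0) ^ 4) * deriv \<phi> z
          - 2 * (3 * \<phi> z * (2 * p (Suc 0) z * p 3 z + (p 2 z)\<^sup>2) + 3 * (p (Suc 0) z)\<^sup>2 * p 2 z
             + \<phi> z * (2 * q (Suc 0) z * q 3 z + (q 2 z)\<^sup>2) + 2 * q (Suc 0) z * q 2 z * p (Suc 0) z + (q (Suc 0) z)\<^sup>2 * p 2 z))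
       (p 4) (q 4)"
proof (unfold p_def q_def y_def, goal_cases)
  note ld = leading_derivs(7,8)[OF T]
  have m: "mat_op P (Hf T s z) T s z $$ 0 = 0" "mat_op Q (Hf T s z) T s z $$ 0 = 0" for z
    using mat_op_nth(1)[OF T leading_derivs(1,2)[OF T]] mat_op_nth(1)[OF T leading_derivs(4,5)[OF T]] by auto
  have t: "tan_op P (Hf T s z) T s z $$ 0 = 0" "tan_op Q (Hf T s z) T s z $$ 0 = 0" for z
    using tan_op_nth(1)[OF T leading_derivs(2,3)[OF T]] tan_op_nth(1)[OF T leading_derivs(5,6)[OF T]] by auto
  note zd = z_derivs(3,4)[OF T] and c = cubic_nth[OF lead(2)[OF T]] and l = lead[OF T]
  note e = pdeH[OF T]
  note s1 = fps_X_mult_small m t fps_mult_small Hf_nth ld l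
  note s2 = power2_eq_square power3_eq_cube power4_eq_xxxx algebra_simps
  case 1 show ?case by (rule profileI[OF T]) (simp, ((simp only: e fps_add_nth fps_sub_nth fps_neg_nth fps_mult_left_const_nth c, simp add: s1 zd del: fDir_nth, (simp add: s2)?)[1])+)
  case 2 show ?case by (rule profileI[OF T]) (simp, ((simp only: e fps_add_nth fps_sub_nth fps_neg_nth fps_mult_left_const_nth c, simp add: s1 zd del: fDir_nth, (simp add: s2)?)[1])+)
  case 3 show ?case by (rule profileI[OF T]) (simp, ((simp only: e fps_add_nth fps_sub_nth fps_neg_nth fps_mult_left_const_nth c, simp add: s1 zd del: fDir_nth, (simp add: s2)?)[1])+)
  case 4 show ?case by (rule profileI[OF T]) (simp, ((simp only: e fps_add_nth fps_sub_nth fps_neg_nth fps_mult_left_const_nth c, simp add: s1 zd del: fDir_nth, (simp add: s2)?)[1])+)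
qed

abbreviation "\<alpha> \<equiv> alpha0 \<beta> \<mu>"
abbreviation "wa \<equiv> fst (W1 \<beta> \<mu>)"
abbreviation "wb \<equiv> snd (W1 \<beta> \<mu>)"
abbreviation "wc \<equiv> fst (W2 \<beta> \<mu>)"
abbreviation "wd \<equiv> snd (W2 \<beta> \<mu>)"

text \<open>A time \<open>T\<close> testifies that there is a front, and its point of nonzero
  leading curvature excludes the edge of the parameter interval. At \<mu> = -1 the velocity law is
  therefore vacuous.\<close>

lemma mu: assumes T: "T \<in> I" shows "\<mu> > -1"
proof (rule ccontr)
  assume "\<not> \<mu> > -1"
  then have m: "\<mu> = -1" using mu1 by simp
  obtain s where "K (T, s) $$ 0 \<noteq> 0" using nonflat[OF T] by blast
  then show False using profile_minus1[OF order_profiles(1)[OF T, of s, unfolded m]] by simp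
qed

lemma velocity_0:
  assumes T: "T \<in> I" shows "V (T, s) $$ 0 = - \<alpha> * K (T, s) $$ 0"
proof -
  note m = mu[OF T]
  have "V (T, s) $$ 0 = solv \<beta> \<mu> (\<lambda>z. K (T, s) $$ 0 * 0) (\<lambda>z. K (T, s) $$ 0 * deriv \<phi> z)"
    using profile_solv[OF order_profiles(1)[OF T, of s] _ _ m beta] by simp
  also have "\<dots> = K (T, s) $$ 0 * solv \<beta> \<mu> (\<lambda>z. 0) (deriv \<phi>)" by (rule solv_scale[OF m]) auto
  finally show ?thesis using alpha0_solv(1)[OF m beta] by simp
qed

lemma profile_W1:
  assumes T: "T \<in> I" shows "profile \<mu> \<beta> (- \<alpha>) (\<lambda>z. 0) (deriv \<phi>) wa wb"
proof -
  obtain s where k: "K (T, s) $$ 0 \<noteq> 0" using nonflat[OF T] by blast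
  let ?k = "K (T, s) $$ 0"
  have "profile \<mu> \<beta> (1 / ?k * V (T, s) $$ 0) (\<lambda>z. 1 / ?k * 0) (\<lambda>z. 1 / ?k * (?k * deriv \<phi> z))
    (\<lambda>z. 1 / ?k * P (T, s, z) $$ Suc 0) (\<lambda>z. 1 / ?k * Q (T, s, z) $$ Suc 0)"
    by (rule profile_scale[OF order_profiles(1)[OF T, of s]])
  then have "\<exists>w. case w of (p, q) \<Rightarrow> profile \<mu> \<beta> (- \<alpha>) (\<lambda>z. 0) (deriv \<phi>) p q"
    using k velocity_0[OF T, of s] by (intro exI) (auto simp: field_simps)
  from someI_ex[OF this] show ?thesis unfolding W1_def by (simp only: case_prod_unfold)
qed

lemma W1_facts:
  assumes T: "T \<in> I"
  shows "wa (- z) = wa z" "wb (- z) = wb z" "deriv wa (- z) = - deriv wa z" "deriv wb (- z) = - deriv wb z"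
    "subexp wa" "subexp wb" "subexp (deriv wa)" "subexp (deriv wb)"
proof -
  note w = profile_W1[OF T] and m = mu[OF T]
  show e: "wa (- z) = wa z" "wb (- z) = wb z" for z using profile_even[OF w m beta] by simp_all
  have t: "twice_differentiable wa" "twice_differentiable wb" using w by (simp_all add: profile_def)
  show "deriv wa (- z) = - deriv wa z" "deriv wb (- z) = - deriv wb z"
    using deriv_even[OF t(1) e(1)] deriv_even[OF t(2) e(2)] .
  show "subexp wa" "subexp wb" "subexp (deriv wa)" "subexp (deriv wb)" using profile_subexp[OF w] by simp_all
qed

lemma correction_1:
  assumes T: "T \<in> I"
  shows "P (T, s, z) $$ Suc 0 = K (T, s) $$ 0 * wa z" "Q (T, s, z) $$ Suc 0 = K (T, s) $$ 0 * wb z"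
proof -
  have "profile \<mu> \<beta> (K (T, s) $$ 0 * - \<alpha>) (\<lambda>z. K (T, s) $$ 0 * 0) (\<lambda>z. K (T, s) $$ 0 * deriv \<phi> z)
    (\<lambda>z. K (T, s) $$ 0 * wa z) (\<lambda>z. K (T, s) $$ 0 * wb z)"
    by (rule profile_scale[OF profile_W1[OF T]])
  then have "profile \<mu> \<beta> (K (T, s) $$ 0 * - \<alpha>) (\<lambda>z. 0) (\<lambda>z. K (T, s) $$ 0 * deriv \<phi> z)
    (\<lambda>z. K (T, s) $$ 0 * wa z) (\<lambda>z. K (T, s) $$ 0 * wb z)" by simp
  from profile_unique(2,3)[OF order_profiles(1)[OF T, of s] this mu[OF T] beta]
  show "P (T, s, z) $$ Suc 0 = K (T, s) $$ 0 * wa z" "Q (T, s, z) $$ Suc 0 = K (T, s) $$ 0 * wb z"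
    by (simp_all add: fun_eq_iff)
qed

lemma deriv_scaled:
  assumes "twice_differentiable f" shows "deriv (\<lambda>z. c * f z) z = c * deriv f z"
  by (rule DERIV_imp_deriv[OF DERIV_cmult[OF twice_differentiableD(1)[OF assms]]])

lemma deriv_lincomb:
  assumes "twice_differentiable f" "twice_differentiable g"
  shows "deriv (\<lambda>z. c * f z + d * g z) z = c * deriv f z + d * deriv g z"
  by (rule DERIV_imp_deriv[OF DERIV_add[OF DERIV_cmult DERIV_cmult, OF assms[THEN twice_differentiableD(1)]]])

lemma correction_1_deriv:
  assumes T: "T \<in> I"
  shows "deriv (\<lambda>z. P (T, s, z) $$ Suc 0) z = K (T, s) $$ 0 * deriv wa z"
    "deriv (\<lambda>z. Q (T, s, z) $$ Suc 0) z = K (T, s) $$ 0 * deriv wb z"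
  using profile_W1[OF T] unfolding correction_1[OF T] profile_def by (simp_all add: deriv_scaled)

lemma src2_facts:
  assumes T: "T \<in> I"
  shows "src2_1 \<beta> \<mu> (- z) = - src2_1 \<beta> \<mu> z" "src2_2 \<beta> \<mu> (- z) = - src2_2 \<beta> \<mu> z"
    "subexp (src2_1 \<beta> \<mu>)" "subexp (src2_2 \<beta> \<mu>)"
  using W1_facts[OF T] by (auto simp: src2_1_def[abs_def] src2_2_def[abs_def] Let_def algebra_simps)

lemma second_profile:
  assumes T: "T \<in> I"
  shows "profile \<mu> \<beta> (V (T, s) $$ Suc 0) (\<lambda>z. (K (T, s) $$ 0)\<^sup>2 * src2_1 \<beta> \<mu> z)
    (\<lambda>z. K (T, s) $$ Suc 0 * deriv \<phi> z + (K (T, s) $$ 0)\<^sup>2 * src2_2 \<beta> \<mu> z) (\<lambda>z. P (T, s, z) $$ 2) (\<lambda>z. Q (T, s, z) $$ 2)"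
proof -
  have 1: "(\<lambda>z. - V (T, s) $$ 0 * deriv (\<lambda>z. P (T, s, z) $$ Suc 0) z + K (T, s) $$ 0 * deriv (\<lambda>z. Q (T, s, z) $$ Suc 0) z
      - 4 * \<phi> z * P (T, s, z) $$ Suc 0 * Q (T, s, z) $$ Suc 0) = (\<lambda>z. (K (T, s) $$ 0)\<^sup>2 * src2_1 \<beta> \<mu> z)"
    unfolding correction_1_deriv[OF T] unfolding correction_1[OF T]
    by (simp add: velocity_0[OF T] src2_1_def Let_def algebra_simps power2_eq_square)
  have 2: "(\<lambda>z. V (T, s) $$ 0 * deriv (\<lambda>z. Q (T, s, z) $$ Suc 0) z + K (T, s) $$ 0 * deriv (\<lambda>z. P (T, s, z) $$ Suc 0) z
      + (K (T, s) $$ Suc 0 - z * (K (T, s) $$ 0)\<^sup>2) * deriv \<phi> z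
      - 6 * \<phi> z * (P (T, s, z) $$ Suc 0)\<^sup>2 - 2 * \<phi> z * (Q (T, s, z) $$ Suc 0)\<^sup>2)
      = (\<lambda>z. K (T, s) $$ Suc 0 * deriv \<phi> z + (K (T, s) $$ 0)\<^sup>2 * src2_2 \<beta> \<mu> z)"
    unfolding correction_1_deriv[OF T] unfolding correction_1[OF T]
    by (simp add: velocity_0[OF T] src2_2_def Let_def algebra_simps power2_eq_square)
  show ?thesis using order_profiles(2)[OF T, of s] unfolding 1 2 .
qed

text \<open>The velocity has no term quadratic in the curvature for reasons of parity: W1 is even,
  so its derivative and its products with \<phi> are odd.\<close>

lemma velocity_1:
  assumes T: "T \<in> I" shows "V (T, s) $$ Suc 0 = - \<alpha> * K (T, s) $$ Suc 0"
proof -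
  note m = mu[OF T] and s2 = src2_facts[OF T]
  let ?k = "(K (T, s) $$ 0)\<^sup>2" and ?l = "K (T, s) $$ Suc 0"
  have "V (T, s) $$ Suc 0 = solv \<beta> \<mu> (\<lambda>z. ?l * 0 + ?k * src2_1 \<beta> \<mu> z) (\<lambda>z. ?l * deriv \<phi> z + ?k * src2_2 \<beta> \<mu> z)"
    using profile_solv[OF second_profile[OF T, of s] _ _ m beta] s2 by simp
  also have "\<dots> = solv \<beta> \<mu> (\<lambda>z. ?l * 0) (\<lambda>z. ?l * deriv \<phi> z) + ?k * solv \<beta> \<mu> (src2_1 \<beta> \<mu>) (src2_2 \<beta> \<mu>)"
    by (rule solv_add[OF m]) (use s2 in auto)
  also have "solv \<beta> \<mu> (src2_1 \<beta> \<mu>) (src2_2 \<beta> \<mu>) = 0" by (rule solv_odd) (use s2 in auto)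
  also have "solv \<beta> \<mu> (\<lambda>z. ?l * 0) (\<lambda>z. ?l * deriv \<phi> z) = ?l * solv \<beta> \<mu> (\<lambda>z. 0) (deriv \<phi>)"
    by (rule solv_scale[OF m]) auto
  finally show ?thesis using alpha0_solv(1)[OF m beta] by simp
qed

text \<open>The second correction of a front also contains a multiple of W1 due to the next
  curvature coefficient. It is subtracted before dividing by the square of the curvature.\<close>

lemma profile_W2:
  assumes T: "T \<in> I" shows "profile \<mu> \<beta> 0 (src2_1 \<beta> \<mu>) (src2_2 \<beta> \<mu>) wc wd"
proof -
  obtain s where k: "K (T, s) $$ 0 \<noteq> 0" using nonflat[OF T] by blast
  let ?k = "(K (T, s) $$ 0)\<^sup>2" and ?l = "K (T, s) $$ Suc 0"
  note p = profile_scale[OF profile_comb[OF second_profile[OF T, of s] profile_W1[OF T], of ?l], of "1 / ?k"]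
  have e: "1 / ?k * (V (T, s) $$ Suc 0 - ?l * - \<alpha>) = 0" "(\<lambda>z. 1 / ?k * (?k * src2_1 \<beta> \<mu> z - ?l * 0)) = src2_1 \<beta> \<mu>"
    "(\<lambda>z. 1 / ?k * (?l * deriv \<phi> z + ?k * src2_2 \<beta> \<mu> z - ?l * deriv \<phi> z)) = src2_2 \<beta> \<mu>"
    using k velocity_1[OF T, of s] by auto
  have "\<exists>w. case w of (p, q) \<Rightarrow> profile \<mu> \<beta> 0 (src2_1 \<beta> \<mu>) (src2_2 \<beta> \<mu>) p q"
    by (rule exI, rule case_prodI, rule p[unfolded e])
  from someI_ex[OF this] show ?thesis unfolding W2_def by (simp only: case_prod_unfold)
qed

lemma W2_facts:
  assumes T: "T \<in> I"
  shows "wc (- z) = - wc z" "wd (- z) = - wd z" "deriv wc (- z) = deriv wc z" "deriv wd (- z) = deriv wd z"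
    "subexp wc" "subexp wd" "subexp (deriv wc)" "subexp (deriv wd)"
proof -
  note w = profile_W2[OF T] and m = mu[OF T] and s2 = src2_facts[OF T]
  show e: "wc (- z) = - wc z" "wd (- z) = - wd z" for z using profile_odd[OF w m beta] s2(1,2) by simp_all
  have t: "twice_differentiable wc" "twice_differentiable wd" using w by (simp_all add: profile_def)
  show "deriv wc (- z) = deriv wc z" "deriv wd (- z) = deriv wd z"
    using deriv_odd[OF t(1) e(1)] deriv_odd[OF t(2) e(2)] .
  show "subexp wc" "subexp wd" "subexp (deriv wc)" "subexp (deriv wd)" using profile_subexp[OF w s2(3,4)] by simp_all
qed

lemma correction_2:
  assumes T: "T \<in> I"
  shows "P (T, s, z) $$ 2 = K (T, s) $$ Suc 0 * wa z + (K (T, s) $$ 0)\<^sup>2 * wc z"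
    "Q (T, s, z) $$ 2 = K (T, s) $$ Suc 0 * wb z + (K (T, s) $$ 0)\<^sup>2 * wd z"
proof -
  let ?k = "(K (T, s) $$ 0)\<^sup>2" and ?l = "K (T, s) $$ Suc 0"
  note p = profile_comb[OF profile_scale[OF profile_W1[OF T], of ?l] profile_W2[OF T], of "- ?k"]
  have "profile \<mu> \<beta> (V (T, s) $$ Suc 0) (\<lambda>z. ?k * src2_1 \<beta> \<mu> z) (\<lambda>z. ?l * deriv \<phi> z + ?k * src2_2 \<beta> \<mu> z)
    (\<lambda>z. ?l * wa z + ?k * wc z) (\<lambda>z. ?l * wb z + ?k * wd z)"
    using p velocity_1[OF T, of s] by (simp add: mult.commute)
  from profile_unique(2,3)[OF second_profile[OF T, of s] this mu[OF T] beta]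
  show "P (T, s, z) $$ 2 = ?l * wa z + ?k * wc z" "Q (T, s, z) $$ 2 = ?l * wb z + ?k * wd z"
    by (simp_all add: fun_eq_iff)
qed

lemma correction_2_deriv:
  assumes T: "T \<in> I"
  shows "deriv (\<lambda>z. P (T, s, z) $$ 2) z = K (T, s) $$ Suc 0 * deriv wa z + (K (T, s) $$ 0)\<^sup>2 * deriv wc z"
    "deriv (\<lambda>z. Q (T, s, z) $$ 2) z = K (T, s) $$ Suc 0 * deriv wb z + (K (T, s) $$ 0)\<^sup>2 * deriv wd z"
  using profile_W1[OF T] profile_W2[OF T] unfolding correction_2[OF T] profile_def by (simp_all add: deriv_lincomb)

lemma Dir_V:
  assumes T: "T \<in> I" and i: "i = 0 \<or> i = Suc 0"
  shows "dS (\<lambda>y. V y $$ i) (T, s) = - \<alpha> * dS (\<lambda>y. K y $$ i) (T, s)"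
    "dS (dS (\<lambda>y. V y $$ i)) (T, s) = - \<alpha> * dS (dS (\<lambda>y. K y $$ i)) (T, s)"
proof -
  have o: "open (I \<times> (UNIV :: real set))" using I by (intro open_Times) auto
  have bl: "bounded_linear (\<lambda>x::real. - \<alpha> * x)" by (rule bounded_linear_mult_right)
  have e: "V y $$ i = - \<alpha> * K y $$ i" if "y \<in> I \<times> UNIV" for y
    using velocity_0[of "fst y" "snd y"] velocity_1[of "fst y" "snd y"] that i by auto
  have 1: "dS (\<lambda>y. V y $$ i) y = - \<alpha> * dS (\<lambda>y. K y $$ i) y" if y: "y \<in> I \<times> UNIV" for y
    using Dir_cong[OF o y e] Dir_bounded_linear[OF bl Kc_diff(1)[OF y]] by simp
  then show "dS (\<lambda>y. V y $$ i) (T, s) = - \<alpha> * dS (\<lambda>y. K y $$ i) (T, s)" using T by simp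
  have y: "(T, s) \<in> I \<times> UNIV" using T by simp
  show "dS (dS (\<lambda>y. V y $$ i)) (T, s) = - \<alpha> * dS (dS (\<lambda>y. K y $$ i)) (T, s)"
    using Dir_cong[OF o y 1] Dir_bounded_linear[OF bl Kc_diff(2)[OF y]] by simp
qed

text \<open>The evolution equation with V = - \<alpha> \<kappa> inserted. That law holds for the
  first two coefficients, so the elimination of the time derivative is available to the same
  order.\<close>

lemma DtK_nth:
  assumes T: "T \<in> I"
  shows "DtK (T, s) $$ 0 = \<alpha> * (LapK (T, s) $$ 0 + (K (T, s) $$ 0) ^ 3)"
    "DtK (T, s) $$ Suc 0 = \<alpha> * (LapK (T, s) $$ Suc 0 + 3 * (K (T, s) $$ 0)\<^sup>2 * K (T, s) $$ Suc 0)"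
proof -
  have y: "(T, s) \<in> I \<times> UNIV" using T by simp
  note d = Dir_V[OF T, of 0 s] Dir_V[OF T, of "Suc 0" s]
  show "DtK (T, s) $$ 0 = \<alpha> * (LapK (T, s) $$ 0 + (K (T, s) $$ 0) ^ 3)"
    unfolding DtK_def evolution[OF y]
    by (simp add: LapK_def d velocity_0[OF T] algebra_simps power3_eq_cube)
  show "DtK (T, s) $$ Suc 0 = \<alpha> * (LapK (T, s) $$ Suc 0 + 3 * (K (T, s) $$ 0)\<^sup>2 * K (T, s) $$ Suc 0)"
    unfolding DtK_def evolution[OF y]
    by (simp add: LapK_def d velocity_0[OF T] velocity_1[OF T] algebra_simps power2_eq_square)
qed

lemma correction_1_tangential:
  assumes T: "T \<in> I"
  shows "fDir (1, 0, 0) P (T, s, z) $$ Suc 0 = dT (\<lambda>y. K y $$ 0) (T, s) * wa z"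
    "fDir (0, 1, 0) P (T, s, z) $$ Suc 0 = dS (\<lambda>y. K y $$ 0) (T, s) * wa z"
    "fDir (0, 1, 0) (fDir (0, 1, 0) P) (T, s, z) $$ Suc 0 = dS (dS (\<lambda>y. K y $$ 0)) (T, s) * wa z"
    "fDir (1, 0, 0) Q (T, s, z) $$ Suc 0 = dT (\<lambda>y. K y $$ 0) (T, s) * wb z"
    "fDir (0, 1, 0) Q (T, s, z) $$ Suc 0 = dS (\<lambda>y. K y $$ 0) (T, s) * wb z"
    "fDir (0, 1, 0) (fDir (0, 1, 0) Q) (T, s, z) $$ Suc 0 = dS (dS (\<lambda>y. K y $$ 0)) (T, s) * wb z"
proof -
  have P: "P (T, s, z) $$ Suc 0 = (\<lambda>y. K y $$ 0) (T, s) * wa z + (\<lambda>y. 0) (T, s) * (\<lambda>z. 0) z + (\<lambda>z. 0) z" if "T \<in> I" for T s z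
    using correction_1(1)[OF that] by simp
  have Q: "Q (T, s, z) $$ Suc 0 = (\<lambda>y. K y $$ 0) (T, s) * wb z + (\<lambda>y. 0) (T, s) * (\<lambda>z. 0) z + (\<lambda>z. 0) z" if "T \<in> I" for T s z
    using correction_1(2)[OF that] by simp
  have k: "(\<lambda>y::real \<times> real. 0::real) differentiable (at y)" "dS (\<lambda>y::real \<times> real. 0::real) differentiable (at y)" for y
    by simp_all
  note dP = separated_derivs[where F = P and k = "\<lambda>y. K y $$ 0" and k' = "\<lambda>y. 0" and a = wa and b = "\<lambda>z. 0" and c = "\<lambda>z. 0" and i = "Suc 0",
      OF Pd(1) Pd(2) Kc_diff(1) Kc_diff(2) k(1) k(2) P T]
  note dQ = separated_derivs[where F = Q and k = "\<lambda>y. K y $$ 0" and k' = "\<lambda>y. 0" and a = wb and b = "\<lambda>z. 0" and c = "\<lambda>z. 0" and i = "Suc 0",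
      OF Qd(1) Qd(2) Kc_diff(1) Kc_diff(2) k(1) k(2) Q T]
  show "fDir (1, 0, 0) P (T, s, z) $$ Suc 0 = dT (\<lambda>y. K y $$ 0) (T, s) * wa z"
    using dP(1) by (simp del: fDir_nth)
  show "fDir (0, 1, 0) P (T, s, z) $$ Suc 0 = dS (\<lambda>y. K y $$ 0) (T, s) * wa z"
    using dP(2) by (simp del: fDir_nth)
  show "fDir (0, 1, 0) (fDir (0, 1, 0) P) (T, s, z) $$ Suc 0 = dS (dS (\<lambda>y. K y $$ 0)) (T, s) * wa z"
    using dP(3) by (simp del: fDir_nth)
  show "fDir (1, 0, 0) Q (T, s, z) $$ Suc 0 = dT (\<lambda>y. K y $$ 0) (T, s) * wb z"
    using dQ(1) by (simp del: fDir_nth)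
  show "fDir (0, 1, 0) Q (T, s, z) $$ Suc 0 = dS (\<lambda>y. K y $$ 0) (T, s) * wb z"
    using dQ(2) by (simp del: fDir_nth)
  show "fDir (0, 1, 0) (fDir (0, 1, 0) Q) (T, s, z) $$ Suc 0 = dS (dS (\<lambda>y. K y $$ 0)) (T, s) * wb z"
    using dQ(3) by (simp del: fDir_nth)
qed

lemma tangential_1:
  assumes T: "T \<in> I"
  shows "mat_op P (Hf T s z) T s z $$ Suc 0 = DtK (T, s) $$ 0 * wa z" "mat_op Q (Hf T s z) T s z $$ Suc 0 = DtK (T, s) $$ 0 * wb z"
    "tan_op P (Hf T s z) T s z $$ Suc 0 = LapK (T, s) $$ 0 * wa z" "tan_op Q (Hf T s z) T s z $$ Suc 0 = LapK (T, s) $$ 0 * wb z"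
proof -
  note dP = correction_1_tangential(1-3)[OF T] and dQ = correction_1_tangential(4-6)[OF T]
  note l = leading_derivs[OF T]
  show "mat_op P (Hf T s z) T s z $$ Suc 0 = DtK (T, s) $$ 0 * wa z"
    unfolding mat_op_nth(2)[OF T l(1,2)] dP by (simp add: DtK_def algebra_simps)
  show "mat_op Q (Hf T s z) T s z $$ Suc 0 = DtK (T, s) $$ 0 * wb z"
    unfolding mat_op_nth(2)[OF T l(4,5)] dQ by (simp add: DtK_def algebra_simps)
  show "tan_op P (Hf T s z) T s z $$ Suc 0 = LapK (T, s) $$ 0 * wa z"
    unfolding tan_op_nth(2)[OF T l(2,3)] dP by (simp add: LapK_def algebra_simps power2_eq_square power3_eq_cube)
  show "tan_op Q (Hf T s z) T s z $$ Suc 0 = LapK (T, s) $$ 0 * wb z"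
    unfolding tan_op_nth(2)[OF T l(5,6)] dQ by (simp add: LapK_def algebra_simps power2_eq_square power3_eq_cube)
qed

lemma correction_2_tangential:
  assumes T: "T \<in> I"
  shows "fDir (1, 0, 0) P (T, s, z) $$ 2 = dT (\<lambda>y. K y $$ Suc 0) (T, s) * wa z + dT (\<lambda>y. (K y $$ 0)\<^sup>2) (T, s) * wc z"
    "fDir (0, 1, 0) P (T, s, z) $$ 2 = dS (\<lambda>y. K y $$ Suc 0) (T, s) * wa z + dS (\<lambda>y. (K y $$ 0)\<^sup>2) (T, s) * wc z"
    "fDir (0, 1, 0) (fDir (0, 1, 0) P) (T, s, z) $$ 2 = dS (dS (\<lambda>y. K y $$ Suc 0)) (T, s) * wa z + dS (dS (\<lambda>y. (K y $$ 0)\<^sup>2)) (T, s) * wc z"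
    "fDir (1, 0, 0) Q (T, s, z) $$ 2 = dT (\<lambda>y. K y $$ Suc 0) (T, s) * wb z + dT (\<lambda>y. (K y $$ 0)\<^sup>2) (T, s) * wd z"
    "fDir (0, 1, 0) Q (T, s, z) $$ 2 = dS (\<lambda>y. K y $$ Suc 0) (T, s) * wb z + dS (\<lambda>y. (K y $$ 0)\<^sup>2) (T, s) * wd z"
    "fDir (0, 1, 0) (fDir (0, 1, 0) Q) (T, s, z) $$ 2 = dS (dS (\<lambda>y. K y $$ Suc 0)) (T, s) * wb z + dS (dS (\<lambda>y. (K y $$ 0)\<^sup>2)) (T, s) * wd z"
proof -
  let ?k2 = "\<lambda>y. (K y $$ 0)\<^sup>2"
  have o: "open (I \<times> (UNIV :: real set))" using I by (intro open_Times) auto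
  have dk: "?k2 differentiable (at y)" if "y \<in> I \<times> UNIV" for y
    unfolding power2_eq_square by (intro differentiable_mult Kc_diff that)
  have dk1: "dS ?k2 y = 2 * K y $$ 0 * dS (\<lambda>y. K y $$ 0) y" if "y \<in> I \<times> UNIV" for y
    unfolding power2_eq_square using Dir_mult[OF Kc_diff(1)[OF that] Kc_diff(1)[OF that]] by simp
  have dk2: "dS ?k2 differentiable (at y)" if y: "y \<in> I \<times> UNIV" for y
    by (rule differentiable_cong_open[OF _ o y dk1[symmetric]])
      (use y in \<open>auto intro!: differentiable_mult Kc_diff\<close>)
  have P2: "P (T, s, z) $$ 2 = (\<lambda>y. K y $$ Suc 0) (T, s) * wa z + ?k2 (T, s) * wc z + (\<lambda>z. 0) z" if "T \<in> I" for T s z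
    using correction_2(1)[OF that] by simp
  have Q2: "Q (T, s, z) $$ 2 = (\<lambda>y. K y $$ Suc 0) (T, s) * wb z + ?k2 (T, s) * wd z + (\<lambda>z. 0) z" if "T \<in> I" for T s z
    using correction_2(2)[OF that] by simp
  note dP2 = separated_derivs[where F = P and k = "\<lambda>y. K y $$ Suc 0" and k' = ?k2 and a = wa and b = wc and c = "\<lambda>z. 0" and i = 2,
      OF Pd(1) Pd(2) Kc_diff(1) Kc_diff(2) dk dk2 P2 T]
  note dQ2 = separated_derivs[where F = Q and k = "\<lambda>y. K y $$ Suc 0" and k' = ?k2 and a = wb and b = wd and c = "\<lambda>z. 0" and i = 2,
      OF Qd(1) Qd(2) Kc_diff(1) Kc_diff(2) dk dk2 Q2 T]
  show "fDir (1, 0, 0) P (T, s, z) $$ 2 = dT (\<lambda>y. K y $$ Suc 0) (T, s) * wa z + dT (\<lambda>y. (K y $$ 0)\<^sup>2) (T, s) * wc z"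
    using dP2(1) by (simp del: fDir_nth)
  show "fDir (0, 1, 0) P (T, s, z) $$ 2 = dS (\<lambda>y. K y $$ Suc 0) (T, s) * wa z + dS (\<lambda>y. (K y $$ 0)\<^sup>2) (T, s) * wc z"
    using dP2(2) by (simp del: fDir_nth)
  show "fDir (0, 1, 0) (fDir (0, 1, 0) P) (T, s, z) $$ 2 = dS (dS (\<lambda>y. K y $$ Suc 0)) (T, s) * wa z + dS (dS (\<lambda>y. (K y $$ 0)\<^sup>2)) (T, s) * wc z"
    using dP2(3) by (simp del: fDir_nth)
  show "fDir (1, 0, 0) Q (T, s, z) $$ 2 = dT (\<lambda>y. K y $$ Suc 0) (T, s) * wb z + dT (\<lambda>y. (K y $$ 0)\<^sup>2) (T, s) * wd z"
    using dQ2(1) by (simp del: fDir_nth)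
  show "fDir (0, 1, 0) Q (T, s, z) $$ 2 = dS (\<lambda>y. K y $$ Suc 0) (T, s) * wb z + dS (\<lambda>y. (K y $$ 0)\<^sup>2) (T, s) * wd z"
    using dQ2(2) by (simp del: fDir_nth)
  show "fDir (0, 1, 0) (fDir (0, 1, 0) Q) (T, s, z) $$ 2 = dS (dS (\<lambda>y. K y $$ Suc 0)) (T, s) * wb z + dS (dS (\<lambda>y. (K y $$ 0)\<^sup>2)) (T, s) * wd z"
    using dQ2(3) by (simp del: fDir_nth)
qed

text \<open>At the next order the tangential operators also act on the odd profiles of order two; only
  the parity of these additional terms matters.\<close>

lemma tangential_2:
  assumes T: "T \<in> I"
  obtains m1 m2 n1 n2 where
    "\<And>z. mat_op P (Hf T s z) T s z $$ 2 = DtK (T, s) $$ Suc 0 * wa z + m1 * wc z + m2 * z * wa z"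
    "\<And>z. mat_op Q (Hf T s z) T s z $$ 2 = DtK (T, s) $$ Suc 0 * wb z + m1 * wd z + m2 * z * wb z"
    "\<And>z. tan_op P (Hf T s z) T s z $$ 2 = LapK (T, s) $$ Suc 0 * wa z + n1 * wc z + n2 * z * wa z"
    "\<And>z. tan_op Q (Hf T s z) T s z $$ 2 = LapK (T, s) $$ Suc 0 * wb z + n1 * wd z + n2 * z * wb z"
proof -
  let ?k2 = "\<lambda>y. (K y $$ 0)\<^sup>2"
  note dP = correction_1_tangential(1-3)[OF T] and dQ = correction_1_tangential(4-6)[OF T]
    and dP2 = correction_2_tangential(1-3)[OF T] and dQ2 = correction_2_tangential(4-6)[OF T]
  note l = leading_derivs[OF T]
  let ?R0 = "R (T, s) $$ 0" and ?R1 = "R (T, s) $$ Suc 0" and ?s0 = "fDir (0, 1) Sg (T, s) $$ 0"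
    and ?ks = "dS (\<lambda>y. K y $$ 0) (T, s)" and ?kss = "dS (dS (\<lambda>y. K y $$ 0)) (T, s)"
  let ?m1 = "dT ?k2 (T, s) - Ta (T, s) $$ 0 * ?R0 * dS ?k2 (T, s)"
    and ?m2 = "(Ta (T, s) $$ 0 * ?R0 * K (T, s) $$ 0 + Th (T, s) $$ 0 * ?R0) * ?ks"
    and ?n1 = "?R0\<^sup>2 * dS (dS ?k2) (T, s) - ?s0 * ?R0 ^ 3 * dS ?k2 (T, s)"
    and ?n2 = "- 2 * K (T, s) $$ 0 * ?R0\<^sup>2 * ?kss
      - (Sg (T, s) $$ 0 * fDir (0, 1) K (T, s) $$ 0 - 2 * ?s0 * K (T, s) $$ 0) * ?R0 ^ 3 * ?ks"
  show thesis
  proof (rule that[of ?m1 ?m2 ?n1 ?n2])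
    fix z
    show "mat_op P (Hf T s z) T s z $$ 2 = DtK (T, s) $$ Suc 0 * wa z + ?m1 * wc z + ?m2 * z * wa z"
      unfolding mat_op_nth(3)[OF T l(1,2)] dP dP2 by (simp add: DtK_def algebra_simps)
    show "mat_op Q (Hf T s z) T s z $$ 2 = DtK (T, s) $$ Suc 0 * wb z + ?m1 * wd z + ?m2 * z * wb z"
      unfolding mat_op_nth(3)[OF T l(4,5)] dQ dQ2 by (simp add: DtK_def algebra_simps)
    show "tan_op P (Hf T s z) T s z $$ 2 = LapK (T, s) $$ Suc 0 * wa z + ?n1 * wc z + ?n2 * z * wa z"
      unfolding tan_op_nth(3)[OF T l(2,3)] dP dP2 by (simp add: LapK_def algebra_simps power2_eq_square power3_eq_cube)
    show "tan_op Q (Hf T s z) T s z $$ 2 = LapK (T, s) $$ Suc 0 * wb z + ?n1 * wd z + ?n2 * z * wb z"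
      unfolding tan_op_nth(3)[OF T l(5,6)] dQ dQ2 by (simp add: LapK_def algebra_simps power2_eq_square power3_eq_cube)
  qed
qed

lemma src3_facts:
  assumes T: "T \<in> I"
  shows "src3_1 \<beta> \<mu> (- z) = src3_1 \<beta> \<mu> z" "src3_2 \<beta> \<mu> (- z) = src3_2 \<beta> \<mu> z"
    "subexp (src3_1 \<beta> \<mu>)" "subexp (src3_2 \<beta> \<mu>)"
  using W1_facts[OF T] W2_facts[OF T]
  by (auto simp: src3_1_def[abs_def] src3_2_def[abs_def] Let_def algebra_simps power2_eq_square power3_eq_cube)

lemma nu_solv:
  assumes T: "T \<in> I"
  shows "nu \<beta> \<mu> = solv \<beta> \<mu> (\<lambda>z. \<alpha> * wa z + wb z) (\<lambda>z. wa z - \<alpha> * wb z)"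
  by (rule first_profile[OF profile_W1[OF T] mu[OF T] beta])

text \<open>The common shape of the sources at orders three and four: \<open>l\<close> and
  \<open>k\<close> are coefficients of Lap \<kappa> and \<kappa>^3, \<open>m\<close> is the newest
  curvature coefficient, and \<open>h1\<close>, \<open>h2\<close> take the odd remainder.\<close>

lemma solv_sources:
  assumes T: "T \<in> I" and h: "subexp h1" "subexp h2"
  shows "solv \<beta> \<mu> (\<lambda>z. l * (\<alpha> * wa z + wb z) + k * (src3_1 \<beta> \<mu> z + \<alpha> * wa z) + h1 z)
      (\<lambda>z. l * (wa z - \<alpha> * wb z) + k * (src3_2 \<beta> \<mu> z - \<alpha> * wb z) + m * deriv \<phi> z + h2 z)
    = nu \<beta> \<mu> * l + zeta \<beta> \<mu> * k - \<alpha> * m + solv \<beta> \<mu> h1 h2"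
proof -
  note mu = mu[OF T] and w = W1_facts[OF T] and s3 = src3_facts[OF T]
  let ?f1 = "\<lambda>z. l * (\<alpha> * wa z + wb z)" and ?g1 = "\<lambda>z. l * (wa z - \<alpha> * wb z)"
  let ?f2 = "\<lambda>z. ?f1 z + k * (src3_1 \<beta> \<mu> z + \<alpha> * wa z)" and ?g2 = "\<lambda>z. ?g1 z + k * (src3_2 \<beta> \<mu> z - \<alpha> * wb z)"
  let ?f3 = "\<lambda>z. ?f2 z + m * 0" and ?g3 = "\<lambda>z. ?g2 z + m * deriv \<phi> z"
  have "solv \<beta> \<mu> (\<lambda>z. ?f3 z + 1 * h1 z) (\<lambda>z. ?g3 z + 1 * h2 z) = solv \<beta> \<mu> ?f3 ?g3 + 1 * solv \<beta> \<mu> h1 h2"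
    by (rule solv_add[OF mu]) (use w s3 h in \<open>auto\<close>)
  also have "solv \<beta> \<mu> ?f3 ?g3 = solv \<beta> \<mu> ?f2 ?g2 + m * solv \<beta> \<mu> (\<lambda>z. 0) (deriv \<phi>)"
    by (rule solv_add[OF mu]) (use w s3 in \<open>auto\<close>)
  also have "solv \<beta> \<mu> ?f2 ?g2 = solv \<beta> \<mu> ?f1 ?g1 + k * zeta \<beta> \<mu>"
    unfolding zeta_def by (rule solv_add[OF mu]) (use w s3 in \<open>auto\<close>)
  also have "solv \<beta> \<mu> ?f1 ?g1 = l * nu \<beta> \<mu>"
    unfolding nu_solv[OF T] by (rule solv_scale[OF mu]) (use w in \<open>auto\<close>)
  finally show ?thesis using alpha0_solv(1)[OF mu beta] by (simp add: algebra_simps)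
qed

text \<open>The sources regroup along the expansion of the full curvature: 2 k0 k1 is the next
  coefficient of \<kappa>^2 and multiplies the sources of W2, while k2 multiplies the source of
  W1.\<close>

lemma third_profile:
  fixes T s
  defines "k0 \<equiv> K (T, s) $$ 0" and "k1 \<equiv> K (T, s) $$ Suc 0" and "k2 \<equiv> K (T, s) $$ 2" and "l0 \<equiv> LapK (T, s) $$ 0"
  assumes T: "T \<in> I"
  shows "profile \<mu> \<beta> (V (T, s) $$ 2)
    (\<lambda>z. l0 * (\<alpha> * wa z + wb z) + k0 ^ 3 * (src3_1 \<beta> \<mu> z + \<alpha> * wa z) + 2 * k0 * k1 * src2_1 \<beta> \<mu> z)
    (\<lambda>z. l0 * (wa z - \<alpha> * wb z) + k0 ^ 3 * (src3_2 \<beta> \<mu> z - \<alpha> * wb z) + k2 * deriv \<phi> z + 2 * k0 * k1 * src2_2 \<beta> \<mu> z)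
    (\<lambda>z. P (T, s, z) $$ 3) (\<lambda>z. Q (T, s, z) $$ 3)"
proof -
  note p = order_profiles(3)[OF T, of s, unfolded correction_1_deriv[OF T] correction_2_deriv[OF T] tangential_1[OF T],
      unfolded correction_1[OF T] correction_2[OF T]]
  note d = k0_def k1_def k2_def l0_def fps_neg_nth velocity_0[OF T] velocity_1[OF T] tangential_1[OF T] DtK_nth[OF T]
    src3_1_def src3_2_def src2_1_def src2_2_def Let_def
  show ?thesis
    by (rule profile_cong[OF p]; simp only: d; simp add: algebra_simps power2_eq_square power3_eq_cube)
qed

lemma velocity_2:
  assumes T: "T \<in> I"
  shows "V (T, s) $$ 2 = - \<alpha> * K (T, s) $$ 2 + nu \<beta> \<mu> * LapK (T, s) $$ 0 + zeta \<beta> \<mu> * (K (T, s) $$ 0) ^ 3"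
proof -
  let ?k = "2 * K (T, s) $$ 0 * K (T, s) $$ Suc 0"
  note s2 = src2_facts[OF T]
  have "solv \<beta> \<mu> (\<lambda>z. ?k * src2_1 \<beta> \<mu> z) (\<lambda>z. ?k * src2_2 \<beta> \<mu> z) = 0"
    by (rule solv_odd) (simp_all add: s2)
  moreover have "V (T, s) $$ 2 = nu \<beta> \<mu> * LapK (T, s) $$ 0 + zeta \<beta> \<mu> * (K (T, s) $$ 0) ^ 3 - \<alpha> * K (T, s) $$ 2
      + solv \<beta> \<mu> (\<lambda>z. ?k * src2_1 \<beta> \<mu> z) (\<lambda>z. ?k * src2_2 \<beta> \<mu> z)"
  proof (subst solv_sources[OF T, symmetric])
    show "subexp (\<lambda>z. ?k * src2_1 \<beta> \<mu> z)" "subexp (\<lambda>z. ?k * src2_2 \<beta> \<mu> z)" using s2 by auto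
  qed (rule profile_solv[OF third_profile[OF T, of s] _ _ mu[OF T] beta]; use W1_facts[OF T] src3_facts[OF T] s2 in auto)
  ultimately show ?thesis by simp
qed

text \<open>Order four uses the third correction through its parity. Removing 2 k0 k1 W2, the share
  of \<kappa>^2 W2, leaves a profile with even sources, which is even by uniqueness.\<close>

lemma correction_3:
  assumes T: "T \<in> I"
  obtains rp rq where "twice_differentiable rp" "twice_differentiable rq" "\<And>z. rp (- z) = rp z" "\<And>z. rq (- z) = rq z"
    "subexp rp" "subexp rq" "subexp (deriv rp)" "subexp (deriv rq)"
    "\<And>z. P (T, s, z) $$ 3 = rp z + 2 * K (T, s) $$ 0 * K (T, s) $$ Suc 0 * wc z"
    "\<And>z. Q (T, s, z) $$ 3 = rq z + 2 * K (T, s) $$ 0 * K (T, s) $$ Suc 0 * wd z"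
proof -
  let ?k = "2 * K (T, s) $$ 0 * K (T, s) $$ Suc 0" and ?l = "LapK (T, s) $$ 0" and ?c = "(K (T, s) $$ 0) ^ 3"
  define rp where "rp = (\<lambda>z. P (T, s, z) $$ 3 - ?k * wc z)"
  define rq where "rq = (\<lambda>z. Q (T, s, z) $$ 3 - ?k * wd z)"
  let ?f = "\<lambda>z. ?l * (\<alpha> * wa z + wb z) + ?c * (src3_1 \<beta> \<mu> z + \<alpha> * wa z)"
  let ?g = "\<lambda>z. ?l * (wa z - \<alpha> * wb z) + ?c * (src3_2 \<beta> \<mu> z - \<alpha> * wb z) + K (T, s) $$ 2 * deriv \<phi> z"
  note w = W1_facts[OF T] and s3 = src3_facts[OF T]
  have p: "profile \<mu> \<beta> (V (T, s) $$ 2) ?f ?g rp rq"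
    using profile_comb[OF third_profile[OF T, of s] profile_W2[OF T], of ?k] by (simp add: rp_def rq_def)
  show thesis
  proof (rule that)
    show "twice_differentiable rp" "twice_differentiable rq" using p by (simp_all add: profile_def)
    show "rp (- z) = rp z" for z by (rule profile_even(1)[OF p mu[OF T] beta]) (simp_all add: w s3)
    show "rq (- z) = rq z" for z by (rule profile_even(2)[OF p mu[OF T] beta]) (simp_all add: w s3)
    have s: "subexp ?f" "subexp ?g" using w s3 by auto
    show "subexp rp" "subexp rq" "subexp (deriv rp)" "subexp (deriv rq)" using profile_subexp[OF p s] by simp_all
  qed (simp_all add: rp_def rq_def)
qed

text \<open>The prediction of the law for the full curvature: l1 and 3 k0^2 k1 are the next
  coefficients of Lap \<kappa> and \<kappa>^3. After the sources with these factors have been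
  removed, what remains is odd and does not contribute to the velocity.\<close>

lemma velocity_3:
  assumes T: "T \<in> I"
  shows "V (T, s) $$ 3 = - \<alpha> * K (T, s) $$ 3 + nu \<beta> \<mu> * LapK (T, s) $$ Suc 0
    + zeta \<beta> \<mu> * (3 * (K (T, s) $$ 0)\<^sup>2 * K (T, s) $$ Suc 0)"
proof -
  obtain rp rq where r: "twice_differentiable rp" "twice_differentiable rq" "\<And>z. rp (- z) = rp z" "\<And>z. rq (- z) = rq z"
    "subexp rp" "subexp rq" "subexp (deriv rp)" "subexp (deriv rq)"
    "\<And>z. P (T, s, z) $$ 3 = rp z + 2 * K (T, s) $$ 0 * K (T, s) $$ Suc 0 * wc z"
    "\<And>z. Q (T, s, z) $$ 3 = rq z + 2 * K (T, s) $$ 0 * K (T, s) $$ Suc 0 * wd z"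
    using correction_3[OF T, of s] by metis
  obtain m1 m2 n1 n2 where t:
    "\<And>z. mat_op P (Hf T s z) T s z $$ 2 = DtK (T, s) $$ Suc 0 * wa z + m1 * wc z + m2 * z * wa z"
    "\<And>z. mat_op Q (Hf T s z) T s z $$ 2 = DtK (T, s) $$ Suc 0 * wb z + m1 * wd z + m2 * z * wb z"
    "\<And>z. tan_op P (Hf T s z) T s z $$ 2 = LapK (T, s) $$ Suc 0 * wa z + n1 * wc z + n2 * z * wa z"
    "\<And>z. tan_op Q (Hf T s z) T s z $$ 2 = LapK (T, s) $$ Suc 0 * wb z + n1 * wd z + n2 * z * wb z"
    using tangential_2[OF T, of s] by metis
  define k0 k1 k2 k3 l1 where k: "k0 = K (T, s) $$ 0" "k1 = K (T, s) $$ Suc 0" "k2 = K (T, s) $$ 2" "k3 = K (T, s) $$ 3"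
    "l1 = LapK (T, s) $$ Suc 0"
  have w2: "twice_differentiable wc" "twice_differentiable wd" using profile_W2[OF T] by (simp_all add: profile_def)
  have d3: "deriv (\<lambda>z. P (T, s, z) $$ 3) z = deriv rp z + 2 * k0 * k1 * deriv wc z"
    "deriv (\<lambda>z. Q (T, s, z) $$ 3) z = deriv rq z + 2 * k0 * k1 * deriv wd z" for z
    unfolding r(9,10) k[symmetric]
    using deriv_lincomb[OF r(1) w2(1), of 1 "2 * k0 * k1" z] deriv_lincomb[OF r(2) w2(2), of 1 "2 * k0 * k1" z] by simp_all
  note parity = W1_facts(1-4)[OF T] W2_facts(1-4)[OF T] r(3,4) deriv_even[OF r(1) r(3)] deriv_even[OF r(2) r(4)]
  note sub = W1_facts(5-8)[OF T] W2_facts(5-8)[OF T] r(5-8)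
  \<comment> \<open>The order four source with all lower corrections inserted, written in functions
    of known parity, so that the oddness of \<open>h1\<close> becomes a calculation; likewise
    \<open>G\<close> for \<open>h2\<close>.\<close>
  define F where "F = (\<lambda>z. \<alpha> * (l1 + 3 * k0\<^sup>2 * k1) * wa z + m1 * wc z + m2 * z * wa z + (l1 * wb z + n1 * wd z + n2 * z * wb z)
      - V (T, s) $$ 2 * (k0 * deriv wa z) + \<alpha> * k1 * (k1 * deriv wa z + k0\<^sup>2 * deriv wc z) + \<alpha> * k0 * (deriv rp z + 2 * k0 * k1 * deriv wc z)
      + k0 * (deriv rq z + 2 * k0 * k1 * deriv wd z) + (k1 - z * k0\<^sup>2) * (k1 * deriv wb z + k0\<^sup>2 * deriv wd z)
      + (k2 - 2 * z * k0 * k1 + z\<^sup>2 * k0 ^ 3) * (k0 * deriv wb z)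
      - 2 * (2 * \<phi> z * (k0 * wa z * (rq z + 2 * k0 * k1 * wd z) + (k1 * wa z + k0\<^sup>2 * wc z) * (k1 * wb z + k0\<^sup>2 * wd z)
            + (rp z + 2 * k0 * k1 * wc z) * (k0 * wb z))
          + 2 * (k0 * wa z) * (k1 * wa z + k0\<^sup>2 * wc z) * (k0 * wb z) + (k0 * wa z)\<^sup>2 * (k1 * wb z + k0\<^sup>2 * wd z)
          + 3 * (k0 * wb z)\<^sup>2 * (k1 * wb z + k0\<^sup>2 * wd z)))"
  define G where "G = (\<lambda>z. - (\<alpha> * (l1 + 3 * k0\<^sup>2 * k1) * wb z + m1 * wd z + m2 * z * wb z) + (l1 * wa z + n1 * wc z + n2 * z * wa z)
      + V (T, s) $$ 2 * (k0 * deriv wb z) - \<alpha> * k1 * (k1 * deriv wb z + k0\<^sup>2 * deriv wd z) - \<alpha> * k0 * (deriv rq z + 2 * k0 * k1 * deriv wd z)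
      + k0 * (deriv rp z + 2 * k0 * k1 * deriv wc z) + (k1 - z * k0\<^sup>2) * (k1 * deriv wa z + k0\<^sup>2 * deriv wc z)
      + (k2 - 2 * z * k0 * k1 + z\<^sup>2 * k0 ^ 3) * (k0 * deriv wa z)
      + (k3 - z * (2 * k0 * k2 + k1\<^sup>2) + 3 * z\<^sup>2 * k0\<^sup>2 * k1 - z ^ 3 * k0 ^ 4) * deriv \<phi> z
      - 2 * (3 * \<phi> z * (2 * (k0 * wa z) * (rp z + 2 * k0 * k1 * wc z) + (k1 * wa z + k0\<^sup>2 * wc z)\<^sup>2)
          + 3 * (k0 * wa z)\<^sup>2 * (k1 * wa z + k0\<^sup>2 * wc z)
          + \<phi> z * (2 * (k0 * wb z) * (rq z + 2 * k0 * k1 * wd z) + (k1 * wb z + k0\<^sup>2 * wd z)\<^sup>2)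
          + 2 * (k0 * wb z) * (k1 * wb z + k0\<^sup>2 * wd z) * (k0 * wa z) + (k0 * wb z)\<^sup>2 * (k1 * wa z + k0\<^sup>2 * wc z)))"
  have p: "profile \<mu> \<beta> (V (T, s) $$ 3) F G (\<lambda>z. P (T, s, z) $$ 4) (\<lambda>z. Q (T, s, z) $$ 4)"
  proof (rule profile_cong[OF order_profiles(4)[OF T, of s, unfolded correction_1_deriv[OF T] correction_2_deriv[OF T] d3,
          unfolded correction_1[OF T] correction_2[OF T] r(9,10) fps_neg_nth t DtK_nth[OF T] velocity_0[OF T] velocity_1[OF T], folded k]], goal_cases)
    case (1 z) then show ?case unfolding F_def by simp
  next
    case (2 z) then show ?case unfolding G_def by simp
  qed
  define h1 where "h1 = (\<lambda>z. F z - l1 * (\<alpha> * wa z + wb z) - 3 * k0\<^sup>2 * k1 * (src3_1 \<beta> \<mu> z + \<alpha> * wa z))"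
  define h2 where "h2 = (\<lambda>z. G z - l1 * (wa z - \<alpha> * wb z) - 3 * k0\<^sup>2 * k1 * (src3_2 \<beta> \<mu> z - \<alpha> * wb z) - k3 * deriv \<phi> z)"
  have FG: "subexp F" "subexp G" unfolding F_def G_def by (intro subexp_add subexp_diff subexp_mult subexp_minus subexp_power subexp_const subexp_ident subexp_phi deriv_phi_facts(2) sub)+
  then have h: "subexp h1" "subexp h2" unfolding h1_def h2_def using sub src3_facts[OF T] by auto
  have "h1 (- z) = - h1 z" for z
    unfolding h1_def F_def src3_1_def Let_def parity
    by (simp add: parity algebra_simps power2_eq_square power3_eq_cube)
  moreover have "h2 (- z) = - h2 z" for z
    unfolding h2_def G_def src3_2_def Let_def parity
    by (simp add: parity algebra_simps power2_eq_square power3_eq_cube power4_eq_xxxx)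
  ultimately have o: "solv \<beta> \<mu> h1 h2 = 0" by (rule solv_odd)
  have "V (T, s) $$ 3 = solv \<beta> \<mu> F G" by (rule profile_solv[OF p FG mu[OF T] beta])
  also have "F = (\<lambda>z. l1 * (\<alpha> * wa z + wb z) + 3 * k0\<^sup>2 * k1 * (src3_1 \<beta> \<mu> z + \<alpha> * wa z) + h1 z)" by (simp add: h1_def)
  also have "G = (\<lambda>z. l1 * (wa z - \<alpha> * wb z) + 3 * k0\<^sup>2 * k1 * (src3_2 \<beta> \<mu> z - \<alpha> * wb z) + k3 * deriv \<phi> z + h2 z)"
    by (simp add: h2_def)
  finally show ?thesis unfolding solv_sources[OF T h] o k by simp
qed

theorem velocity_law:
  assumes T: "T \<in> I" and n: "n < 4"
  shows "(V (T, s) + fps_const \<alpha> * K (T, s)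
    - fps_X * (fps_X * (fps_const (nu \<beta> \<mu>) * LapK (T, s) + fps_const (zeta \<beta> \<mu>) * (K (T, s) * K (T, s) * K (T, s))))) $$ n = 0"
proof -
  from n consider "n = 0" | "n = Suc 0" | "n = 2" | "n = 3" by linarith
  then show ?thesis
    using velocity_0[OF T, of s] velocity_1[OF T, of s] velocity_2[OF T, of s] velocity_3[OF T, of s]
    by cases (simp_all add: fps_X_mult_small power2_eq_square power3_eq_cube algebra_simps)
qed

end

section \<open>From the formal front to the inner problem\<close>

lemma vec2_norm: "norm (v :: real ^ 2) = sqrt (v $ 1 * v $ 1 + v $ 2 * v $ 2)"
  by (simp add: norm_vec_def L2_set_def UNIV_2 power2_eq_square)

lemma vec2_inner: "(v :: real ^ 2) \<bullet> w = v $ 1 * w $ 1 + v $ 2 * w $ 2"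
  by (simp add: inner_vec_def UNIV_2)

lemma curve_derivatives:
  fixes \<gamma> :: "real \<Rightarrow> real \<Rightarrow> real ^ 2" and j :: 2
  assumes I: "open I" and T: "T \<in> I" and sm: "smooth_on (I \<times> UNIV) (\<lambda>(T, s). \<gamma> T s)"
  defines "X \<equiv> \<lambda>y. (case y of (T, s) \<Rightarrow> \<gamma> T s) $ j"
  shows "vector_derivative (\<gamma> T) (at s) $ j = dS X (T, s)"
    "vector_derivative (\<lambda>r. vector_derivative (\<gamma> T) (at r)) (at s) $ j = dS (dS X) (T, s)"
    "vector_derivative (\<lambda>t. \<gamma> t s) (at T) $ j = dT X (T, s)"
proof -
  let ?F = "\<lambda>(T, s). \<gamma> T s"
  have o: "open (I \<times> (UNIV :: real set))" using I by (intro open_Times) auto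
  have bl: "bounded_linear (\<lambda>v::real ^ 2. v $ j)" by (rule bounded_linear_vec_nth)
  have F: "?F differentiable (at (T, s))" "Dir v ?F differentiable (at (T, s))" for s v
    using sm T by (auto intro!: smooth_on_differentiable smooth_on_Dir)
  have s: "((\<lambda>s. (T, s)) has_vector_derivative (0, 1)) (at s)" for s by (auto intro!: derivative_eq_intros)
  have t: "((\<lambda>t. (t, s)) has_vector_derivative (1, 0)) (at T)" by (auto intro!: derivative_eq_intros)
  have 1: "vector_derivative (\<gamma> T) (at s) = Dir (0, 1) ?F (T, s)" for s
    by (rule vector_derivative_at) (use has_vector_derivative_Dir[where p = "\<lambda>s. (T, s)", OF F(1) s] in simp)
  have 2: "vector_derivative (\<lambda>r. Dir (0, 1) ?F (T, r)) (at s) = Dir (0, 1) (Dir (0, 1) ?F) (T, s)" for s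
    by (rule vector_derivative_at) (rule has_vector_derivative_Dir[where p = "\<lambda>s. (T, s)", OF F(2) s])
  have 3: "vector_derivative (\<lambda>t. \<gamma> t s) (at T) = Dir (1, 0) ?F (T, s)"
    by (rule vector_derivative_at) (use has_vector_derivative_Dir[where p = "\<lambda>t. (t, s)", OF F(1) t] in simp)
  have d: "Dir v X y = Dir v ?F y $ j" if "y \<in> I \<times> UNIV" for v y
    unfolding X_def by (rule Dir_bounded_linear[OF bl]) (use sm that in \<open>auto intro!: smooth_on_differentiable\<close>)
  show "vector_derivative (\<gamma> T) (at s) $ j = dS X (T, s)" "vector_derivative (\<lambda>t. \<gamma> t s) (at T) $ j = dT X (T, s)"
    unfolding 1 3 using d T by auto
  have y: "(T, s) \<in> I \<times> UNIV" using T by simp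
  have "dS (dS X) (T, s) = dS (\<lambda>y. Dir (0, 1) ?F y $ j) (T, s)" by (rule Dir_cong[OF o y d])
  also have "\<dots> = Dir (0, 1) (Dir (0, 1) ?F) (T, s) $ j" by (rule Dir_bounded_linear[OF bl F(2)])
  finally show "vector_derivative (\<lambda>r. vector_derivative (\<gamma> T) (at r)) (at s) $ j = dS (dS X) (T, s)"
    unfolding 1 2 by simp
qed

locale front_geometry =
  fixes I :: "real set" and \<gamma> :: "real \<Rightarrow> real \<Rightarrow> real ^ 2" and X Y :: "real \<times> real \<Rightarrow> real"
  assumes I: "open I" and smooth: "smooth_on (I \<times> UNIV) (\<lambda>(T, s). \<gamma> T s)"
    and X: "X = (\<lambda>y. (case y of (T, s) \<Rightarrow> \<gamma> T s) $ 1)" and Y: "Y = (\<lambda>y. (case y of (T, s) \<Rightarrow> \<gamma> T s) $ 2)"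
begin

lemmas cX = curve_derivatives[OF I _ smooth, where j = 1, folded X] and cY = curve_derivatives[OF I _ smooth, where j = 2, folded Y]

lemma speed_rho:
  assumes "T \<in> I" shows "speed (\<gamma> T) s = sqrt (dS X (T, s) * dS X (T, s) + dS Y (T, s) * dS Y (T, s))"
    "1 / speed (\<gamma> T) s = g_rho X Y (T, s)"
  unfolding speed_def vec2_norm g_rho_def cX[OF assms] cY[OF assms] by simp_all

lemma unit_normal_frame:
  assumes "T \<in> I" shows "unit_normal (\<gamma> T) s $ 1 = g_t2 X Y (T, s)" "unit_normal (\<gamma> T) s $ 2 = - g_t1 X Y (T, s)"
  unfolding unit_normal_def Let_def speed_rho(2)[OF assms] by (simp_all add: g_t1_def g_t2_def cX cY assms)

lemma curvature_kap: assumes "T \<in> I" shows "curvature (\<gamma> T) s = g_kap X Y (T, s)"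
proof -
  have "curvature (\<gamma> T) s = (dS X (T, s) * dS (dS Y) (T, s) - dS Y (T, s) * dS (dS X) (T, s)) * (1 / speed (\<gamma> T) s) ^ 3"
    unfolding curvature_def Let_def cX[OF assms] cY[OF assms] by (simp add: power_divide)
  then show ?thesis unfolding speed_rho(2)[OF assms] by (simp add: g_kap_def power3_eq_cube)
qed

lemma normal_velocity_vel: assumes "T \<in> I" shows "normal_velocity \<gamma> T s = g_vel X Y (T, s)"
  unfolding normal_velocity_def vec2_inner unit_normal_frame[OF assms] cX[OF assms] cY[OF assms] by (simp add: g_vel_def)

end

locale front_frame = front_geometry I \<gamma> X Y + moving_frame "I \<times> UNIV" X Y for I \<gamma> X Y
begin

lemma laplace_beltrami_curvature:
  assumes T: "T \<in> I"
  shows "laplace_beltrami (\<gamma> T) (curvature (\<gamma> T)) s = \<rho> (T, s) * \<rho> (T, s) * dS (dS \<kappa>) (T, s)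
    - dS \<sigma> (T, s) * \<rho> (T, s) * \<rho> (T, s) * \<rho> (T, s) * dS \<kappa> (T, s)"
proof -
  have y: "(T, s) \<in> I \<times> UNIV" for s using T by simp
  have sp: "speed (\<gamma> T) s = \<sigma> (T, s)" for s
    using speed_rho(2)[OF T, of s] rho_eq[OF y, of s] by (metis inverse_eq_divide inverse_inverse_eq)
  have k: "curvature (\<gamma> T) = (\<lambda>s. \<kappa> (T, s))" by (rule ext) (rule curvature_kap[OF T])
  have "deriv (\<lambda>s. \<kappa> (T, s)) s = dS \<kappa> (T, s)" for s
    by (rule DERIV_imp_deriv[OF partial_derivs(1)[OF diffs(6)[OF y]]])
  then have 1: "arclength_deriv (\<gamma> T) (curvature (\<gamma> T)) = (\<lambda>s. dS \<kappa> (T, s) / \<sigma> (T, s))"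
    unfolding arclength_deriv_def[abs_def] k sp by simp
  have s: "\<sigma> (T, s) \<noteq> 0" using rho_sigma(2)[OF y, of s] by simp
  have "((\<lambda>s. dS \<kappa> (T, s) / \<sigma> (T, s)) has_real_derivative
      (dS (dS \<kappa>) (T, s) * \<sigma> (T, s) - dS \<kappa> (T, s) * dS \<sigma> (T, s)) / (\<sigma> (T, s) * \<sigma> (T, s))) (at s)"
    by (intro DERIV_divide partial_derivs(1) s) (use y diffs in auto)
  then have "laplace_beltrami (\<gamma> T) (curvature (\<gamma> T)) s
     = (dS (dS \<kappa>) (T, s) * \<sigma> (T, s) - dS \<kappa> (T, s) * dS \<sigma> (T, s)) / (\<sigma> (T, s) * \<sigma> (T, s)) / \<sigma> (T, s)"
    unfolding laplace_beltrami_def 1 by (simp add: arclength_deriv_def DERIV_imp_deriv sp)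
  then show ?thesis using s by (simp add: rho_eq[OF y] divide_simps)
qed

lemma tube_eq: assumes "T \<in> I" shows "\<gamma> T s + (e * z) *\<^sub>R unit_normal (\<gamma> T) s = tube e (T, s, z)"
proof -
  have "X (T, s) = \<gamma> T s $ 1" "Y (T, s) = \<gamma> T s $ 2" by (simp_all add: X Y)
  then show ?thesis by (simp add: vec_eq_iff forall_2 tube_def unit_normal_frame[OF assms] axis_def)
qed

lemma inner_residual:
  assumes T: "T \<in> I" and e: "e > 0" and U: "smooth_on (I \<times> UNIV) (\<lambda>(T, x). U T x)"
    and F: "smooth_on (I \<times> UNIV \<times> UNIV) (\<lambda>(T, s, z). U T (\<gamma> T s + (e * z) *\<^sub>R unit_normal (\<gamma> T) s))"
    and h: "1 + e * z * \<kappa> (T, s) \<noteq> 0"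
  defines "P \<equiv> \<lambda>w. (case w of (T, s, z) \<Rightarrow> U T (\<gamma> T s + (e * z) *\<^sub>R unit_normal (\<gamma> T) s)) $ 1"
    and "Q \<equiv> \<lambda>w. (case w of (T, s, z) \<Rightarrow> U T (\<gamma> T s + (e * z) *\<^sub>R unit_normal (\<gamma> T) s)) $ 2"
    and "hi \<equiv> 1 / (1 + e * z * \<kappa> (T, s))" and "y \<equiv> (T, s)" and "w \<equiv> (T, s, z)"
  defines "L \<equiv> \<lambda>W. Dir (0, 0, 1) (Dir (0, 0, 1) W) w + e * \<kappa> y * hi * Dir (0, 0, 1) W w
       + e\<^sup>2 * ((\<rho> y * hi)\<^sup>2 * Dir (0, 1, 0) (Dir (0, 1, 0) W) w
          - (dS \<sigma> y * (1 + e * z * \<kappa> y) + \<sigma> y * e * z * dS \<kappa> y) * (\<rho> y * hi) ^ 3 * Dir (0, 1, 0) W w)"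
    and "M \<equiv> \<lambda>W. e\<^sup>2 * (Dir (1, 0, 0) W w - (\<tau> y - e * z * \<theta> y) * \<rho> y * hi * Dir (0, 1, 0) W w) - e * V y * Dir (0, 0, 1) W w"
  shows "residual \<beta> \<mu> e U T (tube e w) $ 1
      = M P + (L Q - 2 * (P w * P w + Q w * Q w) * Q w + (1 - \<mu>) * Q w)"
    "residual \<beta> \<mu> e U T (tube e w) $ 2
      = M Q - (L P - 2 * (P w * P w + Q w * Q w) * P w + 2 * P w - \<beta> * Q w)"
proof -
  have oo: "open (I \<times> (UNIV :: (real \<times> real) set))" using I by (intro open_Times) auto
  have u: "U T (tube e w) $ 1 = P w" "U T (tube e w) $ 2 = Q w"
    by (simp_all add: P_def Q_def w_def tube_eq[OF T])
  have sP: "smooth_on (I \<times> UNIV \<times> UNIV) P" "smooth_on (I \<times> UNIV \<times> UNIV) Q"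
    unfolding P_def Q_def
    by (rule smooth_on_bounded_linear(1)[OF _ F bounded_linear_vec_nth], use oo in simp)+
  have n: "(norm (U T (tube e w)))\<^sup>2 = P w * P w + Q w * Q w"
    unfolding vec2_norm u by simp
  let ?f = "\<lambda>j (T, x). U T x $ j"
  have P: "P (T, s, z) = ?f 1 (T, tube e (T, s, z))" "Q (T, s, z) = ?f 2 (T, tube e (T, s, z))" if "T \<in> I" for T s z
    using that by (simp_all add: P_def Q_def tube_eq)
  note c1 = laplacian_component[OF I T U, where j = 1] and c2 = laplacian_component[OF I T U, where j = 2]
  note i1 = inner_operators[OF refl I T e c1(3) sP(1) P(1) h, folded y_def w_def hi_def]
    and i2 = inner_operators[OF refl I T e c2(3) sP(2) P(2) h, folded y_def w_def hi_def]
  have l: "e\<^sup>2 * laplacian (U T) (tube e w) $ 1 = L P" "e\<^sup>2 * laplacian (U T) (tube e w) $ 2 = L Q"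
    unfolding c1(1) c2(1) L_def using i1(1) i2(1) by simp_all
  have m: "e\<^sup>2 * vector_derivative (\<lambda>t. U t (tube e w)) (at T) $ 1 = M P" "e\<^sup>2 * vector_derivative (\<lambda>t. U t (tube e w)) (at T) $ 2 = M Q"
    unfolding c1(2) c2(2) M_def using i1(2) i2(2) by simp_all
  show "residual \<beta> \<mu> e U T (tube e w) $ 1 = M P + (L Q - 2 * (P w * P w + Q w * Q w) * Q w + (1 - \<mu>) * Q w)"
    "residual \<beta> \<mu> e U T (tube e w) $ 2 = M Q - (L P - 2 * (P w * P w + Q w * Q w) * P w + 2 * P w - \<beta> * Q w)"
    unfolding residual_def rhs_def by (simp_all add: l m n u)
qed

end

text \<open>Expansions at a single point, encoded over a one-point set. Identities that hold for
  small \<epsilon> become identities between series through uniqueness.\<close>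

definition pexp :: "(real \<Rightarrow> real) \<Rightarrow> real fps \<Rightarrow> bool" where
  "pexp e a \<longleftrightarrow> uexp {()} (\<lambda>\<epsilon> _. e \<epsilon>) (\<lambda>_. a)"

lemma pexp_ring:
  "pexp e a \<Longrightarrow> pexp f b \<Longrightarrow> pexp (\<lambda>\<epsilon>. e \<epsilon> + f \<epsilon>) (a + b)"
  "pexp e a \<Longrightarrow> pexp f b \<Longrightarrow> pexp (\<lambda>\<epsilon>. e \<epsilon> - f \<epsilon>) (a - b)"
  "pexp e a \<Longrightarrow> pexp f b \<Longrightarrow> pexp (\<lambda>\<epsilon>. e \<epsilon> * f \<epsilon>) (a * b)"
  "pexp e a \<Longrightarrow> pexp (\<lambda>\<epsilon>. - e \<epsilon>) (- a)"
  "pexp (\<lambda>\<epsilon>. x) (fps_const x)" "pexp (\<lambda>\<epsilon>. 1) 1" "pexp (\<lambda>\<epsilon>. \<epsilon>) fps_X"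
  unfolding pexp_def using uexp_const[of "{()}" 1]
  by (simp_all add: uexp_add uexp_diff uexp_mult uexp_minus uexp_const uexp_eps)

lemma pexp_unique: "pexp e a \<Longrightarrow> pexp f b \<Longrightarrow> \<forall>\<^sub>F \<epsilon> in at_right 0. e \<epsilon> = f \<epsilon> \<Longrightarrow> a = b"
proof -
  assume e: "pexp e a" and f: "pexp f b" and ev: "\<forall>\<^sub>F \<epsilon> in at_right 0. e \<epsilon> = f \<epsilon>"
  have "uexp {()} (\<lambda>\<epsilon> _. f \<epsilon>) (\<lambda>_. a)"
    by (rule uexp_cong[OF e[unfolded pexp_def]]) (use ev in auto)
  from uexp_unique[OF this f[unfolded pexp_def]] show "a = b" .
qed

lemma pexp_negligible:
  assumes "pexp e a" "\<And>N. \<exists>C. \<forall>\<^sub>F \<epsilon> in at_right 0. \<bar>e \<epsilon>\<bar> \<le> C * \<epsilon> ^ N" shows "a = 0"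
  using uexp_negligible_imp_0[OF assms(1)[unfolded pexp_def] assms(2)] .

lemma pexp_tendsto:
  assumes "pexp e a" "a $$ 0 > m" shows "\<forall>\<^sub>F \<epsilon> in at_right 0. e \<epsilon> > m"
proof -
  obtain C where C: "\<forall>\<^sub>F \<epsilon> in at_right 0. \<forall>y\<in>{()}. \<bar>e \<epsilon> - (\<Sum>i<Suc 0. a $$ i * \<epsilon> ^ i)\<bar> \<le> C * \<epsilon> ^ Suc 0"
    by (rule uexpE[OF assms(1)[unfolded pexp_def], of "Suc 0"])
  have "((\<lambda>\<epsilon>. a $$ 0 - C * \<epsilon>) \<longlongrightarrow> a $$ 0 - C * 0) (at_right 0)" by (intro tendsto_intros)
  then have "\<forall>\<^sub>F \<epsilon> in at_right 0. a $$ 0 - C * \<epsilon> > m" using assms(2) by (intro order_tendstoD(1)) auto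
  then show ?thesis using C by eventually_elim (auto simp: abs_le_iff)
qed

text \<open>A positive function is inverted by squaring its reciprocal square root, whose expansion
  is known. The algebraic inverse \<open>H\<close> coincides with the square of the corresponding
  series.\<close>

lemma pexp_inverse:
  assumes h: "pexp h a" "a $$ 0 > 0" and H: "H * a = 1"
  shows "pexp (\<lambda>\<epsilon>. 1 / h \<epsilon>) H"
proof -
  define m where "m = a $$ 0 / 2"
  have m: "m > 0" "a $$ 0 > m" using h(2) by (simp_all add: m_def)
  have ev: "\<forall>\<^sub>F \<epsilon> in at_right 0. h \<epsilon> > m" by (rule pexp_tendsto[OF h(1) m(2)])
  have r: "pexp (\<lambda>\<epsilon>. 1 / sqrt (h \<epsilon>)) (fps_rsqrt a)"
    unfolding pexp_def
    by (rule uexp_rsqrt[OF h(1)[unfolded pexp_def] m(1)]) (use ev in \<open>auto elim: eventually_mono\<close>)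
  have "fps_rsqrt a * fps_rsqrt a = H * a * (fps_rsqrt a * fps_rsqrt a)" using H by simp
  also have "\<dots> = H * (fps_rsqrt a * fps_rsqrt a * a)" by (simp add: mult_ac)
  finally have e: "fps_rsqrt a * fps_rsqrt a = H" using fps_rsqrt(1)[OF h(2)] by simp
  have "\<forall>\<^sub>F \<epsilon> in at_right 0. 1 / sqrt (h \<epsilon>) * (1 / sqrt (h \<epsilon>)) = 1 / h \<epsilon>"
    using ev by eventually_elim (use m in auto)
  then show ?thesis
    unfolding pexp_def by (intro uexp_cong[OF pexp_ring(3)[OF r r, unfolded e pexp_def]]) simp_all
qed

text \<open>A single choice of coefficients that is valid for every number of derivatives, so that
  the same series can be differentiated repeatedly.\<close>

definition series :: "'a::real_normed_vector set \<Rightarrow> (real \<Rightarrow> 'a \<Rightarrow> real) \<Rightarrow> 'a \<Rightarrow> real fps" where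
  "series S e = (SOME c. \<forall>n. Aexp n S e c)"

lemma Aexp_series: "\<exists>c. \<forall>n. Aexp n S e c \<Longrightarrow> Aexp n S e (series S e)"
  unfolding series_def by (drule someI_ex) blast

lemma Aexp_Dir: "(\<And>n. Aexp n S e c) \<Longrightarrow> Aexp n S (\<lambda>\<epsilon>. Dir v (e \<epsilon>)) (fDir v c)"
  using Aexp_SucD(3)[of n] by blast

lemma Aexp_pexp: assumes "Aexp n S e c" "y \<in> S" shows "pexp (\<lambda>\<epsilon>. e \<epsilon> y) (c y)"
  unfolding pexp_def
  using uexp_reindex[OF Aexp_uexp[OF assms(1), of "{y}"], of "{()}" "\<lambda>_. y"] assms(2) by simp

lemma in_L2_nth:
  fixes f :: "real \<Rightarrow> real ^ 2" assumes "in_L2 f" shows "in_L2 (\<lambda>z. f z $ j)"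
proof -
  have m: "(\<lambda>z. f z $ j) \<in> borel_measurable lborel"
    using assms unfolding in_L2_def cart_eq_inner_axis by (auto intro!: borel_measurable_inner)
  have "integrable lborel (\<lambda>z. (norm (f z $ j))\<^sup>2)"
  proof (rule Bochner_Integration.integrable_bound)
    show "integrable lborel (\<lambda>z. (norm (f z))\<^sup>2)" using assms by (simp add: in_L2_def)
    show "(\<lambda>z. (norm (f z $ j))\<^sup>2) \<in> borel_measurable lborel" using m by measurable
    show "AE z in lborel. norm ((norm (f z $ j))\<^sup>2) \<le> norm ((norm (f z))\<^sup>2)"
    proof (rule AE_I2)
      fix z
      have "(norm (f z $ j))\<^sup>2 \<le> (norm (f z))\<^sup>2" by (rule power_mono) (simp_all add: component_le_norm_cart)
      then show "norm ((norm (f z $ j))\<^sup>2) \<le> norm ((norm (f z))\<^sup>2)" by simp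
    qed
  qed
  then show ?thesis using m by (simp add: in_L2_def)
qed

locale front_expansion =
  fixes \<beta> \<mu> :: real and I :: "real set" and \<gamma> :: "real \<Rightarrow> real \<Rightarrow> real \<Rightarrow> real ^ 2"
    and U :: "real \<Rightarrow> real \<Rightarrow> real ^ 2 \<Rightarrow> real ^ 2" and g :: "nat \<Rightarrow> real \<times> real \<Rightarrow> real ^ 2"
    and u :: "nat \<Rightarrow> real \<times> real \<times> real \<Rightarrow> real ^ 2" and m :: real
  assumes I: "open I" and beta: "\<beta> > 0" and mu1: "\<mu> \<ge> -1"
    and curve: "asymp_expansion (I \<times> UNIV) (\<lambda>\<epsilon> (T, s). \<gamma> \<epsilon> T s) g"
    and m: "m > 0" and front: "\<forall>\<^sub>F \<epsilon> in at_right 0. \<forall>T\<in>I. \<forall>s. \<gamma> \<epsilon> T (s + 1) = \<gamma> \<epsilon> T s \<and> m \<le> speed (\<gamma> \<epsilon> T) s"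
    and solution: "\<forall>\<^sub>F \<epsilon> in at_right 0. smooth_on (I \<times> UNIV) (\<lambda>(T, x). U \<epsilon> T x)"
      "\<And>T N. T \<in> I \<Longrightarrow> \<exists>C. \<forall>\<^sub>F \<epsilon> in at_right 0. \<forall>x. norm (residual \<beta> \<mu> \<epsilon> (U \<epsilon>) T x) \<le> C * \<epsilon> ^ N"
    and inner: "inner_expansion I \<gamma> U u"
begin

definition "X \<epsilon> = (\<lambda>y. (case y of (T, s) \<Rightarrow> \<gamma> \<epsilon> T s) $ 1)"
definition "Y \<epsilon> = (\<lambda>y. (case y of (T, s) \<Rightarrow> \<gamma> \<epsilon> T s) $ 2)"
definition "P \<epsilon> = (\<lambda>w. (case w of (T, s, z) \<Rightarrow> U \<epsilon> T (\<gamma> \<epsilon> T s + (\<epsilon> * z) *\<^sub>R unit_normal (\<gamma> \<epsilon> T) s)) $ 1)"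
definition "Q \<epsilon> = (\<lambda>w. (case w of (T, s, z) \<Rightarrow> U \<epsilon> T (\<gamma> \<epsilon> T s + (\<epsilon> * z) *\<^sub>R unit_normal (\<gamma> \<epsilon> T) s)) $ 2)"
definition "sX y = Abs_fps (\<lambda>i. g i y $ 1)"
definition "sY y = Abs_fps (\<lambda>i. g i y $ 2)"
definition "sP w = Abs_fps (\<lambda>i. u i w $ 1)"
definition "sQ w = Abs_fps (\<lambda>i. u i w $ 2)"
abbreviation "S \<equiv> I \<times> (UNIV :: real set)"
abbreviation "S3 \<equiv> I \<times> (UNIV :: real set) \<times> (UNIV :: real set)"
definition "sR = series S (\<lambda>\<epsilon>. g_rho (X \<epsilon>) (Y \<epsilon>))"
definition "sSg = series S (\<lambda>\<epsilon>. g_sig (X \<epsilon>) (Y \<epsilon>))"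
definition "st1 = series S (\<lambda>\<epsilon>. g_t1 (X \<epsilon>) (Y \<epsilon>))"
definition "st2 = series S (\<lambda>\<epsilon>. g_t2 (X \<epsilon>) (Y \<epsilon>))"
definition "sK = series S (\<lambda>\<epsilon>. g_kap (X \<epsilon>) (Y \<epsilon>))"
definition "sV = series S (\<lambda>\<epsilon>. g_vel (X \<epsilon>) (Y \<epsilon>))"
definition "sTa = series S (\<lambda>\<epsilon>. g_tau (X \<epsilon>) (Y \<epsilon>))"
definition "sTh = series S (\<lambda>\<epsilon>. g_rot (X \<epsilon>) (Y \<epsilon>))"

section \<open>Expansions of the moving frame and of the field\<close>

lemma open_S: "open S" "open S3" using I by (auto intro: open_Times)

lemma Aexp_curve: "Aexp n S X sX" "Aexp n S Y sY"
  unfolding X_def[abs_def] Y_def[abs_def] sX_def[abs_def] sY_def[abs_def]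
  by (rule asymp_expansion_Aexp[OF open_S(1) curve bounded_linear_vec_nth])+

lemma Aexp_field: "Aexp n S3 P sP" "Aexp n S3 Q sQ"
proof -
  have a: "asymp_expansion S3 (\<lambda>\<epsilon> (T, s, z). U \<epsilon> T (\<gamma> \<epsilon> T s + (\<epsilon> * z) *\<^sub>R unit_normal (\<gamma> \<epsilon> T) s)) u"
    using inner unfolding inner_expansion_def by blast
  show "Aexp n S3 P sP" "Aexp n S3 Q sQ"
    unfolding P_def[abs_def] Q_def[abs_def] sP_def[abs_def] sQ_def[abs_def]
    by (rule asymp_expansion_Aexp[OF open_S(2) a bounded_linear_vec_nth])+
qed

lemma smooth_field:
  "\<forall>\<^sub>F \<epsilon> in at_right 0. smooth_on S3 (\<lambda>(T, s, z). U \<epsilon> T (\<gamma> \<epsilon> T s + (\<epsilon> * z) *\<^sub>R unit_normal (\<gamma> \<epsilon> T) s))"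
  using inner unfolding inner_expansion_def asymp_expansion_def by blast

lemma front_geometry: "\<forall>\<^sub>F \<epsilon> in at_right 0. front_geometry I (\<gamma> \<epsilon>) (X \<epsilon>) (Y \<epsilon>)"
proof -
  have "\<forall>\<^sub>F \<epsilon> in at_right 0. smooth_on S (\<lambda>(T, s). \<gamma> \<epsilon> T s)"
    using curve unfolding asymp_expansion_def by blast
  then show ?thesis by eventually_elim (rule front_geometry.intro[OF I], auto simp: X_def Y_def)
qed

lemma immersed: "\<forall>\<^sub>F \<epsilon> in at_right 0. \<forall>y\<in>S. dS (X \<epsilon>) y * dS (X \<epsilon>) y + dS (Y \<epsilon>) y * dS (Y \<epsilon>) y \<ge> m\<^sup>2"
  using front_geometry front
proof eventually_elim
  case (elim \<epsilon>)
  interpret front_geometry I "\<gamma> \<epsilon>" "X \<epsilon>" "Y \<epsilon>" by (rule elim(1))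
  show ?case
  proof
    fix y assume "y \<in> S"
    then obtain T s where y: "y = (T, s)" "T \<in> I" by auto
    have "m \<le> speed (\<gamma> \<epsilon> T) s" using elim(2) y(2) by blast
    then have "m \<le> sqrt (dS (X \<epsilon>) y * dS (X \<epsilon>) y + dS (Y \<epsilon>) y * dS (Y \<epsilon>) y)"
      unfolding speed_rho(1)[OF y(2)] y(1) .
    then have "m\<^sup>2 \<le> (sqrt (dS (X \<epsilon>) y * dS (X \<epsilon>) y + dS (Y \<epsilon>) y * dS (Y \<epsilon>) y))\<^sup>2"
      using m by (intro power_mono) auto
    then show "m\<^sup>2 \<le> dS (X \<epsilon>) y * dS (X \<epsilon>) y + dS (Y \<epsilon>) y * dS (Y \<epsilon>) y" by simp
  qed
qed

lemma m2: "m\<^sup>2 > 0" using m by simp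

lemma front_frame: "\<forall>\<^sub>F \<epsilon> in at_right 0. front_frame I (\<gamma> \<epsilon>) (X \<epsilon>) (Y \<epsilon>)"
  using front_geometry eventually_moving_frame[OF open_S(1) Aexp_curve(1) Aexp_curve(2) m2 immersed]
  by eventually_elim (rule front_frame.intro)

lemma Aexp_frame:
  "Aexp n S (\<lambda>\<epsilon>. g_rho (X \<epsilon>) (Y \<epsilon>)) sR" "Aexp n S (\<lambda>\<epsilon>. g_sig (X \<epsilon>) (Y \<epsilon>)) sSg"
  "Aexp n S (\<lambda>\<epsilon>. g_t1 (X \<epsilon>) (Y \<epsilon>)) st1" "Aexp n S (\<lambda>\<epsilon>. g_t2 (X \<epsilon>) (Y \<epsilon>)) st2"
  "Aexp n S (\<lambda>\<epsilon>. g_kap (X \<epsilon>) (Y \<epsilon>)) sK" "Aexp n S (\<lambda>\<epsilon>. g_vel (X \<epsilon>) (Y \<epsilon>)) sV"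
  "Aexp n S (\<lambda>\<epsilon>. g_tau (X \<epsilon>) (Y \<epsilon>)) sTa" "Aexp n S (\<lambda>\<epsilon>. g_rot (X \<epsilon>) (Y \<epsilon>)) sTh"
  unfolding sR_def sSg_def st1_def st2_def sK_def sV_def sTa_def sTh_def
  by (rule Aexp_series, rule Aexp_geometry[OF open_S(1) Aexp_curve(1) Aexp_curve(2) m2 immersed])+

lemmas frame_pexp = Aexp_frame[THEN Aexp_pexp[where n = 0]]
lemmas frame_pexp_D = Aexp_frame[THEN Aexp_Dir, THEN Aexp_pexp[where n = 0]]
lemmas frame_pexp_DD = Aexp_frame[THEN Aexp_Dir, THEN Aexp_Dir, THEN Aexp_pexp[where n = 0]]
lemmas field_pexp = Aexp_field[THEN Aexp_pexp[where n = 0]]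
lemmas field_pexp_D = Aexp_field[THEN Aexp_Dir, THEN Aexp_pexp[where n = 0]]
lemmas field_pexp_DD = Aexp_field[THEN Aexp_Dir, THEN Aexp_Dir, THEN Aexp_pexp[where n = 0]]

lemma evolution:
  assumes y: "y \<in> S"
  shows "fDir (1, 0) sK y - sTa y * sR y * fDir (0, 1) sK y
    = - (sR y * sR y * fDir (0, 1) (fDir (0, 1) sV) y - fDir (0, 1) sSg y * sR y * sR y * sR y * fDir (0, 1) sV y) - sK y * sK y * sV y"
proof (rule pexp_unique)
  show "pexp (\<lambda>\<epsilon>. dT (g_kap (X \<epsilon>) (Y \<epsilon>)) y - g_tau (X \<epsilon>) (Y \<epsilon>) y * g_rho (X \<epsilon>) (Y \<epsilon>) y * dS (g_kap (X \<epsilon>) (Y \<epsilon>)) y)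
     (fDir (1, 0) sK y - sTa y * sR y * fDir (0, 1) sK y)"
    by (intro pexp_ring frame_pexp frame_pexp_D y)
  show "pexp (\<lambda>\<epsilon>. - (g_rho (X \<epsilon>) (Y \<epsilon>) y * g_rho (X \<epsilon>) (Y \<epsilon>) y * dS (dS (g_vel (X \<epsilon>) (Y \<epsilon>))) y
       - dS (g_sig (X \<epsilon>) (Y \<epsilon>)) y * g_rho (X \<epsilon>) (Y \<epsilon>) y * g_rho (X \<epsilon>) (Y \<epsilon>) y * g_rho (X \<epsilon>) (Y \<epsilon>) y * dS (g_vel (X \<epsilon>) (Y \<epsilon>)) y)
       - g_kap (X \<epsilon>) (Y \<epsilon>) y * g_kap (X \<epsilon>) (Y \<epsilon>) y * g_vel (X \<epsilon>) (Y \<epsilon>) y)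
     (- (sR y * sR y * fDir (0, 1) (fDir (0, 1) sV) y - fDir (0, 1) sSg y * sR y * sR y * sR y * fDir (0, 1) sV y) - sK y * sK y * sV y)"
    by (intro pexp_ring frame_pexp frame_pexp_D frame_pexp_DD y)
  show "\<forall>\<^sub>F \<epsilon> in at_right 0. dT (g_kap (X \<epsilon>) (Y \<epsilon>)) y - g_tau (X \<epsilon>) (Y \<epsilon>) y * g_rho (X \<epsilon>) (Y \<epsilon>) y * dS (g_kap (X \<epsilon>) (Y \<epsilon>)) y
     = - (g_rho (X \<epsilon>) (Y \<epsilon>) y * g_rho (X \<epsilon>) (Y \<epsilon>) y * dS (dS (g_vel (X \<epsilon>) (Y \<epsilon>))) y
       - dS (g_sig (X \<epsilon>) (Y \<epsilon>)) y * g_rho (X \<epsilon>) (Y \<epsilon>) y * g_rho (X \<epsilon>) (Y \<epsilon>) y * g_rho (X \<epsilon>) (Y \<epsilon>) y * dS (g_vel (X \<epsilon>) (Y \<epsilon>)) y)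
       - g_kap (X \<epsilon>) (Y \<epsilon>) y * g_kap (X \<epsilon>) (Y \<epsilon>) y * g_vel (X \<epsilon>) (Y \<epsilon>) y"
    using front_frame by eventually_elim (rule moving_frame.curvature_evolution[OF front_frame.axioms(2) y])
qed

text \<open>A vanishing leading-order curvature would make the leading tangent constant along a closed
  curve.\<close>

lemma nonflat:
  assumes T: "T \<in> I" shows "\<exists>s. sK (T, s) $$ 0 \<noteq> 0"
proof (rule ccontr)
  assume "\<not> ?thesis"
  then have K: "sK (T, s) $$ 0 = 0" for s by blast
  have y: "(T, s) \<in> S" for s using T by simp
  have "fDir (0, 1) st1 (T, s) = - (sSg (T, s) * sK (T, s) * st2 (T, s))" for s
    by (rule pexp_unique[OF frame_pexp_D(3)[OF y] pexp_ring(4)[OF pexp_ring(3)[OF pexp_ring(3)[OF frame_pexp(2)[OF y] frame_pexp(5)[OF y]] frame_pexp(4)[OF y]]]])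
       (use front_frame in eventually_elim, rule moving_frame.frenet(1)[OF front_frame.axioms(2) y])
  then have d1: "fDir (0, 1) st1 (T, s) $$ 0 = 0" for s by (simp add: K del: fDir_nth)
  have "fDir (0, 1) st2 (T, s) = sSg (T, s) * sK (T, s) * st1 (T, s)" for s
    by (rule pexp_unique[OF frame_pexp_D(4)[OF y] pexp_ring(3)[OF pexp_ring(3)[OF frame_pexp(2)[OF y] frame_pexp(5)[OF y]] frame_pexp(3)[OF y]]])
       (use front_frame in eventually_elim, rule moving_frame.frenet(2)[OF front_frame.axioms(2) y])
  then have d2: "fDir (0, 1) st2 (T, s) $$ 0 = 0" for s by (simp add: K del: fDir_nth)
  have diff: "(\<lambda>y. c y $$ 0) differentiable (at (T, s))" if "Aexp (Suc 0) S e c" for e c s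
    using Aexp_SucD(2)[OF that y[of s]] by (simp add: fps_diff_at_def)
  have DX: "fDir (0, 1) sX (T, s) = sSg (T, s) * st1 (T, s)" for s
    by (rule pexp_unique[OF Aexp_pexp[OF Aexp_Dir[OF Aexp_curve(1), where n = 0] y] pexp_ring(3)[OF frame_pexp(2)[OF y] frame_pexp(3)[OF y]]])
       (use front_frame in eventually_elim, rule moving_frame.rho_sigma(3)[OF front_frame.axioms(2) y])
  have DY: "fDir (0, 1) sY (T, s) = sSg (T, s) * st2 (T, s)" for s
    by (rule pexp_unique[OF Aexp_pexp[OF Aexp_Dir[OF Aexp_curve(2), where n = 0] y] pexp_ring(3)[OF frame_pexp(2)[OF y] frame_pexp(4)[OF y]]])
       (use front_frame in eventually_elim, rule moving_frame.rho_sigma(4)[OF front_frame.axioms(2) y])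
  have U: "st1 (T, s) * st1 (T, s) + st2 (T, s) * st2 (T, s) = 1" for s
    by (rule pexp_unique[OF pexp_ring(1)[OF pexp_ring(3)[OF frame_pexp(3)[OF y] frame_pexp(3)[OF y]] pexp_ring(3)[OF frame_pexp(4)[OF y] frame_pexp(4)[OF y]]] pexp_ring(6)])
       (use front_frame in eventually_elim, rule moving_frame.rho_sigma(5)[OF front_frame.axioms(2) y])
  let ?x = "\<lambda>s. sX (T, s) $$ 0" and ?y = "\<lambda>s. sY (T, s) $$ 0" and ?a = "st1 (T, 0) $$ 0" and ?b = "st2 (T, 0) $$ 0"
  have pd: "((\<lambda>s. c (T, s) $$ 0) has_real_derivative fDir (0, 1) c (T, s) $$ 0) (at s)" if "Aexp (Suc 0) S e c" for e c s
    using partial_derivs(1)[OF diff[OF that]] by simp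
  have c1: "st1 (T, s) $$ 0 = ?a" for s
    by (rule DERIV_isconst_all) (use pd[OF Aexp_frame(3)] d1 in simp)
  have c2: "st2 (T, s) $$ 0 = ?b" for s
    by (rule DERIV_isconst_all) (use pd[OF Aexp_frame(4)] d2 in simp)
  have ab: "?a * ?a + ?b * ?b = 1" using arg_cong[OF U[of 0], of "\<lambda>c. c $$ 0"] by simp
  have px: "((\<lambda>s. ?x s) has_real_derivative sSg (T, s) $$ 0 * ?a) (at s)" for s
    using pd[OF Aexp_curve(1), where s = s] unfolding DX by (simp add: c1[of s])
  have py: "((\<lambda>s. ?y s) has_real_derivative sSg (T, s) $$ 0 * ?b) (at s)" for s
    using pd[OF Aexp_curve(2), where s = s] unfolding DY by (simp add: c2[of s])
  \<comment> \<open>The coordinate of the leading curve along its constant tangent has the speed as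
    derivative. By periodicity it takes equal values at 0 and 1, so Rolle produces a point of zero
    speed, against \<rho> \<sigma> = 1.\<close>
  have p: "((\<lambda>s. ?a * ?x s + ?b * ?y s) has_real_derivative sSg (T, s) $$ 0) (at s)" for s
  proof -
    have e: "?a * (sSg (T, s) $$ 0 * ?a) + ?b * (sSg (T, s) $$ 0 * ?b) = sSg (T, s) $$ 0 * (?a * ?a + ?b * ?b)"
      by (simp add: algebra_simps)
    have "((\<lambda>s. ?a * ?x s + ?b * ?y s) has_real_derivative ?a * (sSg (T, s) $$ 0 * ?a) + ?b * (sSg (T, s) $$ 0 * ?b)) (at s)"
      by (rule DERIV_add[OF DERIV_cmult[OF px] DERIV_cmult[OF py]])
    then show ?thesis unfolding e ab by simp
  qed
  have "sX (T, 0) = sX (T, 1)"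
    by (rule pexp_unique[OF Aexp_pexp[OF Aexp_curve(1)[of 0] y] Aexp_pexp[OF Aexp_curve(1)[of 0] y]])
       (use front in eventually_elim, use T in \<open>force simp: X_def dest!: bspec[OF _ T] spec[of _ 0]\<close>)
  moreover have "sY (T, 0) = sY (T, 1)"
    by (rule pexp_unique[OF Aexp_pexp[OF Aexp_curve(2)[of 0] y] Aexp_pexp[OF Aexp_curve(2)[of 0] y]])
       (use front in eventually_elim, use T in \<open>force simp: Y_def dest!: bspec[OF _ T] spec[of _ 0]\<close>)
  ultimately obtain s where "((\<lambda>s. ?a * ?x s + ?b * ?y s) has_real_derivative 0) (at s)"
    using Rolle[of 0 1 "\<lambda>s. ?a * ?x s + ?b * ?y s"] p
    by (auto intro: DERIV_isCont continuous_at_imp_continuous_on simp: real_differentiable_def)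
  then have s: "sSg (T, s) $$ 0 = 0" using p DERIV_unique by blast
  have "sR (T, s) * sSg (T, s) = 1"
    by (rule pexp_unique[OF pexp_ring(3)[OF frame_pexp(1)[OF y] frame_pexp(2)[OF y]] pexp_ring(6)])
       (use front_frame in eventually_elim, rule moving_frame.rho_sigma(1)[OF front_frame.axioms(2) y])
  from arg_cong[OF this, of "\<lambda>c. c $$ 0"] s show False by simp
qed

text \<open>At the point of the tube the two expressions are the components of the residual, hence
  below every power of \<epsilon>. They also have expansions, built with the same ring operations as
  the left sides; so these series vanish identically.\<close>

lemma inner_equations:
  assumes T: "T \<in> I" and H: "H * (1 + fps_X * (fps_const z * sK (T, s))) = 1"
  defines "L \<equiv> \<lambda>F. fDir (0, 0, 1) (fDir (0, 0, 1) F) (T, s, z) + fps_X * (sK (T, s) * H * fDir (0, 0, 1) F (T, s, z))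
         + fps_X * (fps_X * (sR (T, s) * H * (sR (T, s) * H) * fDir (0, 1, 0) (fDir (0, 1, 0) F) (T, s, z)
            - (fDir (0, 1) sSg (T, s) * (1 + fps_X * (fps_const z * sK (T, s))) + sSg (T, s) * (fps_X * (fps_const z * fDir (0, 1) sK (T, s))))
              * (sR (T, s) * H * (sR (T, s) * H) * (sR (T, s) * H)) * fDir (0, 1, 0) F (T, s, z)))"
    and "M \<equiv> \<lambda>F. fps_X * (fps_X * (fDir (1, 0, 0) F (T, s, z) - (sTa (T, s) - fps_X * (fps_const z * sTh (T, s))) * sR (T, s) * H * fDir (0, 1, 0) F (T, s, z)))
        - fps_X * (sV (T, s) * fDir (0, 0, 1) F (T, s, z))"
  shows "M sP + (L sQ - fps_const 2 * ((sP (T, s, z) * sP (T, s, z) + sQ (T, s, z) * sQ (T, s, z)) * sQ (T, s, z)) + fps_const (1 - \<mu>) * sQ (T, s, z)) = 0"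
    "M sQ - (L sP - fps_const 2 * ((sP (T, s, z) * sP (T, s, z) + sQ (T, s, z) * sQ (T, s, z)) * sP (T, s, z)) + fps_const 2 * sP (T, s, z) - fps_const \<beta> * sQ (T, s, z)) = 0"
proof -
  define y where "y = (T, s)"
  define w where "w = (T, s, z)"
  have y: "y \<in> S" and w: "w \<in> S3" using T by (simp_all add: y_def w_def)
  note f = frame_pexp[OF y] frame_pexp_D[OF y] frame_pexp_DD[OF y]
    and F = field_pexp[OF w] field_pexp_D[OF w] field_pexp_DD[OF w]
  define h where "h \<epsilon> = 1 + \<epsilon> * (z * g_kap (X \<epsilon>) (Y \<epsilon>) y)" for \<epsilon>
  have h: "pexp h (1 + fps_X * (fps_const z * sK y))" unfolding h_def[abs_def] by (intro pexp_ring f)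
  have hi: "pexp (\<lambda>\<epsilon>. 1 / h \<epsilon>) H" by (rule pexp_inverse[OF h]) (use H in \<open>simp_all add: y_def\<close>)
  have hp: "\<forall>\<^sub>F \<epsilon> in at_right 0. h \<epsilon> > 0" by (rule pexp_tendsto[OF h]) simp
  define l where "l W \<epsilon> = Dir (0, 0, 1) (Dir (0, 0, 1) W) w + \<epsilon> * (g_kap (X \<epsilon>) (Y \<epsilon>) y * (1 / h \<epsilon>) * Dir (0, 0, 1) W w)
       + \<epsilon> * (\<epsilon> * (g_rho (X \<epsilon>) (Y \<epsilon>) y * (1 / h \<epsilon>) * (g_rho (X \<epsilon>) (Y \<epsilon>) y * (1 / h \<epsilon>)) * Dir (0, 1, 0) (Dir (0, 1, 0) W) w
          - (dS (g_sig (X \<epsilon>) (Y \<epsilon>)) y * (1 + \<epsilon> * (z * g_kap (X \<epsilon>) (Y \<epsilon>) y)) + g_sig (X \<epsilon>) (Y \<epsilon>) y * (\<epsilon> * (z * dS (g_kap (X \<epsilon>) (Y \<epsilon>)) y)))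
            * (g_rho (X \<epsilon>) (Y \<epsilon>) y * (1 / h \<epsilon>) * (g_rho (X \<epsilon>) (Y \<epsilon>) y * (1 / h \<epsilon>)) * (g_rho (X \<epsilon>) (Y \<epsilon>) y * (1 / h \<epsilon>))) * Dir (0, 1, 0) W w))"
    for W \<epsilon>
  define k where "k W \<epsilon> = \<epsilon> * (\<epsilon> * (Dir (1, 0, 0) W w - (g_tau (X \<epsilon>) (Y \<epsilon>) y - \<epsilon> * (z * g_rot (X \<epsilon>) (Y \<epsilon>) y)) * g_rho (X \<epsilon>) (Y \<epsilon>) y * (1 / h \<epsilon>) * Dir (0, 1, 0) W w))
       - \<epsilon> * (g_vel (X \<epsilon>) (Y \<epsilon>) y * Dir (0, 0, 1) W w)" for W \<epsilon>
  define r1 where "r1 \<epsilon> = k (P \<epsilon>) \<epsilon> + (l (Q \<epsilon>) \<epsilon> - 2 * ((P \<epsilon> w * P \<epsilon> w + Q \<epsilon> w * Q \<epsilon> w) * Q \<epsilon> w) + (1 - \<mu>) * Q \<epsilon> w)" for \<epsilon>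
  define r2 where "r2 \<epsilon> = k (Q \<epsilon>) \<epsilon> - (l (P \<epsilon>) \<epsilon> - 2 * ((P \<epsilon> w * P \<epsilon> w + Q \<epsilon> w * Q \<epsilon> w) * P \<epsilon> w) + 2 * P \<epsilon> w - \<beta> * Q \<epsilon> w)" for \<epsilon>
  have p1: "pexp r1 (M sP + (L sQ - fps_const 2 * ((sP w * sP w + sQ w * sQ w) * sQ w) + fps_const (1 - \<mu>) * sQ w))"
    unfolding r1_def[abs_def] k_def l_def L_def M_def y_def[symmetric] w_def[symmetric] by (intro pexp_ring f F hi)
  have p2: "pexp r2 (M sQ - (L sP - fps_const 2 * ((sP w * sP w + sQ w * sQ w) * sP w) + fps_const 2 * sP w - fps_const \<beta> * sQ w))"
    unfolding r2_def[abs_def] k_def l_def L_def M_def y_def[symmetric] w_def[symmetric] by (intro pexp_ring f F hi)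
  have res: "\<forall>\<^sub>F \<epsilon> in at_right 0. \<exists>x. r1 \<epsilon> = residual \<beta> \<mu> \<epsilon> (U \<epsilon>) T x $ 1 \<and> r2 \<epsilon> = residual \<beta> \<mu> \<epsilon> (U \<epsilon>) T x $ 2"
    using front_frame smooth_field solution(1) hp eventually_at_right_0_pos
  proof eventually_elim
    case (elim \<epsilon>)
    interpret fr: front_frame I "\<gamma> \<epsilon>" "X \<epsilon>" "Y \<epsilon>" by (rule elim(1))
    have e: "\<epsilon> > 0" and hh: "1 + \<epsilon> * z * g_kap (X \<epsilon>) (Y \<epsilon>) (T, s) \<noteq> 0"
      using elim(4,5) by (simp_all add: h_def y_def mult.assoc)
    note ir = fr.inner_residual[OF T e elim(3) elim(2) hh, folded P_def Q_def y_def w_def, where \<beta> = \<beta> and \<mu> = \<mu>]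
    have "r1 \<epsilon> = residual \<beta> \<mu> \<epsilon> (U \<epsilon>) T (fr.tube \<epsilon> w) $ 1" "r2 \<epsilon> = residual \<beta> \<mu> \<epsilon> (U \<epsilon>) T (fr.tube \<epsilon> w) $ 2"
      unfolding ir r1_def r2_def k_def l_def fun_cong[OF P_def, of \<epsilon> w] fun_cong[OF Q_def, of \<epsilon> w]
      by (simp_all add: h_def power2_eq_square power3_eq_cube mult.assoc right_diff_distrib distrib_left)
    then show ?case by blast
  qed
  have neg: "(\<exists>C. \<forall>\<^sub>F \<epsilon> in at_right 0. \<bar>r1 \<epsilon>\<bar> \<le> C * \<epsilon> ^ N) \<and> (\<exists>C. \<forall>\<^sub>F \<epsilon> in at_right 0. \<bar>r2 \<epsilon>\<bar> \<le> C * \<epsilon> ^ N)" for N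
  proof -
    obtain C where C: "\<forall>\<^sub>F \<epsilon> in at_right 0. \<forall>x. norm (residual \<beta> \<mu> \<epsilon> (U \<epsilon>) T x) \<le> C * \<epsilon> ^ N" using solution(2)[OF T] by blast
    have "\<forall>\<^sub>F \<epsilon> in at_right 0. \<bar>r1 \<epsilon>\<bar> \<le> C * \<epsilon> ^ N" "\<forall>\<^sub>F \<epsilon> in at_right 0. \<bar>r2 \<epsilon>\<bar> \<le> C * \<epsilon> ^ N"
      using C res by (eventually_elim, metis component_le_norm_cart order_trans)+
    then show ?thesis by blast
  qed
  show "M sP + (L sQ - fps_const 2 * ((sP (T, s, z) * sP (T, s, z) + sQ (T, s, z) * sQ (T, s, z)) * sQ (T, s, z)) + fps_const (1 - \<mu>) * sQ (T, s, z)) = 0"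
    by (rule pexp_negligible[OF p1[unfolded w_def]]) (use neg in blast)
  show "M sQ - (L sP - fps_const 2 * ((sP (T, s, z) * sP (T, s, z) + sQ (T, s, z) * sQ (T, s, z)) * sP (T, s, z)) + fps_const 2 * sP (T, s, z) - fps_const \<beta> * sQ (T, s, z)) = 0"
    by (rule pexp_negligible[OF p2[unfolded w_def]]) (use neg in blast)
qed

lemma formal_inner: "formal_inner I \<beta> \<mu> sK sV sR sSg sTa sTh sP sQ"
proof
  show "open I" "\<beta> > 0" "\<mu> \<ge> -1" by (rule I beta mu1)+
  show "fps_diff_at sK y" if "y \<in> S" for y by (rule Aexp_SucD(2)[OF Aexp_frame(5)[of "Suc 0"] that])
  show "fps_diff_at (fDir (0, 1) sK) y" if "y \<in> S" for y
    by (rule Aexp_SucD(2)[OF Aexp_Dir[OF Aexp_frame(5), where n = "Suc 0"] that])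
  show "fps_diff_at sP w" "fps_diff_at sQ w" if "w \<in> S3" for w
    by (rule Aexp_SucD(2)[OF Aexp_field(1)[of "Suc 0"] that] Aexp_SucD(2)[OF Aexp_field(2)[of "Suc 0"] that])+
  show "fps_diff_at (fDir v sP) w" "fps_diff_at (fDir v sQ) w" if "w \<in> S3" for w v
    by (rule Aexp_SucD(2)[OF Aexp_Dir[OF Aexp_field(1), where n = "Suc 0"] that] Aexp_SucD(2)[OF Aexp_Dir[OF Aexp_field(2), where n = "Suc 0"] that])+
  have u0: "u 0 (T, s, z) = vector [\<phi> z, 0]" if "T \<in> I" for T s z
    using inner that unfolding inner_expansion_def by blast
  show "sP (T, s, z) $$ 0 = \<phi> z" "sQ (T, s, z) $$ 0 = 0" if "T \<in> I" for T s z
    by (simp_all add: sP_def sQ_def u0[OF that])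
  have ui: "in_L2 (\<lambda>z. u i (T, s, z))" "L2_inner (\<lambda>z. u i (T, s, z) $ 1) (deriv \<phi>) = 0" if "i \<ge> 1" "T \<in> I" for i T s
    using inner that unfolding inner_expansion_def by blast+
  show "in_L2 (\<lambda>z. sP (T, s, z) $$ i)" "in_L2 (\<lambda>z. sQ (T, s, z) $$ i)" "L2_inner (\<lambda>z. sP (T, s, z) $$ i) (deriv \<phi>) = 0"
    if "i \<ge> 1" "T \<in> I" for i T s
    using ui[OF that] by (simp_all add: sP_def sQ_def in_L2_nth)
  show "\<exists>s. sK (T, s) $$ 0 \<noteq> 0" if "T \<in> I" for T by (rule nonflat[OF that])
qed (erule evolution,
    (rule add_eq_0_iff2[THEN iffD1, OF inner_equations(1)]; assumption),
    (rule right_minus_eq[THEN iffD1, OF inner_equations(2)]; assumption))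

sublocale formal_inner I \<beta> \<mu> sK sV sR sSg sTa sTh sP sQ by (rule formal_inner)

section \<open>The velocity law on the whole curve\<close>

definition "lap \<epsilon> y = g_rho (X \<epsilon>) (Y \<epsilon>) y * g_rho (X \<epsilon>) (Y \<epsilon>) y * dS (dS (g_kap (X \<epsilon>) (Y \<epsilon>))) y
    - dS (g_sig (X \<epsilon>) (Y \<epsilon>)) y * g_rho (X \<epsilon>) (Y \<epsilon>) y * g_rho (X \<epsilon>) (Y \<epsilon>) y * g_rho (X \<epsilon>) (Y \<epsilon>) y * dS (g_kap (X \<epsilon>) (Y \<epsilon>)) y"

definition "defect \<epsilon> y = g_vel (X \<epsilon>) (Y \<epsilon>) y + alpha0 \<beta> \<mu> * g_kap (X \<epsilon>) (Y \<epsilon>) y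
    - \<epsilon> * (\<epsilon> * (nu \<beta> \<mu> * lap \<epsilon> y + zeta \<beta> \<mu> * (g_kap (X \<epsilon>) (Y \<epsilon>) y * g_kap (X \<epsilon>) (Y \<epsilon>) y * g_kap (X \<epsilon>) (Y \<epsilon>) y)))"

lemma defect_bound:
  assumes "compact K" "K \<subseteq> S"
  shows "\<exists>C. \<forall>\<^sub>F \<epsilon> in at_right 0. \<forall>y\<in>K. \<bar>defect \<epsilon> y\<bar> \<le> C * \<epsilon> ^ 4"
proof -
  define c where "c y = sV y + fps_const (alpha0 \<beta> \<mu>) * sK y
    - fps_X * (fps_X * (fps_const (nu \<beta> \<mu>) * LapK y + fps_const (zeta \<beta> \<mu>) * (sK y * sK y * sK y)))" for y
  note f = Aexp_frame[THEN Aexp_uexp, OF assms] Aexp_frame[THEN Aexp_Dir, THEN Aexp_uexp, OF assms]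
    Aexp_frame[THEN Aexp_Dir, THEN Aexp_Dir, THEN Aexp_uexp, OF assms]
  have "uexp K defect c"
    unfolding defect_def[abs_def] c_def[abs_def] lap_def LapK_def
    by (intro uexp_add uexp_diff uexp_mult uexp_const uexp_eps f)
  then obtain C where C: "\<forall>\<^sub>F \<epsilon> in at_right 0. \<forall>y\<in>K. \<bar>defect \<epsilon> y - (\<Sum>i<4. c y $$ i * \<epsilon> ^ i)\<bar> \<le> C * \<epsilon> ^ 4"
    by (rule uexpE)
  have "c y $$ i = 0" if "y \<in> K" "i < 4" for y i
    unfolding c_def using velocity_law[of "fst y" i "snd y"] that assms(2) by auto
  then have "(\<Sum>i<4. c y $$ i * \<epsilon> ^ i) = 0" if "y \<in> K" for y \<epsilon> using that by (intro sum.neutral) auto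
  with C have "\<forall>\<^sub>F \<epsilon> in at_right 0. \<forall>y\<in>K. \<bar>defect \<epsilon> y\<bar> \<le> C * \<epsilon> ^ 4" by (simp cong: ball_cong)
  then show ?thesis by blast
qed

text \<open>The expansions are uniform on compact sets of parameters. Invariance under integer
  shifts of s carries the bound from one period to the whole line.\<close>

definition shift_invariant :: "int \<Rightarrow> (real \<times> real \<Rightarrow> real) \<Rightarrow> bool" where
  "shift_invariant n f \<longleftrightarrow> (\<forall>y\<in>S. f (y + (0, of_int n)) = f y)"

lemma shift_invariantD: "shift_invariant n f \<Longrightarrow> y \<in> S \<Longrightarrow> f (y + (0, of_int n)) = f y"
  unfolding shift_invariant_def by blast

lemma shift_S: "y \<in> S \<Longrightarrow> y + (0, of_int n) \<in> S" by (auto simp: mem_Times_iff)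

lemma shift_invariant_Dir:
  assumes f: "shift_invariant n f" and d: "\<And>y. y \<in> S \<Longrightarrow> f differentiable (at y)"
  shows "shift_invariant n (Dir v f)"
  unfolding shift_invariant_def
proof
  fix y assume y: "y \<in> S"
  let ?t = "\<lambda>y. y + (0, real_of_int n)"
  have t: "?t differentiable (at y)" by simp
  have "((\<lambda>y. y + (0, real_of_int n)) has_derivative (\<lambda>v. v)) (at y)" by (auto intro!: derivative_eq_intros)
  then have dt: "Dir v ?t y = v" by (rule Dir_eqI)
  have "Dir v f y = Dir v (\<lambda>y. f (?t y)) y" by (rule Dir_cong[OF open_S(1) y]) (simp add: shift_invariantD[OF f])
  also have "\<dots> = Dir v f (?t y)" using Dir_chain[OF t d[OF shift_S[OF y]], where v = v] unfolding dt .
  finally show "Dir v f (?t y) = Dir v f y" ..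
qed

lemma periodic_defect: "\<forall>\<^sub>F \<epsilon> in at_right 0. \<forall>n. \<forall>y\<in>S. defect \<epsilon> (y + (0, of_int n)) = defect \<epsilon> y"
  using front_frame front
proof eventually_elim
  case (elim \<epsilon>)
  interpret fr: front_frame I "\<gamma> \<epsilon>" "X \<epsilon>" "Y \<epsilon>" by (rule elim(1))
  have per: "\<gamma> \<epsilon> T (s + of_int n) = \<gamma> \<epsilon> T s" if "T \<in> I" for T s n
  proof (induction n arbitrary: s rule: int_induct[where k = 0])
    case (step1 i)
    then show ?case using elim(2) that by (metis add.assoc of_int_1 of_int_add)
  next
    case (step2 i)
    have "\<gamma> \<epsilon> T (s + of_int (i - 1)) = \<gamma> \<epsilon> T (s + of_int (i - 1) + 1)" using elim(2) that by metis
    also have "s + of_int (i - 1) + 1 = s + of_int i" by simp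
    finally show ?case using step2 by simp
  qed simp
  have "shift_invariant n (defect \<epsilon>)" for n
  proof -
    have XY: "shift_invariant n (X \<epsilon>)" "shift_invariant n (Y \<epsilon>)" using per by (auto simp: shift_invariant_def X_def Y_def)
    note D1 = XY[THEN shift_invariant_Dir] and D = fr.diffs
    have XY1: "shift_invariant n (Dir v (X \<epsilon>))" "shift_invariant n (Dir v (Y \<epsilon>))" for v using D1 D by auto
    have XY2: "shift_invariant n (dS (dS (X \<epsilon>)))" "shift_invariant n (dS (dS (Y \<epsilon>)))"
      by (rule shift_invariant_Dir[OF XY1(1)] shift_invariant_Dir[OF XY1(2)], erule D)+
    note s = shift_invariantD[OF XY1(1)] shift_invariantD[OF XY1(2)] shift_invariantD[OF XY2(1)] shift_invariantD[OF XY2(2)]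
    have r: "shift_invariant n (g_rho (X \<epsilon>) (Y \<epsilon>))" unfolding shift_invariant_def g_rho_def by (simp add: s)
    have sg: "shift_invariant n (g_sig (X \<epsilon>) (Y \<epsilon>))" and k: "shift_invariant n (g_kap (X \<epsilon>) (Y \<epsilon>))"
      and v: "shift_invariant n (g_vel (X \<epsilon>) (Y \<epsilon>))"
      unfolding shift_invariant_def g_sig_def g_kap_def g_vel_def g_t1_def g_t2_def by (simp_all add: s shift_invariantD[OF r])
    have "shift_invariant n (dS (g_sig (X \<epsilon>) (Y \<epsilon>)))" by (rule shift_invariant_Dir[OF sg]) (rule D)
    moreover have k1: "shift_invariant n (dS (g_kap (X \<epsilon>) (Y \<epsilon>)))" by (rule shift_invariant_Dir[OF k]) (rule D)
    moreover have "shift_invariant n (dS (dS (g_kap (X \<epsilon>) (Y \<epsilon>))))" by (rule shift_invariant_Dir[OF k1]) (rule D)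
    ultimately show ?thesis using r k v unfolding shift_invariant_def defect_def lap_def by simp
  qed
  then show ?case by (simp add: shift_invariant_def)
qed

theorem velocity_expansion:
  assumes K: "compact K" "K \<subseteq> I"
  shows "\<exists>C. \<forall>\<^sub>F \<epsilon> in at_right 0. \<forall>T\<in>K. \<forall>s.
     \<bar>normal_velocity (\<gamma> \<epsilon>) T s - (- alpha0 \<beta> \<mu> * curvature (\<gamma> \<epsilon> T) s
        + \<epsilon>\<^sup>2 * (nu \<beta> \<mu> * laplace_beltrami (\<gamma> \<epsilon> T) (curvature (\<gamma> \<epsilon> T)) s + zeta \<beta> \<mu> * curvature (\<gamma> \<epsilon> T) s ^ 3))\<bar> \<le> C * \<epsilon> ^ 4"
proof -
  have "compact (K \<times> {0..1::real})" "K \<times> {0..1} \<subseteq> S" using K by (auto intro: compact_Times)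
  then obtain C where C: "\<forall>\<^sub>F \<epsilon> in at_right 0. \<forall>y\<in>K \<times> {0..1}. \<bar>defect \<epsilon> y\<bar> \<le> C * \<epsilon> ^ 4"
    using defect_bound by blast
  have "\<forall>\<^sub>F \<epsilon> in at_right 0. \<forall>T\<in>K. \<forall>s.
     \<bar>normal_velocity (\<gamma> \<epsilon>) T s - (- alpha0 \<beta> \<mu> * curvature (\<gamma> \<epsilon> T) s
        + \<epsilon>\<^sup>2 * (nu \<beta> \<mu> * laplace_beltrami (\<gamma> \<epsilon> T) (curvature (\<gamma> \<epsilon> T)) s + zeta \<beta> \<mu> * curvature (\<gamma> \<epsilon> T) s ^ 3))\<bar> \<le> C * \<epsilon> ^ 4"
    using C front_frame periodic_defect
  proof eventually_elim
    case (elim \<epsilon>)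
    interpret fr: front_frame I "\<gamma> \<epsilon>" "X \<epsilon>" "Y \<epsilon>" by (rule elim(2))
    show ?case
    proof (intro ballI allI)
      fix T s :: real assume "T \<in> K"
      \<comment> \<open>The fractional part of the parameter lies in the compact set where the bound
        is known.\<close>
      then have T: "T \<in> I" and K: "(T, frac s) \<in> K \<times> {0..1}" using K frac_lt_1[of s] by (auto simp: less_imp_le)
      have "(T, frac s) + (0, of_int \<lfloor>s\<rfloor>) = (T, s)" by (simp add: frac_def)
      then have "defect \<epsilon> (T, s) = defect \<epsilon> (T, frac s)" using elim(3) T by (metis UNIV_I mem_Sigma_iff)
      then have b: "\<bar>defect \<epsilon> (T, s)\<bar> \<le> C * \<epsilon> ^ 4" using elim(1) K by auto
      have d: "defect \<epsilon> (T, s) = normal_velocity (\<gamma> \<epsilon>) T s - (- alpha0 \<beta> \<mu> * curvature (\<gamma> \<epsilon> T) s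
        + \<epsilon>\<^sup>2 * (nu \<beta> \<mu> * laplace_beltrami (\<gamma> \<epsilon> T) (curvature (\<gamma> \<epsilon> T)) s + zeta \<beta> \<mu> * curvature (\<gamma> \<epsilon> T) s ^ 3))"
        unfolding fr.laplace_beltrami_curvature[OF T] fr.curvature_kap[OF T] fr.normal_velocity_vel[OF T] defect_def lap_def
        by (simp add: power2_eq_square power3_eq_cube mult.assoc)
      show "\<bar>normal_velocity (\<gamma> \<epsilon>) T s - (- alpha0 \<beta> \<mu> * curvature (\<gamma> \<epsilon> T) s
        + \<epsilon>\<^sup>2 * (nu \<beta> \<mu> * laplace_beltrami (\<gamma> \<epsilon> T) (curvature (\<gamma> \<epsilon> T)) s + zeta \<beta> \<mu> * curvature (\<gamma> \<epsilon> T) s ^ 3))\<bar> \<le> C * \<epsilon> ^ 4"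
        using b unfolding d .
    qed
  qed
  then show ?thesis by blast
qed

end

theorem mainTheorem1:
  fixes \<beta> :: real
  assumes "\<beta> > 0"
  shows "(\<exists>\<zeta> :: real \<Rightarrow> real. \<forall>\<mu>\<in>{-1..3}. \<forall>L T0 T1 \<gamma>.
            L > 0 \<and> formal_front \<beta> \<mu> L {T0<..<T1} \<gamma> \<longrightarrow>
            (\<forall>K. compact K \<and> K \<subseteq> {T0<..<T1} \<longrightarrow>
               (\<exists>C. \<forall>\<^sub>F \<epsilon> in at_right 0. \<forall>T\<in>K. \<forall>s.
                  \<bar>normal_velocity (\<gamma> \<epsilon>) T s
                     - (- alpha0 \<beta> \<mu> * curvature (\<gamma> \<epsilon> T) s
                        + \<epsilon>\<^sup>2 * (nu \<beta> \<mu> * laplace_beltrami (\<gamma> \<epsilon> T) (curvature (\<gamma> \<epsilon> T)) s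
                                + \<zeta> \<mu> * curvature (\<gamma> \<epsilon> T) s ^ 3))\<bar>
                  \<le> C * \<epsilon> ^ 4)))
         \<and> (\<forall>\<mu>\<in>{-1..3}. sgn (alpha0 \<beta> \<mu>) = sgn \<mu>)
         \<and> (\<exists>\<mu>s>0. \<forall>\<mu>\<in>{-1..3}. \<bar>\<mu>\<bar> < \<mu>s \<longrightarrow> nu \<beta> \<mu> > 0)"
proof (intro conjI)
  show "\<forall>\<mu>\<in>{-1..3}. sgn (alpha0 \<beta> \<mu>) = sgn \<mu>" using sgn_alpha0[OF assms] by simp
  show "\<exists>\<mu>s>0. \<forall>\<mu>\<in>{-1..3}. \<bar>\<mu>\<bar> < \<mu>s \<longrightarrow> nu \<beta> \<mu> > 0" using nu_pos_near_0[OF assms] by blast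
  show "\<exists>\<zeta> :: real \<Rightarrow> real. \<forall>\<mu>\<in>{-1..3}. \<forall>L T0 T1 \<gamma>.
            L > 0 \<and> formal_front \<beta> \<mu> L {T0<..<T1} \<gamma> \<longrightarrow>
            (\<forall>K. compact K \<and> K \<subseteq> {T0<..<T1} \<longrightarrow>
               (\<exists>C. \<forall>\<^sub>F \<epsilon> in at_right 0. \<forall>T\<in>K. \<forall>s.
                  \<bar>normal_velocity (\<gamma> \<epsilon>) T s
                     - (- alpha0 \<beta> \<mu> * curvature (\<gamma> \<epsilon> T) s
                        + \<epsilon>\<^sup>2 * (nu \<beta> \<mu> * laplace_beltrami (\<gamma> \<epsilon> T) (curvature (\<gamma> \<epsilon> T)) s
                                + \<zeta> \<mu> * curvature (\<gamma> \<epsilon> T) s ^ 3))\<bar>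
                  \<le> C * \<epsilon> ^ 4))"
  \<comment> \<open>The function \<open>zeta \<beta>\<close> depends on \<beta> and \<mu> alone, so
    one choice serves all fronts, periods and time intervals.\<close>
  proof (rule exI[of _ "zeta \<beta>"], intro ballI allI impI, elim conjE)
    fix \<mu> L T0 T1 :: real and \<gamma> K
    assume mu: "\<mu> \<in> {-1..3}" and ff: "formal_front \<beta> \<mu> L {T0<..<T1} \<gamma>" and K: "compact K" "K \<subseteq> {T0<..<T1}"
    let ?I = "{T0<..<T1}"
    from ff obtain U u where e: "evolving_front L ?I \<gamma>" and sol: "formal_solution \<beta> \<mu> L ?I U" and inn: "inner_expansion ?I \<gamma> U u"
      unfolding formal_front_def by blast
    from e obtain g where g: "asymp_expansion (?I \<times> UNIV) (\<lambda>\<epsilon> (T, s). \<gamma> \<epsilon> T s) g" unfolding evolving_front_def by blast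
    have "\<exists>\<epsilon>0>0. \<exists>m>0. \<forall>\<epsilon>\<in>{0<..<\<epsilon>0}. \<forall>T\<in>?I. \<forall>s. \<gamma> \<epsilon> T (s + 1) = \<gamma> \<epsilon> T s \<and> m \<le> speed (\<gamma> \<epsilon> T) s"
      using e unfolding evolving_front_def by (elim conjE exE) (intro exI conjI, assumption+, blast)
    then obtain \<epsilon>0 m where m: "\<epsilon>0 > 0" "m > 0"
      "\<forall>\<epsilon>\<in>{0<..<\<epsilon>0}. \<forall>T\<in>?I. \<forall>s. \<gamma> \<epsilon> T (s + 1) = \<gamma> \<epsilon> T s \<and> m \<le> speed (\<gamma> \<epsilon> T) s" by blast
    have "\<forall>\<^sub>F \<epsilon> in at_right 0. \<epsilon> \<in> {0<..<\<epsilon>0}" by (rule eventually_at_right_real[OF m(1)])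
    then have ev: "\<forall>\<^sub>F \<epsilon> in at_right 0. \<forall>T\<in>?I. \<forall>s. \<gamma> \<epsilon> T (s + 1) = \<gamma> \<epsilon> T s \<and> m \<le> speed (\<gamma> \<epsilon> T) s"
      by eventually_elim (use m(3) in blast)
    interpret front_expansion \<beta> \<mu> ?I \<gamma> U g u m
    proof
      show "open ?I" "\<beta> > 0" "\<mu> \<ge> -1" "m > 0" using assms mu m(2) by auto
      show "\<forall>\<^sub>F \<epsilon> in at_right 0. smooth_on (?I \<times> UNIV) (\<lambda>(T, x). U \<epsilon> T x)"
        using sol unfolding formal_solution_def by (auto elim: eventually_mono)
      show "\<exists>C. \<forall>\<^sub>F \<epsilon> in at_right 0. \<forall>x. norm (residual \<beta> \<mu> \<epsilon> (U \<epsilon>) T x) \<le> C * \<epsilon> ^ N" if T: "T \<in> ?I" for T N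
      proof -
        have "compact {T} \<and> {T} \<subseteq> ?I" using T by simp
        then obtain C where "\<forall>\<^sub>F \<epsilon> in at_right 0. \<forall>T\<in>{T}. \<forall>x. norm (residual \<beta> \<mu> \<epsilon> (U \<epsilon>) T x) \<le> C * \<epsilon> ^ N"
          using sol unfolding formal_solution_def by blast
        then show ?thesis by (intro exI[of _ C]) simp
      qed
    qed (rule g ev inn)+
    show "\<exists>C. \<forall>\<^sub>F \<epsilon> in at_right 0. \<forall>T\<in>K. \<forall>s. \<bar>normal_velocity (\<gamma> \<epsilon>) T s
        - (- alpha0 \<beta> \<mu> * curvature (\<gamma> \<epsilon> T) s
           + \<epsilon>\<^sup>2 * (nu \<beta> \<mu> * laplace_beltrami (\<gamma> \<epsilon> T) (curvature (\<gamma> \<epsilon> T)) s + zeta \<beta> \<mu> * curvature (\<gamma> \<epsilon> T) s ^ 3))\<bar> \<le> C * \<epsilon> ^ 4"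
      by (rule velocity_expansion[OF K])
  qed
qed

end
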